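(* Let $X$ be a local isometric immersion of $H^n$ in $H^{n+m}$ with flat and non-degenerate normal bundle, with image $M^n$, and $\{e_\alpha\}_{\alpha=n+1}^{n+m}$ a parallel normal frame. Then: (i) There exist a line of curvature coordinate system $(x_1,\dots,x_n)$, an $\mathcal M_{m\times n}$-valued map $A_1=(a_{ij})$ satisfying $A_1^tA_1=I$, and an $\mathcal M_{n\times1}$-valued map $b=(b_1,\dots,b_n)^t$ such that the two fundamental forms of $X$ are given by $$I=\sum_ib_i^2\,dx_i^2,\qquad II=\sum_{i=1}^n\sum_{j=1}^{m}a_{ji}b_i\,dx_i^2\,e_{n+j}.$$ (ii) Let $f_{ij}=(b_i)_{x_j}/b_j$ if $i\ne j$, $f_{ii}=0$ for all $1\le i\le n$, and $F=(f_{ij})$. Then $(A_1,F,b)$ is a solution of the partial $G^1_{m,n}$-system I. (iii) Let $e_i=\frac1{b_i}X_{x_i}$ and $g=(e_{n+1},\dots,e_{n+m},e_1,\dots,e_n,X)$. Then $$g^{-1}dg=\sum_{i=1}^n\begin{pmatrix}0&-A_1C_i&0\\ C_iA_1^t&-F^tC_i+C_iF&C_ib\\0&b^tC_i&0\end{pmatrix}dx_i,\qquad(\ast)$$ which is equal to the Lax connection $\tau^I_\lambda$ of the partial $G^1_{m,n}$-system I at $\lambda=1$. (iv) If $(A_1,F,b)$ is a solution of the partial $G^1_{m,n}$-system I, then system $(\ast)$ is solvable. (v) Let $g$ be a solution of $(\ast)$. Then the last column of $g$ is an isometric immersion of a constant sectional curvature $-1$ submanifold of $H^{n+m}$. (vi)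 $M^n$ lies in a totally umbilic hypersurface of $H^{n+m}$ if and only if there is a constant vector $w\in\mathcal M_{m\times1}$ such that $b=A_1^tw$. Moreover, $M^n$ lies in a flat totally umbilic hypersurface if and only if $\|w\|=1$.
   Context: $\mathbb R^{k,1}$ is $\mathbb R^{k+1}$ with the form $\langle x,y\rangle_1=x_1y_1+\dots+x_ky_k-x_{k+1}y_{k+1}$, and $H^k=\{x\in\mathbb R^{k,1}:\langle x,x\rangle_1=-1,\ x_{k+1}>0\}$ is hyperbolic $k$-space (curvature $-1$). $\mathcal M_{p\times q}$: real $p\times q$ matrices; $gl_*(n)$: real $n\times n$ matrices with zero diagonal; $C_i$: the $n\times n$ matrix whose only non-zero entry is a $1$ at $(i,i)$. The partial $G^1_{m,n}$-system I is the PDE for $(A_1,F,b)=((a_{ij}),(f_{ij}),(b_i)):\mathbb R^n\to\{A_1\in\mathcal M_{m\times n}:A_1^tA_1=I\}\times gl_*(n)\times\mathcal M_{n\times1}$: $(f_{ij})_{x_j}+(f_{ji})_{x_i}+\sum_{k=1}^nf_{ik}f_{jk}-b_ib_j=0$ for $i\ne j$; $(f_{ij})_{x_k}=f_{ik}f_{kj}$ for $i,j,k$ distinct; $(b_i)_{x_j}=f_{ij}b_j$ for $i\ne j$; $(a_{ki})_{x_j}=f_{ij}a_{kj}$ for $i\ne j$. It is equivalent to the flatness, for all $\lambda\in\mathbb C$, of its Lax connection $\tau^I_\lambda=\sum_i\begin{pmatrix}0&-A_1C_i\lambda&0\\ C_iA_1^t\lambda&-F^tC_i+C_iF&C_ib\\0&b^tC_i&0\end{pmatrix}dx_i$.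 Solutions $g$ of $(\ast)$ are understood to take values in $O(n+m,1)$, the group of matrices preserving $\langle\cdot,\cdot\rangle_1$ on $\mathbb R^{n+m,1}$. Conventions: with $\omega_i=\langle dX,e_i\rangle_1$ and $\omega_{i\alpha}=\langle e_i,de_\alpha\rangle_1$, $I=\sum_i\omega_i^2$, $II=\sum_{i,\alpha}\omega_{i\alpha}\omega_ie_\alpha$, $e_\alpha$ running over the normal frame of $X$ in $H^{n+m}$. The normal bundle is non-degenerate if at each point the space of shape operators $\{A_v:v\text{ normal}\}$ has dimension $n$. Line of curvature coordinates are coordinates in which $I=\sum_ia_i^2dx_i^2$ and $II=\sum_{i,j}c_{ji}dx_i^2e_{n+j}$.
   Formalization: (v) assumes all b_i nowhere zero and takes the last column of g up to a constant sign; (vi) excludes n=m=1, and its first equivalence is for not totally geodesic hypersurfaces (literally if m=n or M lies in no totally geodesic one); ‖w‖=1 is read as: some such w has norm 1. *)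

theory Defs
  imports "HOL-Analysis.Analysis"
begin

text \<open>
  Finite types index the coordinates. The space \<open>\<real>\<^bsup>k,1\<^esup>\<close> is \<open>real ^ 'k option\<close> with \<open>CARD('k) = k\<close>:
  the coordinates \<open>Some i\<close> are the \<open>k\<close> space-like ones, and \<open>None\<close> is the last, time-like one.
  For \<open>k = n + m\<close> we take \<open>'k = 'm + 'n\<close>, so that the column blocks of sizes
  \<open>m\<close>, \<open>n\<close>, \<open>1\<close> are indexed by \<open>Some (Inl a)\<close>, \<open>Some (Inr i)\<close>, \<open>None\<close>.
\<close>


subsection \<open>Smooth maps and local parametrisations\<close>

definition pd :: "'d::finite \<Rightarrow> (real ^ 'd \<Rightarrow> 'b::real_normed_vector) \<Rightarrow> real ^ 'd \<Rightarrow> 'b" where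
  "pd i f u = frechet_derivative f (at u) (axis i 1)"

text \<open>\<open>Ck_on k S f\<close> is meant for open \<open>S\<close>.\<close>

fun Ck_on :: "nat \<Rightarrow> 'a::real_normed_vector set \<Rightarrow> ('a \<Rightarrow> 'b::real_normed_vector) \<Rightarrow> bool" where
  "Ck_on 0 S f \<longleftrightarrow> continuous_on S f"
| "Ck_on (Suc k) S f \<longleftrightarrow>
     (\<forall>x\<in>S. f differentiable (at x)) \<and> (\<forall>v. Ck_on k S (\<lambda>x. frechet_derivative f (at x) v))"

definition smooth_on :: "'a::real_normed_vector set \<Rightarrow> ('a \<Rightarrow> 'b::real_normed_vector) \<Rightarrow> bool" where
  "smooth_on S f \<longleftrightarrow> (\<forall>k. Ck_on k S f)"

text \<open>Smoothness on a subset that need not be open: there are local smooth extensions.\<close>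

definition smooth_map_on :: "'a::real_normed_vector set \<Rightarrow> ('a \<Rightarrow> 'b::real_normed_vector) \<Rightarrow> bool" where
  "smooth_map_on S f \<longleftrightarrow>
     (\<forall>p\<in>S. \<exists>W f'. open W \<and> p \<in> W \<and> smooth_on W f' \<and> (\<forall>x \<in> S \<inter> W. f' x = f x))"

text \<open>The inverse of \<open>\<psi>\<close> is a coordinate system \<open>(x\<^sub>1,\<dots>,x\<^sub>d)\<close> on the open piece \<open>\<psi> ` V\<close> of \<open>S\<close>.\<close>

definition local_param ::
    "'b::real_normed_vector set \<Rightarrow> (real ^ 'd) set \<Rightarrow> (real ^ 'd \<Rightarrow> 'b) \<Rightarrow> bool" where
  "local_param S V \<psi> \<longleftrightarrow>
     open V \<and> smooth_on V \<psi> \<and> (\<forall>u\<in>V. inj (frechet_derivative \<psi> (at u))) \<and>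
     openin (top_of_set S) (\<psi> ` V) \<and> (\<exists>\<phi>. homeomorphism V (\<psi> ` V) \<psi> \<phi>)"


subsection \<open>Lorentzian space and hyperbolic space\<close>

definition lorentz :: "real ^ ('k::finite) option \<Rightarrow> real ^ 'k option \<Rightarrow> real"  (infixl "\<bullet>\<^sub>1" 70) where
  "x \<bullet>\<^sub>1 y = (\<Sum>i\<in>UNIV. x $ Some i * y $ Some i) - x $ None * y $ None"

definition hyp :: "(real ^ ('k::finite) option) set" where
  "hyp = {x. x \<bullet>\<^sub>1 x = -1 \<and> x $ None > 0}"

definition Lorentz_group :: "(real ^ ('k::finite) option ^ 'k option) set" where
  "Lorentz_group = {g. \<forall>x y. (g *v x) \<bullet>\<^sub>1 (g *v y) = x \<bullet>\<^sub>1 y}"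


subsection \<open>Curvature of a Riemannian metric in coordinates\<close>

definition christoffel ::
    "(real ^ 'd \<Rightarrow> real ^ 'd ^ 'd) \<Rightarrow> 'd \<Rightarrow> 'd \<Rightarrow> 'd \<Rightarrow> real ^ 'd \<Rightarrow> real" where
  "christoffel G l i j u =
     (\<Sum>p\<in>UNIV. matrix_inv (G u) $ l $ p *
        (pd i (\<lambda>x. G x $ j $ p) u + pd j (\<lambda>x. G x $ i $ p) u - pd p (\<lambda>x. G x $ i $ j) u)) / 2"

text \<open>\<open>R(\<partial>\<^sub>i, \<partial>\<^sub>j) \<partial>\<^sub>k = \<Sum>\<^sub>l riemann G l k i j \<partial>\<^sub>l\<close>
  where \<open>R(x, y) = \<nabla>\<^sub>x \<nabla>\<^sub>y - \<nabla>\<^sub>y \<nabla>\<^sub>x - \<nabla>\<^bsub>[x,y]\<^esub>\<close>.\<close>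

definition riemann ::
    "(real ^ 'd \<Rightarrow> real ^ 'd ^ 'd) \<Rightarrow> 'd \<Rightarrow> 'd \<Rightarrow> 'd \<Rightarrow> 'd \<Rightarrow> real ^ 'd \<Rightarrow> real" where
  "riemann G l k i j u =
     pd i (christoffel G l j k) u - pd j (christoffel G l i k) u +
     (\<Sum>p\<in>UNIV. christoffel G l i p u * christoffel G p j k u
              - christoffel G l j p u * christoffel G p i k u)"

definition metric :: "(real ^ 'd \<Rightarrow> real ^ 'd ^ 'd) \<Rightarrow> real ^ 'd \<Rightarrow> real ^ 'd \<Rightarrow> real ^ 'd \<Rightarrow> real" where
  "metric G u x y = x \<bullet> (G u *v y)"

definition curv_op ::
    "(real ^ 'd \<Rightarrow> real ^ 'd ^ 'd) \<Rightarrow> real ^ 'd \<Rightarrow> real ^ 'd \<Rightarrow> real ^ 'd \<Rightarrow> real ^ 'd \<Rightarrow> real ^ 'd" where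
  "curv_op G u x y z =
     (\<chi> l. \<Sum>k\<in>UNIV. \<Sum>i\<in>UNIV. \<Sum>j\<in>UNIV. riemann G l k i j u * x $ i * y $ j * z $ k)"

definition sectional_curvature ::
    "(real ^ 'd \<Rightarrow> real ^ 'd ^ 'd) \<Rightarrow> real ^ 'd \<Rightarrow> real ^ 'd \<Rightarrow> real ^ 'd \<Rightarrow> real" where
  "sectional_curvature G u x y =
     metric G u (curv_op G u x y y) x /
     (metric G u x x * metric G u y y - (metric G u x y)\<^sup>2)"

definition const_curvature :: "(real ^ 'd) set \<Rightarrow> (real ^ 'd \<Rightarrow> real ^ 'd ^ 'd) \<Rightarrow> real \<Rightarrow> bool" where
  "const_curvature V G c \<longleftrightarrow>
     (\<forall>u\<in>V. \<forall>x y. x \<noteq> y \<and> independent {x, y} \<longrightarrow> sectional_curvature G u x y = c)"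


subsection \<open>Immersions into hyperbolic space, in coordinates\<close>

text \<open>In this subsection \<open>Y\<close> is an immersion of an open subset of \<open>\<real>\<^sup>d\<close> into \<open>hyp\<close>.\<close>

definition first_ff :: "(real ^ 'd \<Rightarrow> real ^ ('k::finite) option) \<Rightarrow> real ^ 'd \<Rightarrow> real ^ 'd ^ 'd" where
  "first_ff Y u = (\<chi> i j. pd i Y u \<bullet>\<^sub>1 pd j Y u)"

text \<open>The normal space in the tangent space of \<open>hyp\<close>.\<close>

definition normal_space :: "(real ^ 'd \<Rightarrow> real ^ ('k::finite) option) \<Rightarrow> real ^ 'd \<Rightarrow> (real ^ 'k option) set" where
  "normal_space Y u = {\<nu>. \<nu> \<bullet>\<^sub>1 Y u = 0 \<and> (\<forall>i. \<nu> \<bullet>\<^sub>1 pd i Y u = 0)}"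

text \<open>The coefficient of \<open>e\<close> in \<open>II(\<partial>\<^sub>i, \<partial>\<^sub>j)\<close>, for a normal frame field \<open>e = e\<^sub>\<alpha>\<close>, with the sign
  convention \<open>II = \<Sum> \<omega>\<^bsub>k\<alpha>\<^esub> \<omega>\<^sub>k e\<^sub>\<alpha>\<close>, \<open>\<omega>\<^bsub>k\<alpha>\<^esub> = \<langle>e\<^sub>k, de\<^sub>\<alpha>\<rangle>\<^sub>1\<close>, \<open>\<omega>\<^sub>k = \<langle>dX, e\<^sub>k\<rangle>\<^sub>1\<close>: as the \<open>e\<^sub>k\<close> are an
  orthonormal tangent frame, \<open>\<Sum>\<^sub>k \<omega>\<^bsub>k\<alpha>\<^esub>(\<partial>\<^sub>i) \<omega>\<^sub>k(\<partial>\<^sub>j) = \<langle>\<partial>\<^sub>i e\<^sub>\<alpha>, \<partial>\<^sub>j X\<rangle>\<^sub>1\<close>.\<close>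

definition second_ff ::
    "(real ^ 'd \<Rightarrow> real ^ ('k::finite) option) \<Rightarrow> (real ^ 'd \<Rightarrow> real ^ 'k option) \<Rightarrow> real ^ 'd \<Rightarrow> real ^ 'd ^ 'd" where
  "second_ff Y e u = (\<chi> i j. pd i e u \<bullet>\<^sub>1 pd j Y u)"

text \<open>The same form \<open>\<langle>II(\<partial>\<^sub>i, \<partial>\<^sub>j), \<nu>\<rangle>\<^sub>1\<close> for a single normal vector \<open>\<nu>\<close>; the sign comes from
  differentiating \<open>\<langle>e, \<partial>\<^sub>j Y\<rangle>\<^sub>1 = 0\<close>.\<close>

definition second_ff_vec ::
    "(real ^ 'd \<Rightarrow> real ^ ('k::finite) option) \<Rightarrow> real ^ 'k option \<Rightarrow> real ^ 'd \<Rightarrow> real ^ 'd ^ 'd" where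
  "second_ff_vec Y \<nu> u = (\<chi> i j. - (\<nu> \<bullet>\<^sub>1 pd i (pd j Y) u))"

text \<open>The matrix, in the basis \<open>\<partial>\<^sub>1 Y, \<dots>, \<partial>\<^sub>d Y\<close>, of the shape operator \<open>A\<^sub>\<nu>\<close>,
  \<open>\<langle>A\<^sub>\<nu> x, y\<rangle>\<^sub>1 = \<langle>II(x, y), \<nu>\<rangle>\<^sub>1\<close>.\<close>

definition shape_operator ::
    "(real ^ 'd \<Rightarrow> real ^ ('k::finite) option) \<Rightarrow> real ^ 'k option \<Rightarrow> real ^ 'd \<Rightarrow> real ^ 'd ^ 'd" where
  "shape_operator Y \<nu> u = matrix_inv (first_ff Y u) ** second_ff_vec Y \<nu> u"

definition normal_part ::
    "(real ^ 'd \<Rightarrow> real ^ ('k::finite) option) \<Rightarrow> real ^ 'd \<Rightarrow> real ^ 'k option \<Rightarrow> real ^ 'k option" where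
  "normal_part Y u z =
     (THE \<nu>. \<nu> \<in> normal_space Y u \<and> z - \<nu> \<in> span (insert (Y u) (range (\<lambda>i. pd i Y u))))"

definition normal_deriv ::
    "(real ^ 'd \<Rightarrow> real ^ ('k::finite) option) \<Rightarrow> 'd \<Rightarrow> (real ^ 'd \<Rightarrow> real ^ 'k option) \<Rightarrow> real ^ 'd \<Rightarrow> real ^ 'k option" where
  "normal_deriv Y i \<xi> u = normal_part Y u (pd i \<xi> u)"


subsection \<open>Local isometric immersions of hyperbolic spaces\<close>

text \<open>\<open>X\<close> is defined on an open piece \<open>U\<close> of \<open>H\<^sup>n\<close>. Properties of \<open>X\<close> are expressed through
  \<open>X \<circ> \<psi>\<close> for all local coordinate systems of \<open>U\<close>.\<close>

definition local_isometric_immersion ::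
    "(real ^ ('n::finite) option) set \<Rightarrow> (real ^ 'n option \<Rightarrow> real ^ ('k::finite) option) \<Rightarrow> bool" where
  "local_isometric_immersion U X \<longleftrightarrow>
     openin (top_of_set hyp) U \<and> smooth_map_on U X \<and> X ` U \<subseteq> hyp \<and>
     (\<forall>V \<psi>. local_param U V (\<psi> :: real ^ 'n \<Rightarrow> _) \<longrightarrow>
        (\<forall>u\<in>V. first_ff (X \<circ> \<psi>) u = first_ff \<psi> u))"

definition flat_normal_bundle ::
    "(real ^ ('n::finite) option) set \<Rightarrow> (real ^ 'n option \<Rightarrow> real ^ ('k::finite) option) \<Rightarrow> bool" where
  "flat_normal_bundle U X \<longleftrightarrow>
     (\<forall>V \<psi> \<xi>. local_param U V (\<psi> :: real ^ 'n \<Rightarrow> _) \<and> smooth_on V \<xi> \<and>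
        (\<forall>u\<in>V. \<xi> u \<in> normal_space (X \<circ> \<psi>) u) \<longrightarrow>
        (\<forall>u\<in>V. \<forall>i j. normal_deriv (X \<circ> \<psi>) i (normal_deriv (X \<circ> \<psi>) j \<xi>) u =
                     normal_deriv (X \<circ> \<psi>) j (normal_deriv (X \<circ> \<psi>) i \<xi>) u))"

definition nondegenerate_normal_bundle ::
    "(real ^ ('n::finite) option) set \<Rightarrow> (real ^ 'n option \<Rightarrow> real ^ ('k::finite) option) \<Rightarrow> bool" where
  "nondegenerate_normal_bundle U X \<longleftrightarrow>
     (\<forall>V \<psi>. local_param U V (\<psi> :: real ^ 'n \<Rightarrow> _) \<longrightarrow>
        (\<forall>u\<in>V. dim {shape_operator (X \<circ> \<psi>) \<nu> u | \<nu>. \<nu> \<in> normal_space (X \<circ> \<psi>) u} = CARD('n)))"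

text \<open>Frames are orthonormal. Here \<open>e a\<close>, \<open>a :: 'm\<close>, stands for \<open>e\<^bsub>n+a\<^esub>\<close>; as the normal spaces have
  dimension \<open>CARD('m)\<close>, the \<open>e a\<close> form a basis.\<close>

definition parallel_normal_frame ::
    "(real ^ ('n::finite) option) set \<Rightarrow> (real ^ 'n option \<Rightarrow> real ^ (('m::finite) + 'n) option) \<Rightarrow>
     ('m \<Rightarrow> real ^ 'n option \<Rightarrow> real ^ ('m + 'n) option) \<Rightarrow> bool" where
  "parallel_normal_frame U X e \<longleftrightarrow>
     (\<forall>a. smooth_map_on U (e a)) \<and>
     (\<forall>p\<in>U. \<forall>a c. e a p \<bullet>\<^sub>1 e c p = (if a = c then 1 else 0)) \<and>
     (\<forall>V \<psi>. local_param U V (\<psi> :: real ^ 'n \<Rightarrow> _) \<longrightarrow>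
        (\<forall>u\<in>V. \<forall>a. e a (\<psi> u) \<in> normal_space (X \<circ> \<psi>) u \<and>
                   (\<forall>i. normal_deriv (X \<circ> \<psi>) i (e a \<circ> \<psi>) u = 0)))"

definition line_of_curvature_coords ::
    "(real ^ 'n option \<Rightarrow> real ^ (('m::finite) + 'n) option) \<Rightarrow> ('m \<Rightarrow> real ^ 'n option \<Rightarrow> real ^ ('m + 'n) option) \<Rightarrow>
     (real ^ 'n) set \<Rightarrow> (real ^ 'n \<Rightarrow> real ^ 'n option) \<Rightarrow> bool" where
  "line_of_curvature_coords X e V \<psi> \<longleftrightarrow>
     (\<exists>(a :: real ^ 'n \<Rightarrow> real ^ 'n) (c :: real ^ 'n \<Rightarrow> real ^ 'n ^ 'm). \<forall>u\<in>V. \<forall>i j.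
        first_ff (X \<circ> \<psi>) u $ i $ j = (if i = j then (a u $ i)\<^sup>2 else 0) \<and>
        (\<forall>k. second_ff (X \<circ> \<psi>) (e k \<circ> \<psi>) u $ i $ j = (if i = j then c u $ k $ i else 0)))"

text \<open>Coordinates \<open>\<psi>\<close> on a piece of \<open>U\<close> with maps \<open>A = A\<^sub>1\<close> and \<open>b\<close> such that \<open>A\<^sup>t A = I\<close>,
  \<open>I = \<Sum> b\<^sub>i\<^sup>2 dx\<^sub>i\<^sup>2\<close> and \<open>II = \<Sum> a\<^bsub>ki\<^esub> b\<^sub>i dx\<^sub>i\<^sup>2 e\<^bsub>n+k\<^esub>\<close>.\<close>

definition adapted_coords ::
    "(real ^ 'n option) set \<Rightarrow> (real ^ 'n option \<Rightarrow> real ^ ('m + 'n) option) \<Rightarrow>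
     ('m \<Rightarrow> real ^ 'n option \<Rightarrow> real ^ ('m + 'n) option) \<Rightarrow>
     (real ^ 'n) set \<Rightarrow> (real ^ 'n \<Rightarrow> real ^ 'n option) \<Rightarrow>
     (real ^ 'n \<Rightarrow> real ^ 'n ^ 'm) \<Rightarrow> (real ^ 'n \<Rightarrow> real ^ 'n) \<Rightarrow> bool" where
  "adapted_coords U X e V \<psi> A b \<longleftrightarrow>
     local_param U V \<psi> \<and> line_of_curvature_coords X e V \<psi> \<and> smooth_on V A \<and> smooth_on V b \<and>
     (\<forall>u\<in>V. transpose (A u) ** A u = mat 1) \<and>
     (\<forall>u\<in>V. \<forall>i j. first_ff (X \<circ> \<psi>) u $ i $ j = (if i = j then (b u $ i)\<^sup>2 else 0)) \<and>
     (\<forall>u\<in>V. \<forall>k i j. second_ff (X \<circ> \<psi>) (e k \<circ> \<psi>) u $ i $ j =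
                     (if i = j then A u $ k $ i * b u $ i else 0))"


subsection \<open>The partial \<open>G\<^sup>1\<^bsub>m,n\<^esub>\<close>-system I and its Lax connection\<close>

text \<open>Smooth maps \<open>(A, F, b)\<close> into the target space of the system.\<close>

definition G1_maps ::
    "(real ^ 'n) set \<Rightarrow> (real ^ 'n \<Rightarrow> real ^ 'n ^ 'm) \<Rightarrow> (real ^ 'n \<Rightarrow> real ^ 'n ^ 'n) \<Rightarrow>
     (real ^ 'n \<Rightarrow> real ^ 'n) \<Rightarrow> bool" where
  "G1_maps V A F b \<longleftrightarrow>
     smooth_on V A \<and> smooth_on V F \<and> smooth_on V b \<and>
     (\<forall>u\<in>V. transpose (A u) ** A u = mat 1) \<and> (\<forall>u\<in>V. \<forall>i. F u $ i $ i = 0)"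

definition G1_system_I ::
    "(real ^ 'n) set \<Rightarrow> (real ^ 'n \<Rightarrow> real ^ 'n ^ 'm) \<Rightarrow> (real ^ 'n \<Rightarrow> real ^ 'n ^ 'n) \<Rightarrow>
     (real ^ 'n \<Rightarrow> real ^ 'n) \<Rightarrow> bool" where
  "G1_system_I V A F b \<longleftrightarrow> G1_maps V A F b \<and>
     (\<forall>u\<in>V.
       (\<forall>i j. i \<noteq> j \<longrightarrow>
          pd j (\<lambda>x. F x $ i $ j) u + pd i (\<lambda>x. F x $ j $ i) u
            + (\<Sum>k\<in>UNIV. F u $ i $ k * F u $ j $ k) - b u $ i * b u $ j = 0) \<and>
       (\<forall>i j k. i \<noteq> j \<and> j \<noteq> k \<and> i \<noteq> k \<longrightarrow>
          pd k (\<lambda>x. F x $ i $ j) u = F u $ i $ k * F u $ k $ j) \<and>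
       (\<forall>i j. i \<noteq> j \<longrightarrow> pd j (\<lambda>x. b x $ i) u = F u $ i $ j * b u $ j) \<and>
       (\<forall>k i j. i \<noteq> j \<longrightarrow> pd j (\<lambda>x. A x $ k $ i) u = F u $ i $ j * A u $ k $ j))"

definition Cmat :: "'n::finite \<Rightarrow> 'a::semiring_1 ^ 'n ^ 'n" where
  "Cmat i = (\<chi> r c. if r = i \<and> c = i then 1 else 0)"

text \<open>The block matrix with rows \<open>(p\<^sub>1 p\<^sub>2 p\<^sub>3)\<close>, \<open>(q\<^sub>1 q\<^sub>2 q\<^sub>3)\<close>, \<open>(r\<^sub>1 r\<^sub>2 r\<^sub>3)\<close> of sizes \<open>m, n, 1\<close>.\<close>

definition block3 ::
    "'a ^ 'm ^ 'm \<Rightarrow> 'a ^ 'n ^ 'm \<Rightarrow> 'a ^ 'm \<Rightarrow>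
     'a ^ 'm ^ 'n \<Rightarrow> 'a ^ 'n ^ 'n \<Rightarrow> 'a ^ 'n \<Rightarrow>
     'a ^ 'm \<Rightarrow> 'a ^ 'n \<Rightarrow> 'a \<Rightarrow> 'a ^ ('m + 'n) option ^ ('m + 'n) option" where
  "block3 p1 p2 p3 q1 q2 q3 r1 r2 r3 = (\<chi> r c.
     case r of
       Some (Inl k) \<Rightarrow> (case c of Some (Inl l) \<Rightarrow> p1 $ k $ l | Some (Inr j) \<Rightarrow> p2 $ k $ j | None \<Rightarrow> p3 $ k)
     | Some (Inr i) \<Rightarrow> (case c of Some (Inl l) \<Rightarrow> q1 $ i $ l | Some (Inr j) \<Rightarrow> q2 $ i $ j | None \<Rightarrow> q3 $ i)
     | None \<Rightarrow> (case c of Some (Inl l) \<Rightarrow> r1 $ l | Some (Inr j) \<Rightarrow> r2 $ j | None \<Rightarrow> r3))"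

text \<open>The coefficient of \<open>dx\<^sub>i\<close> on the right-hand side of \<open>(\<star>)\<close>.\<close>

definition star_coeff ::
    "real ^ 'n ^ 'm \<Rightarrow> real ^ 'n ^ 'n \<Rightarrow> real ^ 'n \<Rightarrow> 'n \<Rightarrow> real ^ ('m + 'n) option ^ ('m + 'n) option" where
  "star_coeff A F b i = block3
     0                       (- (A ** Cmat i))                             0
     (Cmat i ** transpose A) (- (transpose F ** Cmat i) + Cmat i ** F)     (Cmat i *v b)
     0                       (b v* Cmat i)                                 0"

definition cpx_vec :: "real ^ 'n \<Rightarrow> complex ^ 'n" where
  "cpx_vec v = (\<chi> i. complex_of_real (v $ i))"

definition cpx_mat :: "real ^ 'n ^ 'm \<Rightarrow> complex ^ 'n ^ 'm" where
  "cpx_mat M = (\<chi> i j. complex_of_real (M $ i $ j))"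

text \<open>The coefficient of \<open>dx\<^sub>i\<close> in the Lax connection \<open>\<tau>\<^sup>I\<^sub>\<lambda>\<close>; \<open>mat z ** M\<close> is the scalar multiple \<open>z M\<close>.\<close>

definition lax_coeff ::
    "real ^ 'n ^ 'm \<Rightarrow> real ^ 'n ^ 'n \<Rightarrow> real ^ 'n \<Rightarrow> complex \<Rightarrow> 'n \<Rightarrow>
     complex ^ ('m + 'n) option ^ ('m + 'n) option" where
  "lax_coeff A F b z i = block3
     0
     (- (mat z ** (cpx_mat A ** Cmat i)))
     0
     (mat z ** (Cmat i ** transpose (cpx_mat A)))
     (- (transpose (cpx_mat F) ** Cmat i) + Cmat i ** cpx_mat F)
     (Cmat i *v cpx_vec b)
     0
     (cpx_vec b v* Cmat i)
     0"

definition solves_star ::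
    "(real ^ 'n) set \<Rightarrow> (real ^ 'n \<Rightarrow> real ^ 'n ^ 'm) \<Rightarrow> (real ^ 'n \<Rightarrow> real ^ 'n ^ 'n) \<Rightarrow>
     (real ^ 'n \<Rightarrow> real ^ 'n) \<Rightarrow> (real ^ 'n \<Rightarrow> real ^ ('m + 'n) option ^ ('m + 'n) option) \<Rightarrow> bool" where
  "solves_star V A F b g \<longleftrightarrow>
     smooth_on V g \<and> (\<forall>u\<in>V. g u \<in> Lorentz_group) \<and>
     (\<forall>u\<in>V. \<forall>v. matrix_inv (g u) ** frechet_derivative g (at u) v =
                (\<Sum>i\<in>UNIV. v $ i *\<^sub>R star_coeff (A u) (F u) (b u) i))"

definition F_of :: "(real ^ 'n \<Rightarrow> real ^ 'n) \<Rightarrow> real ^ 'n \<Rightarrow> real ^ 'n ^ 'n" where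
  "F_of b u = (\<chi> i j. if i = j then 0 else pd j (\<lambda>x. b x $ i) u / b u $ j)"

definition frame_matrix ::
    "(('m::finite) \<Rightarrow> real ^ 'n \<Rightarrow> real ^ ('m + 'n) option) \<Rightarrow> (real ^ 'n \<Rightarrow> real ^ ('m + 'n) option) \<Rightarrow>
     (real ^ 'n \<Rightarrow> real ^ 'n) \<Rightarrow> real ^ 'n \<Rightarrow> real ^ ('m + 'n) option ^ ('m + 'n) option" where
  "frame_matrix e Y b u = (\<chi> r c.
     case c of
       Some (Inl k) \<Rightarrow> e k u $ r
     | Some (Inr i) \<Rightarrow> ((1 / b u $ i) *\<^sub>R pd i Y u) $ r
     | None \<Rightarrow> Y u $ r)"

definition immersion_into_hyp :: "(real ^ 'n) set \<Rightarrow> (real ^ 'n \<Rightarrow> real ^ ('k::finite) option) \<Rightarrow> bool" where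
  "immersion_into_hyp V Y \<longleftrightarrow>
     smooth_on V Y \<and> Y ` V \<subseteq> hyp \<and> (\<forall>u\<in>V. inj (frechet_derivative Y (at u)))"


subsection \<open>Hypersurfaces of hyperbolic space\<close>

text \<open>The argument \<open>TYPE('q)\<close> supplies \<open>\<real>\<^bsup>k-1\<^esup>\<close> as the domain of the parametrisations.\<close>

definition hypersurface :: "'q::finite itself \<Rightarrow> (real ^ ('k::finite) option) set \<Rightarrow> bool" where
  "hypersurface q Q \<longleftrightarrow>
     CARD('q) + 1 = CARD('k) \<and> Q \<noteq> {} \<and> connected Q \<and> Q \<subseteq> hyp \<and>
     (\<forall>p\<in>Q. \<exists>V (y :: real ^ 'q \<Rightarrow> _). local_param Q V y \<and> p \<in> y ` V)"

definition totally_umbilic :: "'q::finite itself \<Rightarrow> (real ^ ('k::finite) option) set \<Rightarrow> bool" where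
  "totally_umbilic q Q \<longleftrightarrow> hypersurface q Q \<and>
     (\<forall>V (y :: real ^ 'q \<Rightarrow> _). local_param Q V y \<longrightarrow>
        (\<forall>u\<in>V. \<forall>\<nu>\<in>normal_space y u. \<exists>c. shape_operator y \<nu> u = mat c))"

definition totally_geodesic :: "'q::finite itself \<Rightarrow> (real ^ ('k::finite) option) set \<Rightarrow> bool" where
  "totally_geodesic q Q \<longleftrightarrow> hypersurface q Q \<and>
     (\<forall>V (y :: real ^ 'q \<Rightarrow> _). local_param Q V y \<longrightarrow>
        (\<forall>u\<in>V. \<forall>\<nu>\<in>normal_space y u. shape_operator y \<nu> u = 0))"

definition flat_hypersurface :: "'q::finite itself \<Rightarrow> (real ^ ('k::finite) option) set \<Rightarrow> bool" where
  "flat_hypersurface q Q \<longleftrightarrow> hypersurface q Q \<and>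
     (\<forall>V (y :: real ^ 'q \<Rightarrow> _). local_param Q V y \<longrightarrow> const_curvature V (first_ff y) 0)"

end

theory Submission
  imports Defs
begin

text \<open>
  A parallel normal frame makes the shape operators commute, and non-degeneracy makes their joint eigenvalues, the curvature
  normals \<open>\<mu>\<^sub>1, \<dots>, \<mu>\<^sub>n\<close>, distinct and non-zero, so that the joint eigenvectors \<open>E\<^sub>i\<close> form a smooth frame. As \<open>X\<close> is
  isometric, the Gauss equation makes the \<open>\<mu>\<^sub>i\<close> pairwise orthogonal, and \<open>b\<^sub>i = 1 / \<bar>\<mu>\<^sub>i\<bar>\<close>, \<open>a\<^sub>i = \<mu>\<^sub>i / \<bar>\<mu>\<^sub>i\<bar>\<close>. The
  derivatives of the parallel frame are \<open>d\<epsilon>\<^sub>k = \<Sum> a\<^bsub>ki\<^esub> \<omega>\<^sub>i e\<^sub>i\<close>, and \<open>d(d\<epsilon>\<^sub>k) = 0\<close> shows that the forms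
  \<open>\<omega>\<^sub>i = \<bar>\<mu>\<^sub>i\<bar> \<langle>\<cdot>, e\<^sub>i\<rangle>\<close> are closed; their primitives are the coordinates. The structure equations of the frame are then
  \<open>(\<star>)\<close>, whose flatness is the partial \<open>G\<^sup>1\<^bsub>m,n\<^esub>\<close>-system; conversely a flat connection is integrated along rays.

  The umbilic hypersurfaces of \<open>H\<^bsup>n+m\<^esup>\<close> lie in the affine hyperplanes \<open>\<langle>p, x\<rangle>\<^sub>1 = l\<close> with \<open>\<langle>p, p\<rangle>\<^sub>1 + l\<^sup>2 = 1\<close>: along such a
  hypersurface with unit normal \<open>\<nu>\<close> and shape operator \<open>l\<close>, the vector \<open>p = \<nu> - l x\<close> is constant. It is totally geodesic iff
  \<open>l = 0\<close> and flat iff \<open>p\<close> is null. If \<open>M\<^sup>n\<close> lies in this hyperplane, then \<open>w\<^sub>k = \<langle>p, \<epsilon>\<^sub>k\<rangle>\<^sub>1\<close> is constant, \<open>p\<close> is orthogonal to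
  \<open>M\<^sup>n\<close>, and differentiating \<open>\<langle>p, e\<^sub>i\<rangle>\<^sub>1 = 0\<close> gives \<open>A\<^sub>1\<^sup>t w = l b\<close>. Conversely \<open>b = A\<^sub>1\<^sup>t w\<close> makes \<open>p = \<Sum> w\<^sub>k \<epsilon>\<^sub>k - X\<close>
  constant, with \<open>\<langle>p, X\<rangle>\<^sub>1 = 1\<close> and \<open>\<langle>p, p\<rangle>\<^sub>1 = \<bar>w\<bar>\<^sup>2 - 1\<close>.
\<close>

subsection \<open>Calculus of smooth maps\<close>

text \<open>Reasons behind the main constructions. Joint eigenvectors can be chosen smoothly near a
  point if they belong to simple eigenvalues of one operator, so a combination of the commuting
  shape operators with prescribed distinct eigenvalues is built from the orthogonality of the
  curvature normals. The Gauss equation is used for \<open>X\<close> and for the chart of H^n alike: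
  the common intrinsic curvature cancels and only products of second fundamental forms remain. One
  integrability theorem for linear total systems serves both the coordinates (closed forms, via a
  nilpotent matrix) and (iv); differentiability of its solution is a direct estimate between
  neighbouring rays. In (v) the group O(n+m,1) also contains time-reversing matrices, hence a sign
  in front of the last column. In (vi) a totally geodesic hypersurface is the degenerate case l = 0,
  where A^t w = l b says nothing about \<open>b\<close>; and for hypersurfaces of dimension one
  every shape operator is a multiple of the identity, so that umbilicity would not force l to be
  constant.\<close>

lemma Ck_on_cong:
  assumes "open S" "Ck_on k S f" "\<And>x. x \<in> S \<Longrightarrow> f x = g x"
  shows "Ck_on k S g"
  using assms(2,3)
proof (induction k arbitrary: f g)
  case 0
  then show ?case by (auto cong: continuous_on_cong)
next
  case (Suc k)
  have D: "(g has_derivative frechet_derivative f (at x)) (at x)" if "x \<in> S" for x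
    by (rule has_derivative_transform_within_open[where f=f, OF _ assms(1) that])
      (use Suc.prems that in \<open>simp_all add: frechet_derivative_works[symmetric]\<close>)
  have "frechet_derivative f (at x) = frechet_derivative g (at x)" if "x \<in> S" for x
    using D[OF that] frechet_derivative_at by blast
  then have "Ck_on k S (\<lambda>x. frechet_derivative g (at x) v)" for v
    using Suc.IH[of "\<lambda>x. frechet_derivative f (at x) v" "\<lambda>x. frechet_derivative g (at x) v"] Suc.prems by auto
  then show ?case using differentiableI[OF D] by simp
qed

lemma Ck_on_has_derivative:
  assumes "Ck_on (Suc k) S f" "x \<in> S"
  shows "(f has_derivative frechet_derivative f (at x)) (at x)"
  using assms by (simp add: frechet_derivative_works[symmetric])

lemma Ck_on_SucI:
  assumes "open S" "\<And>x. x \<in> S \<Longrightarrow> (f has_derivative f' x) (at x)" "\<And>v. Ck_on k S (\<lambda>x. f' x v)"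
  shows "Ck_on (Suc k) S f"
proof -
  have "f' x = frechet_derivative f (at x)" if "x \<in> S" for x
    using assms(2)[OF that] frechet_derivative_at by blast
  then have "Ck_on k S (\<lambda>x. frechet_derivative f (at x) v)" for v
    by (intro Ck_on_cong[OF assms(1) assms(3)[of v]]) simp
  then show ?thesis using differentiableI[OF assms(2)] by simp
qed

lemma Ck_on_SucD: "Ck_on (Suc k) S f \<Longrightarrow> Ck_on k S f"
proof (induction k arbitrary: f)
  case 0
  then have "f differentiable_on S"
    unfolding differentiable_on_def by (simp add: differentiable_at_withinI)
  then show ?case by (simp add: differentiable_imp_continuous_on)
next
  case (Suc k)
  have "f differentiable (at x)" if "x \<in> S" for x using Suc.prems that by simp
  moreover have "Ck_on k S (\<lambda>x. frechet_derivative f (at x) v)" for v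
    using Suc.prems by (intro Suc.IH) simp
  ultimately show ?case by simp
qed

lemma Ck_on_subset: "Ck_on k S f \<Longrightarrow> T \<subseteq> S \<Longrightarrow> Ck_on k T f"
proof (induction k arbitrary: f)
  case 0
  then show ?case by (auto intro: continuous_on_subset)
next
  case (Suc k)
  have "Ck_on k T (\<lambda>x. frechet_derivative f (at x) v)" for v
    using Suc.prems by (intro Suc.IH) simp_all
  then show ?case using Suc.prems by auto
qed

lemma Ck_on_const: "Ck_on k S (\<lambda>x. c)"
  by (induction k arbitrary: c) simp_all

lemma Ck_on_bounded_linear:
  assumes "open S" "bounded_linear L"
  shows "Ck_on k S f \<Longrightarrow> Ck_on k S (\<lambda>x. L (f x))"
proof (induction k arbitrary: f)
  case 0
  then show ?case using bounded_linear.continuous_on[OF assms(2)] by simp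
next
  case (Suc k)
  show ?case
    by (rule Ck_on_SucI[OF assms(1) bounded_linear.has_derivative[OF assms(2) Ck_on_has_derivative[OF Suc.prems]]], assumption)
      (intro Suc.IH, use Suc.prems in simp)
qed

lemma Ck_on_add:
  assumes "open S"
  shows "Ck_on k S f \<Longrightarrow> Ck_on k S g \<Longrightarrow> Ck_on k S (\<lambda>x. f x + g x)"
proof (induction k arbitrary: f g)
  case 0
  then show ?case by (auto intro: continuous_on_add)
next
  case (Suc k)
  show ?case
    by (rule Ck_on_SucI[OF assms has_derivative_add[OF Ck_on_has_derivative[OF Suc.prems(1)] Ck_on_has_derivative[OF Suc.prems(2)]]], assumption, assumption)
      (intro Suc.IH, use Suc.prems in simp_all)
qed

lemma Ck_on_bilinear:
  assumes "open S" "bounded_bilinear B"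
  shows "Ck_on k S f \<Longrightarrow> Ck_on k S g \<Longrightarrow> Ck_on k S (\<lambda>x. B (f x) (g x))"
proof (induction k arbitrary: f g)
  case 0
  then show ?case using bounded_bilinear.continuous_on[OF assms(2)] by simp
next
  case (Suc k)
  note D = bounded_bilinear.FDERIV[OF assms(2) Ck_on_has_derivative[OF Suc.prems(1)] Ck_on_has_derivative[OF Suc.prems(2)]]
  show ?case
    by (rule Ck_on_SucI[OF assms(1) D], assumption, assumption)
      (intro Ck_on_add[OF assms(1)] Suc.IH Ck_on_SucD[OF Suc.prems(1)] Ck_on_SucD[OF Suc.prems(2)],
        use Suc.prems in simp_all)
qed

lemma Ck_on_sum:
  assumes "open S" "\<And>i. i \<in> I \<Longrightarrow> Ck_on k S (f i)"
  shows "Ck_on k S (\<lambda>x. \<Sum>i\<in>I. f i x)"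
  using assms(2)
  by (induction I rule: infinite_finite_induct) (simp_all add: Ck_on_const Ck_on_add[OF assms(1)])

text \<open>\<open>Ck_on\<close> controls derivatives in fixed directions only, whereas the chain
  rule produces the derivative of \<open>f\<close> in the moving direction Dg(x) v. Expanding that
  direction in a basis of the middle space leaves finitely many fixed directions, with coefficients
  of class C^k.\<close>

lemma Ck_on_compose:
  fixes g :: "'a::real_normed_vector \<Rightarrow> 'b::euclidean_space"
  assumes "open S" "open T"
  shows "Ck_on k T f \<Longrightarrow> Ck_on k S g \<Longrightarrow> g ` S \<subseteq> T \<Longrightarrow> Ck_on k S (\<lambda>x. f (g x))"
proof (induction k arbitrary: f)
  case 0
  then show ?case using continuous_on_compose2[of T f S g] by simp
next
  case (Suc k)
  have lin: "linear (frechet_derivative f (at (g x)))" if "x \<in> S" for x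
    using Suc.prems that by (auto intro!: linear_frechet_derivative)
  have D: "((\<lambda>x. f (g x)) has_derivative
      (\<lambda>v. \<Sum>b\<in>Basis. (frechet_derivative g (at x) v \<bullet> b) *\<^sub>R frechet_derivative f (at (g x)) b)) (at x)"
    if "x \<in> S" for x
  proof -
    have 1: "(f has_derivative frechet_derivative f (at (g x))) (at (g x))"
      using Ck_on_has_derivative[OF Suc.prems(1)] Suc.prems(3) that by auto
    have "((\<lambda>x. f (g x)) has_derivative (\<lambda>v. frechet_derivative f (at (g x)) (frechet_derivative g (at x) v))) (at x)"
      using has_derivative_compose[OF Ck_on_has_derivative[OF Suc.prems(2) that] 1] .
    moreover have "frechet_derivative f (at (g x)) w = (\<Sum>b\<in>Basis. (w \<bullet> b) *\<^sub>R frechet_derivative f (at (g x)) b)" for w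
      using linear_sum[OF lin[OF that], of "\<lambda>b. (w \<bullet> b) *\<^sub>R b" Basis] linear_cmul[OF lin[OF that]]
      by (simp add: euclidean_representation)
    ultimately show ?thesis by (metis (no_types, lifting) ext)
  qed
  have C: "Ck_on k S (\<lambda>x. \<Sum>b\<in>Basis. (frechet_derivative g (at x) v \<bullet> b) *\<^sub>R frechet_derivative f (at (g x)) b)" for v
  proof (intro Ck_on_sum Ck_on_bilinear[OF _ bounded_bilinear_scaleR] assms)
    fix b
    show "Ck_on k S (\<lambda>x. frechet_derivative g (at x) v \<bullet> b)"
      using Suc.prems by (intro Ck_on_bounded_linear[OF assms(1) bounded_linear_inner_left]) simp
    show "Ck_on k S (\<lambda>x. frechet_derivative f (at (g x)) b)"
      using Suc.prems Ck_on_SucD[OF Suc.prems(2)] by (intro Suc.IH) simp_all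
  qed
  show ?case using D C by (rule Ck_on_SucI[OF assms(1)])
qed

section \<open>Closure properties of smooth maps\<close>

named_theorems smooth_intros

lemma smooth_on_cong: "open S \<Longrightarrow> smooth_on S f \<Longrightarrow> (\<And>x. x \<in> S \<Longrightarrow> f x = g x) \<Longrightarrow> smooth_on S g"
  unfolding smooth_on_def using Ck_on_cong[of S _ f g] by simp

lemma smooth_on_subset: "smooth_on S f \<Longrightarrow> T \<subseteq> S \<Longrightarrow> smooth_on T f"
  unfolding smooth_on_def using Ck_on_subset[of _ S f T] by simp

lemma smooth_on_const [smooth_intros]: "smooth_on S (\<lambda>x. c)"
  by (auto simp: smooth_on_def Ck_on_const)

lemma smooth_on_ident [smooth_intros]: "open S \<Longrightarrow> smooth_on S (\<lambda>x. x)"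
  unfolding smooth_on_def
proof
  fix k assume "open S"
  then show "Ck_on k S (\<lambda>x. x)" by (cases k) (auto simp: Ck_on_const)
qed

lemma smooth_on_bounded_linear:
  "bounded_linear L \<Longrightarrow> open S \<Longrightarrow> smooth_on S f \<Longrightarrow> smooth_on S (\<lambda>x. L (f x))"
  by (auto simp: smooth_on_def Ck_on_bounded_linear)

lemma smooth_on_bilinear:
  "bounded_bilinear B \<Longrightarrow> open S \<Longrightarrow> smooth_on S f \<Longrightarrow> smooth_on S g \<Longrightarrow> smooth_on S (\<lambda>x. B (f x) (g x))"
  by (auto simp: smooth_on_def Ck_on_bilinear)

lemma smooth_on_add [smooth_intros]:
  "open S \<Longrightarrow> smooth_on S f \<Longrightarrow> smooth_on S g \<Longrightarrow> smooth_on S (\<lambda>x. f x + g x)"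
  by (auto simp: smooth_on_def Ck_on_add)

lemma smooth_on_uminus [smooth_intros]:
  "open S \<Longrightarrow> smooth_on S f \<Longrightarrow> smooth_on S (\<lambda>x. - f x)"
  by (rule smooth_on_bounded_linear[OF bounded_linear_minus[OF bounded_linear_ident]])

lemma smooth_on_diff [smooth_intros]:
  "open S \<Longrightarrow> smooth_on S f \<Longrightarrow> smooth_on S g \<Longrightarrow> smooth_on S (\<lambda>x. f x - g x)"
  using smooth_on_add[of S f "\<lambda>x. - g x"] smooth_on_uminus[of S g] by auto

lemma smooth_on_sum [smooth_intros]:
  "open S \<Longrightarrow> (\<And>i. i \<in> I \<Longrightarrow> smooth_on S (f i)) \<Longrightarrow> smooth_on S (\<lambda>x. \<Sum>i\<in>I. f i x)"
  by (auto simp: smooth_on_def Ck_on_sum)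

lemma smooth_on_scaleR [smooth_intros]:
  "open S \<Longrightarrow> smooth_on S f \<Longrightarrow> smooth_on S g \<Longrightarrow> smooth_on S (\<lambda>x. f x *\<^sub>R g x)"
  by (rule smooth_on_bilinear[OF bounded_bilinear_scaleR])

lemma smooth_on_mult [smooth_intros]:
  fixes f g :: "'a::real_normed_vector \<Rightarrow> 'b::real_normed_algebra"
  shows "open S \<Longrightarrow> smooth_on S f \<Longrightarrow> smooth_on S g \<Longrightarrow> smooth_on S (\<lambda>x. f x * g x)"
  by (rule smooth_on_bilinear[OF bounded_bilinear_mult])

lemma smooth_on_prod [smooth_intros]:
  fixes f :: "'i \<Rightarrow> 'a::real_normed_vector \<Rightarrow> real"
  assumes "open S" "\<And>i. i \<in> I \<Longrightarrow> smooth_on S (f i)"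
  shows "smooth_on S (\<lambda>x. \<Prod>i\<in>I. f i x)"
  using assms(2) by (induction I rule: infinite_finite_induct) (simp_all add: smooth_on_const smooth_on_mult assms)

lemma smooth_on_compose:
  fixes g :: "'a::real_normed_vector \<Rightarrow> 'b::euclidean_space"
  shows "open S \<Longrightarrow> open T \<Longrightarrow> smooth_on T f \<Longrightarrow> smooth_on S g \<Longrightarrow> g ` S \<subseteq> T \<Longrightarrow> smooth_on S (\<lambda>x. f (g x))"
  by (simp add: smooth_on_def Ck_on_compose)

text \<open>The derivative of 1/f is a polynomial in 1/f and Df, so class C^k of 1/f yields class
  C^(k+1).\<close>

lemma smooth_on_inverse [smooth_intros]:
  fixes f :: "'a::real_normed_vector \<Rightarrow> real"
  assumes "open S" "smooth_on S f" "\<And>x. x \<in> S \<Longrightarrow> f x \<noteq> 0"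
  shows "smooth_on S (\<lambda>x. inverse (f x))"
  unfolding smooth_on_def
proof
  fix k show "Ck_on k S (\<lambda>x. inverse (f x))"
  proof (induction k)
    case 0
    have "Ck_on 0 S f" using assms unfolding smooth_on_def by blast
    then show ?case using assms by (auto intro: continuous_on_inverse)
  next
    case (Suc k)
    have f: "Ck_on (Suc k) S f" using assms unfolding smooth_on_def by blast
    have "((\<lambda>x. inverse (f x)) has_derivative
        (\<lambda>v. - (inverse (f x) * frechet_derivative f (at x) v * inverse (f x)))) (at x)" if "x \<in> S" for x
      using Deriv.has_derivative_inverse[OF assms(3)[OF that] Ck_on_has_derivative[OF f that]] by auto
    moreover have "Ck_on k S (\<lambda>x. - (inverse (f x) * frechet_derivative f (at x) v * inverse (f x)))" for v
      by (intro Ck_on_bounded_linear[OF assms(1) bounded_linear_minus[OF bounded_linear_ident]]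
          Ck_on_bilinear[OF assms(1) bounded_bilinear_mult] Suc) (use f in auto)
    ultimately show ?case by (rule Ck_on_SucI[OF assms(1)])
  qed
qed

lemma smooth_on_divide [smooth_intros]:
  fixes f :: "'a::real_normed_vector \<Rightarrow> real"
  assumes "open S" "smooth_on S f" "smooth_on S g" "\<And>x. x \<in> S \<Longrightarrow> g x \<noteq> 0"
  shows "smooth_on S (\<lambda>x. f x / g x)"
  unfolding divide_inverse using assms by (intro smooth_intros)

lemma smooth_on_sqrt [smooth_intros]:
  assumes "open S" "smooth_on S f" "\<And>x. x \<in> S \<Longrightarrow> f x > 0"
  shows "smooth_on S (\<lambda>x. sqrt (f x))"
  unfolding smooth_on_def
proof
  fix k show "Ck_on k S (\<lambda>x. sqrt (f x))"
  proof (induction k)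
    case 0
    have "Ck_on 0 S f" using assms unfolding smooth_on_def by blast
    then show ?case using assms by (auto intro: continuous_on_real_sqrt)
  next
    case (Suc k)
    have f: "Ck_on (Suc k) S f" using assms unfolding smooth_on_def by blast
    \<comment> \<open>Writing 1/sqrt f as sqrt f times 1/f expresses the derivative through sqrt f,
      to which the induction hypothesis applies, and through factors already known to be
      smooth.\<close>
    have eq: "inverse (sqrt (f x)) = sqrt (f x) * inverse (f x)" if "x \<in> S" for x
      using assms(3)[OF that] by (simp add: field_simps)
    have "((\<lambda>x. sqrt (f x)) has_derivative
        (\<lambda>v. (1/2) * (sqrt (f x) * (inverse (f x) * frechet_derivative f (at x) v)))) (at x)" if "x \<in> S" for x
      using has_derivative_real_sqrt[OF assms(3)[OF that] Ck_on_has_derivative[OF f that]]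
      apply (rule has_derivative_eq_rhs)
      using assms(3)[OF that] eq[OF that] by (auto simp: fun_eq_iff field_simps)
    moreover have "Ck_on k S (\<lambda>x. inverse (f x))"
      using smooth_on_inverse[OF assms(1,2)] assms(3) unfolding smooth_on_def by force
    then have "Ck_on k S (\<lambda>x. (1/2) * (sqrt (f x) * (inverse (f x) * frechet_derivative f (at x) v)))" for v
      by (intro Ck_on_bilinear[OF assms(1) bounded_bilinear_mult] Suc Ck_on_const) (use f in auto)
    ultimately show ?case by (rule Ck_on_SucI[OF assms(1)])
  qed
qed

lemma smooth_on_vec_nth [smooth_intros]:
  "open S \<Longrightarrow> smooth_on S f \<Longrightarrow> smooth_on S (\<lambda>x. f x $ i)"
  by (rule smooth_on_bounded_linear[OF bounded_linear_vec_nth])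

lemma bounded_linear_axis: "bounded_linear (axis i :: 'b::real_normed_vector \<Rightarrow> 'b ^ 'n::finite)"
proof (rule bounded_linear_intro[where K=1])
  show "norm (axis i x :: 'b ^ 'n) \<le> norm x * 1" for x
    unfolding norm_vec_def
  proof (rule order_trans[OF L2_set_le_sum])
    have "(\<Sum>j\<in>UNIV. norm ((axis i x :: 'b ^ 'n) $ j)) = (\<Sum>j\<in>UNIV. if j = i then norm x else 0)"
      by (intro sum.cong) (auto simp: axis_def)
    then show "(\<Sum>j\<in>UNIV. norm ((axis i x :: 'b ^ 'n) $ j)) \<le> norm x * 1" by (simp add: sum.delta)
  qed simp
qed (auto simp: axis_def vec_eq_iff)

lemma smooth_on_vec_lambda [smooth_intros]:
  fixes f :: "'a::real_normed_vector \<Rightarrow> 'n::finite \<Rightarrow> 'b::real_normed_vector"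
  assumes "open S" "\<And>i. smooth_on S (\<lambda>x. f x i)"
  shows "smooth_on S (\<lambda>x. \<chi> i. f x i)"
proof -
  have "(\<chi> i. f x i) = (\<Sum>i\<in>UNIV. axis i (f x i))" for x
    by (simp add: vec_eq_iff axis_def sum.delta)
  then show ?thesis using assms by (auto intro!: smooth_on_sum smooth_on_bounded_linear[OF bounded_linear_axis])
qed

lemma smooth_on_inner [smooth_intros]:
  "open S \<Longrightarrow> smooth_on S f \<Longrightarrow> smooth_on S g \<Longrightarrow> smooth_on S (\<lambda>x. f x \<bullet> g x)"
  by (rule smooth_on_bilinear[OF bounded_bilinear_inner])

lemma smooth_on_matrix_mul [smooth_intros]:
  fixes f :: "'a::real_normed_vector \<Rightarrow> real ^ 'n::finite ^ 'm::finite" and g :: "'a \<Rightarrow> real ^ 'k::finite ^ 'n"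
  shows "open S \<Longrightarrow> smooth_on S f \<Longrightarrow> smooth_on S g \<Longrightarrow> smooth_on S (\<lambda>x. f x ** g x)"
  unfolding matrix_matrix_mult_def by (intro smooth_intros)

lemma smooth_on_matrix_vector_mul [smooth_intros]:
  fixes f :: "'a::real_normed_vector \<Rightarrow> real ^ 'n::finite ^ 'm::finite" and g :: "'a \<Rightarrow> real ^ 'n"
  shows "open S \<Longrightarrow> smooth_on S f \<Longrightarrow> smooth_on S g \<Longrightarrow> smooth_on S (\<lambda>x. f x *v g x)"
  unfolding matrix_vector_mult_def by (intro smooth_intros)

lemma smooth_on_lorentz [smooth_intros]:
  "open S \<Longrightarrow> smooth_on S f \<Longrightarrow> smooth_on S g \<Longrightarrow> smooth_on S (\<lambda>x. f x \<bullet>\<^sub>1 g x)"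
  unfolding lorentz_def by (intro smooth_intros)

lemma smooth_on_det [smooth_intros]:
  fixes f :: "'a::real_normed_vector \<Rightarrow> real ^ 'n::finite ^ 'n"
  shows "open S \<Longrightarrow> smooth_on S f \<Longrightarrow> smooth_on S (\<lambda>x. det (f x))"
  unfolding det_def by (intro smooth_intros)

lemma matrix_inv_inverse:
  fixes A :: "real ^ 'n::finite ^ 'n"
  assumes "invertible A"
  shows "A ** matrix_inv A = mat 1" "matrix_inv A ** A = mat 1"
  using someI_ex[OF assms[unfolded invertible_def]] unfolding matrix_inv_def by auto

text \<open>Cramer's rule writes the entries of the inverse as quotients of determinants; smoothness
  of inversion then follows from that of \<open>det\<close>.\<close>

lemma matrix_inv_cramer:
  fixes A :: "real ^ 'n::finite ^ 'n"
  assumes "invertible A"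
  shows "matrix_inv A $ r $ c = det (\<chi> i j. if j = r then axis c 1 $ i else A $ i $ j) / det A"
proof -
  have 0: "det A \<noteq> 0" using assms invertible_det_nz by blast
  have "A *v (matrix_inv A *v axis c 1) = axis c 1"
    using assms by (simp add: matrix_inv_inverse matrix_vector_mul_assoc)
  then have "matrix_inv A *v axis c 1 = (\<chi> k. det (\<chi> i j. if j = k then axis c 1 $ i else A $ i $ j) / det A)"
    using cramer[OF 0] by blast
  then have "(matrix_inv A *v axis c 1) $ r = det (\<chi> i j. if j = r then axis c 1 $ i else A $ i $ j) / det A"
    by simp
  moreover have "(matrix_inv A *v axis c 1) $ r = matrix_inv A $ r $ c"
    by (simp add: matrix_vector_mult_def axis_def if_distrib sum.delta cong: if_cong)
  ultimately show ?thesis by simp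
qed

lemma smooth_on_if [smooth_intros]:
  "(P \<Longrightarrow> smooth_on S f) \<Longrightarrow> (\<not> P \<Longrightarrow> smooth_on S g) \<Longrightarrow> smooth_on S (\<lambda>x. if P then f x else g x)"
  by (cases P) simp_all

lemma smooth_on_matrix_inv [smooth_intros]:
  fixes f :: "'a::real_normed_vector \<Rightarrow> real ^ 'n::finite ^ 'n"
  assumes "open S" "smooth_on S f" "\<And>x. x \<in> S \<Longrightarrow> invertible (f x)"
  shows "smooth_on S (\<lambda>x. matrix_inv (f x))"
proof (rule smooth_on_cong[OF assms(1)])
  show "smooth_on S (\<lambda>x. \<chi> r c. det (\<chi> i j. if j = r then axis c 1 $ i else f x $ i $ j) / det (f x))"
    using assms by (intro smooth_intros) (auto simp: invertible_det_nz)
  show "(\<chi> r c. det (\<chi> i j. if j = r then axis c 1 $ i else f x $ i $ j) / det (f x)) = matrix_inv (f x)" if "x \<in> S" for x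
    using matrix_inv_cramer[OF assms(3)[OF that]] by (simp add: vec_eq_iff)
qed

lemma smooth_on_differentiable: "smooth_on S f \<Longrightarrow> x \<in> S \<Longrightarrow> f differentiable (at x)"
  unfolding smooth_on_def by (metis Ck_on.simps(2))

lemma smooth_on_has_derivative:
  "smooth_on S f \<Longrightarrow> x \<in> S \<Longrightarrow> (f has_derivative frechet_derivative f (at x)) (at x)"
  using smooth_on_differentiable frechet_derivative_works by blast

lemma smooth_on_continuous: "smooth_on S f \<Longrightarrow> continuous_on S f"
  unfolding smooth_on_def using Ck_on.simps(1) by blast

lemma smooth_on_frechet: "smooth_on S f \<Longrightarrow> smooth_on S (\<lambda>x. frechet_derivative f (at x) v)"
  unfolding smooth_on_def by (metis Ck_on.simps(2))

lemma smooth_on_pd [smooth_intros]: "smooth_on S f \<Longrightarrow> smooth_on S (pd i f)"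
  unfolding pd_def[abs_def] by (rule smooth_on_frechet)

text \<open>Localising allows smoothness to be checked on the local extensions that
  \<open>smooth_map_on\<close> provides.\<close>

lemma smooth_on_local:
  assumes "\<And>x. x \<in> S \<Longrightarrow> \<exists>W. open W \<and> x \<in> W \<and> W \<subseteq> S \<and> smooth_on W f"
  shows "smooth_on S f"
proof -
  have "Ck_on k S f" if "\<And>x. x \<in> S \<Longrightarrow> \<exists>W. open W \<and> x \<in> W \<and> W \<subseteq> S \<and> Ck_on k W f" for k
    using that
  proof (induction k arbitrary: f)
    case 0
    have "continuous (at x) f" if "x \<in> S" for x
      using 0[OF that] continuous_on_eq_continuous_at by auto
    then show ?case by (simp add: continuous_at_imp_continuous_on)
  next
    case (Suc k)
    have "f differentiable (at x)" if "x \<in> S" for x using Suc.prems[OF that] by auto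
    moreover have "Ck_on k S (\<lambda>x. frechet_derivative f (at x) v)" for v
      by (rule Suc.IH) (use Suc.prems in \<open>metis Ck_on.simps(2)\<close>)
    ultimately show ?case by auto
  qed
  then show ?thesis using assms unfolding smooth_on_def by metis
qed

lemma smooth_map_on_compose:
  fixes \<psi> :: "'a::real_normed_vector \<Rightarrow> 'b::euclidean_space"
  assumes "smooth_map_on S f" "open V" "smooth_on V \<psi>" "\<psi> ` V \<subseteq> S"
  shows "smooth_on V (f \<circ> \<psi>)"
proof (rule smooth_on_local)
  fix x assume x: "x \<in> V"
  then obtain W f' where W: "open W" "\<psi> x \<in> W" "smooth_on W f'" "\<forall>y \<in> S \<inter> W. f' y = f y"
    using assms unfolding smooth_map_on_def by blast
  define V' where "V' = V \<inter> \<psi> -` W"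
  have o: "open V'" unfolding V'_def
    using assms(2,3) W(1) continuous_open_preimage smooth_on_continuous by blast
  have "smooth_on V' (\<lambda>x. f' (\<psi> x))"
    by (rule smooth_on_compose[OF o W(1,3)]) (use assms in \<open>auto simp: V'_def intro: smooth_on_subset\<close>)
  then have "smooth_on V' (f \<circ> \<psi>)"
    by (rule smooth_on_cong[OF o]) (use W assms in \<open>auto simp: V'_def\<close>)
  then show "\<exists>W. open W \<and> x \<in> W \<and> W \<subseteq> V \<and> smooth_on W (f \<circ> \<psi>)"
    using o x W V'_def by blast
qed

section \<open>Calculus of partial derivatives\<close>

lemma frechet_derivative_eq: "(f has_derivative f') (at x) \<Longrightarrow> frechet_derivative f (at x) = f'"
  by (rule frechet_derivative_at[symmetric])

lemma pd_eq: "(f has_derivative f') (at u) \<Longrightarrow> pd i f u = f' (axis i 1)"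
  unfolding pd_def by (simp add: frechet_derivative_eq)

lemma pd_const [simp]: "pd i (\<lambda>x. c) u = 0"
  unfolding pd_def by simp

lemma pd_cong:
  assumes "open S" "u \<in> S" "\<And>x. x \<in> S \<Longrightarrow> f x = g x" "f differentiable (at u)"
  shows "pd i f u = pd i g u"
  unfolding pd_def using frechet_derivative_transform_within_open[OF assms(4,1,2,3)] by simp

lemma pd_bounded_linear:
  assumes "bounded_linear L" "f differentiable (at u)"
  shows "pd i (\<lambda>x. L (f x)) u = L (pd i f u)"
  using pd_eq[OF bounded_linear.has_derivative[OF assms(1) assms(2)[unfolded frechet_derivative_works]]]
  unfolding pd_def .

lemma pd_bilinear:
  assumes "bounded_bilinear B" "f differentiable (at u)" "g differentiable (at u)"
  shows "pd i (\<lambda>x. B (f x) (g x)) u = B (f u) (pd i g u) + B (pd i f u) (g u)"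
  using pd_eq[OF bounded_bilinear.FDERIV[OF assms(1) assms(2)[unfolded frechet_derivative_works] assms(3)[unfolded frechet_derivative_works]]]
  unfolding pd_def .

lemma pd_add:
  assumes "f differentiable (at u)" "g differentiable (at u)"
  shows "pd i (\<lambda>x. f x + g x) u = pd i f u + pd i g u"
  using pd_eq[OF has_derivative_add[OF assms[unfolded frechet_derivative_works]]] unfolding pd_def .

lemma pd_diff:
  assumes "f differentiable (at u)" "g differentiable (at u)"
  shows "pd i (\<lambda>x. f x - g x) u = pd i f u - pd i g u"
  using pd_eq[OF has_derivative_diff[OF assms[unfolded frechet_derivative_works]]] unfolding pd_def .

lemma pd_sum:
  assumes "\<And>k. k \<in> I \<Longrightarrow> f k differentiable (at u)"
  shows "pd i (\<lambda>x. \<Sum>k\<in>I. f k x) u = (\<Sum>k\<in>I. pd i (f k) u)"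
  unfolding pd_def
  by (subst frechet_derivative_eq[OF has_derivative_sum]) (use assms frechet_derivative_works in blast, simp)

lemma pd_mult:
  fixes f g :: "real ^ 'd \<Rightarrow> real"
  assumes "f differentiable (at u)" "g differentiable (at u)"
  shows "pd i (\<lambda>x. f x * g x) u = f u * pd i g u + pd i f u * g u"
  by (rule pd_bilinear[OF bounded_bilinear_mult assms])

lemma pd_scaleR:
  assumes "f differentiable (at u)" "g differentiable (at u)"
  shows "pd i (\<lambda>x. f x *\<^sub>R g x) u = f u *\<^sub>R pd i g u + pd i f u *\<^sub>R g u"
  by (rule pd_bilinear[OF bounded_bilinear_scaleR assms])

lemma pd_vec_nth:
  assumes "f differentiable (at u)"
  shows "pd i (\<lambda>x. f x $ k) u = pd i f u $ k"
  by (rule pd_bounded_linear[OF bounded_linear_vec_nth assms])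

lemma frechet_eq_sum_pd:
  assumes "f differentiable (at u)"
  shows "frechet_derivative f (at u) v = (\<Sum>i\<in>UNIV. v $ i *\<^sub>R pd i f u)"
proof -
  have "v = (\<Sum>i\<in>UNIV. v $ i *\<^sub>R axis i 1)" using basis_expansion[of v] by (simp add: scalar_mult_eq_scaleR)
  then have "frechet_derivative f (at u) v = frechet_derivative f (at u) (\<Sum>i\<in>UNIV. v $ i *\<^sub>R axis i 1)" by simp
  also have "\<dots> = (\<Sum>i\<in>UNIV. v $ i *\<^sub>R pd i f u)"
    unfolding pd_def using linear_frechet_derivative[OF assms] by (simp add: linear_sum linear_cmul)
  finally show ?thesis .
qed

lemma pd_compose:
  assumes "g differentiable (at u)" "f differentiable (at (g u))"
  shows "pd i (f \<circ> g) u = (\<Sum>p\<in>UNIV. pd i g u $ p *\<^sub>R pd p f (g u))"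
proof -
  have "pd i (f \<circ> g) u = frechet_derivative f (at (g u)) (pd i g u)"
    unfolding pd_def using assms by (simp add: frechet_derivative_compose)
  then show ?thesis using frechet_eq_sum_pd[OF assms(2)] by simp
qed

lemma DERIV_along_line:
  fixes f :: "'a::real_normed_vector \<Rightarrow> real"
  assumes "f differentiable (at (p + s *\<^sub>R v))"
  shows "((\<lambda>s. f (p + s *\<^sub>R v)) has_real_derivative frechet_derivative f (at (p + s *\<^sub>R v)) v) (at s)"
proof -
  have "((\<lambda>s. p + s *\<^sub>R v) has_derivative (\<lambda>h. h *\<^sub>R v)) (at s)"
    by (auto intro!: derivative_eq_intros)
  from has_derivative_compose[OF this assms[unfolded frechet_derivative_works]]
  show ?thesis unfolding has_field_derivative_def
    by (rule has_derivative_eq_rhs) (use linear_cmul[OF linear_frechet_derivative[OF assms]] in \<open>auto simp: fun_eq_iff mult.commute\<close>)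
qed

text \<open>Two applications of the mean value theorem, one in the direction \<open>v\<close> and
  one in the direction \<open>w\<close>. The second difference is symmetric in \<open>v\<close> and
  \<open>w\<close>, the iterated derivative is not visibly so; symmetry of second derivatives rests
  on this. The additional summand \<open>t\<close> in the distance bound keeps the inequality strict
  when \<open>v\<close> and \<open>w\<close> vanish.\<close>

lemma second_difference_mean_value:
  fixes f :: "'a::real_normed_vector \<Rightarrow> real"
  assumes f: "smooth_on (ball u r) f" and t: "0 < t" "t * (norm v + norm w) < r"
  shows "\<exists>x. dist u x < t * (norm v + norm w) + t \<and> x \<in> ball u r \<and>
    f (u + t *\<^sub>R v + t *\<^sub>R w) - f (u + t *\<^sub>R v) - f (u + t *\<^sub>R w) + f u =
      t * t * frechet_derivative (\<lambda>x. frechet_derivative f (at x) v) (at x) w"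
proof -
  let ?D = "\<lambda>x. frechet_derivative f (at x) v"
  have nb: "norm (a *\<^sub>R v + b *\<^sub>R w) \<le> t * (norm v + norm w)" if "0 \<le> a" "a \<le> t" "0 \<le> b" "b \<le> t" for a b
  proof -
    have "norm (a *\<^sub>R v + b *\<^sub>R w) \<le> a * norm v + b * norm w"
      using norm_triangle_ineq[of "a *\<^sub>R v" "b *\<^sub>R w"] that by simp
    also have "\<dots> \<le> t * norm v + t * norm w" using that by (intro add_mono mult_right_mono) auto
    finally show ?thesis by (simp add: algebra_simps)
  qed
  have inb: "u + a *\<^sub>R v + b *\<^sub>R w \<in> ball u r" if "0 \<le> a" "a \<le> t" "0 \<le> b" "b \<le> t" for a b
  proof -
    have "dist u (u + a *\<^sub>R v + b *\<^sub>R w) = norm (a *\<^sub>R v + b *\<^sub>R w)"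
      by (metis add.assoc dist_add_cancel2 dist_commute dist_0_norm add.right_neutral dist_add_cancel)
    then show ?thesis using nb[OF that] t by simp
  qed
  have df: "f differentiable (at x)" "?D differentiable (at x)" if "x \<in> ball u r" for x
    using smooth_on_differentiable[OF f that] smooth_on_differentiable[OF smooth_on_frechet[OF f] that] by auto
  define \<phi> where "\<phi> s = f (u + t *\<^sub>R w + s *\<^sub>R v) - f (u + s *\<^sub>R v)" for s
  have "(\<phi> has_real_derivative (?D (u + t *\<^sub>R w + s *\<^sub>R v) - ?D (u + s *\<^sub>R v))) (at s)" if "0 \<le> s" "s \<le> t" for s
    unfolding \<phi>_def using inb[OF that, of t] inb[OF that, of 0] t
    by (intro DERIV_diff DERIV_along_line df) (auto simp: algebra_simps)
  from MVT2[OF t(1) this] obtain \<xi> where xi: "0 < \<xi>" "\<xi> < t"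
    "\<phi> t - \<phi> 0 = t * (?D (u + t *\<^sub>R w + \<xi> *\<^sub>R v) - ?D (u + \<xi> *\<^sub>R v))" by auto
  have "((\<lambda>s. ?D (u + \<xi> *\<^sub>R v + s *\<^sub>R w)) has_real_derivative
      frechet_derivative ?D (at (u + \<xi> *\<^sub>R v + s *\<^sub>R w)) w) (at s)" if "0 \<le> s" "s \<le> t" for s
    using inb[of \<xi> s] that xi by (intro DERIV_along_line df) auto
  from MVT2[OF t(1) this] obtain \<eta> where eta: "0 < \<eta>" "\<eta> < t"
    "?D (u + \<xi> *\<^sub>R v + t *\<^sub>R w) - ?D (u + \<xi> *\<^sub>R v) = t * frechet_derivative ?D (at (u + \<xi> *\<^sub>R v + \<eta> *\<^sub>R w)) w"
    by auto
  have in2: "u + \<xi> *\<^sub>R v + \<eta> *\<^sub>R w \<in> ball u r" using inb xi eta by simp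
  have "dist u (u + \<xi> *\<^sub>R v + \<eta> *\<^sub>R w) = norm (\<xi> *\<^sub>R v + \<eta> *\<^sub>R w)"
    by (metis add.assoc dist_add_cancel2 dist_commute dist_0_norm add.right_neutral dist_add_cancel)
  then have "dist u (u + \<xi> *\<^sub>R v + \<eta> *\<^sub>R w) < t * (norm v + norm w) + t"
    using nb[of \<xi> \<eta>] xi eta t by simp
  moreover have "f (u + t *\<^sub>R v + t *\<^sub>R w) - f (u + t *\<^sub>R v) - f (u + t *\<^sub>R w) + f u = \<phi> t - \<phi> 0"
    by (simp add: \<phi>_def algebra_simps)
  moreover have "\<phi> t - \<phi> 0 = t * t * frechet_derivative ?D (at (u + \<xi> *\<^sub>R v + \<eta> *\<^sub>R w)) w"
    using xi(3) eta(3) by (simp add: algebra_simps)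
  ultimately show ?thesis using in2 by metis
qed

text \<open>Schwarz's theorem: the same second difference is t^2 times one iterated derivative at a
  point near \<open>u\<close>, and t^2 times the other at a second such point; continuity of both at
  \<open>u\<close> leaves no room for a gap.\<close>

lemma frechet_commute_real:
  fixes f :: "'a::real_normed_vector \<Rightarrow> real"
  assumes "open V" "smooth_on V f" "u \<in> V"
  shows "frechet_derivative (\<lambda>x. frechet_derivative f (at x) v) (at u) w =
         frechet_derivative (\<lambda>x. frechet_derivative f (at x) w) (at u) v" (is "?P u = ?Q u")
proof (rule ccontr)
  assume ne: "?P u \<noteq> ?Q u"
  \<comment> \<open>Half of the gap: values closer than this to \<open>?P u\<close> and to
    \<open>?Q u\<close> cannot coincide.\<close>
  define \<epsilon> where "\<epsilon> = \<bar>?P u - ?Q u\<bar> / 2"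
  have e: "\<epsilon> > 0" using ne by (simp add: \<epsilon>_def)
  have "continuous_on V ?P" "continuous_on V ?Q"
    by (rule smooth_on_continuous[OF smooth_on_frechet[OF smooth_on_frechet[OF assms(2)]]])+
  then have "isCont ?P u" "isCont ?Q u" using assms continuous_on_eq_continuous_at by blast+
  then obtain d1 d2 where d1: "d1 > 0" "\<And>x. dist x u < d1 \<Longrightarrow> dist (?P x) (?P u) < \<epsilon>"
    and d2: "d2 > 0" "\<And>x. dist x u < d2 \<Longrightarrow> dist (?Q x) (?Q u) < \<epsilon>"
    unfolding continuous_at_eps_delta using e by metis
  obtain r where r: "r > 0" "ball u r \<subseteq> V" using assms openE by blast
  define \<delta> where "\<delta> = min r (min d1 d2)"
  \<comment> \<open>The summand 2 makes t (|v| + |w|) + t strictly smaller than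
    \<open>\<delta>\<close>, as the distance bound of the second difference requires.\<close>
  define t where "t = \<delta> / (norm v + norm w + 2)"
  have d: "\<delta> > 0" using r d1 d2 by (simp add: \<delta>_def)
  have pos: "norm v + norm w + 2 > 0" by (smt (verit) norm_ge_zero)
  have t: "t > 0" using d pos by (simp add: t_def)
  have tt: "t * (norm v + norm w) + t < \<delta>"
  proof -
    have "t * (norm v + norm w + 2) = \<delta>" using pos by (simp add: t_def)
    then show ?thesis using t by (simp add: algebra_simps)
  qed
  have f: "smooth_on (ball u r) f" using assms(2) r smooth_on_subset by blast
  have tr: "t * (norm v + norm w) < r" "t * (norm w + norm v) < r" using tt t by (simp_all add: \<delta>_def add.commute)
  obtain x where x: "dist u x < t * (norm v + norm w) + t"
    "f (u + t *\<^sub>R v + t *\<^sub>R w) - f (u + t *\<^sub>R v) - f (u + t *\<^sub>R w) + f u = t * t * ?P x"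
    using second_difference_mean_value[OF f t tr(1)] by blast
  obtain y where y: "dist u y < t * (norm w + norm v) + t"
    "f (u + t *\<^sub>R w + t *\<^sub>R v) - f (u + t *\<^sub>R w) - f (u + t *\<^sub>R v) + f u = t * t * ?Q y"
    using second_difference_mean_value[OF f t tr(2)] by blast
  have "t * t * ?P x = t * t * ?Q y" using x(2) y(2) by (simp add: algebra_simps)
  then have "?P x = ?Q y" using t by simp
  moreover have "dist (?P x) (?P u) < \<epsilon>" using d1(2)[of x] x(1) tt by (simp add: \<delta>_def dist_commute)
  moreover have "dist (?Q y) (?Q u) < \<epsilon>" using d2(2)[of y] y(1) tt by (simp add: \<delta>_def dist_commute add.commute)
  ultimately show False using ne unfolding \<epsilon>_def dist_real_def by (smt (verit) field_sum_of_halves)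
qed

lemma frechet_inner:
  assumes "f differentiable (at x)"
  shows "frechet_derivative (\<lambda>x. f x \<bullet> b) (at x) v = frechet_derivative f (at x) v \<bullet> b"
  using frechet_derivative_eq[OF bounded_linear.has_derivative[OF bounded_linear_inner_left assms[unfolded frechet_derivative_works]]]
  by simp

lemma pd_commute:
  fixes f :: "real ^ 'd \<Rightarrow> 'b::euclidean_space"
  assumes "open V" "smooth_on V f" "u \<in> V"
  shows "pd i (pd j f) u = pd j (pd i f) u"
proof (rule euclidean_eqI)
  fix b :: 'b
  have s: "smooth_on V (\<lambda>x. f x \<bullet> b)" using assms by (intro smooth_intros)
  have 1: "pd i (pd j f) u \<bullet> b = frechet_derivative (\<lambda>x. frechet_derivative (\<lambda>x. f x \<bullet> b) (at x) (axis j 1)) (at u) (axis i 1)" for i j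
  proof -
    have "pd i (pd j f) u \<bullet> b = frechet_derivative (\<lambda>x. pd j f x \<bullet> b) (at u) (axis i 1)"
      using frechet_inner[OF smooth_on_differentiable[OF smooth_on_pd[OF assms(2)] assms(3)]] by (simp add: pd_def[of i])
    also have "frechet_derivative (\<lambda>x. pd j f x \<bullet> b) (at u)
        = frechet_derivative (\<lambda>x. frechet_derivative (\<lambda>x. f x \<bullet> b) (at x) (axis j 1)) (at u)"
    proof (rule frechet_derivative_transform_within_open[OF _ assms(1,3)])
      show "(\<lambda>x. pd j f x \<bullet> b) differentiable at u"
        by (rule smooth_on_differentiable[OF _ assms(3)]) (intro smooth_intros assms)
      show "pd j f x \<bullet> b = frechet_derivative (\<lambda>x. f x \<bullet> b) (at x) (axis j 1)" if "x \<in> V" for x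
        unfolding pd_def using frechet_inner[OF smooth_on_differentiable[OF assms(2) that]] by simp
    qed
    finally show ?thesis .
  qed
  show "pd i (pd j f) u \<bullet> b = pd j (pd i f) u \<bullet> b"
    unfolding 1 by (rule frechet_commute_real[OF assms(1) s assms(3)])
qed

text \<open>The C^1 theorem gives an inverse \<open>g\<close> with Dg(y) = M(g y)^(-1), where
  \<open>M\<close> is the Jacobian matrix. Inversion of matrices is smooth where the determinant is
  non-zero, so the right-hand side is as regular as \<open>g\<close>, and regularity climbs one
  order at a time.\<close>

theorem smooth_inverse_function:
  fixes f :: "real ^ 'n::finite \<Rightarrow> real ^ 'n"
  assumes "open U" "smooth_on U f" "x0 \<in> U" "inj (frechet_derivative f (at x0))"
  obtains U' V g where "open U'" "U' \<subseteq> U" "x0 \<in> U'" "open V" "f x0 \<in> V" "homeomorphism U' V f g" "smooth_on V g"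
    "\<And>y v. y \<in> V \<Longrightarrow> frechet_derivative f (at (g y)) (frechet_derivative g (at y) v) = v"
proof -
  define D where "D x = Blinfun (frechet_derivative f (at x))" for x
  have D: "blinfun_apply (D x) = frechet_derivative f (at x)" if "x \<in> U" for x
    unfolding D_def using smooth_on_has_derivative[OF assms(2) that] has_derivative_bounded_linear
    by (auto intro: bounded_linear_Blinfun_apply)
  have derf: "(f has_derivative blinfun_apply (D x)) (at x)" if "x \<in> U" for x
    unfolding D[OF that] by (rule smooth_on_has_derivative[OF assms(2) that])
  have contD: "continuous_on U D"
  proof (rule continuous_on_blinfun_componentwise)
    fix i
    show "continuous_on U (\<lambda>x. blinfun_apply (D x) i)"
      by (rule continuous_on_eq[OF smooth_on_continuous[OF smooth_on_frechet[OF assms(2), of i]]]) (simp add: D)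
  qed
  have lin: "linear (frechet_derivative f (at x0))"
    by (rule linear_frechet_derivative[OF smooth_on_differentiable[OF assms(2,3)]])
  obtain L where L: "linear L" "L \<circ> frechet_derivative f (at x0) = id"
    using linear_injective_left_inverse[OF lin assms(4)] by blast
  have "Blinfun L o\<^sub>L D x0 = id_blinfun"
  proof (rule blinfun_eqI)
    fix v
    have "blinfun_apply (Blinfun L) w = L w" for w
      using L(1) by (simp add: bounded_linear_Blinfun_apply linear_conv_bounded_linear)
    then show "blinfun_apply (Blinfun L o\<^sub>L D x0) v = blinfun_apply id_blinfun v"
      using L(2) assms(3) by (simp add: D fun_eq_iff)
  qed
  from inverse_function_theorem[OF assms(1) derf contD assms(3) this]
  obtain U' V g g' where *: "open U'" "U' \<subseteq> U" "x0 \<in> U'" "open V" "f x0 \<in> V" "homeomorphism U' V f g"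
    and g: "\<And>y. y \<in> V \<Longrightarrow> (g has_derivative (g' y)) (at y)"
    and g': "\<And>y. y \<in> V \<Longrightarrow> g' y = inv (blinfun_apply (D (g y)))"
    and bij: "\<And>y. y \<in> V \<Longrightarrow> bij (blinfun_apply (D (g y)))" by metis
  have gU: "g y \<in> U" if "y \<in> V" for y using * that unfolding homeomorphism_def by blast
  define M where "M x = matrix (frechet_derivative f (at x))" for x
  have Mv: "M x *v v = frechet_derivative f (at x) v" if "x \<in> U" for x v
    unfolding M_def using linear_frechet_derivative[OF smooth_on_differentiable[OF assms(2) that]]
    by (metis matrix_vector_mul(2))
  have inv: "invertible (M (g y))" if "y \<in> V" for y
  proof -
    have "inj ((*v) (M (g y)))" using bij[OF that] D[OF gU[OF that]] Mv[OF gU[OF that]]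
      by (metis (no_types, lifting) bij_is_inj ext)
    then show ?thesis using invertible_left_inverse matrix_left_invertible_injective by blast
  qed
  have g'v: "g' y v = matrix_inv (M (g y)) *v v" if "y \<in> V" for y v
  proof -
    have "blinfun_apply (D (g y)) (matrix_inv (M (g y)) *v v) = v"
      using Mv[OF gU[OF that]] D[OF gU[OF that]] matrix_inv_inverse[OF inv[OF that]]
      by (metis matrix_vector_mul_assoc matrix_vector_mul_lid)
    then show ?thesis using g'[OF that] bij[OF that] by (metis bij_inv_eq_iff)
  qed
  define W where "W = {x \<in> U. det (M x) \<noteq> 0}"
  have sM: "smooth_on U M"
    unfolding M_def[abs_def] matrix_def using assms by (intro smooth_intros smooth_on_frechet)
  have oW: "open W"
  proof -
    have "continuous_on U (\<lambda>x. det (M x))" by (intro smooth_on_continuous smooth_intros assms sM)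
    then have "open ((\<lambda>x. det (M x)) -` (- {0}) \<inter> U)"
      using continuous_on_open_vimage[OF assms(1)] by (metis open_Compl closed_singleton)
    moreover have "(\<lambda>x. det (M x)) -` (- {0}) \<inter> U = W" by (auto simp: W_def)
    ultimately show ?thesis by simp
  qed
  have gW: "g ` V \<subseteq> W" using gU inv by (auto simp: W_def invertible_det_nz)
  have sW: "smooth_on W (\<lambda>x. matrix_inv (M x) *v v)" for v
    by (intro smooth_intros oW smooth_on_subset[OF sM]) (auto simp: W_def invertible_det_nz)
  have "Ck_on k V g" for k
  proof (induction k)
    case 0
    show ?case using * by (simp add: homeomorphism_def)
  next
    case (Suc k)
    have "Ck_on k V (\<lambda>y. g' y v)" for v
    proof (rule Ck_on_cong[OF *(4)])
      show "Ck_on k V (\<lambda>y. matrix_inv (M (g y)) *v v)"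
        using sW[of v] unfolding smooth_on_def by (intro Ck_on_compose[OF *(4) oW _ Suc gW]) blast
    qed (simp add: g'v)
    with g show ?case by (rule Ck_on_SucI[OF *(4)])
  qed
  then have sg: "smooth_on V g" by (simp add: smooth_on_def)
  have "frechet_derivative f (at (g y)) (frechet_derivative g (at y) v) = v" if "y \<in> V" for y v
    unfolding frechet_derivative_eq[OF g[OF that]] using g'[OF that] bij[OF that] D[OF gU[OF that]]
    by (metis bij_inv_eq_iff)
  with * sg show ?thesis using that by blast
qed

subsection \<open>Linear total differential equations\<close>

text \<open>Picard iteration written as a series: \<open>Y n\<close> is the increment contributed by
  the n-th iteration, bounded by |y0| (K t)^n / n!. The factorial gives convergence on the whole
  unit interval, with no restriction on its length in terms of \<open>M\<close>.\<close>

lemma linear_ode_exists: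
  fixes B :: "'b::banach \<Rightarrow> 'c::real_normed_vector \<Rightarrow> 'b"
  assumes B: "bounded_bilinear B" and M: "continuous_on {0..1} M"
  shows "\<exists>y. y 0 = y0 \<and> (\<forall>t\<in>{0..1}. (y has_vector_derivative B (y t) (M t)) (at t within {0..1::real}))"
proof -
  define Y where "Y = rec_nat (\<lambda>t. y0) (\<lambda>n f t. integral {0..t} (\<lambda>s. B (f s) (M s)))"
  have Y0: "Y 0 t = y0" and YS: "Y (Suc n) t = integral {0..t} (\<lambda>s. B (Y n s) (M s))" for n t
    by (simp_all add: Y_def)
  obtain \<kappa> where \<kappa>: "\<kappa> > 0" "\<And>a b. norm (B a b) \<le> norm a * norm b * \<kappa>"
    using bounded_bilinear.pos_bounded[OF B] by blast
  obtain m where m: "m > 0" "\<And>t. t \<in> {0..1} \<Longrightarrow> norm (M t) \<le> m"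
    using compact_imp_bounded[OF compact_continuous_image[OF M compact_Icc]]
    unfolding bounded_pos by auto
  define K where "K = m * \<kappa>"
  have K: "K > 0" using m \<kappa> by (simp add: K_def)
  have BK: "norm (B a (M t)) \<le> K * norm a" if "t \<in> {0..1}" for a t
  proof -
    have "norm (B a (M t)) \<le> norm a * norm (M t) * \<kappa>" by (rule \<kappa>)
    also have "\<dots> \<le> norm a * m * \<kappa>" using m(2)[OF that] \<kappa> by (intro mult_right_mono mult_left_mono) auto
    finally show ?thesis by (simp add: K_def mult_ac)
  qed
  have cont: "continuous_on {0..1} (Y n)" for n
  proof (induction n)
    case 0
    show ?case by (simp add: Y0[abs_def])
  next
    case (Suc n)
    have "continuous_on {0..1} (\<lambda>s. B (Y n s) (M s))" by (rule bounded_bilinear.continuous_on[OF B Suc M])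
    then have "continuous_on {0..1} (\<lambda>t. integral {0..t} (\<lambda>s. B (Y n s) (M s)))"
      by (intro indefinite_integral_continuous_1 integrable_continuous_real)
    then show ?case by (simp add: YS[abs_def])
  qed
  have contB: "continuous_on {0..1} (\<lambda>s. B (Y n s) (M s))" for n
    by (rule bounded_bilinear.continuous_on[OF B cont M])
  have bound: "norm (Y n t) \<le> norm y0 * (K * t) ^ n / fact n" if "t \<in> {0..1}" for n t
    using that
  proof (induction n arbitrary: t)
    case 0
    show ?case by (simp add: Y0)
  next
    case (Suc n)
    let ?g = "\<lambda>s. K * (norm y0 * (K * s) ^ n / fact n)"
    have i: "(?g has_integral (norm y0 * (K * t) ^ Suc n / fact (Suc n) - norm y0 * (K * 0) ^ Suc n / fact (Suc n))) {0..t}"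
    proof (rule fundamental_theorem_of_calculus)
      show "0 \<le> t" using Suc.prems by simp
      fix s
      have "((\<lambda>s. K * s) has_real_derivative K) (at s within {0..t})"
        by (auto intro!: derivative_eq_intros)
      from DERIV_cdivide[OF DERIV_cmult[OF DERIV_power[OF this, of "Suc n"], of "norm y0"], of "fact (Suc n)"]
      have "((\<lambda>s. norm y0 * (K * s) ^ Suc n / fact (Suc n)) has_real_derivative
          norm y0 * (real (Suc n) * (K * (K * s) ^ n)) / fact (Suc n)) (at s within {0..t})"
        by (simp only: diff_Suc_Suc diff_zero)
      moreover have "norm y0 * (real (Suc n) * (K * (K * s) ^ n)) / fact (Suc n) = ?g s"
        by (simp add: fact_Suc del: of_nat_Suc)
      ultimately show "((\<lambda>s. norm y0 * (K * s) ^ Suc n / fact (Suc n)) has_vector_derivative ?g s) (at s within {0..t})"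
        by (simp only: has_real_derivative_iff_has_vector_derivative)
    qed
    have sub: "{0..t} \<subseteq> {0..1}" using Suc.prems by auto
    have "norm (integral {0..t} (\<lambda>s. B (Y n s) (M s))) \<le> integral {0..t} ?g"
    proof (rule integral_norm_bound_integral)
      show "(\<lambda>s. B (Y n s) (M s)) integrable_on {0..t}"
        by (rule integrable_continuous_real[OF continuous_on_subset[OF contB sub]])
      show "?g integrable_on {0..t}" using i by (rule has_integral_integrable)
      fix s assume s: "s \<in> {0..t}"
      then have "norm (B (Y n s) (M s)) \<le> K * norm (Y n s)" using BK sub by blast
      also have "\<dots> \<le> ?g s" using K Suc.IH[of s] s sub by (intro mult_left_mono) auto
      finally show "norm (B (Y n s) (M s)) \<le> ?g s" .
    qed
    then show ?case using integral_unique[OF i] by (simp add: YS)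
  qed
  define m' where "m' n = norm y0 * (K ^ n / fact n)" for n
  have summ: "summable m'"
    unfolding m'_def using summable_exp[of K] by (intro summable_mult) (simp add: divide_inverse mult.commute)
  have bound': "norm (Y n t) \<le> m' n" if "t \<in> {0..1}" for n t
  proof -
    have "(K * t) ^ n \<le> K ^ n" using that K by (intro power_mono mult_left_le) auto
    then have "norm y0 * (K * t) ^ n / fact n \<le> norm y0 * K ^ n / fact n"
      by (intro divide_right_mono mult_left_mono) auto
    then show ?thesis using bound[OF that, of n] by (simp add: m'_def)
  qed
  define y where "y t = (\<Sum>n. Y n t)" for t
  have unif: "uniform_limit {0..1} (\<lambda>n t. \<Sum>i<n. Y i t) y sequentially"
    unfolding y_def[abs_def] by (rule Weierstrass_m_test[OF bound' summ])
  have sums: "(\<lambda>n. Y n t) sums y t" if "t \<in> {0..1}" for t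
    unfolding y_def by (rule summable_sums[OF summable_comparison_test'[OF summ bound'[OF that]]])
  \<comment> \<open>The derivative of \<open>Y n\<close>: zero for the constant term
    \<open>Y 0\<close>, otherwise the integrand that defines it.\<close>
  define f' where "f' n t h = (case n of 0 \<Rightarrow> 0 | Suc k \<Rightarrow> h *\<^sub>R B (Y k t) (M t))" for n t and h :: real
  have d: "(Y n has_derivative f' n t) (at t within {0..1})" if t: "t \<in> {0..1}" for n t
  proof (cases n)
    case 0
    then show ?thesis by (simp add: f'_def[abs_def] Y0[abs_def])
  next
    case (Suc k)
    show ?thesis using integral_has_vector_derivative[OF contB t, of k]
      unfolding has_vector_derivative_def by (simp add: f'_def[abs_def] Suc YS[abs_def])
  qed
  have "\<exists>g. \<forall>t\<in>{0..1}. (\<lambda>n. Y n t) sums g t \<and> (g has_derivative (\<lambda>h. h *\<^sub>R B (y t) (M t))) (at t within {0..1})"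
  proof (rule has_derivative_series[where f=Y and f'=f'])
    show "convex {0..1::real}" by simp
    show "(0::real) \<in> {0..1}" by simp
    show "(\<lambda>n. Y n 0) sums y 0" by (rule sums) simp
    show "(Y n has_derivative f' n x) (at x within {0..1})" if "x \<in> {0..1}" for n x by (rule d[OF that])
    fix e :: real assume e: "e > 0"
    have "\<forall>\<^sub>F n in sequentially. \<forall>t\<in>{0..1}. dist (\<Sum>i<n. Y i t) (y t) < e / K"
      using unif e K unfolding uniform_limit_iff by simp
    \<comment> \<open>The derivative of the partial sum of n terms is \<open>B\<close> applied to
      the partial sum of n - 1 terms, hence the shift and the exclusion of n = 0.\<close>
    then have "\<forall>\<^sub>F n in sequentially. \<forall>t\<in>{0..1}. dist (\<Sum>i<n-1. Y i t) (y t) < e / K \<and> n > 0"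
      using eventually_sequentially_Suc[of "\<lambda>n. \<forall>t\<in>{0..1}. dist (\<Sum>i<n-1. Y i t) (y t) < e / K \<and> n > 0"] by simp
    then show "\<forall>\<^sub>F n in sequentially. \<forall>x\<in>{0..1}. \<forall>h. norm ((\<Sum>i<n. f' i x h) - h *\<^sub>R B (y x) (M x)) \<le> e * norm h"
    proof (rule eventually_mono, intro ballI allI)
      fix n x h assume n: "\<forall>t\<in>{0..1}. dist (\<Sum>i<n-1. Y i t) (y t) < e / K \<and> n > 0" and x: "x \<in> {0..1::real}"
      obtain k where k: "n = Suc k" using n x by (cases n) auto
      have "(\<Sum>i<n. f' i x h) = h *\<^sub>R B (\<Sum>i<k. Y i x) (M x)"
        unfolding k sum.lessThan_Suc_shift
        by (simp add: f'_def scaleR_sum_right bounded_bilinear.sum_left[OF B])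
      then have "(\<Sum>i<n. f' i x h) - h *\<^sub>R B (y x) (M x) = h *\<^sub>R B ((\<Sum>i<k. Y i x) - y x) (M x)"
        by (simp add: bounded_bilinear.diff_left[OF B] scaleR_diff_right)
      then have "norm ((\<Sum>i<n. f' i x h) - h *\<^sub>R B (y x) (M x)) = \<bar>h\<bar> * norm (B ((\<Sum>i<k. Y i x) - y x) (M x))" by simp
      also have "\<dots> \<le> \<bar>h\<bar> * (K * norm ((\<Sum>i<k. Y i x) - y x))" by (intro mult_left_mono BK x) auto
      also have "\<dots> \<le> \<bar>h\<bar> * (K * (e / K))"
        using n x K k by (intro mult_left_mono) (auto simp: dist_norm intro: less_imp_le)
      finally show "norm ((\<Sum>i<n. f' i x h) - h *\<^sub>R B (y x) (M x)) \<le> e * norm h" using K by (simp add: mult.commute)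
    qed
  qed
  then obtain g where g: "\<And>t. t \<in> {0..1} \<Longrightarrow> (\<lambda>n. Y n t) sums g t"
    "\<And>t. t \<in> {0..1} \<Longrightarrow> (g has_derivative (\<lambda>h. h *\<^sub>R B (y t) (M t))) (at t within {0..1})" by blast
  have gy: "g t = y t" if "t \<in> {0..1}" for t using sums_unique2[OF g(1)[OF that] sums[OF that]] .
  have "g 0 = y0"
  proof -
    have "Y n 0 = (if n = 0 then y0 else 0)" for n by (cases n) (simp_all add: Y0 YS)
    then have "(\<lambda>n. Y n 0) sums y0" using sums_single[of 0 "\<lambda>n. y0"] by simp
    then show ?thesis using g(1)[of 0] sums_unique2 by auto
  qed
  then show ?thesis using g(2) gy unfolding has_vector_derivative_def by (intro exI[of _ g]) auto
qed

text \<open>The square of |e| is weighted with exp(- c t), c = 2 K + 1: the part 2 K absorbs the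
  linear term, and the 1 absorbs 2 |e| \<epsilon> \<le> |e|^2 + \<epsilon>^2. The mean value theorem
  then bounds the increase of the weighted square by \<epsilon>^2.\<close>

lemma gronwall_zero_initial:
  fixes e :: "real \<Rightarrow> 'b::real_inner"
  assumes d: "\<And>t. t \<in> {0..1} \<Longrightarrow> (e has_vector_derivative (N t + r t)) (at t within {0..1})"
    and e0: "e 0 = 0"
    and N: "\<And>t. t \<in> {0..1} \<Longrightarrow> norm (N t) \<le> K * norm (e t)"
    and r: "\<And>t. t \<in> {0..1} \<Longrightarrow> norm (r t) \<le> \<epsilon>"
    and K: "K \<ge> 0"
  shows "(norm (e 1))\<^sup>2 \<le> \<epsilon>\<^sup>2 * exp (2 * K + 1)"
proof -
  define c where "c = 2 * K + 1"
  define \<phi> where "\<phi> t = (e t \<bullet> e t) * exp (- c * t)" for t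
  define \<phi>' where "\<phi>' t = (2 * (e t \<bullet> (N t + r t)) - c * (e t \<bullet> e t)) * exp (- c * t)" for t
  have D: "(\<phi> has_real_derivative \<phi>' t) (at t within {0..1})" if "t \<in> {0..1}" for t
  proof -
    have 1: "((\<lambda>t. e t \<bullet> e t) has_real_derivative (2 * (e t \<bullet> (N t + r t)))) (at t within {0..1})"
      using bounded_bilinear.has_vector_derivative[OF bounded_bilinear_inner d[OF that] d[OF that]]
      by (simp add: has_real_derivative_iff_has_vector_derivative inner_commute)
    show ?thesis unfolding \<phi>_def[abs_def] \<phi>'_def
      by (rule derivative_eq_intros 1 refl | simp add: algebra_simps)+
  qed
  have cont: "continuous_on {0..1} \<phi>"
    using D by (meson DERIV_continuous continuous_on_eq_continuous_within)
  have D': "(\<phi> has_derivative (*) (\<phi>' t)) (at t)" if "0 < t" "t < 1" for t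
    using D[of t] that at_within_Icc_at[of 0 t 1] by (simp add: has_field_derivative_def)
  obtain z where z: "0 < z" "z < 1" "\<phi> 1 - \<phi> 0 = \<phi>' z * (1 - 0)"
    using mvt[OF zero_less_one cont D'] by auto
  have "\<phi>' z \<le> \<epsilon>\<^sup>2"
  proof -
    have zi: "z \<in> {0..1}" using z by simp
    have "e z \<bullet> N z \<le> norm (e z) * (K * norm (e z))"
      using norm_cauchy_schwarz[of "e z" "N z"] N[OF zi] by (smt (verit) mult_left_mono norm_ge_zero)
    moreover have "e z \<bullet> r z \<le> norm (e z) * \<epsilon>"
      using norm_cauchy_schwarz[of "e z" "r z"] r[OF zi] by (smt (verit) mult_left_mono norm_ge_zero)
    moreover have "e z \<bullet> e z = (norm (e z))\<^sup>2" by (simp add: power2_norm_eq_inner)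
    ultimately have "2 * (e z \<bullet> (N z + r z)) - c * (e z \<bullet> e z) \<le> 2 * norm (e z) * \<epsilon> - (norm (e z))\<^sup>2"
      by (simp add: c_def inner_add_right algebra_simps power2_eq_square)
    also have "\<dots> \<le> \<epsilon>\<^sup>2" using zero_le_power2[of "norm (e z) - \<epsilon>"] by (simp add: power2_eq_square algebra_simps)
    finally have "\<phi>' z \<le> \<epsilon>\<^sup>2 * exp (- c * z)" unfolding \<phi>'_def by (intro mult_right_mono) auto
    also have "\<dots> \<le> \<epsilon>\<^sup>2 * 1" using z K by (intro mult_left_mono) (auto simp: c_def intro: mult_nonpos_nonneg)
    finally show ?thesis by simp
  qed
  then have "(e 1 \<bullet> e 1) * exp (- c) \<le> \<epsilon>\<^sup>2" using z(3) e0 by (simp add: \<phi>_def)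
  then have "(e 1 \<bullet> e 1) * exp (- c) * exp c \<le> \<epsilon>\<^sup>2 * exp c" by (intro mult_right_mono) auto
  then show ?thesis by (simp add: c_def power2_norm_eq_inner mult.assoc flip: exp_add)
qed

lemma onorm_le_axis:
  fixes L :: "real ^ 'd::finite \<Rightarrow> 'b::real_normed_vector"
  assumes "linear L" "\<And>i. norm (L (axis i 1)) \<le> B"
  shows "onorm L \<le> real CARD('d) * B"
proof (rule onorm_bound)
  have "0 \<le> B" using assms(2) norm_ge_zero order_trans by blast
  then show "0 \<le> real CARD('d) * B" by simp
  fix v :: "real ^ 'd"
  have "L v = L (\<Sum>i\<in>UNIV. v $ i *\<^sub>R axis i 1)"
    using basis_expansion[of v] by (simp add: scalar_mult_eq_scaleR)
  also have "\<dots> = (\<Sum>i\<in>UNIV. v $ i *\<^sub>R L (axis i 1))"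
    using assms(1) by (simp add: linear_sum linear_cmul)
  finally have "norm (L v) \<le> (\<Sum>i\<in>UNIV. norm (v $ i *\<^sub>R L (axis i 1)))" by (simp only: norm_sum)
  also have "\<dots> \<le> (\<Sum>i\<in>(UNIV::'d set). norm v * B)"
    using assms(2) \<open>0 \<le> B\<close> component_le_norm_cart[of v] by (intro sum_mono) (simp add: mult_mono)
  finally show "norm (L v) \<le> real CARD('d) * B * norm v" by (simp add: mult_ac)
qed

lemma finite_family_bounded:
  fixes h :: "'i::finite \<Rightarrow> 'a::topological_space \<Rightarrow> 'b::euclidean_space"
  assumes "compact C" "\<And>i. continuous_on C (h i)"
  shows "\<exists>B\<ge>0. \<forall>x\<in>C. \<forall>i. norm (h i x) \<le> B"
proof -
  have "continuous_on C (\<lambda>x. \<chi> i. h i x)" using assms(2) by (intro continuous_on_vec_lambda)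
  from compact_imp_bounded[OF compact_continuous_image[OF this assms(1)]]
  obtain B where B: "B > 0" "\<And>x. x \<in> C \<Longrightarrow> norm (\<chi> i. h i x) \<le> B" unfolding bounded_pos by auto
  have "norm (h i x) \<le> B" if "x \<in> C" for i x
    using B(2)[OF that] Finite_Cartesian_Product.norm_nth_le[of "\<chi> i. h i x" i] by simp
  then show ?thesis using B by (intro exI[of _ B]) auto
qed

text \<open>Compactness makes the constants uniform in the base point: a closed
  \<open>e\<close>-neighbourhood of \<open>K\<close> is a compact subset of \<open>W\<close>, on
  which \<open>f\<close> and its partial derivatives of the first two orders are bounded. The
  quadratic remainder is the mean value bound for \<open>f\<close> minus its linear part, whose
  derivative is at most a multiple of |k| on the ball of radius |k|.\<close>

lemma taylor_uniform:
  fixes f :: "real ^ 'd::finite \<Rightarrow> 'b::euclidean_space"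
  assumes "open W" "smooth_on W f" "compact K" "K \<subseteq> W"
  shows "\<exists>e>0. \<exists>L\<ge>0. \<forall>x\<in>K. \<forall>k. norm k \<le> e \<longrightarrow> x + k \<in> W \<and> norm (f (x + k)) \<le> L \<and>
    norm (f (x + k) - f x) \<le> L * norm k \<and>
    norm (f (x + k) - f x - frechet_derivative f (at x) k) \<le> L * (norm k)\<^sup>2"
proof -
  obtain e where e: "e > 0" "(\<Union>x\<in>K. cball x e) \<subseteq> W"
    using compact_subset_open_imp_cball_epsilon_subset[OF assms(3,1,4)] by blast
  define C where "C = {x + y |x y. x \<in> K \<and> y \<in> cball 0 e}"
  have cC: "compact C" unfolding C_def by (rule compact_sums[OF assms(3) compact_cball])
  have cbC: "cball x e \<subseteq> C" if "x \<in> K" for x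
  proof
    fix y assume "y \<in> cball x e"
    then have "y = x + (y - x)" "y - x \<in> cball 0 e" by (auto simp: dist_norm norm_minus_commute)
    then show "y \<in> C" unfolding C_def using that by blast
  qed
  have CW: "C \<subseteq> W" using e(2) by (force simp: C_def dist_norm)
  have co: "continuous_on C h" if "smooth_on W h" for h :: "real ^ 'd \<Rightarrow> 'b"
    using smooth_on_continuous[OF that] CW by (rule continuous_on_subset)
  obtain B0 where B0: "B0 \<ge> 0" "\<And>x. x \<in> C \<Longrightarrow> norm (f x) \<le> B0"
    using finite_family_bounded[OF cC, of "\<lambda>_::unit. f"] co[OF assms(2)] by auto
  obtain B1 where B1: "B1 \<ge> 0" "\<And>x i. x \<in> C \<Longrightarrow> norm (pd i f x) \<le> B1"
    using finite_family_bounded[OF cC, of "\<lambda>i. pd i f"] co[OF smooth_on_pd[OF assms(2)]] by auto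
  obtain B2 where B2: "B2 \<ge> 0" "\<And>x i j. x \<in> C \<Longrightarrow> norm (pd j (pd i f) x) \<le> B2"
    using finite_family_bounded[OF cC, of "\<lambda>p. pd (snd p) (pd (fst p) f)"] co[OF smooth_on_pd[OF smooth_on_pd[OF assms(2)]]]
    by auto
  define n where "n = real CARD('d)"
  have n: "n \<ge> 0" by (simp add: n_def)
  have lip: "norm (h y - h x) \<le> n * B * norm (y - x)"
    if h: "smooth_on W h" and B: "\<And>x i. x \<in> C \<Longrightarrow> norm (pd i h x) \<le> B" and x: "x \<in> K" and y: "y \<in> cball x e"
    for h :: "real ^ 'd \<Rightarrow> 'b" and B x y
  proof (rule differentiable_bound[of "cball x e" h "\<lambda>x. frechet_derivative h (at x)"])
    fix z assume z: "z \<in> cball x e"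
    then have zC: "z \<in> C" "z \<in> W" using cbC[OF x] CW by blast+
    show "(h has_derivative frechet_derivative h (at z)) (at z within cball x e)"
      by (rule has_derivative_at_withinI[OF smooth_on_has_derivative[OF h zC(2)]])
    show "onorm (frechet_derivative h (at z)) \<le> n * B"
      unfolding n_def using B[OF zC(1)] linear_frechet_derivative[OF smooth_on_differentiable[OF h zC(2)]]
      by (intro onorm_le_axis) (auto simp: pd_def)
  qed (use y e in auto)
  define L where "L = B0 + n * B1 + n * (n * B2)"
  have L: "L \<ge> 0" "B0 \<le> L" "n * B1 \<le> L" "n * (n * B2) \<le> L" using n B0 B1 B2 by (simp_all add: L_def)
  have "x + k \<in> W \<and> norm (f (x + k)) \<le> L \<and> norm (f (x + k) - f x) \<le> L * norm k \<and>
      norm (f (x + k) - f x - frechet_derivative f (at x) k) \<le> L * (norm k)\<^sup>2"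
    if x: "x \<in> K" and k: "norm k \<le> e" for x k
  proof (intro conjI)
    have xk: "x + k \<in> cball x e" using k by (simp add: dist_norm)
    then have xC: "x + k \<in> C" using cbC[OF x] by blast
    show "x + k \<in> W" using xC CW by blast
    show "norm (f (x + k)) \<le> L" using B0(2)[OF xC] L by simp
    have "norm (f (x + k) - f x) \<le> n * B1 * norm k" using lip[OF assms(2) B1(2) x xk] by simp
    also have "\<dots> \<le> L * norm k" using L by (intro mult_right_mono) auto
    finally show "norm (f (x + k) - f x) \<le> L * norm k" .
    let ?D = "frechet_derivative f (at x)"
    have xW: "x \<in> W" using x assms by blast
    have bl: "bounded_linear ?D" using has_derivative_bounded_linear[OF smooth_on_has_derivative[OF assms(2) xW]] .
    have "norm ((f (x + k) - ?D (x + k)) - (f x - ?D x)) \<le> n * (n * B2 * norm k) * norm (x + k - x)"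
    proof (rule differentiable_bound[of "cball x (norm k)" "\<lambda>y. f y - ?D y" "\<lambda>y v. frechet_derivative f (at y) v - ?D v"])
      fix z assume z: "z \<in> cball x (norm k)"
      then have ze: "z \<in> cball x e" using k by auto
      then have zC: "z \<in> C" "z \<in> W" using cbC[OF x] CW by blast+
      note lz = linear_frechet_derivative[OF smooth_on_differentiable[OF assms(2) zC(2)]]
      show "((\<lambda>y. f y - ?D y) has_derivative (\<lambda>v. frechet_derivative f (at z) v - ?D v)) (at z within cball x (norm k))"
        by (rule has_derivative_at_withinI[OF has_derivative_diff[OF smooth_on_has_derivative[OF assms(2) zC(2)]
              bounded_linear_imp_has_derivative[OF bl]]])
      show "onorm (\<lambda>v. frechet_derivative f (at z) v - ?D v) \<le> n * (n * B2 * norm k)"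
        unfolding n_def
      proof (rule onorm_le_axis)
        show "linear (\<lambda>v. frechet_derivative f (at z) v - ?D v)"
          by (rule linear_compose_sub[OF lz bounded_linear.linear[OF bl]])
        fix i
        have "norm (pd i f z - pd i f x) \<le> n * B2 * norm (z - x)"
          by (rule lip[OF smooth_on_pd[OF assms(2)] B2(2) x ze])
        also have "\<dots> \<le> n * B2 * norm k" using z n B2 by (intro mult_left_mono) (auto simp: dist_norm norm_minus_commute)
        finally show "norm (frechet_derivative f (at z) (axis i 1) - ?D (axis i 1)) \<le> real CARD('d) * B2 * norm k"
          by (simp add: pd_def n_def)
      qed
    qed (simp_all add: dist_norm)
    moreover have "?D (x + k) = ?D x + ?D k" using bl by (simp add: linear_add bounded_linear.linear)
    ultimately have "norm (f (x + k) - f x - ?D k) \<le> n * (n * B2) * (norm k)\<^sup>2"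
      by (simp add: power2_eq_square mult_ac algebra_simps)
    also have "\<dots> \<le> L * (norm k)\<^sup>2" using L by (intro mult_right_mono) auto
    finally show "norm (f (x + k) - f x - ?D k) \<le> L * (norm k)\<^sup>2" .
  qed
  then show ?thesis using e(1) L(1) by blast
qed

text \<open>The coefficients of all dx_i are kept in one vector, so that a connection is a single
  smooth map and its evaluation on a tangent vector is bilinear.\<close>

definition one_form :: "real ^ 'k ^ 'k ^ 'd \<Rightarrow> real ^ 'd \<Rightarrow> real ^ 'k ^ ('k::finite)" where
  "one_form \<Theta> v = (\<Sum>i\<in>UNIV. v $ i *\<^sub>R \<Theta> $ i)"

lemma bounded_bilinear_one_form: "bounded_bilinear (one_form :: real ^ 'k ^ 'k ^ 'd::finite \<Rightarrow> _ \<Rightarrow> real ^ 'k ^ ('k::finite))"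
  unfolding bilinear_conv_bounded_bilinear[symmetric] bilinear_def one_form_def
  by (auto intro!: linearI simp: sum.distrib scaleR_sum_right algebra_simps scaleR_add_left)

lemma bounded_bilinear_matrix_mul:
  "bounded_bilinear ((**) :: real ^ 'n::finite ^ 'm::finite \<Rightarrow> real ^ 'k::finite ^ 'n \<Rightarrow> _)"
  unfolding bilinear_conv_bounded_bilinear[symmetric] bilinear_def
  by (auto intro!: linearI simp: vec_eq_iff matrix_matrix_mult_def sum.distrib sum_distrib_left algebra_simps)

lemma smooth_on_one_form [smooth_intros]:
  "open S \<Longrightarrow> smooth_on S f \<Longrightarrow> smooth_on S g \<Longrightarrow> smooth_on S (\<lambda>x. one_form (f x) (g x))"
  by (rule smooth_on_bilinear[OF bounded_bilinear_one_form])

text \<open>A Taylor expansion of the connection shows that \<open>\<gamma> + t \<gamma> b\<close>, the first order guess for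
  the solution along the ray to a neighbouring point, solves the equation of that ray up to second order;
  the curvature enters through the premise.\<close>

lemma neighbouring_ray_defect:
  fixes \<gamma> a b p q a' b' :: "real ^ 'k::finite ^ 'k"
  assumes "a ** b + p = b ** a + q"
  shows "\<gamma> ** a + (\<gamma> ** b + t *\<^sub>R ((\<gamma> ** a) ** b + \<gamma> ** p)) - (\<gamma> + t *\<^sub>R (\<gamma> ** b)) ** (a' + b') =
    - (\<gamma> ** ((a' - a - t *\<^sub>R q) + (b' - b) + t *\<^sub>R (b ** (a' + b' - a))))"
proof -
  note bb = bounded_bilinear_matrix_mul
  have "\<gamma> ** (a ** b + p) = \<gamma> ** (b ** a + q)" using assms by simp
  then have "(\<gamma> ** a) ** b + \<gamma> ** p = (\<gamma> ** b) ** a + \<gamma> ** q"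
    by (simp add: matrix_mul_assoc bounded_bilinear.add_right[OF bb])
  then have "t *\<^sub>R ((\<gamma> ** a) ** b + \<gamma> ** p) = t *\<^sub>R ((\<gamma> ** b) ** a + \<gamma> ** q)" by simp
  then show ?thesis
    by (simp add: matrix_mul_assoc bounded_bilinear.add_right[OF bb] bounded_bilinear.add_left[OF bb]
        bounded_bilinear.diff_right[OF bb] bounded_bilinear.scaleR_right[OF bb] bounded_bilinear.scaleR_left[OF bb]
        scaleR_add_right scaleR_diff_right)
qed

text \<open>The Frobenius theorem for dg = g \<Theta>. \<open>g u\<close> is the endpoint of the
  solution along the ray from \<open>u0\<close> to \<open>u\<close>. The solution along the ray to u
  + h is compared with a first order guess: their difference starts at 0 and solves a linear
  equation with an inhomogeneity of order |h|^2. Gronwall bounds its endpoint by a multiple of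
  |h|^2, which is differentiability of \<open>g\<close> at \<open>u\<close> with the required
  derivative.\<close>

theorem linear_total_pde_solvable:
  fixes \<Theta> :: "real ^ 'd::finite \<Rightarrow> real ^ 'k::finite ^ 'k ^ 'd" and g0 :: "real ^ 'k ^ 'k"
  assumes W: "open W" "convex W" "u0 \<in> W" and s: "smooth_on W \<Theta>"
    and flat: "\<And>u i j. u \<in> W \<Longrightarrow> pd i \<Theta> u $ j + \<Theta> u $ i ** \<Theta> u $ j = pd j \<Theta> u $ i + \<Theta> u $ j ** \<Theta> u $ i"
  shows "\<exists>g. smooth_on W g \<and> g u0 = g0 \<and> (\<forall>u\<in>W. (g has_derivative (\<lambda>v. g u ** one_form (\<Theta> u) v)) (at u))"
proof -
  note bb = bounded_bilinear_matrix_mul and bo = bounded_bilinear_one_form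
  let ?T = "\<lambda>y v. one_form (\<Theta> y) v"
  let ?D = "\<lambda>x k. frechet_derivative \<Theta> (at x) k"
  \<comment> \<open>The hypothesis on coefficients, summed against w_i h_j.\<close>
  have flat': "?T u w ** ?T u h + one_form (?D u w) h = ?T u h ** ?T u w + one_form (?D u h) w" if u: "u \<in> W" for u w h
  proof -
    have e: "?T u w ** ?T u h + one_form (?D u w) h =
      (\<Sum>i\<in>UNIV. \<Sum>j\<in>UNIV. (w $ i * h $ j) *\<^sub>R (pd i \<Theta> u $ j + \<Theta> u $ i ** \<Theta> u $ j))" for w h
    proof -
      have 1: "?T u w ** ?T u h = (\<Sum>i\<in>UNIV. \<Sum>j\<in>UNIV. (w $ i * h $ j) *\<^sub>R (\<Theta> u $ i ** \<Theta> u $ j))"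
        by (simp add: one_form_def bounded_bilinear.sum_left[OF bb] bounded_bilinear.sum_right[OF bb]
            bounded_bilinear.scaleR_left[OF bb] bounded_bilinear.scaleR_right[OF bb] scaleR_sum_right)
          (subst sum.swap, simp add: mult.commute)
      have 2: "one_form (?D u w) h = (\<Sum>i\<in>UNIV. \<Sum>j\<in>UNIV. (w $ i * h $ j) *\<^sub>R (pd i \<Theta> u $ j))"
        unfolding frechet_eq_sum_pd[OF smooth_on_differentiable[OF s u]]
        by (simp add: bounded_bilinear.sum_left[OF bo] bounded_bilinear.scaleR_left[OF bo])
          (simp add: one_form_def scaleR_sum_right)
      show ?thesis unfolding 1 2 by (simp add: scaleR_add_right sum.distrib)
    qed
    show ?thesis unfolding e by (subst sum.swap) (simp add: flat[OF u] mult.commute)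
  qed
  \<comment> \<open>Membership in \<open>W\<close> is a premise inside the existential, so that a
    single choice function \<open>\<gamma>\<close> covers every \<open>u\<close>.\<close>
  have "\<exists>y. y 0 = g0 \<and> (u \<in> W \<longrightarrow> (\<forall>t\<in>{0..1}.
      (y has_vector_derivative y t ** ?T (u0 + t *\<^sub>R (u - u0)) (u - u0)) (at t within {0..1})))" for u
  proof (cases "u \<in> W")
    case True
    have "continuous_on {0..1} (\<lambda>t. \<Theta> (u0 + t *\<^sub>R (u - u0)))"
    proof (rule continuous_on_compose2[OF smooth_on_continuous[OF s]])
      show "(\<lambda>t. u0 + t *\<^sub>R (u - u0)) ` {0..1} \<subseteq> W"
      proof clarify
        fix t :: real assume "t \<in> {0..1}"
        then show "u0 + t *\<^sub>R (u - u0) \<in> W"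
          using convexD[OF W(2,3) True, of "1 - t" t] by (simp add: algebra_simps)
      qed
    qed (intro continuous_intros)
    then have "continuous_on {0..1} (\<lambda>t. ?T (u0 + t *\<^sub>R (u - u0)) (u - u0))"
      by (intro bounded_bilinear.continuous_on[OF bo] continuous_on_const)
    from linear_ode_exists[OF bb this] show ?thesis by blast
  qed auto
  then obtain \<gamma> where \<gamma>0: "\<And>u. \<gamma> u 0 = g0" and \<gamma>: "\<And>u t. u \<in> W \<Longrightarrow> t \<in> {0..1} \<Longrightarrow>
      (\<gamma> u has_vector_derivative \<gamma> u t ** ?T (u0 + t *\<^sub>R (u - u0)) (u - u0)) (at t within {0..1})"
    by metis
  define g where "g u = \<gamma> u 1" for u
  have D: "(g has_derivative (\<lambda>v. g u ** one_form (\<Theta> u) v)) (at u)" if u: "u \<in> W" for u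
  proof -
    define w where "w = u - u0"
    define x where "x t = u0 + t *\<^sub>R w" for t :: real
    have xW: "x t \<in> W" if "t \<in> {0..1}" for t
      using convexD[OF W(2,3) u, of "1 - t" t] that by (auto simp: x_def w_def algebra_simps)
    have xd: "(x has_vector_derivative w) (at t within S)" for t S
      unfolding x_def[abs_def] by (auto intro!: derivative_eq_intros)
    have cx: "compact (x ` {0..1})"
      by (rule compact_continuous_image) (auto simp: x_def[abs_def] intro!: continuous_intros)
    obtain e L where e: "e > 0" and L: "L \<ge> 0" and T: "\<And>t k. t \<in> {0..1} \<Longrightarrow> norm k \<le> e \<Longrightarrow> x t + k \<in> W \<and>
        norm (\<Theta> (x t + k)) \<le> L \<and> norm (\<Theta> (x t + k) - \<Theta> (x t)) \<le> L * norm k \<and>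
        norm (\<Theta> (x t + k) - \<Theta> (x t) - ?D (x t) k) \<le> L * (norm k)\<^sup>2"
      using taylor_uniform[OF W(1) s cx] xW by blast
    obtain \<kappa> where \<kappa>: "\<kappa> > 0" "\<And>(a :: real ^ 'k ^ 'k) (b :: real ^ 'k ^ 'k). norm (a ** b) \<le> norm a * norm b * \<kappa>"
      using bounded_bilinear.pos_bounded[OF bb] by blast
    obtain \<kappa>' where \<kappa>': "\<kappa>' > 0" "\<And>(a :: real ^ 'k ^ 'k ^ 'd) b. norm (one_form a b) \<le> norm a * norm b * \<kappa>'"
      using bounded_bilinear.pos_bounded[OF bo] by blast
    have c\<gamma>: "continuous_on {0..1} (\<gamma> u)"
      using \<gamma>[OF u] has_vector_derivative_continuous continuous_on_eq_continuous_within by blast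
    obtain \<Gamma> where \<Gamma>: "\<Gamma> > 0" "\<And>t. t \<in> {0..1} \<Longrightarrow> norm (\<gamma> u t) \<le> \<Gamma>"
      using compact_imp_bounded[OF compact_continuous_image[OF c\<gamma> compact_Icc]] unfolding bounded_pos by auto
    define L' where "L' = L * \<kappa>'"
    have L': "L' \<ge> 0" using L \<kappa>' by (simp add: L'_def)
    have oneL: "norm (one_form a v) \<le> L' * c * norm v" if "norm a \<le> L * c" for a :: "real ^ 'k ^ 'k ^ 'd" and v c
    proof -
      have "norm (one_form a v) \<le> norm a * norm v * \<kappa>'" by (rule \<kappa>')
      also have "\<dots> \<le> (L * c) * norm v * \<kappa>'" using that \<kappa>' by (intro mult_right_mono) auto
      finally show ?thesis by (simp add: L'_def mult_ac)
    qed
    \<comment> \<open>\<open>Q\<close> adds up the bounds on the three contributions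
      \<open>z1\<close>, \<open>z2\<close>, \<open>z3\<close> to the defect, multiplied by the bound
      on \<open>\<gamma> u\<close>; \<open>N\<close> bounds right multiplication by the connection
      along the neighbouring ray.\<close>
    define Q where "Q = \<kappa> * \<Gamma> * (L' * norm w + L' + \<kappa> * (L' * (L' * norm w + L')))"
    define N where "N = \<kappa> * (L' * (norm w + e))"
    have QN: "Q \<ge> 0" "N \<ge> 0" using \<kappa> \<Gamma> L' e by (simp_all add: Q_def N_def)
    have main: "norm (g (u + h) - g u - g u ** ?T u h) \<le> Q * exp (N + 1/2) * (norm h)\<^sup>2" if h: "norm h \<le> e" for h
    proof -
      have uh: "u + h \<in> W" using T[of 1 h] h by (simp add: x_def w_def)
      define xh where "xh t = x t + t *\<^sub>R h" for t
      have xh: "u0 + t *\<^sub>R (u + h - u0) = xh t" for t by (simp add: xh_def x_def w_def algebra_simps)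
      have x: "u0 + t *\<^sub>R (u - u0) = x t" for t by (simp add: x_def w_def)
      define \<delta> where "\<delta> t = \<gamma> u t + t *\<^sub>R (\<gamma> u t ** ?T (x t) h)" for t
      define E where "E t = \<delta> t - \<gamma> (u + h) t" for t
      define N' where "N' t = E t ** ?T (xh t) (w + h)" for t
      define r where "r t = - (\<gamma> u t ** ((?T (xh t) w - ?T (x t) w - t *\<^sub>R one_form (?D (x t) h) w)
          + (?T (xh t) h - ?T (x t) h) + t *\<^sub>R (?T (x t) h ** (?T (xh t) w + ?T (xh t) h - ?T (x t) w))))" for t
      have \<gamma>1: "(\<gamma> u has_vector_derivative \<gamma> u t ** ?T (x t) w) (at t within {0..1})" if "t \<in> {0..1}" for t
        using \<gamma>[OF u that] unfolding x by (simp only: w_def)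
      have \<gamma>2: "(\<gamma> (u + h) has_vector_derivative \<gamma> (u + h) t ** ?T (xh t) (w + h)) (at t within {0..1})" if "t \<in> {0..1}" for t
      proof -
        have "u + h - u0 = w + h" by (simp add: w_def)
        then show ?thesis using \<gamma>[OF uh that] xh[of t] by (simp only:)
      qed
      have E': "(E has_vector_derivative (N' t + r t)) (at t within {0..1})" if t: "t \<in> {0..1}" for t
      proof -
        have "((\<lambda>t. \<Theta> (x t)) has_vector_derivative ?D (x t) w) (at t within {0..1})"
          using has_derivative_compose[OF xd[unfolded has_vector_derivative_def] smooth_on_has_derivative[OF s xW[OF t]]]
            linear_cmul[OF linear_frechet_derivative[OF smooth_on_differentiable[OF s xW[OF t]]]]
          by (simp add: has_vector_derivative_def)
        from bounded_bilinear.has_vector_derivative[OF bo this has_vector_derivative_const]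
        have dT: "((\<lambda>t. ?T (x t) h) has_vector_derivative one_form (?D (x t) w) h) (at t within {0..1})"
          by (simp add: bounded_bilinear.zero_right[OF bo])
        from has_vector_derivative_diff[OF has_vector_derivative_add[OF \<gamma>1[OF t]
            has_vector_derivative_scaleR[OF DERIV_ident bounded_bilinear.has_vector_derivative[OF bb \<gamma>1[OF t] dT]]] \<gamma>2[OF t]]
        have "(E has_vector_derivative (\<gamma> u t ** ?T (x t) w + (t *\<^sub>R (\<gamma> u t ** one_form (?D (x t) w) h + \<gamma> u t ** ?T (x t) w ** ?T (x t) h)
            + 1 *\<^sub>R (\<gamma> u t ** ?T (x t) h)) - \<gamma> (u + h) t ** ?T (xh t) (w + h))) (at t within {0..1})"
          unfolding E_def[abs_def] \<delta>_def[abs_def] .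
        moreover have "\<gamma> u t ** ?T (x t) w + (t *\<^sub>R (\<gamma> u t ** one_form (?D (x t) w) h + \<gamma> u t ** ?T (x t) w ** ?T (x t) h)
            + 1 *\<^sub>R (\<gamma> u t ** ?T (x t) h)) - \<gamma> (u + h) t ** ?T (xh t) (w + h) = N' t + r t"
        proof -
          have "r t = \<gamma> u t ** ?T (x t) w + (\<gamma> u t ** ?T (x t) h + t *\<^sub>R ((\<gamma> u t ** ?T (x t) w) ** ?T (x t) h + \<gamma> u t ** one_form (?D (x t) w) h))
             - \<delta> t ** (?T (xh t) w + ?T (xh t) h)"
            unfolding r_def \<delta>_def
            by (rule neighbouring_ray_defect[OF flat'[OF xW[OF t]], symmetric])
          moreover have "N' t = \<delta> t ** (?T (xh t) w + ?T (xh t) h) - \<gamma> (u + h) t ** ?T (xh t) (w + h)"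
            unfolding N'_def E_def by (simp add: bounded_bilinear.diff_left[OF bb] bounded_bilinear.add_right[OF bo])
          ultimately show ?thesis by (simp only:) (simp add: algebra_simps)
        qed
        ultimately show ?thesis by simp
      qed
      have bN: "norm (N' t) \<le> N * norm (E t)" and br: "norm (r t) \<le> Q * (norm h)\<^sup>2" if t: "t \<in> {0..1}" for t
      proof -
        have nk: "norm (t *\<^sub>R h) \<le> norm h" using t by (simp add: mult_left_le_one_le)
        then have ke: "norm (t *\<^sub>R h) \<le> e" using h by simp
        note TT = T[OF t ke, folded xh_def]
        have q1: "norm (?T (xh t) v) \<le> L' * norm v" for v
          using oneL[of "\<Theta> (xh t)" 1 v] TT by simp
        have q1': "norm (?T (x t) v) \<le> L' * norm v" for v
          using oneL[of "\<Theta> (x t)" 1 v] T[OF t, of 0] e by simp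
        have q2: "norm (?T (xh t) v - ?T (x t) v) \<le> L' * norm h * norm v" for v
          unfolding bounded_bilinear.diff_left[OF bo, symmetric]
        proof (rule oneL)
          have "norm (\<Theta> (xh t) - \<Theta> (x t)) \<le> L * norm (t *\<^sub>R h)" using TT by blast
          also have "\<dots> \<le> L * norm h" using nk L by (rule mult_left_mono)
          finally show "norm (\<Theta> (xh t) - \<Theta> (x t)) \<le> L * norm h" .
        qed
        have q3: "norm (?T (xh t) w - ?T (x t) w - t *\<^sub>R one_form (?D (x t) h) w) \<le> L' * (norm h)\<^sup>2 * norm w"
        proof -
          have "?D (x t) (t *\<^sub>R h) = t *\<^sub>R ?D (x t) h"
            using linear_cmul[OF linear_frechet_derivative[OF smooth_on_differentiable[OF s xW[OF t]]]] .
          then have "?T (xh t) w - ?T (x t) w - t *\<^sub>R one_form (?D (x t) h) w =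
            one_form (\<Theta> (xh t) - \<Theta> (x t) - ?D (x t) (t *\<^sub>R h)) w"
            by (simp add: bounded_bilinear.diff_left[OF bo] bounded_bilinear.scaleR_left[OF bo])
          moreover have "norm (\<Theta> (xh t) - \<Theta> (x t) - ?D (x t) (t *\<^sub>R h)) \<le> L * (norm h)\<^sup>2"
          proof -
            have "norm (\<Theta> (xh t) - \<Theta> (x t) - ?D (x t) (t *\<^sub>R h)) \<le> L * (norm (t *\<^sub>R h))\<^sup>2" using TT by blast
            also have "\<dots> \<le> L * (norm h)\<^sup>2" using nk L by (intro mult_left_mono power_mono) auto
            finally show ?thesis .
          qed
          ultimately show ?thesis using oneL by simp
        qed
        have "norm (N' t) \<le> norm (E t) * norm (?T (xh t) (w + h)) * \<kappa>" unfolding N'_def by (rule \<kappa>)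
        also have "\<dots> \<le> norm (E t) * (L' * (norm w + e)) * \<kappa>"
        proof (intro mult_right_mono mult_left_mono)
          have "norm (?T (xh t) (w + h)) \<le> L' * norm (w + h)" by (rule q1)
          also have "\<dots> \<le> L' * (norm w + e)" using h norm_triangle_ineq[of w h] L' by (intro mult_left_mono) auto
          finally show "norm (?T (xh t) (w + h)) \<le> L' * (norm w + e)" .
        qed (use \<kappa> in auto)
        finally show "norm (N' t) \<le> N * norm (E t)" by (simp add: N_def mult_ac)
        define z1 where "z1 = ?T (xh t) w - ?T (x t) w - t *\<^sub>R one_form (?D (x t) h) w"
        define z2 where "z2 = ?T (xh t) h - ?T (x t) h"
        define z3 where "z3 = t *\<^sub>R (?T (x t) h ** (?T (xh t) w + ?T (xh t) h - ?T (x t) w))"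
        have z1: "norm z1 \<le> L' * norm w * (norm h)\<^sup>2" using q3 by (simp add: z1_def mult_ac)
        have z2: "norm z2 \<le> L' * (norm h)\<^sup>2" using q2[of h] by (simp add: z2_def power2_eq_square mult_ac)
        have z3: "norm z3 \<le> \<kappa> * (L' * (L' * norm w + L')) * (norm h)\<^sup>2"
        proof -
          have "norm z3 \<le> norm (?T (x t) h ** (?T (xh t) w + ?T (xh t) h - ?T (x t) w))"
            using t by (simp add: z3_def mult_left_le_one_le)
          also have "\<dots> \<le> norm (?T (x t) h) * norm (?T (xh t) w + ?T (xh t) h - ?T (x t) w) * \<kappa>" by (rule \<kappa>)
          also have "\<dots> \<le> (L' * norm h) * (L' * norm h * norm w + L' * norm h) * \<kappa>"
          proof (intro mult_right_mono mult_mono q1')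
            have *: "?T (xh t) w + ?T (xh t) h - ?T (x t) w = (?T (xh t) w - ?T (x t) w) + ?T (xh t) h" by simp
            show "norm (?T (xh t) w + ?T (xh t) h - ?T (x t) w) \<le> L' * norm h * norm w + L' * norm h"
              unfolding * using q2[of w] q1[of h] norm_triangle_ineq[of "?T (xh t) w - ?T (x t) w" "?T (xh t) h"] by linarith
          qed (use \<kappa> L' in auto)
          finally show ?thesis by (simp add: power2_eq_square algebra_simps)
        qed
        have "norm (r t) = norm (\<gamma> u t ** (z1 + z2 + z3))" by (simp add: r_def z1_def z2_def z3_def)
        also have "\<dots> \<le> norm (\<gamma> u t) * norm (z1 + z2 + z3) * \<kappa>" by (rule \<kappa>)
        also have "\<dots> \<le> \<Gamma> * ((L' * norm w + L' + \<kappa> * (L' * (L' * norm w + L'))) * (norm h)\<^sup>2) * \<kappa>"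
        proof (intro mult_right_mono mult_mono \<Gamma> t)
          have "norm (z1 + z2 + z3) \<le> norm z1 + norm z2 + norm z3"
            using norm_triangle_ineq[of "z1 + z2" z3] norm_triangle_ineq[of z1 z2] by simp
          then show "norm (z1 + z2 + z3) \<le> (L' * norm w + L' + \<kappa> * (L' * (L' * norm w + L'))) * (norm h)\<^sup>2"
            unfolding distrib_right using z1 z2 z3 by (simp add: algebra_simps)
        qed (use \<kappa> \<Gamma> in auto)
        finally show "norm (r t) \<le> Q * (norm h)\<^sup>2" by (simp add: Q_def mult_ac)
      qed
      have E0: "E 0 = 0" by (simp add: E_def \<delta>_def \<gamma>0)
      have "(norm (E 1))\<^sup>2 \<le> (Q * (norm h)\<^sup>2)\<^sup>2 * exp (2 * N + 1)"
        by (rule gronwall_zero_initial[OF E' E0 bN br QN(2)])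
      also have "\<dots> = (Q * exp (N + 1/2) * (norm h)\<^sup>2)\<^sup>2"
      proof -
        have "exp (2 * N + 1) = (exp (N + 1/2))\<^sup>2" by (simp add: power2_eq_square flip: exp_add)
        then show ?thesis by (simp add: power_mult_distrib)
      qed
      finally have "norm (E 1) \<le> Q * exp (N + 1/2) * (norm h)\<^sup>2"
        by (rule power2_le_imp_le) (use QN in simp)
      moreover have "E 1 = - (g (u + h) - g u - g u ** ?T u h)"
        by (simp add: E_def \<delta>_def g_def x_def w_def)
      ultimately show ?thesis by (metis norm_minus_cancel)
    qed
    define C where "C = Q * exp (N + 1/2)"
    have C: "C \<ge> 0" using QN by (simp add: C_def)
    show ?thesis
      unfolding has_derivative_at_alt
    proof (intro conjI allI impI)
      show "bounded_linear (\<lambda>v. g u ** ?T u v)"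
        by (rule bounded_linear_compose[OF bounded_bilinear.bounded_linear_right[OF bb] bounded_bilinear.bounded_linear_right[OF bo]])
      fix \<epsilon> :: real assume \<epsilon>: "\<epsilon> > 0"
      define d where "d = min e (\<epsilon> / (C + 1))"
      have d: "d > 0" using e \<epsilon> C by (simp add: d_def)
      have "norm (g y - g u - g u ** ?T u (y - u)) \<le> \<epsilon> * norm (y - u)" if y: "norm (y - u) < d" for y
      proof -
        have "norm (g (u + (y - u)) - g u - g u ** ?T u (y - u)) \<le> C * (norm (y - u))\<^sup>2"
          unfolding C_def using y by (intro main) (simp add: d_def)
        also have "\<dots> = (C * norm (y - u)) * norm (y - u)" by (simp add: power2_eq_square)
        also have "\<dots> \<le> \<epsilon> * norm (y - u)"
        proof (intro mult_right_mono)
          have "norm (y - u) \<le> \<epsilon> / (C + 1)" using y by (simp add: d_def)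
          then have "(C + 1) * norm (y - u) \<le> \<epsilon>" using C by (simp add: field_simps)
          then have "C * norm (y - u) + norm (y - u) \<le> \<epsilon>" by (simp add: distrib_right)
          then show "C * norm (y - u) \<le> \<epsilon>" using norm_ge_zero[of "y - u"] by linarith
        qed simp
        finally show ?thesis by simp
      qed
      then show "\<exists>d>0. \<forall>y. norm (y - u) < d \<longrightarrow> norm (g y - g u - g u ** ?T u (y - u)) \<le> \<epsilon> * norm (y - u)"
        using d by blast
    qed
  qed
  \<comment> \<open>The ray from \<open>u0\<close> to itself has velocity 0, so the solution along
    it is constant.\<close>
  have "g u0 = g0"
  proof -
    have "\<gamma> u0 1 = \<gamma> u0 0"
    proof (rule has_derivative_zero_unique[of "{0..1::real}" "\<gamma> u0", symmetric])
      show "(\<gamma> u0 has_derivative (\<lambda>h. 0)) (at t within {0..1})" if "t \<in> {0..1}" for t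
        using \<gamma>[OF W(3) that]
        by (simp add: bounded_bilinear.zero_right[OF bo] bounded_bilinear.zero_right[OF bb] has_vector_derivative_def)
    qed auto
    then show ?thesis by (simp add: g_def \<gamma>0)
  qed
  \<comment> \<open>The equation dg = g \<Theta> makes the derivative as regular as \<open>g\<close>
    itself.\<close>
  moreover have "Ck_on k W g" for k
  proof (induction k)
    case 0
    show ?case using D by (auto intro!: has_derivative_continuous continuous_at_imp_continuous_on)
  next
    case (Suc k)
    have "Ck_on k W (\<lambda>u. one_form (\<Theta> u) v)" for v
      using smooth_on_one_form[OF W(1) s smooth_on_const] unfolding smooth_on_def by blast
    from D Ck_on_bilinear[OF W(1) bb Suc this] show ?case by (rule Ck_on_SucI[OF W(1)])
  qed
  ultimately show ?thesis using D unfolding smooth_on_def by blast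
qed

subsection \<open>Immersions into hyperbolic space\<close>

lemma sum_UNIV_option: "(\<Sum>r\<in>UNIV. f r) = f None + (\<Sum>i\<in>UNIV. f (Some i))" for f :: "'k::finite option \<Rightarrow> 'b::comm_monoid_add"
  by (simp add: UNIV_option_conv sum.reindex)

lemma sum_UNIV_sum: "(\<Sum>r\<in>UNIV. f r) = (\<Sum>i\<in>UNIV. f (Inl i)) + (\<Sum>i\<in>UNIV. f (Inr i))"
  for f :: "'m::finite + 'n::finite \<Rightarrow> 'b::comm_monoid_add"
  using sum.Plus[of "UNIV :: 'm set" "UNIV :: 'n set" f] by simp

lemma sum4_product:
  fixes a b :: "'d::finite \<Rightarrow> 'd \<Rightarrow> real"
  shows "(\<Sum>q\<in>UNIV. \<Sum>k\<in>UNIV. \<Sum>i\<in>UNIV. \<Sum>j\<in>UNIV. a i q * b j k) =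
    (\<Sum>i\<in>UNIV. \<Sum>q\<in>UNIV. a i q) * (\<Sum>j\<in>UNIV. \<Sum>k\<in>UNIV. b j k)"
proof -
  have "(\<Sum>q\<in>UNIV. \<Sum>k\<in>UNIV. \<Sum>i\<in>UNIV. \<Sum>j\<in>UNIV. a i q * b j k) =
      (\<Sum>q\<in>UNIV. \<Sum>i\<in>UNIV. a i q) * (\<Sum>k\<in>UNIV. \<Sum>j\<in>UNIV. b j k)"
    by (simp add: sum_product[symmetric])
  also have "(\<Sum>q\<in>UNIV. \<Sum>i\<in>UNIV. a i q) = (\<Sum>i\<in>UNIV. \<Sum>q\<in>UNIV. a i q)" by (rule sum.swap)
  also have "(\<Sum>k\<in>UNIV. \<Sum>j\<in>UNIV. b j k) = (\<Sum>j\<in>UNIV. \<Sum>k\<in>UNIV. b j k)" by (rule sum.swap)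
  finally show ?thesis .
qed

section \<open>Algebra of the Lorentz form\<close>

lemma lorentz_commute: "x \<bullet>\<^sub>1 y = y \<bullet>\<^sub>1 x"
  by (simp add: lorentz_def mult.commute)

definition space_part :: "real ^ ('k::finite) option \<Rightarrow> real ^ 'k" where
  "space_part x = (\<chi> i. x $ Some i)"

lemma lorentz_space_part: "x \<bullet>\<^sub>1 y = space_part x \<bullet> space_part y - x $ None * y $ None"
  by (simp add: lorentz_def space_part_def inner_vec_def)

text \<open>Trades Lorentz orthogonality for Euclidean orthogonality, so that Euclidean facts about
  orthogonal complements and their dimensions apply.\<close>

definition time_flip :: "real ^ ('k::finite) option \<Rightarrow> real ^ 'k option" where
  "time_flip x = (\<chi> r. if r = None then - x $ None else x $ r)"

lemma lorentz_eq_inner: "x \<bullet>\<^sub>1 y = x \<bullet> time_flip y"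
  by (simp add: lorentz_def inner_vec_def sum_UNIV_option time_flip_def)

lemma time_flip_time_flip [simp]: "time_flip (time_flip x) = x"
  by (simp add: time_flip_def vec_eq_iff)

lemma linear_time_flip: "linear time_flip"
  by (auto intro!: linearI simp: time_flip_def vec_eq_iff)

lemma bounded_bilinear_lorentz: "bounded_bilinear (\<bullet>\<^sub>1)"
  unfolding bilinear_conv_bounded_bilinear[symmetric] bilinear_def
  by (auto intro!: linearI simp: lorentz_def sum.distrib algebra_simps sum_distrib_left)

lemmas lorentz_add_left = bounded_bilinear.add_left[OF bounded_bilinear_lorentz]
  and lorentz_add_right = bounded_bilinear.add_right[OF bounded_bilinear_lorentz]
  and lorentz_diff_left = bounded_bilinear.diff_left[OF bounded_bilinear_lorentz]
  and lorentz_diff_right = bounded_bilinear.diff_right[OF bounded_bilinear_lorentz]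
  and lorentz_minus_left = bounded_bilinear.minus_left[OF bounded_bilinear_lorentz]
  and lorentz_minus_right = bounded_bilinear.minus_right[OF bounded_bilinear_lorentz]
  and lorentz_sum_left = bounded_bilinear.sum_left[OF bounded_bilinear_lorentz]
  and lorentz_sum_right = bounded_bilinear.sum_right[OF bounded_bilinear_lorentz]
  and lorentz_zero_left = bounded_bilinear.zero_left[OF bounded_bilinear_lorentz]
  and lorentz_zero_right = bounded_bilinear.zero_right[OF bounded_bilinear_lorentz]

lemma lorentz_scaleR_left: "(c *\<^sub>R x) \<bullet>\<^sub>1 y = c * (x \<bullet>\<^sub>1 y)"
  using bounded_bilinear.scaleR_left[OF bounded_bilinear_lorentz] by simp

lemma lorentz_scaleR_right: "x \<bullet>\<^sub>1 (c *\<^sub>R y) = c * (x \<bullet>\<^sub>1 y)"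
  using bounded_bilinear.scaleR_right[OF bounded_bilinear_lorentz] by simp

lemmas lorentz_simps = lorentz_add_left lorentz_add_right lorentz_diff_left lorentz_diff_right
  lorentz_minus_left lorentz_minus_right lorentz_sum_left lorentz_sum_right lorentz_zero_left
  lorentz_zero_right lorentz_scaleR_left lorentz_scaleR_right

lemma pd_lorentz:
  assumes "f differentiable (at u)" "g differentiable (at u)"
  shows "pd i (\<lambda>x. f x \<bullet>\<^sub>1 g x) u = f u \<bullet>\<^sub>1 pd i g u + pd i f u \<bullet>\<^sub>1 g u"
  by (rule pd_bilinear[OF bounded_bilinear_lorentz assms])

text \<open>Cauchy-Schwarz for the space parts, made strict because the space part of
  \<open>y\<close> is shorter than its time component.\<close>

lemma lorentz_orthogonal_to_timelike:
  assumes y: "y \<bullet>\<^sub>1 y < 0" and xy: "x \<bullet>\<^sub>1 y = 0" and x: "x \<noteq> 0"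
  shows "x \<bullet>\<^sub>1 x > 0"
proof -
  let ?a = "space_part x" and ?b = "space_part y"
  have y': "?b \<bullet> ?b < (y $ None)\<^sup>2" using y by (simp add: lorentz_space_part power2_eq_square)
  have xy': "?a \<bullet> ?b = x $ None * y $ None" using xy by (simp add: lorentz_space_part)
  have a0: "?a \<noteq> 0"
  proof
    assume a: "?a = 0"
    have "y $ None \<noteq> 0"
    proof
      assume "y $ None = 0"
      then have "?b \<bullet> ?b < 0" using y' by simp
      then show False using inner_ge_zero[of ?b] by linarith
    qed
    then have "x $ None = 0" using xy' a by simp
    moreover have "x $ Some i = 0" for i using a by (simp add: space_part_def vec_eq_iff)
    ultimately have "x $ r = 0" for r by (cases r) auto
    then show False using x by (simp add: vec_eq_iff)
  qed
  have "(x $ None)\<^sup>2 * (y $ None)\<^sup>2 = (?a \<bullet> ?b)\<^sup>2" by (simp add: xy' power_mult_distrib)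
  also have "\<dots> \<le> (?a \<bullet> ?a) * (?b \<bullet> ?b)" by (rule Cauchy_Schwarz_ineq)
  also have "\<dots> < (?a \<bullet> ?a) * (y $ None)\<^sup>2" using a0 y' by (intro mult_strict_left_mono) auto
  finally have "(x $ None)\<^sup>2 < ?a \<bullet> ?a" by (simp add: mult_less_cancel_right)
  then show ?thesis by (simp add: lorentz_space_part power2_eq_square)
qed

text \<open>Cauchy-Schwarz reversed: with a and b the space parts, the time components are sqrt(1 +
  |a|^2) and sqrt(1 + |b|^2), and their product is at least 1 + |a| |b|.\<close>

lemma hyp_lorentz_le:
  assumes "x \<in> hyp" "y \<in> hyp"
  shows "x \<bullet>\<^sub>1 y \<le> -1"
proof -
  let ?a = "space_part x" and ?b = "space_part y"
  have a: "(x $ None)\<^sup>2 = 1 + (norm ?a)\<^sup>2" "x $ None > 0" and b: "(y $ None)\<^sup>2 = 1 + (norm ?b)\<^sup>2" "y $ None > 0"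
    using assms by (auto simp: hyp_def lorentz_space_part power2_eq_square dot_square_norm)
  have "(1 + norm ?a * norm ?b)\<^sup>2 \<le> (x $ None * y $ None)\<^sup>2"
    using sum_squares_bound[of "norm ?a" "norm ?b"]
    by (simp add: power_mult_distrib a b) (simp add: power2_eq_square algebra_simps)
  then have "1 + norm ?a * norm ?b \<le> x $ None * y $ None"
    by (rule power2_le_imp_le) (use a b in simp)
  then show ?thesis using norm_cauchy_schwarz[of ?a ?b] by (simp add: lorentz_space_part)
qed

text \<open>A unit timelike vector outside \<open>hyp\<close> is the negative of one inside, for
  which the reversed Cauchy-Schwarz inequality gives the opposite sign.\<close>

lemma hyp_memI:
  assumes "x \<in> hyp" "y \<bullet>\<^sub>1 y = -1" "x \<bullet>\<^sub>1 y < 0"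
  shows "y \<in> hyp"
proof (rule ccontr)
  assume "y \<notin> hyp"
  then have "y $ None \<le> 0" using assms by (auto simp: hyp_def)
  moreover have "y $ None \<noteq> 0"
  proof
    assume "y $ None = 0"
    then show False using assms(2) inner_ge_zero[of "space_part y"] by (simp add: lorentz_space_part)
  qed
  ultimately have "- y \<in> hyp" using assms by (auto simp: hyp_def lorentz_simps)
  from hyp_lorentz_le[OF assms(1) this] show False using assms(3) by (simp add: lorentz_simps)
qed

lemma lorentz_nondegenerate: "(\<And>y. x \<bullet>\<^sub>1 y = 0) \<Longrightarrow> x = 0"
  by (metis lorentz_eq_inner inner_eq_zero_iff time_flip_time_flip)

text \<open>The hypothesis says that the Gram matrix has trivial kernel. Indexing by
  \<open>'k option\<close> makes the number of vectors equal to the dimension, so independence gives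
  a basis, and non-degeneracy of the form gives completeness.\<close>

lemma lorentz_frame:
  fixes f :: "'k::finite option \<Rightarrow> real ^ 'k option"
  assumes gram: "\<And>c. (\<And>s. (\<Sum>r\<in>UNIV. c r * (f r \<bullet>\<^sub>1 f s)) = 0) \<Longrightarrow> (\<And>r. c r = 0)"
  shows lorentz_frame_spans: "\<exists>c. x = (\<Sum>r\<in>UNIV. c r *\<^sub>R f r)"
    and lorentz_frame_complete: "(\<And>s. x \<bullet>\<^sub>1 f s = 0) \<Longrightarrow> x = 0"
proof -
  define g where "g c = (\<Sum>r\<in>UNIV. c $ r *\<^sub>R f r)" for c :: "real ^ 'k option"
  have lg: "linear g" unfolding g_def by (auto intro!: linearI simp: sum.distrib scaleR_add_left scaleR_sum_right)
  have "inj g"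
    unfolding linear_injective_0[OF lg]
  proof (intro allI impI)
    fix c assume "g c = 0"
    then have "g c \<bullet>\<^sub>1 f s = 0" for s by (simp add: lorentz_simps)
    then have "(\<Sum>r\<in>UNIV. c $ r * (f r \<bullet>\<^sub>1 f s)) = 0" for s
      by (simp add: g_def lorentz_simps)
    then show "c = 0" using gram[of "\<lambda>r. c $ r"] by (simp add: vec_eq_iff)
  qed
  then have "surj g" by (rule linear_injective_imp_surjective[OF lg]) simp
  then show sp: "\<exists>c. x = (\<Sum>r\<in>UNIV. c r *\<^sub>R f r)" for x unfolding surj_def g_def by metis
  assume o: "\<And>s. x \<bullet>\<^sub>1 f s = 0"
  show "x = 0"
  proof (rule lorentz_nondegenerate)
    fix y
    obtain c where "y = (\<Sum>r\<in>UNIV. c r *\<^sub>R f r)" using sp by blast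
    then show "x \<bullet>\<^sub>1 y = 0" by (simp add: lorentz_simps o)
  qed
qed

definition lsign :: "'k option \<Rightarrow> real" where
  "lsign r = (if r = None then -1 else 1)"

lemma lsign_simps [simp]: "lsign None = -1" "lsign (Some k) = 1" "lsign r * lsign r = 1" "lsign r \<noteq> 0"
  by (simp_all add: lsign_def)

lemma lorentz_orthonormal_expand:
  fixes f :: "'k::finite option \<Rightarrow> real ^ 'k option"
  assumes "\<And>r s. f r \<bullet>\<^sub>1 f s = (if r = s then lsign r else 0)"
  shows "x = (\<Sum>r\<in>UNIV. (lsign r * (x \<bullet>\<^sub>1 f r)) *\<^sub>R f r)"
proof -
  have gram: "c r = 0" if "\<And>s. (\<Sum>r\<in>UNIV. c r * (f r \<bullet>\<^sub>1 f s)) = 0" for c r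
    using that[of r] by (simp add: assms if_distrib sum.delta cong: if_cong)
  have "(x - (\<Sum>r\<in>UNIV. (lsign r * (x \<bullet>\<^sub>1 f r)) *\<^sub>R f r)) \<bullet>\<^sub>1 f s = 0" for s
    by (simp add: lorentz_simps assms if_distrib sum.delta cong: if_cong)
  then have "x - (\<Sum>r\<in>UNIV. (lsign r * (x \<bullet>\<^sub>1 f r)) *\<^sub>R f r) = 0"
    by (intro lorentz_frame_complete[of f]) (use gram in auto)
  then show ?thesis by simp
qed

lemma matrix_vector_mult_axis: "A *v axis r (1::real) = column r A"
  by (simp add: matrix_vector_mult_def column_def vec_eq_iff axis_def if_distrib sum.delta cong: if_cong)

lemma lorentz_axis: "axis r 1 \<bullet>\<^sub>1 axis s 1 = (if r = s then lsign r else 0)"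
proof -
  have "axis r 1 \<bullet>\<^sub>1 axis s 1 = time_flip (axis s 1) $ r"
    by (simp add: lorentz_eq_inner inner_commute[of "axis r 1"] cart_eq_inner_axis)
  then show ?thesis by (auto simp: time_flip_def lsign_def axis_def)
qed

lemma Lorentz_group_iff:
  "g \<in> Lorentz_group \<longleftrightarrow> (\<forall>r s. column r g \<bullet>\<^sub>1 column s g = (if r = s then lsign r else 0))"
proof
  assume "g \<in> Lorentz_group"
  then have "(g *v axis r 1) \<bullet>\<^sub>1 (g *v axis s 1) = axis r 1 \<bullet>\<^sub>1 axis s 1" for r s by (auto simp: Lorentz_group_def)
  then show "\<forall>r s. column r g \<bullet>\<^sub>1 column s g = (if r = s then lsign r else 0)"
    by (simp add: matrix_vector_mult_axis lorentz_axis)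
next
  assume o: "\<forall>r s. column r g \<bullet>\<^sub>1 column s g = (if r = s then lsign r else 0)"
  have "(g *v x) \<bullet>\<^sub>1 (g *v y) = x \<bullet>\<^sub>1 y" for x y
  proof -
    have c: "g *v x = (\<Sum>r\<in>UNIV. x $ r *\<^sub>R column r g)" for x
      by (simp add: matrix_mult_sum scalar_mult_eq_scaleR)
    have "(g *v x) \<bullet>\<^sub>1 (g *v y) = (\<Sum>r\<in>UNIV. lsign r * (x $ r * y $ r))"
      unfolding c by (simp add: lorentz_simps o[rule_format] if_distrib sum.delta mult_ac cong: if_cong)
    also have "\<dots> = x \<bullet>\<^sub>1 y" by (simp add: sum_UNIV_option lorentz_def)
    finally show ?thesis .
  qed
  then show "g \<in> Lorentz_group" by (simp add: Lorentz_group_def)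
qed

lemma Lorentz_group_invertible:
  assumes "g \<in> Lorentz_group"
  shows "invertible g"
proof -
  have "inj ((*v) g)"
    unfolding linear_injective_0[OF matrix_vector_mul_linear]
  proof (intro allI impI)
    fix x assume "g *v x = 0"
    then have "x \<bullet>\<^sub>1 y = 0" for y using assms by (metis (mono_tags, lifting) Lorentz_group_def lorentz_zero_left mem_Collect_eq)
    then show "x = 0" by (rule lorentz_nondegenerate)
  qed
  then show ?thesis by (simp add: invertible_left_inverse matrix_left_invertible_injective)
qed

lemma first_ff_nth: "first_ff Y u $ i $ j = pd i Y u \<bullet>\<^sub>1 pd j Y u"
  by (simp add: first_ff_def)

lemma first_ff_sym: "first_ff Y u $ i $ j = first_ff Y u $ j $ i"
  by (simp add: first_ff_nth lorentz_commute)

lemma first_ff_form: "x \<bullet> (first_ff Y u *v y) = (\<Sum>i\<in>UNIV. x $ i *\<^sub>R pd i Y u) \<bullet>\<^sub>1 (\<Sum>i\<in>UNIV. y $ i *\<^sub>R pd i Y u)"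
  by (simp add: inner_vec_def matrix_vector_mult_def first_ff_nth lorentz_simps sum_distrib_left mult_ac)
    (rule sum.swap)

text \<open>Positivity of the first fundamental form stands for injectivity of the differential. It
  is the property that the computations use, and an isometric immersion inherits it from a chart of
  its domain.\<close>

locale hyp_immersion =
  fixes V :: "(real ^ 'd::finite) set" and Y :: "real ^ 'd \<Rightarrow> real ^ ('k::finite) option"
  assumes open_domain: "open V" and smooth: "smooth_on V Y" and in_hyp: "u \<in> V \<Longrightarrow> Y u \<in> hyp"
    and first_ff_pos: "u \<in> V \<Longrightarrow> x \<noteq> 0 \<Longrightarrow> x \<bullet> (first_ff Y u *v x) > 0"
begin

lemma norm_Y: "u \<in> V \<Longrightarrow> Y u \<bullet>\<^sub>1 Y u = -1"
  using in_hyp by (auto simp: hyp_def)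

lemma diff_Y: "u \<in> V \<Longrightarrow> Y differentiable (at u)"
  by (rule smooth_on_differentiable[OF smooth])

lemma smooth_pd: "smooth_on V (pd i Y)"
  by (rule smooth_on_pd[OF smooth])

lemma diff_pd: "u \<in> V \<Longrightarrow> pd i Y differentiable (at u)"
  by (rule smooth_on_differentiable[OF smooth_pd])

lemma pd_eq_zero_of_constant:
  assumes u: "u \<in> V" and "\<And>x. x \<in> V \<Longrightarrow> f x = (c :: 'b::real_normed_vector)"
  shows "pd i f u = 0"
proof -
  have "pd i (\<lambda>x. c) u = pd i f u" by (rule pd_cong[OF open_domain u]) (use assms in auto)
  then show ?thesis by simp
qed

lemma tangent_orthogonal: "u \<in> V \<Longrightarrow> pd i Y u \<bullet>\<^sub>1 Y u = 0"
  using pd_eq_zero_of_constant[of u "\<lambda>x. Y x \<bullet>\<^sub>1 Y x" "-1" i] norm_Y pd_lorentz[OF diff_Y diff_Y, of u i]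
  by (simp add: lorentz_commute)

lemma tangent_orthogonal': "u \<in> V \<Longrightarrow> Y u \<bullet>\<^sub>1 pd i Y u = 0"
  using tangent_orthogonal[of u i] by (simp add: lorentz_commute)

lemma orthogonal_derivative:
  assumes "u \<in> V" "f differentiable (at u)" "g differentiable (at u)" "\<And>x. x \<in> V \<Longrightarrow> f x \<bullet>\<^sub>1 g x = c"
  shows "pd i f u \<bullet>\<^sub>1 g u = - (f u \<bullet>\<^sub>1 pd i g u)"
  using pd_eq_zero_of_constant[of u "\<lambda>x. f x \<bullet>\<^sub>1 g x" c i] assms pd_lorentz[OF assms(2,3), of i] by simp

lemma pd_pd_sym: "u \<in> V \<Longrightarrow> pd i (pd j Y) u = pd j (pd i Y) u"
  by (rule pd_commute[OF open_domain smooth])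

lemma pd_pd_orthogonal: "u \<in> V \<Longrightarrow> pd i (pd j Y) u \<bullet>\<^sub>1 Y u = - first_ff Y u $ i $ j"
  using orthogonal_derivative[of u "pd j Y" Y 0 i] diff_pd diff_Y tangent_orthogonal
  by (simp add: first_ff_nth lorentz_commute)

lemma invertible_first_ff: "u \<in> V \<Longrightarrow> invertible (first_ff Y u)"
proof -
  assume u: "u \<in> V"
  have "inj ((*v) (first_ff Y u))"
    unfolding linear_injective_0[OF matrix_vector_mul_linear]
    using first_ff_pos[OF u] by (metis inner_zero_right less_irrefl)
  then show ?thesis by (simp add: invertible_left_inverse matrix_left_invertible_injective)
qed

lemma smooth_first_ff: "smooth_on V (first_ff Y)"
  unfolding first_ff_def[abs_def] by (intro smooth_intros open_domain smooth)

text \<open>The inverse metric produces the tangent vector whose products with the coordinate fields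
  are the given numbers; every orthogonal projection below is computed with it.\<close>

lemma tangent_coefficients:
  assumes u: "u \<in> V"
  shows "(\<Sum>p\<in>UNIV. (matrix_inv (first_ff Y u) *v c) $ p * first_ff Y u $ p $ q) = c $ q"
proof -
  have "(\<Sum>p\<in>UNIV. (matrix_inv (first_ff Y u) *v c) $ p * first_ff Y u $ p $ q)
      = (first_ff Y u *v (matrix_inv (first_ff Y u) *v c)) $ q"
    by (simp add: matrix_vector_mult_def[of "first_ff Y u"] first_ff_sym[of Y u q] mult.commute)
  also have "\<dots> = c $ q"
    using matrix_inv_inverse(1)[OF invertible_first_ff[OF u]] by (simp add: matrix_vector_mul_assoc)
  finally show ?thesis .
qed

lemma spacelike_of_orthogonal: "u \<in> V \<Longrightarrow> x \<bullet>\<^sub>1 Y u = 0 \<Longrightarrow> x \<noteq> 0 \<Longrightarrow> x \<bullet>\<^sub>1 x > 0"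
  using lorentz_orthogonal_to_timelike[of "Y u" x] norm_Y by simp

text \<open>An explicit orthogonal projection in place of the definite description. The difference
  of two candidates lies in the span of \<open>Y u\<close> and the tangent vectors and is orthogonal
  to it; so it is null, and a null vector orthogonal to the timelike \<open>Y u\<close>
  vanishes.\<close>

lemma normal_part_eq:
  assumes u: "u \<in> V"
  shows "normal_part Y u z = z + (z \<bullet>\<^sub>1 Y u) *\<^sub>R Y u
    - (\<Sum>p\<in>UNIV. (matrix_inv (first_ff Y u) *v (\<chi> q. z \<bullet>\<^sub>1 pd q Y u)) $ p *\<^sub>R pd p Y u)" (is "_ = ?\<nu>")
  unfolding normal_part_def
proof (rule the_equality)
  let ?S = "insert (Y u) (range (\<lambda>i. pd i Y u))"
  let ?t = "\<lambda>p. (matrix_inv (first_ff Y u) *v (\<chi> q. z \<bullet>\<^sub>1 pd q Y u)) $ p"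
  have 1: "?\<nu> \<in> normal_space Y u"
    using tangent_coefficients[OF u, of "\<chi> q. z \<bullet>\<^sub>1 pd q Y u"] tangent_orthogonal[OF u]
    by (simp add: normal_space_def lorentz_simps norm_Y[OF u] first_ff_nth tangent_orthogonal'[OF u])
  have 2: "z - ?\<nu> \<in> span ?S"
  proof -
    have "z - ?\<nu> = - ((z \<bullet>\<^sub>1 Y u) *\<^sub>R Y u) + (\<Sum>p\<in>UNIV. ?t p *\<^sub>R pd p Y u)" by simp
    also have "\<dots> \<in> span ?S"
      by (intro span_add span_neg span_scale span_sum span_base) auto
    finally show ?thesis .
  qed
  show "?\<nu> \<in> normal_space Y u \<and> z - ?\<nu> \<in> span ?S" using 1 2 by blast
  fix \<nu> assume \<nu>: "\<nu> \<in> normal_space Y u \<and> z - \<nu> \<in> span ?S"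
  define d where "d = ?\<nu> - \<nu>"
  have dn: "d \<bullet>\<^sub>1 Y u = 0" "\<And>i. d \<bullet>\<^sub>1 pd i Y u = 0" using 1 \<nu> by (simp_all add: d_def normal_space_def lorentz_diff_left)
  have "d = (z - \<nu>) - (z - ?\<nu>)" by (simp add: d_def)
  then have ds: "d \<in> span ?S" using span_diff[OF conjunct2[OF \<nu>] 2] by (simp only:)
  have "d \<bullet>\<^sub>1 s = 0" if "s \<in> span ?S" for s
    using that by (induction rule: span_induct_alt) (auto simp: lorentz_simps dn)
  from this[OF ds] have "d = 0" using spacelike_of_orthogonal[OF u dn(1)] by fastforce
  then show "\<nu> = ?\<nu>" by (simp add: d_def)
qed

lemma parallel_derivative_tangent:
  assumes u: "u \<in> V" and \<xi>: "\<xi> differentiable (at u)" "\<And>x. x \<in> V \<Longrightarrow> \<xi> x \<bullet>\<^sub>1 Y x = 0" "\<xi> u \<bullet>\<^sub>1 pd i Y u = 0"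
    and par: "normal_deriv Y i \<xi> u = 0"
  shows "pd i \<xi> u = (\<Sum>p\<in>UNIV. (matrix_inv (first_ff Y u) *v (\<chi> q. pd i \<xi> u \<bullet>\<^sub>1 pd q Y u)) $ p *\<^sub>R pd p Y u)"
proof -
  have "pd i \<xi> u \<bullet>\<^sub>1 Y u = 0"
    using orthogonal_derivative[of u \<xi> Y 0 i] u \<xi> diff_Y by simp
  then show ?thesis using par unfolding normal_deriv_def normal_part_eq[OF u] by simp
qed

lemma pd_first_ff:
  assumes u: "u \<in> V"
  shows "pd i (\<lambda>x. first_ff Y x $ j $ p) u = pd i (pd j Y) u \<bullet>\<^sub>1 pd p Y u + pd j Y u \<bullet>\<^sub>1 pd i (pd p Y) u"
  using pd_lorentz[OF diff_pd[OF u, of j] diff_pd[OF u, of p], of i] by (simp add: first_ff_nth[abs_def])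

text \<open>Koszul's formula: by symmetry of second derivatives everything cancels in the three
  metric derivatives except twice the product of \<open>pd i (pd j Y)\<close> with
  \<open>pd p Y\<close>.\<close>

lemma christoffel_first_ff:
  assumes u: "u \<in> V"
  shows "christoffel (first_ff Y) l i j u = (matrix_inv (first_ff Y u) *v (\<chi> p. pd i (pd j Y) u \<bullet>\<^sub>1 pd p Y u)) $ l"
proof -
  have "pd i (\<lambda>x. first_ff Y x $ j $ p) u + pd j (\<lambda>x. first_ff Y x $ i $ p) u - pd p (\<lambda>x. first_ff Y x $ i $ j) u
      = 2 * (pd i (pd j Y) u \<bullet>\<^sub>1 pd p Y u)" for p
    unfolding pd_first_ff[OF u] using pd_pd_sym[OF u, of i j] pd_pd_sym[OF u, of p i] pd_pd_sym[OF u, of p j]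
    by (simp add: lorentz_commute)
  then show ?thesis
    by (simp add: christoffel_def matrix_vector_mult_def sum_divide_distrib)
qed

text \<open>The second fundamental form in the flat space R^{k,1}, not in \<open>hyp\<close>: it
  keeps the component along \<open>Y\<close>, which accounts for the curvature -1 of hyperbolic
  space.\<close>

definition second_normal :: "'d \<Rightarrow> 'd \<Rightarrow> real ^ 'd \<Rightarrow> real ^ 'k option" where
  "second_normal i j u = pd i (pd j Y) u - (\<Sum>l\<in>UNIV. christoffel (first_ff Y) l i j u *\<^sub>R pd l Y u)"

lemma second_normal_orthogonal: "u \<in> V \<Longrightarrow> second_normal i j u \<bullet>\<^sub>1 pd q Y u = 0"
  using tangent_coefficients[of u "\<chi> p. pd i (pd j Y) u \<bullet>\<^sub>1 pd p Y u" q]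
  by (simp add: second_normal_def christoffel_first_ff lorentz_simps first_ff_nth)

lemma second_normal_Y: "u \<in> V \<Longrightarrow> second_normal i j u \<bullet>\<^sub>1 Y u = - first_ff Y u $ i $ j"
  by (simp add: second_normal_def lorentz_simps tangent_orthogonal pd_pd_orthogonal)

lemma smooth_christoffel: "smooth_on V (christoffel (first_ff Y) l i j)"
  by (rule smooth_on_cong[OF open_domain, of "\<lambda>u. (matrix_inv (first_ff Y u) *v (\<chi> p. pd i (pd j Y) u \<bullet>\<^sub>1 pd p Y u)) $ l"])
    (auto simp: christoffel_first_ff intro!: smooth_intros open_domain smooth smooth_first_ff invertible_first_ff)

lemma smooth_second_normal: "smooth_on V (second_normal i j)"
  unfolding second_normal_def[abs_def] by (intro smooth_intros open_domain smooth smooth_christoffel)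

text \<open>In the flat ambient space the third derivatives of \<open>Y\<close> commute in
  \<open>i\<close> and \<open>j\<close>. Paired with \<open>pd q Y\<close>, this identity has the
  curvature tensor from differentiating the Christoffel symbols, and products of
  \<open>second_normal\<close> from differentiating the normal parts.\<close>

lemma gauss_equation:
  assumes u: "u \<in> V"
  shows "(\<Sum>l\<in>UNIV. first_ff Y u $ l $ q * riemann (first_ff Y) l k i j u) =
    second_normal j k u \<bullet>\<^sub>1 second_normal i q u - second_normal i k u \<bullet>\<^sub>1 second_normal j q u"
proof -
  let ?\<Gamma> = "christoffel (first_ff Y)"
  have df: "christoffel (first_ff Y) l i j differentiable (at u)" "second_normal i j differentiable (at u)" for l i j
    by (rule smooth_on_differentiable[OF smooth_christoffel u], rule smooth_on_differentiable[OF smooth_second_normal u])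
  have third: "pd i (pd j (pd k Y)) u = (\<Sum>l\<in>UNIV. ?\<Gamma> l j k u *\<^sub>R pd i (pd l Y) u + pd i (?\<Gamma> l j k) u *\<^sub>R pd l Y u)
      + pd i (second_normal j k) u" for i j
  proof -
    have "pd i (pd j (pd k Y)) u = pd i (\<lambda>x. (\<Sum>l\<in>UNIV. ?\<Gamma> l j k x *\<^sub>R pd l Y x) + second_normal j k x) u"
      by (simp add: second_normal_def[abs_def])
    also have "\<dots> = (\<Sum>l\<in>UNIV. pd i (\<lambda>x. ?\<Gamma> l j k x *\<^sub>R pd l Y x) u) + pd i (second_normal j k) u"
      by (subst pd_add, (intro differentiable_sum differentiable_scaleR df diff_pd[OF u] finite ballI df)+,
          subst pd_sum) (auto intro!: differentiable_scaleR df diff_pd[OF u])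
    finally show ?thesis by (simp add: pd_scaleR[OF df(1) diff_pd[OF u]])
  qed
  have N: "pd i (second_normal j k) u \<bullet>\<^sub>1 pd q Y u = - (second_normal j k u \<bullet>\<^sub>1 second_normal i q u)" for i j
  proof -
    have "pd i (second_normal j k) u \<bullet>\<^sub>1 pd q Y u = - (second_normal j k u \<bullet>\<^sub>1 pd i (pd q Y) u)"
      using orthogonal_derivative[OF u df(2)[of j k] diff_pd[OF u, of q], of 0 i] second_normal_orthogonal by simp
    moreover have "pd i (pd q Y) u = second_normal i q u + (\<Sum>l\<in>UNIV. ?\<Gamma> l i q u *\<^sub>R pd l Y u)"
      by (simp add: second_normal_def)
    ultimately show ?thesis by (simp add: lorentz_simps second_normal_orthogonal[OF u])
  qed
  have G: "pd i (pd l Y) u \<bullet>\<^sub>1 pd q Y u = (\<Sum>p\<in>UNIV. first_ff Y u $ p $ q * ?\<Gamma> p i l u)" for i l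
  proof -
    have "pd i (pd l Y) u = second_normal i l u + (\<Sum>p\<in>UNIV. ?\<Gamma> p i l u *\<^sub>R pd p Y u)"
      by (simp add: second_normal_def)
    then show ?thesis by (simp add: lorentz_simps second_normal_orthogonal[OF u] first_ff_nth mult.commute)
  qed
  have T: "pd i (pd j (pd k Y)) u \<bullet>\<^sub>1 pd q Y u =
      (\<Sum>l\<in>UNIV. first_ff Y u $ l $ q * (pd i (?\<Gamma> l j k) u + (\<Sum>p\<in>UNIV. ?\<Gamma> l i p u * ?\<Gamma> p j k u)))
      - second_normal j k u \<bullet>\<^sub>1 second_normal i q u" for i j
  proof -
    have "(\<Sum>l\<in>UNIV. ?\<Gamma> l j k u * (\<Sum>p\<in>UNIV. first_ff Y u $ p $ q * ?\<Gamma> p i l u)) =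
        (\<Sum>l\<in>UNIV. first_ff Y u $ l $ q * (\<Sum>p\<in>UNIV. ?\<Gamma> l i p u * ?\<Gamma> p j k u))"
      unfolding sum_distrib_left by (subst sum.swap) (simp add: mult_ac)
    then show ?thesis
      unfolding third by (simp add: lorentz_simps N G sum.distrib distrib_left first_ff_nth mult_ac)
  qed
  have "pd i (pd j (pd k Y)) u \<bullet>\<^sub>1 pd q Y u = pd j (pd i (pd k Y)) u \<bullet>\<^sub>1 pd q Y u"
    by (simp add: pd_commute[OF open_domain smooth_pd u])
  then show ?thesis
    unfolding T by (simp add: riemann_def sum_subtractf right_diff_distrib distrib_left sum.distrib algebra_simps)
qed

lemma sectional_curvature_eq:
  assumes u: "u \<in> V"
    and R: "\<And>i j k q. second_normal j k u \<bullet>\<^sub>1 second_normal i q u - second_normal i k u \<bullet>\<^sub>1 second_normal j q u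
      = c * (first_ff Y u $ j $ k * first_ff Y u $ i $ q - first_ff Y u $ i $ k * first_ff Y u $ j $ q)"
    and ind: "x \<noteq> y" "independent {x, y}"
  shows "sectional_curvature (first_ff Y) u x y = c"
proof -
  let ?G = "first_ff Y u" and ?m = "metric (first_ff Y) u"
  have m: "?m x y = (\<Sum>i\<in>UNIV. \<Sum>j\<in>UNIV. ?G $ i $ j * x $ i * y $ j)" for x y
    by (simp add: metric_def inner_vec_def matrix_vector_mult_def sum_distrib_left mult_ac)
  have msym: "?m x y = ?m y x" for x y
    unfolding m by (subst sum.swap) (simp add: first_ff_sym[of Y u] mult_ac)
  have mlin: "?m (a *\<^sub>R x + b *\<^sub>R y) z = a * ?m x z + b * ?m y z" for a b x y z
    by (simp add: metric_def inner_add_left)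
  have mlin': "?m z (a *\<^sub>R x + b *\<^sub>R y) = a * ?m z x + b * ?m z y" for a b x y z
    using mlin[of a x b y z] msym[of z] by simp
  have "?m (curv_op (first_ff Y) u x y y) x =
      (\<Sum>q\<in>UNIV. \<Sum>k\<in>UNIV. \<Sum>i\<in>UNIV. \<Sum>j\<in>UNIV. (\<Sum>l\<in>UNIV. ?G $ l $ q * riemann (first_ff Y) l k i j u) * x $ i * y $ j * y $ k * x $ q)"
  proof -
    have "?m (curv_op (first_ff Y) u x y y) x = (\<Sum>l\<in>UNIV. \<Sum>q\<in>UNIV. \<Sum>k\<in>UNIV. \<Sum>i\<in>UNIV. \<Sum>j\<in>UNIV.
        ?G $ l $ q * riemann (first_ff Y) l k i j u * x $ i * y $ j * y $ k * x $ q)"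
      by (simp add: m curv_op_def sum_distrib_left sum_distrib_right mult_ac)
    also have "\<dots> = (\<Sum>q\<in>UNIV. \<Sum>k\<in>UNIV. \<Sum>i\<in>UNIV. \<Sum>j\<in>UNIV. \<Sum>l\<in>UNIV.
        ?G $ l $ q * riemann (first_ff Y) l k i j u * x $ i * y $ j * y $ k * x $ q)"
      by (subst sum.swap, rule sum.cong[OF refl], subst sum.swap, rule sum.cong[OF refl],
          subst sum.swap, rule sum.cong[OF refl], rule sum.swap)
    finally show ?thesis by (simp add: sum_distrib_right)
  qed
  also have "\<dots> = c * (\<Sum>q\<in>UNIV. \<Sum>k\<in>UNIV. \<Sum>i\<in>UNIV. \<Sum>j\<in>UNIV. (?G $ j $ k * ?G $ i $ q - ?G $ i $ k * ?G $ j $ q) * x $ i * y $ j * y $ k * x $ q)"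
    unfolding gauss_equation[OF u] R sum_distrib_left by (simp add: mult.assoc)
  also have "(\<Sum>q\<in>UNIV. \<Sum>k\<in>UNIV. \<Sum>i\<in>UNIV. \<Sum>j\<in>UNIV. (?G $ j $ k * ?G $ i $ q - ?G $ i $ k * ?G $ j $ q) * x $ i * y $ j * y $ k * x $ q)
      = ?m x x * ?m y y - (?m x y)\<^sup>2"
  proof -
    have 1: "(\<Sum>q\<in>UNIV. \<Sum>k\<in>UNIV. \<Sum>i\<in>UNIV. \<Sum>j\<in>UNIV. ?G $ j $ k * ?G $ i $ q * x $ i * y $ j * y $ k * x $ q) = ?m x x * ?m y y"
      unfolding m using sum4_product[of "\<lambda>i q. ?G $ i $ q * x $ i * x $ q" "\<lambda>j k. ?G $ j $ k * y $ j * y $ k"]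
      by (simp add: mult_ac)
    have 2: "(\<Sum>q\<in>UNIV. \<Sum>k\<in>UNIV. \<Sum>i\<in>UNIV. \<Sum>j\<in>UNIV. ?G $ i $ k * ?G $ j $ q * x $ i * y $ j * y $ k * x $ q) = (?m x y)\<^sup>2"
    proof -
      have "(?m x y)\<^sup>2 = ?m x y * ?m y x" using msym[of y x] by (simp add: power2_eq_square)
      then show ?thesis unfolding m using sum4_product[of "\<lambda>i k. ?G $ i $ k * x $ i * y $ k" "\<lambda>j q. ?G $ j $ q * y $ j * x $ q"]
        by (subst sum.swap) (simp add: mult_ac)
    qed
    show ?thesis unfolding 1[symmetric] 2[symmetric] by (simp add: left_diff_distrib sum_subtractf)
  qed
  finally have num: "?m (curv_op (first_ff Y) u x y y) x = c * (?m x x * ?m y y - (?m x y)\<^sup>2)" .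
  have y0: "y \<noteq> 0" using ind(2) dependent_zero by blast
  \<comment> \<open>The squared length of this vector is \<open>?m y y\<close> times the Gram
    determinant of \<open>x\<close> and \<open>y\<close>; that it does not vanish makes the
    denominator of the sectional curvature non-zero.\<close>
  have "?m y y *\<^sub>R x + (- ?m x y) *\<^sub>R y \<noteq> 0"
  proof
    assume e: "?m y y *\<^sub>R x + (- ?m x y) *\<^sub>R y = 0"
    have my: "?m y y > 0" using first_ff_pos[OF u y0] by (simp add: metric_def)
    have "x = (?m x y / ?m y y) *\<^sub>R y"
    proof -
      have "?m y y *\<^sub>R x = ?m x y *\<^sub>R y" using e by simp
      then have "inverse (?m y y) *\<^sub>R (?m y y *\<^sub>R x) = inverse (?m y y) *\<^sub>R (?m x y *\<^sub>R y)" by simp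
      then show ?thesis using my by (simp add: divide_inverse mult.commute)
    qed
    then have "x \<in> span {y}" by (metis span_base span_scale singletonI)
    then show False using ind by (simp add: independent_insert)
  qed
  from first_ff_pos[OF u this]
  have "0 < ?m (?m y y *\<^sub>R x + (- ?m x y) *\<^sub>R y) (?m y y *\<^sub>R x + (- ?m x y) *\<^sub>R y)" by (simp add: metric_def)
  also have "\<dots> = ?m y y * (?m x x * ?m y y - (?m x y)\<^sup>2)"
    unfolding mlin mlin' using msym[of y x] by (simp add: power2_eq_square algebra_simps)
  finally have "?m x x * ?m y y - (?m x y)\<^sup>2 \<noteq> 0" by auto
  then show ?thesis unfolding sectional_curvature_def num by simp
qed

end

text \<open>The image of the differential is orthogonal to the timelike vector \<open>Y u\<close>,
  hence spacelike away from 0; injectivity then gives positivity.\<close>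

lemma hyp_immersionI:
  assumes "open V" "smooth_on V Y" "Y ` V \<subseteq> hyp" "\<And>u. u \<in> V \<Longrightarrow> inj (frechet_derivative Y (at u))"
  shows "hyp_immersion V Y"
proof
  show "open V" "smooth_on V Y" by fact+
  show in_hyp: "Y u \<in> hyp" if "u \<in> V" for u using assms(3) that by blast
  fix u and x :: "real ^ 'a" assume u: "u \<in> V" and x: "x \<noteq> 0"
  note df = smooth_on_differentiable[OF assms(2) u]
  let ?v = "frechet_derivative Y (at u) x"
  have "?v \<noteq> 0"
    using assms(4)[OF u] x linear_injective_0[OF linear_frechet_derivative[OF df]] by blast
  moreover have "pd i Y u \<bullet>\<^sub>1 Y u = 0" for i
  proof -
    have "pd i (\<lambda>x. -1) u = pd i (\<lambda>x. Y x \<bullet>\<^sub>1 Y x) u"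
      by (rule pd_cong[OF assms(1) u]) (use in_hyp in \<open>auto simp: hyp_def\<close>)
    then show ?thesis using pd_lorentz[OF df df, of i] by (simp add: lorentz_commute)
  qed
  then have "?v \<bullet>\<^sub>1 Y u = 0" unfolding frechet_eq_sum_pd[OF df] by (simp add: lorentz_simps)
  moreover have "Y u \<bullet>\<^sub>1 Y u < 0" using in_hyp[OF u] by (simp add: hyp_def)
  ultimately have "?v \<bullet>\<^sub>1 ?v > 0" using lorentz_orthogonal_to_timelike by blast
  then show "x \<bullet> (first_ff Y u *v x) > 0" by (simp add: first_ff_form frechet_eq_sum_pd[OF df])
qed

subsection \<open>Flatness of the Lax connection\<close>

lemma sum_if_mult:
  fixes f g :: "'n::finite \<Rightarrow> 'b::semiring_0"
  shows "(\<Sum>q\<in>UNIV. (if q = a then f q else 0) * g q) = f a * g a"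
    "(\<Sum>q\<in>UNIV. g q * (if q = a then f q else 0)) = g a * f a"
proof -
  have "(\<Sum>q\<in>UNIV. (if q = a then f q else 0) * g q) = (\<Sum>q\<in>UNIV. if q = a then f q * g q else 0)"
    by (intro sum.cong) auto
  then show "(\<Sum>q\<in>UNIV. (if q = a then f q else 0) * g q) = f a * g a" by (simp add: sum.delta)
  have "(\<Sum>q\<in>UNIV. g q * (if q = a then f q else 0)) = (\<Sum>q\<in>UNIV. if q = a then g q * f q else 0)"
    by (intro sum.cong) auto
  then show "(\<Sum>q\<in>UNIV. g q * (if q = a then f q else 0)) = g a * f a" by (simp add: sum.delta)
qed

lemma Cmat_mult:
  fixes A :: "'a::comm_semiring_1 ^ 'n::finite ^ 'm::finite" and B :: "'a ^ 'k::finite ^ 'n" and b :: "'a ^ 'n"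
  shows "(A ** Cmat i) $ r $ q = (if q = i then A $ r $ i else 0)"
    "(Cmat i ** B) $ p $ s = (if p = i then B $ i $ s else 0)"
    "(Cmat i *v b) $ p = (if p = i then b $ i else 0)"
    "(b v* Cmat i) $ p = (if p = i then b $ i else 0)"
proof -
  have C: "(Cmat i :: 'a ^ 'n ^ 'n) $ r $ c = (if c = i then (if r = i then 1 else 0) else 0)" for r c
    by (simp add: Cmat_def)
  note C' = sum_if_mult
  show "(A ** Cmat i) $ r $ q = (if q = i then A $ r $ i else 0)"
    by (simp add: matrix_matrix_mult_def C C')
  show "(b v* Cmat i) $ p = (if p = i then b $ i else 0)"
    by (simp add: vector_matrix_mult_def C C')
  have D: "(Cmat i :: 'a ^ 'n ^ 'n) $ r $ c = (if r = i then (if c = i then 1 else 0) else 0)" for r c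
    by (simp add: Cmat_def)
  show "(Cmat i ** B) $ p $ s = (if p = i then B $ i $ s else 0)"
    by (simp add: matrix_matrix_mult_def D C')
  show "(Cmat i *v b) $ p = (if p = i then b $ i else 0)"
    by (simp add: matrix_vector_mult_def D C')
qed

lemma star_coeff_nth:
  "star_coeff A F b i $ Some (Inl k) $ Some (Inl l) = 0"
  "star_coeff A F b i $ Some (Inl k) $ Some (Inr j) = (if j = i then - A $ k $ i else 0)"
  "star_coeff A F b i $ Some (Inl k) $ None = 0"
  "star_coeff A F b i $ Some (Inr j) $ Some (Inl l) = (if j = i then A $ l $ i else 0)"
  "star_coeff A F b i $ Some (Inr j) $ Some (Inr q) = (if j = i then F $ i $ q else 0) - (if q = i then F $ i $ j else 0)"
  "star_coeff A F b i $ Some (Inr j) $ None = (if j = i then b $ i else 0)"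
  "star_coeff A F b i $ None $ Some (Inl l) = 0"
  "star_coeff A F b i $ None $ Some (Inr q) = (if q = i then b $ i else 0)"
  "star_coeff A F b i $ None $ None = 0"
  by (simp_all add: star_coeff_def block3_def Cmat_mult transpose_def)

lemma bounded_linear_star_coeff:
  "bounded_linear (\<lambda>z. star_coeff (fst z) (fst (snd z)) (snd (snd z)) i ::
     real ^ ('m::finite + 'n::finite) option ^ ('m + 'n) option)"
  unfolding linear_conv_bounded_linear[symmetric]
proof (rule linearI)
  fix x y :: "(real ^ 'n ^ 'm) \<times> (real ^ 'n ^ 'n) \<times> (real ^ 'n)" and c :: real
  show "star_coeff (fst (x + y)) (fst (snd (x + y))) (snd (snd (x + y))) i =
      star_coeff (fst x) (fst (snd x)) (snd (snd x)) i + star_coeff (fst y) (fst (snd y)) (snd (snd y)) i"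
    by (simp add: vec_eq_iff split_option_all split_sum_all star_coeff_nth)
  show "star_coeff (fst (c *\<^sub>R x)) (fst (snd (c *\<^sub>R x))) (snd (snd (c *\<^sub>R x))) i =
      c *\<^sub>R star_coeff (fst x) (fst (snd x)) (snd (snd x)) i"
    by (simp add: vec_eq_iff split_option_all split_sum_all star_coeff_nth right_diff_distrib)
qed

lemma pd_star_coeff:
  assumes "A differentiable (at u)" "F differentiable (at u)" "b differentiable (at u)"
  shows "pd i (\<lambda>x. star_coeff (A x) (F x) (b x) j) u = star_coeff (pd i A u) (pd i F u) (pd i b u) j"
proof -
  have "((\<lambda>x. (A x, F x, b x)) has_derivative (\<lambda>v. (frechet_derivative A (at u) v, frechet_derivative F (at u) v, frechet_derivative b (at u) v))) (at u)"
    using assms unfolding frechet_derivative_works by (intro has_derivative_Pair)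
  from pd_eq[OF bounded_linear.has_derivative[OF bounded_linear_star_coeff this]]
  show ?thesis by (simp add: pd_def)
qed

lemma smooth_on_star_coeff [smooth_intros]:
  assumes "open V" "smooth_on V A" "smooth_on V F" "smooth_on V b"
  shows "smooth_on V (\<lambda>x. star_coeff (A x) (F x) (b x) i)"
proof -
  have "smooth_on V (\<lambda>x. star_coeff (A x) (F x) (b x) i $ r $ c)" for r c
  proof -
    consider "r = None \<and> c = None" | k where "r = None" "c = Some (Inl k)" | q where "r = None" "c = Some (Inr q)"
      | k where "r = Some (Inl k)" "c = None" | k l where "r = Some (Inl k)" "c = Some (Inl l)"
      | k q where "r = Some (Inl k)" "c = Some (Inr q)" | p where "r = Some (Inr p)" "c = None"
      | p k where "r = Some (Inr p)" "c = Some (Inl k)" | p q where "r = Some (Inr p)" "c = Some (Inr q)"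
      by (metis option.exhaust sum.exhaust)
    then show ?thesis by cases (simp_all add: star_coeff_nth, (intro smooth_intros assms)+)
  qed
  then have "smooth_on V (\<lambda>x. \<chi> r c. star_coeff (A x) (F x) (b x) i $ r $ c)" by (intro smooth_on_vec_lambda assms)
  then show ?thesis by (rule smooth_on_cong[OF assms(1)]) (simp add: vec_eq_iff)
qed

lemma orthonormal_columns:
  fixes A :: "real ^ 'n::finite ^ 'm::finite"
  assumes "transpose A ** A = mat 1"
  shows "(\<Sum>k\<in>UNIV. A $ k $ i * A $ k $ j) = (if i = j then 1 else 0)"
proof -
  have "(transpose A ** A) $ i $ j = (mat 1 :: real ^ 'n ^ 'n) $ i $ j" using assms by simp
  then show ?thesis by (simp add: matrix_matrix_mult_def transpose_def mat_def)
qed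

text \<open>The coefficient of dx_i is supported in the row and the column
  \<open>Some (Inr i)\<close>, so for i \<noteq> j almost every entry of the product collapses to a
  single term. In the entry (i, j), orthogonality of the columns of \<open>A\<close> removes the sum
  of a_ki a_kj.\<close>

lemma star_prod_nth:
  fixes A :: "real ^ 'n::finite ^ 'm::finite" and i j :: 'n and b :: "real ^ 'n"
  assumes ij: "i \<noteq> j" and A: "transpose A ** A = mat 1" and F: "\<And>i. F $ i $ i = 0"
  defines "P \<equiv> star_coeff A F b i ** star_coeff A F b j"
  shows "P $ r $ Some (Inl k) = (if r = Some (Inr i) then F $ i $ j * A $ k $ j else 0)"
    "P $ r $ None = (if r = Some (Inr i) then F $ i $ j * b $ j else 0)"
    "l \<noteq> j \<Longrightarrow> P $ r $ Some (Inr l) = (if r = Some (Inr i) then F $ i $ j * F $ j $ l else 0)"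
    "P $ Some (Inl k) $ Some (Inr j) = F $ j $ i * A $ k $ i"
    "P $ None $ Some (Inr j) = - (F $ j $ i * b $ i)"
    "q \<noteq> i \<Longrightarrow> P $ Some (Inr q) $ Some (Inr j) = F $ j $ i * F $ i $ q"
    "P $ Some (Inr i) $ Some (Inr j) = b $ i * b $ j - (\<Sum>k\<in>UNIV. F $ i $ k * F $ j $ k)"
proof -
  have prod: "P $ r $ s = star_coeff A F b i $ r $ None * star_coeff A F b j $ None $ s +
    (\<Sum>k\<in>UNIV. star_coeff A F b i $ r $ Some (Inl k) * star_coeff A F b j $ Some (Inl k) $ s) +
    (\<Sum>q\<in>UNIV. star_coeff A F b i $ r $ Some (Inr q) * star_coeff A F b j $ Some (Inr q) $ s)" for r s
    by (simp add: P_def matrix_matrix_mult_def sum_UNIV_option sum_UNIV_sum add.assoc)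
  show "P $ r $ Some (Inl k) = (if r = Some (Inr i) then F $ i $ j * A $ k $ j else 0)"
    using ij F unfolding prod
    by (cases r; cases "the r") (auto simp: star_coeff_nth sum_if_mult sum_negf)
  show "P $ r $ None = (if r = Some (Inr i) then F $ i $ j * b $ j else 0)"
    using ij F unfolding prod
    by (cases r; cases "the r") (auto simp: star_coeff_nth sum_if_mult sum_negf)
  show "P $ r $ Some (Inr l) = (if r = Some (Inr i) then F $ i $ j * F $ j $ l else 0)" if "l \<noteq> j"
    using ij F that unfolding prod
    by (cases r; cases "the r") (auto simp: star_coeff_nth sum_if_mult sum_negf)
  show "P $ Some (Inl k) $ Some (Inr j) = F $ j $ i * A $ k $ i"
    using ij F unfolding prod by (auto simp: star_coeff_nth sum_if_mult sum_negf)
  show "P $ None $ Some (Inr j) = - (F $ j $ i * b $ i)"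
    using ij F unfolding prod by (auto simp: star_coeff_nth sum_if_mult sum_negf)
  show "P $ Some (Inr q) $ Some (Inr j) = F $ j $ i * F $ i $ q" if "q \<noteq> i"
    using ij F that unfolding prod by (auto simp: star_coeff_nth sum_if_mult sum_negf)
  have "(\<Sum>q\<in>UNIV. star_coeff A F b i $ Some (Inr i) $ Some (Inr q) * star_coeff A F b j $ Some (Inr q) $ Some (Inr j))
      = (\<Sum>q\<in>UNIV. - (F $ i $ q * F $ j $ q))"
    by (intro sum.cong) (auto simp: star_coeff_nth F)
  moreover have "(\<Sum>k\<in>UNIV. star_coeff A F b i $ Some (Inr i) $ Some (Inl k) * star_coeff A F b j $ Some (Inl k) $ Some (Inr j)) = 0"
    using orthonormal_columns[OF A, of i j] ij by (simp add: star_coeff_nth sum_negf)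
  ultimately show "P $ Some (Inr i) $ Some (Inr j) = b $ i * b $ j - (\<Sum>k\<in>UNIV. F $ i $ k * F $ j $ k)"
    unfolding prod by (simp add: star_coeff_nth sum_negf)
qed

text \<open>\<open>A\<^sub>i\<close>, \<open>F\<^sub>i\<close>, \<open>b\<^sub>i\<close> stand for the \<open>i\<close>-th partial derivatives.\<close>

lemma star_flat_iff:
  fixes A :: "real ^ 'n::finite ^ 'm::finite" and i j :: 'n
  assumes ij: "i \<noteq> j" and A: "transpose A ** A = mat 1" and F: "\<And>i. F $ i $ i = 0"
    and Fi: "\<And>l. Fi $ l $ l = 0" and Fj: "\<And>l. Fj $ l $ l = 0"
  shows "star_coeff Ai Fi bi j + star_coeff A F b i ** star_coeff A F b j =
      star_coeff Aj Fj bj i + star_coeff A F b j ** star_coeff A F b i \<longleftrightarrow>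
    (\<forall>k. Aj $ k $ i = F $ i $ j * A $ k $ j \<and> Ai $ k $ j = F $ j $ i * A $ k $ i) \<and>
    bj $ i = F $ i $ j * b $ j \<and> bi $ j = F $ j $ i * b $ i \<and>
    (\<forall>l. l \<noteq> i \<and> l \<noteq> j \<longrightarrow> Fj $ i $ l = F $ i $ j * F $ j $ l \<and> Fi $ j $ l = F $ j $ i * F $ i $ l) \<and>
    Fj $ i $ j + Fi $ j $ i + (\<Sum>k\<in>UNIV. F $ i $ k * F $ j $ k) - b $ i * b $ j = 0" (is "?L = ?R \<longleftrightarrow> ?S")
proof
  note P = star_prod_nth[OF ij A F, where b=b] star_prod_nth[OF ij[symmetric] A F, where b=b]
  assume "?L = ?R"
  then have e: "?L $ r $ s = ?R $ r $ s" for r s by simp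
  have "Aj $ k $ i = F $ i $ j * A $ k $ j" "Ai $ k $ j = F $ j $ i * A $ k $ i" for k
    using e[of "Some (Inr i)" "Some (Inl k)"] e[of "Some (Inr j)" "Some (Inl k)"] ij by (simp_all add: P star_coeff_nth)
  moreover have "bj $ i = F $ i $ j * b $ j" "bi $ j = F $ j $ i * b $ i"
    using e[of "Some (Inr i)" "None"] e[of "Some (Inr j)" "None"] ij by (simp_all add: P star_coeff_nth)
  moreover have "Fj $ i $ l = F $ i $ j * F $ j $ l" "Fi $ j $ l = F $ j $ i * F $ i $ l" if "l \<noteq> i" "l \<noteq> j" for l
    using e[of "Some (Inr i)" "Some (Inr l)"] e[of "Some (Inr j)" "Some (Inr l)"] ij that by (simp_all add: P star_coeff_nth)
  moreover have "Fj $ i $ j + Fi $ j $ i + (\<Sum>k\<in>UNIV. F $ i $ k * F $ j $ k) - b $ i * b $ j = 0"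
    using e[of "Some (Inr i)" "Some (Inr j)"] ij by (simp add: P star_coeff_nth)
  ultimately show ?S by blast
next
  note P = star_prod_nth[OF ij A F, where b=b] star_prod_nth[OF ij[symmetric] A F, where b=b]
  assume S: ?S
  have sw: "(\<Sum>k\<in>UNIV. F $ j $ k * F $ i $ k) = (\<Sum>k\<in>UNIV. F $ i $ k * F $ j $ k)" by (simp add: mult.commute)
  \<comment> \<open>By columns: those of the normal frame carry the equations for \<open>A\<close>,
    the last one those for \<open>b\<close>, the tangent columns other than i and j those for F with
    distinct indices, and the columns i and j in addition the curvature equation.\<close>
  have k0: "?L $ r $ Some (Inl k) = ?R $ r $ Some (Inl k)" for r k
    using S ij by (cases r; cases "the r") (auto simp: P star_coeff_nth)
  have n0: "?L $ r $ None = ?R $ r $ None" for r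
    using S ij by (cases r; cases "the r") (auto simp: P star_coeff_nth)
  have l0: "?L $ r $ Some (Inr l) = ?R $ r $ Some (Inr l)" if "l \<noteq> i" "l \<noteq> j" for r l
    using S ij that by (cases r; cases "the r") (auto simp: P star_coeff_nth)
  have j0: "?L $ r $ Some (Inr j) = ?R $ r $ Some (Inr j)" for r
  proof (cases r)
    case None
    then show ?thesis using S ij by (simp add: P star_coeff_nth)
  next
    case (Some a)
    show ?thesis
    proof (cases a)
      case (Inl k)
      then show ?thesis using Some S ij by (simp add: P star_coeff_nth)
    next
      case (Inr q)
      show ?thesis
      proof (cases "q = i")
        case True
        then show ?thesis using Some Inr S ij by (simp add: P star_coeff_nth F Fi Fj)
      next
        case False
        then show ?thesis using Some Inr S ij by (cases "q = j") (simp_all add: P star_coeff_nth F Fi Fj)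
      qed
    qed
  qed
  have i0: "?L $ r $ Some (Inr i) = ?R $ r $ Some (Inr i)" for r
  proof (cases r)
    case None
    then show ?thesis using S ij by (simp add: P star_coeff_nth)
  next
    case (Some a)
    show ?thesis
    proof (cases a)
      case (Inl k)
      then show ?thesis using Some S ij by (simp add: P star_coeff_nth)
    next
      case (Inr q)
      show ?thesis
      proof (cases "q = j")
        case True
        then show ?thesis using Some Inr S ij by (simp add: P star_coeff_nth F Fi Fj sw) (simp add: algebra_simps)
      next
        case False
        then show ?thesis using Some Inr S ij by (cases "q = i") (simp_all add: P star_coeff_nth F Fi Fj)
      qed
    qed
  qed
  have "?L $ r $ s = ?R $ r $ s" for r s
  proof (cases s)
    case None
    then show ?thesis using n0 by simp
  next
    case (Some a)
    show ?thesis
    proof (cases a)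
      case (Inl k)
      then show ?thesis using Some k0 by simp
    next
      case (Inr l)
      then show ?thesis using Some l0[of l r] i0[of r] j0[of r] by (cases "l = i"; cases "l = j") simp_all
    qed
  qed
  then show "?L = ?R" by (simp add: vec_eq_iff)
qed

text \<open>Flatness at \<lambda> = 1 alone already amounts to the system. Read from left to right
  this is the integrability condition behind (iv); read from right to left it turns commuting
  derivatives of an adapted frame into (ii).\<close>

lemma G1_system_flat_iff:
  fixes A :: "real ^ 'n::finite \<Rightarrow> real ^ 'n ^ 'm::finite"
  assumes V: "open V" and maps: "G1_maps V A F b"
  defines "\<Theta> \<equiv> \<lambda>i u. star_coeff (A u) (F u) (b u) i"
  shows "G1_system_I V A F b \<longleftrightarrow>
    (\<forall>u\<in>V. \<forall>i j. pd i (\<Theta> j) u + \<Theta> i u ** \<Theta> j u = pd j (\<Theta> i) u + \<Theta> j u ** \<Theta> i u)"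
proof -
  have sm: "smooth_on V A" "smooth_on V F" "smooth_on V b" and AA: "\<And>u. u \<in> V \<Longrightarrow> transpose (A u) ** A u = mat 1"
    and FF: "\<And>u i. u \<in> V \<Longrightarrow> F u $ i $ i = 0"
    using maps unfolding G1_maps_def by auto
  note df = smooth_on_differentiable[OF sm(1)] smooth_on_differentiable[OF sm(2)] smooth_on_differentiable[OF sm(3)]
  have nth: "pd j (\<lambda>x. F x $ i $ k) u = pd j F u $ i $ k" "pd j (\<lambda>x. b x $ i) u = pd j b u $ i"
    "pd j (\<lambda>x. A x $ l $ i) u = pd j A u $ l $ i" if "u \<in> V" for u i j k l
  proof -
    have *: "pd j (\<lambda>x. h x $ i $ k) u = pd j h u $ i $ k" if h: "h differentiable (at u)" for h :: "real ^ 'n \<Rightarrow> real ^ 'n ^ 'x::finite" and i k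
      using pd_vec_nth[of "\<lambda>x. h x $ i" u j k] pd_vec_nth[OF h, of j i]
        differentiable_compose[OF bounded_linear_imp_differentiable[OF bounded_linear_vec_nth] h]
      by (simp add: o_def)
    show "pd j (\<lambda>x. F x $ i $ k) u = pd j F u $ i $ k" "pd j (\<lambda>x. b x $ i) u = pd j b u $ i"
      "pd j (\<lambda>x. A x $ l $ i) u = pd j A u $ l $ i" using df that by (simp_all add: * pd_vec_nth)
  qed
  have Fd: "pd j F u $ i $ i = 0" if u: "u \<in> V" for u i j
  proof -
    have "pd j (\<lambda>x. 0::real) u = pd j (\<lambda>x. F x $ i $ i) u"
      by (rule pd_cong[OF V u]) (use FF in auto)
    then show ?thesis using nth(1)[OF u] by simp
  qed
  have "(\<forall>i j. pd i (\<Theta> j) u + \<Theta> i u ** \<Theta> j u = pd j (\<Theta> i) u + \<Theta> j u ** \<Theta> i u) \<longleftrightarrow>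
      (\<forall>i j. i \<noteq> j \<longrightarrow>
          pd j (\<lambda>x. F x $ i $ j) u + pd i (\<lambda>x. F x $ j $ i) u
            + (\<Sum>k\<in>UNIV. F u $ i $ k * F u $ j $ k) - b u $ i * b u $ j = 0) \<and>
       (\<forall>i j k. i \<noteq> j \<and> j \<noteq> k \<and> i \<noteq> k \<longrightarrow>
          pd k (\<lambda>x. F x $ i $ j) u = F u $ i $ k * F u $ k $ j) \<and>
       (\<forall>i j. i \<noteq> j \<longrightarrow> pd j (\<lambda>x. b x $ i) u = F u $ i $ j * b u $ j) \<and>
       (\<forall>k i j. i \<noteq> j \<longrightarrow> pd j (\<lambda>x. A x $ k $ i) u = F u $ i $ j * A u $ k $ j)" (is "?L \<longleftrightarrow> ?R") if u: "u \<in> V" for u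
  proof -
    have X: "pd i (\<Theta> j) u + \<Theta> i u ** \<Theta> j u = pd j (\<Theta> i) u + \<Theta> j u ** \<Theta> i u \<longleftrightarrow>
      (\<forall>k. pd j A u $ k $ i = F u $ i $ j * A u $ k $ j \<and> pd i A u $ k $ j = F u $ j $ i * A u $ k $ i) \<and>
      pd j b u $ i = F u $ i $ j * b u $ j \<and> pd i b u $ j = F u $ j $ i * b u $ i \<and>
      (\<forall>l. l \<noteq> i \<and> l \<noteq> j \<longrightarrow> pd j F u $ i $ l = F u $ i $ j * F u $ j $ l \<and> pd i F u $ j $ l = F u $ j $ i * F u $ i $ l) \<and>
      pd j F u $ i $ j + pd i F u $ j $ i + (\<Sum>k\<in>UNIV. F u $ i $ k * F u $ j $ k) - b u $ i * b u $ j = 0"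
      if "i \<noteq> j" for i j
      unfolding \<Theta>_def pd_star_coeff[OF df(1)[OF u] df(2)[OF u] df(3)[OF u]]
      by (rule star_flat_iff[OF that AA[OF u] FF[OF u] Fd[OF u] Fd[OF u]])
    show ?thesis
    proof
      assume L: ?L
      note XL = X[THEN iffD1, OF _ L[rule_format]]
      show ?R unfolding nth[OF u]
      proof (intro conjI allI impI)
        fix i j :: 'n assume "i \<noteq> j"
        then show "pd j F u $ i $ j + pd i F u $ j $ i + (\<Sum>k\<in>UNIV. F u $ i $ k * F u $ j $ k) - b u $ i * b u $ j = 0"
          and "pd j b u $ i = F u $ i $ j * b u $ j" using XL[of i j] by simp_all
      next
        \<comment> \<open>The derivative of f_ij in the direction x_k is an entry of the flatness
          condition for the pair (i, k).\<close>
        fix i j k :: 'n assume "i \<noteq> j \<and> j \<noteq> k \<and> i \<noteq> k"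
        then have "j \<noteq> i" "j \<noteq> k" "i \<noteq> k" by auto
        then show "pd k F u $ i $ j = F u $ i $ k * F u $ k $ j" using XL[of i k] by simp
      next
        fix k and i j :: 'n assume "i \<noteq> j"
        then show "pd j A u $ k $ i = F u $ i $ j * A u $ k $ j" using XL[of i j] by simp
      qed
    next
      assume R: ?R
      have "pd i (\<Theta> j) u + \<Theta> i u ** \<Theta> j u = pd j (\<Theta> i) u + \<Theta> j u ** \<Theta> i u" if "i \<noteq> j" for i j
        unfolding X[OF that] using R that unfolding nth[OF u] by (intro conjI allI impI) (simp_all, simp_all add: eq_commute)
      \<comment> \<open>For i = j the flatness equation is trivial.\<close>
      then show ?L by metis
    qed
  qed
  then show ?thesis using maps unfolding G1_system_I_def by auto
qed

section \<open>The Lorentz group and its Lie algebra\<close>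

definition lorentz_matrix :: "real ^ ('k::finite) option ^ 'k option" where
  "lorentz_matrix = (\<chi> r s. if s = r then lsign r else 0)"

lemma Lorentz_group_iff_matrix: "g \<in> Lorentz_group \<longleftrightarrow> transpose g ** lorentz_matrix ** g = lorentz_matrix"
proof -
  have "(transpose g ** lorentz_matrix ** g) $ r $ s = column r g \<bullet>\<^sub>1 column s g" for r s
  proof -
    have "(transpose g ** lorentz_matrix) $ r $ t = g $ t $ r * lsign t" for t
      using sum_if_mult(2)[of "\<lambda>p. g $ p $ r" t "\<lambda>p. lsign p"]
      by (simp add: matrix_matrix_mult_def transpose_def lorentz_matrix_def eq_commute[of t])
    then show ?thesis
      by (simp add: matrix_matrix_mult_def[of "transpose g ** lorentz_matrix"] sum_UNIV_option lorentz_def column_def)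
  qed
  then show ?thesis
    by (auto simp: Lorentz_group_iff vec_eq_iff lorentz_matrix_def)
qed

text \<open>From g^t J g = J the inverse of g is J g^t J, and using it from the other side gives g J
  g^t = J. It is needed because solutions of dg = g \<Theta> preserve the products of rows, while
  the group is defined by those of columns.\<close>

lemma Lorentz_group_transpose:
  assumes "g \<in> Lorentz_group"
  shows "transpose g \<in> Lorentz_group"
proof -
  let ?J = "lorentz_matrix :: real ^ 'a option ^ 'a option"
  have JJ: "?J ** ?J = mat 1"
  proof -
    have "(?J ** ?J) $ r $ s = (mat 1 :: real ^ 'a option ^ 'a option) $ r $ s" for r s
      using sum_if_mult(1)[of r "\<lambda>p. lsign r" "\<lambda>p. ?J $ p $ s"]
      by (simp add: matrix_matrix_mult_def lorentz_matrix_def mat_def)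
    then show ?thesis by (simp add: vec_eq_iff)
  qed
  have "(?J ** transpose g ** ?J) ** g = ?J ** (transpose g ** ?J ** g)" by (simp add: matrix_mul_assoc)
  also have "\<dots> = mat 1" using assms JJ by (simp add: Lorentz_group_iff_matrix)
  finally have "g ** (?J ** transpose g ** ?J) = mat 1" by (simp add: matrix_left_right_inverse)
  then have "(g ** ?J ** transpose g) ** ?J ** ?J = ?J" by (simp add: matrix_mul_assoc)
  then have "g ** ?J ** transpose g = ?J" using JJ by (simp add: matrix_mul_assoc[symmetric])
  then show ?thesis by (simp add: Lorentz_group_iff_matrix)
qed

text \<open>The coefficients lie in the Lie algebra of the Lorentz group; this keeps the integrated
  solutions inside the group.\<close>

lemma star_coeff_skew:
  "lsign r * star_coeff A F b i $ r $ s + lsign s * star_coeff A F b i $ s $ r = 0"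
proof -
  consider "r = None \<and> s = None" | k where "r = None" "s = Some (Inl k)" | q where "r = None" "s = Some (Inr q)"
    | k where "r = Some (Inl k)" "s = None" | k l where "r = Some (Inl k)" "s = Some (Inl l)"
    | k q where "r = Some (Inl k)" "s = Some (Inr q)" | p where "r = Some (Inr p)" "s = None"
    | p k where "r = Some (Inr p)" "s = Some (Inl k)" | p q where "r = Some (Inr p)" "s = Some (Inr q)"
    by (metis option.exhaust sum.exhaust)
  then show ?thesis by cases (auto simp: star_coeff_nth)
qed

lemma lorentz_eq_lsign: "x \<bullet>\<^sub>1 y = (\<Sum>r\<in>UNIV. lsign r * x $ r * y $ r)"
  by (simp add: lorentz_def sum_UNIV_option)

lemma lorentz_skew:
  assumes "\<And>r s. lsign r * M $ r $ s + lsign s * M $ s $ r = 0"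
  shows "x \<bullet>\<^sub>1 (y v* M) + (x v* M) \<bullet>\<^sub>1 y = 0"
proof -
  have M: "lsign r * M $ s $ r = - (lsign s * M $ r $ s)" for r s
  proof -
    have "lsign r * (lsign s * (lsign r * M $ r $ s + lsign s * M $ s $ r)) = 0" using assms by simp
    then have "(lsign r * lsign r) * (lsign s * M $ r $ s) + (lsign s * lsign s) * (lsign r * M $ s $ r) = 0"
      by (simp only: algebra_simps)
    then show ?thesis by simp
  qed
  have "x \<bullet>\<^sub>1 (y v* M) = (\<Sum>r\<in>UNIV. \<Sum>s\<in>UNIV. x $ r * y $ s * (lsign r * M $ s $ r))"
    by (simp add: lorentz_eq_lsign vector_matrix_mult_def sum_distrib_left mult_ac)
  also have "\<dots> = (\<Sum>s\<in>UNIV. \<Sum>r\<in>UNIV. x $ r * y $ s * (- (lsign s * M $ r $ s)))"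
    by (subst sum.swap) (intro sum.cong refl arg_cong2[where f="(*)"] M)
  also have "\<dots> = - ((x v* M) \<bullet>\<^sub>1 y)"
    by (simp add: lorentz_eq_lsign vector_matrix_mult_def sum_distrib_left sum_distrib_right sum_negf mult_ac)
  finally show ?thesis by simp
qed

lemma lorentz_skew_one_form:
  "x \<bullet>\<^sub>1 (y v* one_form (\<chi> i. star_coeff A F b i) v) + (x v* one_form (\<chi> i. star_coeff A F b i) v) \<bullet>\<^sub>1 y = 0"
proof (rule lorentz_skew)
  fix r s
  have "lsign r * one_form (\<chi> i. star_coeff A F b i) v $ r $ s + lsign s * one_form (\<chi> i. star_coeff A F b i) v $ s $ r
    = (\<Sum>i\<in>UNIV. v $ i * (lsign r * star_coeff A F b i $ r $ s + lsign s * star_coeff A F b i $ s $ r))"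
    by (simp add: one_form_def sum_distrib_left distrib_left sum.distrib mult_ac)
  then show "lsign r * one_form (\<chi> i. star_coeff A F b i) v $ r $ s + lsign s * one_form (\<chi> i. star_coeff A F b i) v $ s $ r = 0"
    by (simp add: star_coeff_skew)
qed

text \<open>With dg = g \<Theta> and \<Theta> skew for the Lorentz form, the products of
  \<open>x v* g u\<close> and \<open>y v* g u\<close> do not depend on \<open>u\<close>, so a start
  in the group keeps \<open>g\<close> in the group. Convexity of \<open>W\<close> permits the
  integration along rays from \<open>u0\<close>.\<close>

theorem star_solvable:
  fixes A :: "real ^ 'n::finite \<Rightarrow> real ^ 'n ^ 'm::finite"
  assumes V: "open V" and sys: "G1_system_I V A F b"
    and W: "W \<subseteq> V" "open W" "convex W" "u0 \<in> W" and g0: "g0 \<in> Lorentz_group"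
  shows "\<exists>g. solves_star W A F b g \<and> g u0 = g0"
proof -
  define \<Theta> where "\<Theta> u = (\<chi> i. star_coeff (A u) (F u) (b u) i)" for u
  have maps: "G1_maps V A F b" using sys by (simp add: G1_system_I_def)
  then have sm: "smooth_on V A" "smooth_on V F" "smooth_on V b" by (auto simp: G1_maps_def)
  have s\<Theta>: "smooth_on W \<Theta>"
    unfolding \<Theta>_def[abs_def] using sm W by (intro smooth_intros) (auto intro: smooth_on_subset)
  have flat: "pd i \<Theta> u $ j + \<Theta> u $ i ** \<Theta> u $ j = pd j \<Theta> u $ i + \<Theta> u $ j ** \<Theta> u $ i" if u: "u \<in> W" for u i j
  proof -
    have "pd i \<Theta> u $ j = pd i (\<lambda>u. star_coeff (A u) (F u) (b u) j) u" for i j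
      using pd_vec_nth[OF smooth_on_differentiable[OF s\<Theta> u], of i j] by (simp add: \<Theta>_def)
    moreover have "u \<in> V" using u W by blast
    ultimately show ?thesis using sys unfolding G1_system_flat_iff[OF V maps] by (simp add: \<Theta>_def)
  qed
  obtain g where g: "smooth_on W g" "g u0 = g0"
    and D: "\<And>u. u \<in> W \<Longrightarrow> (g has_derivative (\<lambda>v. g u ** one_form (\<Theta> u) v)) (at u)"
    using linear_total_pde_solvable[OF W(2,3,4) s\<Theta> flat] by blast
  have "g u \<in> Lorentz_group" if u: "u \<in> W" for u
  proof -
    have "(x v* g u) \<bullet>\<^sub>1 (y v* g u) = x \<bullet>\<^sub>1 y" for x y
    proof -
      have bl: "bounded_linear (\<lambda>M. x v* M)" for x :: "real ^ ('m + 'n) option"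
        unfolding linear_conv_bounded_linear[symmetric]
        by (rule linearI) (simp_all add: vector_matrix_mult_def vec_eq_iff sum.distrib distrib_left sum_distrib_left mult_ac)
      have "((\<lambda>u. (x v* g u) \<bullet>\<^sub>1 (y v* g u)) has_derivative (\<lambda>v. 0)) (at u within W)" if "u \<in> W" for u
      proof -
        have "((\<lambda>u. (x v* g u) \<bullet>\<^sub>1 (y v* g u)) has_derivative
          (\<lambda>v. (x v* g u) \<bullet>\<^sub>1 (y v* (g u ** one_form (\<Theta> u) v)) + (x v* (g u ** one_form (\<Theta> u) v)) \<bullet>\<^sub>1 (y v* g u))) (at u within W)"
          by (intro bounded_bilinear.FDERIV[OF bounded_bilinear_lorentz] bounded_linear.has_derivative[OF bl]
              has_derivative_at_withinI[OF D[OF that]])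
        moreover have "(x v* g u) \<bullet>\<^sub>1 (y v* (g u ** one_form (\<Theta> u) v)) + (x v* (g u ** one_form (\<Theta> u) v)) \<bullet>\<^sub>1 (y v* g u) = 0" for v
          unfolding vector_matrix_mul_assoc[symmetric] \<Theta>_def by (rule lorentz_skew_one_form)
        ultimately show ?thesis by simp
      qed
      from has_derivative_zero_constant[OF W(3) this] obtain c where
        c: "\<And>u. u \<in> W \<Longrightarrow> (x v* g u) \<bullet>\<^sub>1 (y v* g u) = c" by blast
      have "(x v* g u) \<bullet>\<^sub>1 (y v* g u) = (x v* g0) \<bullet>\<^sub>1 (y v* g0)" using c[OF u] c[OF W(4)] g(2) by simp
      also have "\<dots> = x \<bullet>\<^sub>1 y"
        using Lorentz_group_transpose[OF g0] by (simp add: Lorentz_group_def transpose_matrix_vector)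
      finally show ?thesis .
    qed
    then have "transpose (g u) \<in> Lorentz_group" by (simp add: Lorentz_group_def transpose_matrix_vector)
    from Lorentz_group_transpose[OF this] show ?thesis by simp
  qed
  moreover have "matrix_inv (g u) ** frechet_derivative g (at u) v = (\<Sum>i\<in>UNIV. v $ i *\<^sub>R star_coeff (A u) (F u) (b u) i)"
    if "u \<in> W" for u v
    using matrix_inv_inverse(2)[OF Lorentz_group_invertible[OF calculation[OF that]]]
    unfolding frechet_derivative_eq[OF D[OF that]] by (simp add: matrix_mul_assoc one_form_def \<Theta>_def)
  ultimately have "solves_star W A F b g" using g unfolding solves_star_def by blast
  then show ?thesis using g by blast
qed

lemma column_matrix_mult: "column s (g ** M) = (\<Sum>r\<in>UNIV. M $ r $ s *\<^sub>R column r g)" for g M :: "real ^ 'k::finite ^ 'k"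
  by (simp add: vec_eq_iff column_def matrix_matrix_mult_def mult.commute)

lemma bounded_linear_column: "bounded_linear (column s :: real ^ 'k::finite ^ 'k \<Rightarrow> _)"
  unfolding linear_conv_bounded_linear[symmetric]
  by (rule linearI) (simp_all add: column_def vec_eq_iff)

lemma sum_if_scaleR:
  fixes f :: "'n::finite \<Rightarrow> real" and g :: "'n \<Rightarrow> 'b::real_vector"
  shows "(\<Sum>q\<in>UNIV. (if q = a then f q else 0) *\<^sub>R g q) = f a *\<^sub>R g a"
proof -
  have "(\<Sum>q\<in>UNIV. (if q = a then f q else 0) *\<^sub>R g q) = (\<Sum>q\<in>UNIV. if q = a then f q *\<^sub>R g q else 0)"
    by (intro sum.cong) auto
  then show ?thesis by (simp add: sum.delta)
qed

text \<open>With \<open>c\<close> the columns of a solution, these are the structure equations: the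
  i-th derivative of the position vector, of a normal vector and of a tangent vector.\<close>

lemma star_combination:
  fixes c :: "('m::finite + 'n::finite) option \<Rightarrow> 'b::real_vector"
  shows "(\<Sum>r\<in>UNIV. star_coeff A F b i $ r $ None *\<^sub>R c r) = b $ i *\<^sub>R c (Some (Inr i))"
    "(\<Sum>r\<in>UNIV. star_coeff A F b i $ r $ Some (Inl k) *\<^sub>R c r) = A $ k $ i *\<^sub>R c (Some (Inr i))"
    "(\<Sum>r\<in>UNIV. star_coeff A F b i $ r $ Some (Inr j) *\<^sub>R c r) = F $ i $ j *\<^sub>R c (Some (Inr i)) +
      (if i = j then b $ i *\<^sub>R c None - (\<Sum>k\<in>UNIV. A $ k $ i *\<^sub>R c (Some (Inl k)))
        - (\<Sum>q\<in>UNIV. F $ i $ q *\<^sub>R c (Some (Inr q))) else 0)"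
  by (auto simp: sum_UNIV_option sum_UNIV_sum star_coeff_nth sum_if_scaleR scaleR_diff_left sum_subtractf sum_negf)

lemma solves_star_pd:
  assumes "solves_star V A F b g" "u \<in> V"
  shows "pd i g u = g u ** star_coeff (A u) (F u) (b u) i"
    "pd i (\<lambda>u. column s (g u)) u = (\<Sum>r\<in>UNIV. star_coeff (A u) (F u) (b u) i $ r $ s *\<^sub>R column r (g u))"
proof -
  have g: "g differentiable (at u)" "g u \<in> Lorentz_group"
    using assms smooth_on_differentiable by (auto simp: solves_star_def)
  have "matrix_inv (g u) ** pd i g u = star_coeff (A u) (F u) (b u) i"
    using assms sum_if_scaleR[of i "\<lambda>_. 1" "\<lambda>j. star_coeff (A u) (F u) (b u) j"]
    by (simp add: solves_star_def pd_def axis_def cong: if_cong)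
  then have "g u ** (matrix_inv (g u) ** pd i g u) = g u ** star_coeff (A u) (F u) (b u) i" by simp
  then show 1: "pd i g u = g u ** star_coeff (A u) (F u) (b u) i"
    by (simp add: matrix_mul_assoc matrix_inv_inverse[OF Lorentz_group_invertible[OF g(2)]])
  show "pd i (\<lambda>u. column s (g u)) u = (\<Sum>r\<in>UNIV. star_coeff (A u) (F u) (b u) i $ r $ s *\<^sub>R column r (g u))"
    unfolding pd_bounded_linear[OF bounded_linear_column g(1)] 1 column_matrix_mult ..
qed

text \<open>Lorentz matrices may reverse time, so the last column is multiplied by the sign of its
  time component at \<open>u0\<close>; that component has absolute value at least 1, hence constant
  sign on the connected domain. For the curvature, the second normals vanish off the diagonal, and
  A^t A = I makes their products differ from those of a hyperbolic space only by terms that cancel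
  in the Gauss equation.\<close>

theorem star_solution_immersion:
  fixes A :: "real ^ 'n::finite \<Rightarrow> real ^ 'n ^ 'm::finite"
  assumes V: "open V" "connected V" and maps: "G1_maps V A F b" and b: "\<And>u i. u \<in> V \<Longrightarrow> b u $ i \<noteq> 0"
    and g: "solves_star V A F b g" and u0: "u0 \<in> V"
  defines "Y \<equiv> \<lambda>u. sgn (g u0 $ None $ None) *\<^sub>R column None (g u)"
  shows "immersion_into_hyp V Y \<and>
    (\<forall>u\<in>V. \<forall>i j. first_ff Y u $ i $ j = (if i = j then (b u $ i)\<^sup>2 else 0)) \<and>
    const_curvature V (first_ff Y) (-1)"
proof -
  define \<sigma> where "\<sigma> = sgn (g u0 $ None $ None)"
  define c where "c r u = column r (g u)" for r u
  have sg: "smooth_on V g" using g by (simp add: solves_star_def)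
  have sc: "smooth_on V (c r)" for r
    unfolding c_def[abs_def] by (rule smooth_on_bounded_linear[OF bounded_linear_column V(1) sg])
  have dc: "c r differentiable (at u)" if "u \<in> V" for r u by (rule smooth_on_differentiable[OF sc that])
  have on: "c r u \<bullet>\<^sub>1 c s u = (if r = s then lsign r else 0)" if "u \<in> V" for r s u
    using g that by (simp add: solves_star_def Lorentz_group_iff c_def)
  have pdc: "pd i (c s) u = (\<Sum>r\<in>UNIV. star_coeff (A u) (F u) (b u) i $ r $ s *\<^sub>R c r u)" if "u \<in> V" for i s u
    using solves_star_pd(2)[OF g that, of i s] unfolding c_def[abs_def] .
  have ge1: "(g u $ None $ None)\<^sup>2 \<ge> 1" if "u \<in> V" for u
  proof -
    have "c None u \<bullet>\<^sub>1 c None u = -1" using on[OF that] by simp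
    then have "space_part (c None u) \<bullet> space_part (c None u) = (g u $ None $ None)\<^sup>2 - 1"
      by (simp add: lorentz_space_part c_def column_def power2_eq_square)
    then show ?thesis using inner_ge_zero[of "space_part (c None u)"] by simp
  qed
  have n0: "g u $ None $ None \<noteq> 0" if "u \<in> V" for u using ge1[OF that] by auto
  have pos: "\<sigma> * g u $ None $ None > 0" if u: "u \<in> V" for u
  proof (rule ccontr)
    let ?h = "\<lambda>u. g u $ None $ None"
    assume neg: "\<not> \<sigma> * ?h u > 0"
    have con: "connected (?h ` V)"
      by (intro connected_continuous_image V smooth_on_continuous smooth_intros sg)
    have "0 \<in> ?h ` V"
    proof (cases "?h u0 > 0")
      case True
      then have "?h u \<le> 0" using neg by (simp add: \<sigma>_def)
      then show ?thesis using connected_contains_Icc[OF con, of "?h u" "?h u0"] u u0 True by auto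
    next
      case False
      then have "?h u0 < 0" "?h u \<ge> 0" using neg n0[OF u0] by (auto simp: \<sigma>_def)
      then show ?thesis using connected_contains_Icc[OF con, of "?h u0" "?h u"] u u0 by auto
    qed
    then show False using n0 by auto
  qed
  have \<sigma>: "\<sigma> * \<sigma> = 1" using n0[OF u0] by (simp add: \<sigma>_def sgn_if)
  have Yc: "Y = (\<lambda>u. \<sigma> *\<^sub>R c None u)" by (simp add: Y_def \<sigma>_def c_def fun_eq_iff)
  have sY: "smooth_on V Y" unfolding Yc by (intro smooth_intros V sc)
  have inh: "Y u \<in> hyp" if "u \<in> V" for u
    using on[OF that, of None None] pos[OF that] \<sigma>
    by (simp add: hyp_def Yc lorentz_simps c_def column_def mult.assoc[symmetric])
  have pdY: "pd i Y u = (\<sigma> * b u $ i) *\<^sub>R c (Some (Inr i)) u" if "u \<in> V" for i u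
    unfolding Yc pd_bounded_linear[OF bounded_linear_scaleR_right dc[OF that]] pdc[OF that] star_combination by simp
  have ff: "first_ff Y u $ i $ j = (if i = j then (b u $ i)\<^sup>2 else 0)" if "u \<in> V" for u i j
    using \<sigma> by (simp add: first_ff_nth pdY[OF that] lorentz_simps on[OF that] power2_eq_square mult.assoc[symmetric])
  interpret hyp_immersion V Y
  proof
    fix u and x :: "real ^ 'n" assume u: "u \<in> V" and x: "x \<noteq> 0"
    have "(first_ff Y u *v x) $ i = (b u $ i)\<^sup>2 * x $ i" for i
      using sum_if_mult(1)[of i "\<lambda>j. (b u $ i)\<^sup>2" "\<lambda>j. x $ j"] by (simp add: matrix_vector_mult_def ff[OF u] eq_commute[of i])
    then have "x \<bullet> (first_ff Y u *v x) = (\<Sum>i\<in>UNIV. (b u $ i * x $ i)\<^sup>2)"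
      by (simp add: inner_vec_def power_mult_distrib power2_eq_square mult_ac)
    also have "\<dots> > 0"
    proof -
      obtain i where "x $ i \<noteq> 0" using x by (auto simp: vec_eq_iff)
      then have "(b u $ i * x $ i)\<^sup>2 > 0" using b[OF u] by simp
      then show ?thesis by (intro sum_pos2[of _ i]) auto
    qed
    finally show "x \<bullet> (first_ff Y u *v x) > 0" .
  qed (use V sY inh in auto)
  \<comment> \<open>\<open>?Z\<close> is the normal part that the structure equations give for the
    second derivative. Its difference to \<open>second_normal\<close> is tangential and orthogonal
    to all tangent vectors, hence null; being orthogonal to the timelike \<open>Y u\<close> as well,
    it vanishes.\<close>
  have N: "second_normal i j u = (if i = j then (\<sigma> * b u $ j) *\<^sub>R (b u $ i *\<^sub>R c None u - (\<Sum>k\<in>UNIV. A u $ k $ i *\<^sub>R c (Some (Inl k)) u)) else 0)"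
    (is "_ = ?Z") if u: "u \<in> V" for i j u
  proof -
    have "pd i (pd j Y) u = pd i (\<lambda>x. (\<sigma> * b x $ j) *\<^sub>R c (Some (Inr j)) x) u"
      by (rule pd_cong[OF V(1) u pdY diff_pd[OF u]])
    also have "\<dots> = (\<sigma> * b u $ j) *\<^sub>R pd i (c (Some (Inr j))) u + pd i (\<lambda>x. \<sigma> * b x $ j) u *\<^sub>R c (Some (Inr j)) u"
      by (rule pd_scaleR[OF smooth_on_differentiable[OF _ u] dc[OF u]])
        (use maps in \<open>auto simp: G1_maps_def intro!: smooth_intros V\<close>)
    finally have pp: "pd i (pd j Y) u = \<dots>" .
    define w where "w q = (if i = j then - (\<sigma> * b u $ j) * F u $ i $ q else 0) + (if q = i then (\<sigma> * b u $ j) * F u $ i $ j else 0)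
      + (if q = j then pd i (\<lambda>x. \<sigma> * b x $ j) u else 0)" for q
    have e1: "pd i (pd j Y) u = ?Z + (\<Sum>q\<in>UNIV. w q *\<^sub>R c (Some (Inr q)) u)"
      unfolding pp pdc[OF u] star_combination w_def
      by (simp add: scaleR_add_left sum.distrib sum_if_scaleR scaleR_add_right scaleR_diff_right scaleR_sum_right sum_negf)
    have e2: "c (Some (Inr q)) u = (\<sigma> / b u $ q) *\<^sub>R pd q Y u" for q
      using \<sigma> b[OF u, of q] by (simp add: pdY[OF u])
    define w' where "w' q = w q * (\<sigma> / b u $ q) - christoffel (first_ff Y) q i j u" for q
    have w': "second_normal i j u - ?Z = (\<Sum>q\<in>UNIV. w' q *\<^sub>R pd q Y u)"
      unfolding second_normal_def e1 unfolding e2 w'_def by (simp add: scaleR_diff_left sum_subtractf)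
    let ?D = "second_normal i j u - ?Z"
    have "?D \<bullet>\<^sub>1 pd q Y u = 0" for q
      by (simp add: lorentz_simps second_normal_orthogonal[OF u]) (simp add: pdY[OF u] lorentz_simps on[OF u])
    then have "?D \<bullet>\<^sub>1 ?D = 0" by (subst (2) w') (simp add: lorentz_simps)
    moreover have "?D \<bullet>\<^sub>1 Y u = 0" unfolding w' by (simp add: lorentz_simps tangent_orthogonal[OF u])
    ultimately have "?D = 0" using spacelike_of_orthogonal[OF u] by fastforce
    then show ?thesis by simp
  qed
  have NN: "second_normal i j u \<bullet>\<^sub>1 second_normal k l u = (if i = j \<and> k = l \<and> i = k then (b u $ i)\<^sup>2 else 0)
      - first_ff Y u $ i $ j * first_ff Y u $ k $ l" if u: "u \<in> V" for i j k l u
  proof (cases "i = j \<and> k = l")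
    case True
    define d :: real where "d = (if i = k then 1 else 0)"
    have AA: "(\<Sum>a\<in>UNIV. A u $ a $ i * A u $ a $ k) = d"
      unfolding d_def by (rule orthonormal_columns) (use maps u in \<open>auto simp: G1_maps_def\<close>)
    define B where "B i = b u $ i *\<^sub>R c None u - (\<Sum>a\<in>UNIV. A u $ a $ i *\<^sub>R c (Some (Inl a)) u)" for i
    have BB: "B i \<bullet>\<^sub>1 B k = d - b u $ i * b u $ k"
    proof -
      have "(\<Sum>a\<in>UNIV. \<Sum>a'\<in>UNIV. A u $ a $ i * (A u $ a' $ k * (c (Some (Inl a)) u \<bullet>\<^sub>1 c (Some (Inl a')) u))) = d"
        unfolding AA[symmetric] by (intro sum.cong refl) (simp add: on[OF u] if_distrib sum.delta cong: if_cong)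
      then show ?thesis unfolding B_def
        by (simp add: lorentz_diff_left lorentz_diff_right lorentz_scaleR_left lorentz_scaleR_right lorentz_sum_left)
          (simp add: lorentz_sum_right lorentz_scaleR_left lorentz_scaleR_right on[OF u] sum_distrib_left)
    qed
    have "second_normal i j u \<bullet>\<^sub>1 second_normal k l u = (\<sigma> * \<sigma>) * ((b u $ i * b u $ k) * (B i \<bullet>\<^sub>1 B k))"
      using True unfolding N[OF u] B_def[symmetric] by (simp add: lorentz_scaleR_left lorentz_scaleR_right mult_ac)
    then show ?thesis using True unfolding BB \<sigma> by (simp add: d_def ff[OF u] power2_eq_square algebra_simps)
  next
    case False
    then show ?thesis by (auto simp: N[OF u] ff[OF u] lorentz_simps)
  qed
  \<comment> \<open>The extra term b_i^2 occurs only when all four indices agree, and there the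
    antisymmetric expression is zero.\<close>
  have R: "second_normal j k u \<bullet>\<^sub>1 second_normal i q u - second_normal i k u \<bullet>\<^sub>1 second_normal j q u
      = -1 * (first_ff Y u $ j $ k * first_ff Y u $ i $ q - first_ff Y u $ i $ k * first_ff Y u $ j $ q)" if "u \<in> V" for u i j k q
    unfolding NN[OF that] by (cases "i = j"; cases "j = k"; cases "i = q"; simp)
  have "sectional_curvature (first_ff Y) u x y = -1" if "u \<in> V" "x \<noteq> y" "independent {x, y}" for u x y
    by (rule sectional_curvature_eq[OF that(1) R[OF that(1)] that(2,3)])
  then have "const_curvature V (first_ff Y) (-1)" by (simp add: const_curvature_def)
  moreover have "inj (frechet_derivative Y (at u))" if u: "u \<in> V" for u
    unfolding linear_injective_0[OF linear_frechet_derivative[OF diff_Y[OF u]]]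
  proof (intro allI impI)
    fix x assume "frechet_derivative Y (at u) x = 0"
    then have "x \<bullet> (first_ff Y u *v x) = 0"
      by (simp add: first_ff_form frechet_eq_sum_pd[OF diff_Y[OF u], symmetric] lorentz_simps)
    then show "x = 0" using first_ff_pos[OF u] by force
  qed
  ultimately show ?thesis
    using sY inh ff unfolding immersion_into_hyp_def by blast
qed

subsection \<open>Adapted frames\<close>

lemma christoffel_cong:
  assumes "open V" "x \<in> V" "\<And>y. y \<in> V \<Longrightarrow> G y = G' y" "smooth_on V G"
  shows "christoffel G l i j x = christoffel G' l i j x"
proof -
  have "pd i (\<lambda>x. G x $ j $ p) x = pd i (\<lambda>x. G' x $ j $ p) x" for i j p
    by (rule pd_cong[OF assms(1,2)])
      (use assms smooth_on_differentiable[OF smooth_on_vec_nth[OF assms(1) smooth_on_vec_nth[OF assms(1,4)]] assms(2)] in auto)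
  then show ?thesis using assms by (simp add: christoffel_def)
qed

text \<open>The two metrics agree only on the open set \<open>V\<close>, whereas curvature
  differentiates them as functions; the equality has to be carried through both derivatives.\<close>

lemma riemann_cong:
  assumes "open V" "x \<in> V" "\<And>y. y \<in> V \<Longrightarrow> G y = G' y" "smooth_on V G"
    and "\<And>l i j. smooth_on V (christoffel G l i j)"
  shows "riemann G l k i j x = riemann G' l k i j x"
proof -
  have "pd i (christoffel G l j k) x = pd i (christoffel G' l j k) x" for i l j k
    by (rule pd_cong[OF assms(1,2)])
      (use christoffel_cong[OF assms(1) _ assms(3,4)] smooth_on_differentiable[OF assms(5) assms(2)] in auto)
  then show ?thesis using christoffel_cong[OF assms(1-4)] by (simp add: riemann_def)
qed

text \<open>\<open>\<psi> u\<close> and the n vectors \<open>pd i \<psi> u\<close> already span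
  R^{n,1}, so a vector orthogonal to the tangent vectors is a multiple of \<open>\<psi> u\<close>;
  its product with \<open>\<psi> u\<close> gives the factor.\<close>

lemma hyp_chart_second_normal:
  fixes \<psi> :: "real ^ 'n::finite \<Rightarrow> real ^ 'n option"
  assumes "hyp_immersion V \<psi>" "u \<in> V"
  shows "hyp_immersion.second_normal \<psi> i j u = first_ff \<psi> u $ i $ j *\<^sub>R \<psi> u"
proof -
  interpret hyp_immersion V \<psi> by fact
  note u = assms(2)
  define f where "f r = (case r of None \<Rightarrow> \<psi> u | Some i \<Rightarrow> pd i \<psi> u)" for r
  have fs: "f None = \<psi> u" "f (Some i) = pd i \<psi> u" for i by (simp_all add: f_def)
  have gram: "c r = 0" if c: "\<And>s. (\<Sum>r\<in>UNIV. c r * (f r \<bullet>\<^sub>1 f s)) = 0" for c r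
  proof -
    have "c None = 0"
      using c[of None] by (simp add: sum_UNIV_option fs norm_Y[OF u] tangent_orthogonal[OF u])
    moreover have "c (Some i) = 0" for i
    proof -
      have "first_ff \<psi> u *v (\<chi> i. c (Some i)) = 0"
        using c[of "Some j" for j] by (simp add: vec_eq_iff matrix_vector_mult_def first_ff_nth sum_UNIV_option fs
            tangent_orthogonal'[OF u] mult.commute lorentz_commute)
      then have "(\<chi> i. c (Some i)) = 0" using first_ff_pos[OF u, of "\<chi> i. c (Some i)"] by force
      then show ?thesis by (simp add: vec_eq_iff)
    qed
    ultimately show ?thesis by (cases r) auto
  qed
  have "second_normal i j u - first_ff \<psi> u $ i $ j *\<^sub>R \<psi> u = 0"
  proof (rule lorentz_frame_complete[of f])
    show "c r = 0" if "\<And>s. (\<Sum>r\<in>UNIV. c r * (f r \<bullet>\<^sub>1 f s)) = 0" for c r using gram that by blast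
    fix s show "(second_normal i j u - first_ff \<psi> u $ i $ j *\<^sub>R \<psi> u) \<bullet>\<^sub>1 f s = 0"
      by (cases s) (simp_all add: fs lorentz_simps second_normal_orthogonal[OF u] second_normal_Y[OF u] norm_Y[OF u]
          tangent_orthogonal'[OF u])
  qed
  then show ?thesis by simp
qed

section \<open>Immersions with a parallel normal frame\<close>

locale framed_immersion = hyp_immersion V Y
  for V :: "(real ^ 'n::finite) set" and Y :: "real ^ 'n \<Rightarrow> real ^ ('m::finite + 'n) option" +
  fixes \<epsilon> :: "'m \<Rightarrow> real ^ 'n \<Rightarrow> real ^ ('m + 'n) option"
  assumes smooth_frame: "smooth_on V (\<epsilon> a)"
    and frame_orthonormal: "u \<in> V \<Longrightarrow> \<epsilon> a u \<bullet>\<^sub>1 \<epsilon> c u = (if a = c then 1 else 0)"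
    and frame_normal: "u \<in> V \<Longrightarrow> \<epsilon> a u \<in> normal_space Y u"
    and frame_parallel: "u \<in> V \<Longrightarrow> normal_deriv Y i (\<epsilon> a) u = 0"
begin

abbreviation "H k u \<equiv> second_ff Y (\<epsilon> k) u"

lemma frame_Y: "u \<in> V \<Longrightarrow> \<epsilon> a u \<bullet>\<^sub>1 Y u = 0" and frame_tangent: "u \<in> V \<Longrightarrow> \<epsilon> a u \<bullet>\<^sub>1 pd i Y u = 0"
  using frame_normal[of u a] by (simp_all add: normal_space_def)

lemma frame_Y': "u \<in> V \<Longrightarrow> Y u \<bullet>\<^sub>1 \<epsilon> a u = 0" and frame_tangent': "u \<in> V \<Longrightarrow> pd i Y u \<bullet>\<^sub>1 \<epsilon> a u = 0"
  using frame_Y[of u a] frame_tangent[of u a i] by (simp_all add: lorentz_commute)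

lemma diff_frame: "u \<in> V \<Longrightarrow> \<epsilon> a differentiable (at u)"
  by (rule smooth_on_differentiable[OF smooth_frame])

lemma H_nth: "H k u $ i $ j = pd i (\<epsilon> k) u \<bullet>\<^sub>1 pd j Y u"
  by (simp add: second_ff_def)

lemma H_eq: "u \<in> V \<Longrightarrow> H k u $ i $ j = - (\<epsilon> k u \<bullet>\<^sub>1 pd i (pd j Y) u)"
  unfolding H_nth using orthogonal_derivative[of u "\<epsilon> k" "pd j Y" 0 i] diff_frame diff_pd frame_tangent by simp

lemma H_sym: "u \<in> V \<Longrightarrow> H k u $ i $ j = H k u $ j $ i"
  by (simp add: H_eq pd_pd_sym)

lemma smooth_H: "smooth_on V (H k)"
  unfolding second_ff_def[abs_def] by (intro smooth_intros open_domain smooth smooth_frame)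

lemma weingarten:
  "u \<in> V \<Longrightarrow> pd i (\<epsilon> k) u = (\<Sum>p\<in>UNIV. (matrix_inv (first_ff Y u) *v (\<chi> q. H k u $ i $ q)) $ p *\<^sub>R pd p Y u)"
  unfolding H_nth by (rule parallel_derivative_tangent) (auto intro: diff_frame frame_Y frame_tangent frame_parallel)

lemma frame_pd_frame: "u \<in> V \<Longrightarrow> \<epsilon> a u \<bullet>\<^sub>1 pd i (\<epsilon> k) u = 0"
  by (simp add: weingarten lorentz_simps frame_tangent)

text \<open>The derivatives of a parallel frame are tangential, so differentiating the product of
  \<open>\<epsilon> k\<close> and \<open>pd j (\<epsilon> l)\<close>, which is zero, expresses the
  left-hand side through \<open>pd i (pd j (\<epsilon> l))\<close>, and that is symmetric in
  \<open>i\<close> and \<open>j\<close>.\<close>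

lemma ricci_equation:
  assumes u: "u \<in> V"
  shows "pd i (\<epsilon> k) u \<bullet>\<^sub>1 pd j (\<epsilon> l) u = pd j (\<epsilon> k) u \<bullet>\<^sub>1 pd i (\<epsilon> l) u"
proof -
  have "pd i (\<epsilon> k) u \<bullet>\<^sub>1 pd j (\<epsilon> l) u = - (\<epsilon> k u \<bullet>\<^sub>1 pd i (pd j (\<epsilon> l)) u)" for i j
    using orthogonal_derivative[OF u diff_frame[OF u], of "pd j (\<epsilon> l)" k 0 i] frame_pd_frame
      smooth_on_differentiable[OF smooth_on_pd[OF smooth_frame] u] by simp
  then show ?thesis by (simp add: pd_commute[OF open_domain smooth_frame u])
qed

lemma frame_complete:
  assumes u: "u \<in> V" and x: "x \<bullet>\<^sub>1 Y u = 0" "\<And>i. x \<bullet>\<^sub>1 pd i Y u = 0" "\<And>a. x \<bullet>\<^sub>1 \<epsilon> a u = 0"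
  shows "x = 0"
proof -
  define f where "f r = (case r of None \<Rightarrow> Y u | Some (Inl a) \<Rightarrow> \<epsilon> a u | Some (Inr i) \<Rightarrow> pd i Y u)" for r
  have fs: "f None = Y u" "f (Some (Inl a)) = \<epsilon> a u" "f (Some (Inr i)) = pd i Y u" for i a by (simp_all add: f_def)
  have gram: "c r = 0" if c: "\<And>s. (\<Sum>r\<in>UNIV. c r * (f r \<bullet>\<^sub>1 f s)) = 0" for c r
  proof -
    have "c None = 0"
      using c[of None] by (simp add: sum_UNIV_option sum_UNIV_sum fs norm_Y[OF u] tangent_orthogonal[OF u] frame_Y[OF u])
    moreover have "c (Some (Inl a)) = 0" for a
      using c[of "Some (Inl a)"]
      by (simp add: sum_UNIV_option sum_UNIV_sum fs frame_Y'[OF u] frame_tangent'[OF u] frame_orthonormal[OF u]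
          if_distrib sum.delta cong: if_cong)
    moreover have "c (Some (Inr i)) = 0" for i
    proof -
      have "first_ff Y u *v (\<chi> i. c (Some (Inr i))) = 0"
        using c[of "Some (Inr j)" for j] by (simp add: vec_eq_iff matrix_vector_mult_def first_ff_nth sum_UNIV_option sum_UNIV_sum fs
            tangent_orthogonal'[OF u] frame_tangent[OF u] mult.commute lorentz_commute)
      then have "(\<chi> i. c (Some (Inr i))) = 0" using first_ff_pos[OF u, of "\<chi> i. c (Some (Inr i))"] by force
      then show ?thesis by (simp add: vec_eq_iff)
    qed
    ultimately show ?thesis by (cases r; cases "the r") auto
  qed
  show ?thesis
  proof (rule lorentz_frame_complete[of f])
    show "c r = 0" if "\<And>s. (\<Sum>r\<in>UNIV. c r * (f r \<bullet>\<^sub>1 f s)) = 0" for c r using gram that by blast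
    fix s show "x \<bullet>\<^sub>1 f s = 0" by (cases s; cases "the s") (simp_all add: fs x)
  qed
qed

lemma second_normal_eq:
  assumes u: "u \<in> V"
  shows "second_normal i j u = first_ff Y u $ i $ j *\<^sub>R Y u - (\<Sum>k\<in>UNIV. H k u $ i $ j *\<^sub>R \<epsilon> k u)"
proof -
  have "second_normal i j u - (first_ff Y u $ i $ j *\<^sub>R Y u - (\<Sum>k\<in>UNIV. H k u $ i $ j *\<^sub>R \<epsilon> k u)) = 0"
  proof (rule frame_complete[OF u])
    have "second_normal i j u \<bullet>\<^sub>1 \<epsilon> a u = - H a u $ i $ j" for a
      by (simp add: second_normal_def lorentz_simps frame_tangent'[OF u] frame_tangent[OF u] H_eq[OF u] lorentz_commute)
    then show "(second_normal i j u - (first_ff Y u $ i $ j *\<^sub>R Y u - (\<Sum>k\<in>UNIV. H k u $ i $ j *\<^sub>R \<epsilon> k u))) \<bullet>\<^sub>1 \<epsilon> a u = 0" for a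
      by (simp add: lorentz_simps frame_Y'[OF u] frame_orthonormal[OF u] if_distrib sum.delta cong: if_cong)
  qed (simp_all add: lorentz_simps second_normal_orthogonal[OF u] second_normal_Y[OF u] norm_Y[OF u]
      tangent_orthogonal'[OF u] frame_Y[OF u] frame_tangent[OF u])
  then show ?thesis by simp
qed

text \<open>\<open>Y\<close> and the chart \<open>\<psi>\<close> induce the same metric, hence the
  same curvature tensor. Equating the two Gauss equations removes the curvature and the products of
  metric coefficients, and leaves the products of the second fundamental forms.\<close>

lemma gauss_isometric:
  assumes \<psi>: "hyp_immersion V (\<psi> :: real ^ 'n \<Rightarrow> real ^ 'n option)"
    and iso: "\<And>u. u \<in> V \<Longrightarrow> first_ff Y u = first_ff \<psi> u" and u: "u \<in> V"
  shows "(\<Sum>a\<in>UNIV. H a u $ j $ k * H a u $ i $ q) = (\<Sum>a\<in>UNIV. H a u $ i $ k * H a u $ j $ q)"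
proof -
  interpret C: hyp_immersion V \<psi> by fact
  have R: "riemann (first_ff Y) l k i j u = riemann (first_ff \<psi>) l k i j u" for l k i j
    by (rule riemann_cong[OF open_domain u iso smooth_first_ff smooth_christoffel])
  have NN: "second_normal i j u \<bullet>\<^sub>1 second_normal k l u =
      (\<Sum>a\<in>UNIV. H a u $ i $ j * H a u $ k $ l) - first_ff Y u $ i $ j * first_ff Y u $ k $ l" for i j k l
    unfolding second_normal_eq[OF u]
    by (simp add: lorentz_diff_left lorentz_diff_right lorentz_scaleR_left lorentz_scaleR_right lorentz_sum_left norm_Y[OF u])
      (simp add: lorentz_sum_right lorentz_scaleR_left lorentz_scaleR_right frame_orthonormal[OF u] frame_Y[OF u] frame_Y'[OF u]
        if_distrib sum.delta cong: if_cong)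
  have CC: "C.second_normal i j u \<bullet>\<^sub>1 C.second_normal k l u = - (first_ff Y u $ i $ j * first_ff Y u $ k $ l)" for i j k l
    by (simp add: hyp_chart_second_normal[OF \<psi> u] iso[OF u] lorentz_simps C.norm_Y[OF u])
  have "second_normal j k u \<bullet>\<^sub>1 second_normal i q u - second_normal i k u \<bullet>\<^sub>1 second_normal j q u =
      C.second_normal j k u \<bullet>\<^sub>1 C.second_normal i q u - C.second_normal i k u \<bullet>\<^sub>1 C.second_normal j q u"
    unfolding gauss_equation[OF u, symmetric] C.gauss_equation[OF u, symmetric] R by (simp add: iso[OF u])
  then show ?thesis unfolding NN CC by simp
qed

end

section \<open>Structure equations of an adapted frame\<close>

locale adapted_immersion = framed_immersion V Y \<epsilon>
  for V :: "(real ^ 'n::finite) set" and Y :: "real ^ 'n \<Rightarrow> real ^ ('m::finite + 'n) option" and \<epsilon> +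
  fixes A :: "real ^ 'n \<Rightarrow> real ^ 'n ^ 'm" and b :: "real ^ 'n \<Rightarrow> real ^ 'n"
  assumes smooth_A: "smooth_on V A" and smooth_b: "smooth_on V b"
    and orthonormal_A: "u \<in> V \<Longrightarrow> transpose (A u) ** A u = mat 1"
    and first_ff_diag: "u \<in> V \<Longrightarrow> first_ff Y u $ i $ j = (if i = j then (b u $ i)\<^sup>2 else 0)"
    and second_ff_diag: "u \<in> V \<Longrightarrow> second_ff Y (\<epsilon> k) u $ i $ j = (if i = j then A u $ k $ i * b u $ i else 0)"
begin

lemma b_nonzero: "u \<in> V \<Longrightarrow> b u $ i \<noteq> 0"
proof -
  assume u: "u \<in> V"
  have "axis i 1 \<bullet> (first_ff Y u *v axis i 1) = first_ff Y u $ i $ i"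
    by (simp add: matrix_vector_mult_axis inner_axis' column_def)
  then show "b u $ i \<noteq> 0" using first_ff_pos[OF u, of "axis i 1"] first_ff_diag[OF u, of i i] by (auto simp: axis_eq_0_iff)
qed

definition fr :: "('m + 'n) option \<Rightarrow> real ^ 'n \<Rightarrow> real ^ ('m + 'n) option" where
  "fr r u = (case r of None \<Rightarrow> Y u | Some (Inl k) \<Rightarrow> \<epsilon> k u | Some (Inr i) \<Rightarrow> (1 / b u $ i) *\<^sub>R pd i Y u)"

lemma fr_simps: "fr None u = Y u" "fr (Some (Inl k)) u = \<epsilon> k u" "fr (Some (Inr i)) u = (1 / b u $ i) *\<^sub>R pd i Y u"
  by (simp_all add: fr_def)

lemma pd_Y_eq: "u \<in> V \<Longrightarrow> pd i Y u = b u $ i *\<^sub>R fr (Some (Inr i)) u"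
  using b_nonzero[of u i] by (simp add: fr_simps)

lemma smooth_fr: "smooth_on V (fr r)"
proof -
  have "smooth_on V (fr None)" "smooth_on V (fr (Some (Inl k)))" "smooth_on V (fr (Some (Inr i)))" for k i
    unfolding fr_def[abs_def] using smooth_frame[of k] smooth b_nonzero
    by (auto intro!: smooth_intros open_domain smooth_b)
  then show ?thesis by (cases r; cases "the r") auto
qed

lemma diff_fr: "u \<in> V \<Longrightarrow> fr r differentiable (at u)"
  by (rule smooth_on_differentiable[OF smooth_fr])

lemma diff_b: "u \<in> V \<Longrightarrow> (\<lambda>x. b x $ i) differentiable (at u)"
  by (rule smooth_on_differentiable[OF smooth_on_vec_nth[OF open_domain smooth_b]])

lemma fr_orthonormal: "u \<in> V \<Longrightarrow> fr r u \<bullet>\<^sub>1 fr s u = (if r = s then lsign r else 0)"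
  using b_nonzero[of u]
  by (cases r; cases s; cases "the r"; cases "the s")
    (auto simp: fr_simps lorentz_simps norm_Y frame_Y frame_Y' frame_tangent frame_tangent' tangent_orthogonal
      tangent_orthogonal' frame_orthonormal first_ff_nth[symmetric] first_ff_diag power2_eq_square)

lemma fr_skew: "u \<in> V \<Longrightarrow> pd i (fr s) u \<bullet>\<^sub>1 fr r u = - (pd i (fr r) u \<bullet>\<^sub>1 fr s u)"
  using orthogonal_derivative[of u "fr s" "fr r" "if r = s then lsign r else 0" i] diff_fr fr_orthonormal[of _ s r]
  by (auto simp: lorentz_commute)

lemma pd_frame_inner: "u \<in> V \<Longrightarrow> pd i (\<epsilon> k) u \<bullet>\<^sub>1 fr (Some (Inr j)) u = (if i = j then A u $ k $ i else 0)"
  using b_nonzero[of u j] by (simp add: fr_simps lorentz_simps H_nth[symmetric] second_ff_diag)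

text \<open>Equality of the mixed second derivatives of \<open>Y\<close>, with each first derivative
  written as b_i e_i.\<close>

lemma levi_civita_relation:
  assumes u: "u \<in> V"
  shows "b u $ j * (pd i (fr (Some (Inr j))) u \<bullet>\<^sub>1 fr (Some (Inr l)) u) + (if j = l then pd i (\<lambda>x. b x $ j) u else 0) =
    b u $ i * (pd j (fr (Some (Inr i))) u \<bullet>\<^sub>1 fr (Some (Inr l)) u) + (if i = l then pd j (\<lambda>x. b x $ i) u else 0)"
proof -
  have "pd i (pd j Y) u = b u $ j *\<^sub>R pd i (fr (Some (Inr j))) u + pd i (\<lambda>x. b x $ j) u *\<^sub>R fr (Some (Inr j)) u" for i j
  proof -
    have "pd i (pd j Y) u = pd i (\<lambda>x. b x $ j *\<^sub>R fr (Some (Inr j)) x) u"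
      by (rule pd_cong[OF open_domain u pd_Y_eq diff_pd[OF u]])
    then show ?thesis by (simp add: pd_scaleR[OF diff_b[OF u] diff_fr[OF u]])
  qed
  then have "(b u $ j *\<^sub>R pd i (fr (Some (Inr j))) u + pd i (\<lambda>x. b x $ j) u *\<^sub>R fr (Some (Inr j)) u) \<bullet>\<^sub>1 fr (Some (Inr l)) u =
    (b u $ i *\<^sub>R pd j (fr (Some (Inr i))) u + pd j (\<lambda>x. b x $ i) u *\<^sub>R fr (Some (Inr i)) u) \<bullet>\<^sub>1 fr (Some (Inr l)) u"
    using pd_pd_sym[OF u, of i j] by simp
  then show ?thesis by (simp add: lorentz_simps fr_orthonormal[OF u] split: if_splits)
qed

text \<open>The functions f_ij are the connection coefficients of the orthonormal frame e_i: the
  absence of torsion and skewness determine them.\<close>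

lemma levi_civita:
  assumes u: "u \<in> V"
  shows "pd i (fr (Some (Inr j))) u \<bullet>\<^sub>1 fr (Some (Inr l)) u =
    (if l = i then F_of b u $ i $ j else 0) - (if j = i then F_of b u $ i $ l else 0)"
proof -
  define \<Gamma> where "\<Gamma> i l j = pd i (fr (Some (Inr j))) u \<bullet>\<^sub>1 fr (Some (Inr l)) u" for i l j
  have sk: "\<Gamma> i l j = - \<Gamma> i j l" for i j l unfolding \<Gamma>_def by (rule fr_skew[OF u])
  have d0: "\<Gamma> i l l = 0" for i l using sk[of i l l] by simp
  have rel: "b u $ j * \<Gamma> i l j + (if j = l then pd i (\<lambda>x. b x $ j) u else 0) =
    b u $ i * \<Gamma> j l i + (if i = l then pd j (\<lambda>x. b x $ i) u else 0)" for i j l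
    unfolding \<Gamma>_def by (rule levi_civita_relation[OF u])
  have F: "\<Gamma> i i j = F_of b u $ i $ j" for i j
  proof (cases "i = j")
    case False
    then show ?thesis using rel[of j i i] d0[of j i] b_nonzero[OF u, of j] by (simp add: F_of_def field_simps)
  qed (simp add: d0 F_of_def)
  have distinct: "\<Gamma> i l j = 0" if "i \<noteq> l" "j \<noteq> l" "i \<noteq> j"
  proof -
    \<comment> \<open>After this rescaling the coefficients are symmetric in the first two slots and
      skew in the last two, which forces them to vanish for distinct indices, as in the uniqueness
      of the Levi-Civita connection.\<close>
    define Q where "Q i j l = b u $ j * b u $ l * \<Gamma> i l j" for i j l
    have s: "Q i j l = Q j i l" if "i \<noteq> l" "j \<noteq> l" for i j l using rel[of j i l] that by (simp add: Q_def)
    have a: "Q i j l = - Q i l j" for i j l unfolding Q_def by (subst sk) simp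
    have "Q i j l = - Q i j l"
      using s[of i l j] s[of j l i] s[of l i j] a[of i j l] a[of j i l] a[of l i j] a[of l j i] that by (metis a s)
    then have "Q i j l = 0" by simp
    then show ?thesis using b_nonzero[OF u] by (simp add: Q_def)
  qed
  have "\<Gamma> i l j = (if l = i then F_of b u $ i $ j else 0) - (if j = i then F_of b u $ i $ l else 0)"
  proof (cases "l = i")
    case True
    then show ?thesis using F[of i j] d0 by (simp add: F_of_def)
  next
    case False
    show ?thesis
    proof (cases "j = i")
      case True
      then show ?thesis using False F[of i l] sk[of i l i] by simp
    next
      case False
      then show ?thesis using \<open>l \<noteq> i\<close> distinct d0 by (cases "j = l") auto
    qed
  qed
  then show ?thesis by (simp add: \<Gamma>_def)
qed

text \<open>In a Lorentz-orthonormal frame each coefficient is a signed product of the derivative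
  with a frame vector. Skewness reduces the list to the derivatives of \<open>Y\<close>, of the
  parallel normals and the Levi-Civita coefficients.\<close>

lemma pd_fr:
  assumes u: "u \<in> V"
  shows "pd i (fr s) u = (\<Sum>r\<in>UNIV. star_coeff (A u) (F_of b u) (b u) i $ r $ s *\<^sub>R fr r u)"
proof -
  have Ypart: "pd i (fr None) u \<bullet>\<^sub>1 fr r u = (if r = Some (Inr i) then b u $ i else 0)" for r i
    using pd_Y_eq[OF u, of i] by (simp add: fr_simps(1)[abs_def] lorentz_simps fr_orthonormal[OF u] eq_commute)
  have fn: "fr (Some (Inl k)) = \<epsilon> k" "fr None = Y" for k by (simp_all add: fun_eq_iff fr_simps)
  have lp: "pd i (fr (Some (Inl k))) u \<bullet>\<^sub>1 fr (Some (Inl l)) u = 0" for k l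
    using frame_pd_frame[OF u, of l i k] by (simp add: fn lorentz_commute)
  have np: "pd i (fr (Some (Inl k))) u \<bullet>\<^sub>1 fr None u = 0" for k
    using fr_skew[OF u, of i "Some (Inl k)" None] Ypart[of i "Some (Inl k)"] by simp
  have lr: "pd i (fr (Some (Inl k))) u \<bullet>\<^sub>1 fr (Some (Inr j)) u = (if i = j then A u $ k $ i else 0)" for k j
    using pd_frame_inner[OF u, of i k j] by (simp add: fn)
  have rl: "pd i (fr (Some (Inr j))) u \<bullet>\<^sub>1 fr (Some (Inl k)) u = - (if i = j then A u $ k $ i else 0)" for k j
    using fr_skew[OF u, of i "Some (Inr j)" "Some (Inl k)"] lr by simp
  have rn: "pd i (fr (Some (Inr j))) u \<bullet>\<^sub>1 fr None u = - (if j = i then b u $ i else 0)" for j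
    using fr_skew[OF u, of i "Some (Inr j)" None] Ypart[of i "Some (Inr j)"] by simp
  have "lsign r * (pd i (fr s) u \<bullet>\<^sub>1 fr r u) = star_coeff (A u) (F_of b u) (b u) i $ r $ s" for r
  proof -
    consider "r = None \<and> s = None" | k where "r = None" "s = Some (Inl k)" | q where "r = None" "s = Some (Inr q)"
      | k where "r = Some (Inl k)" "s = None" | k l where "r = Some (Inl k)" "s = Some (Inl l)"
      | k q where "r = Some (Inl k)" "s = Some (Inr q)" | p where "r = Some (Inr p)" "s = None"
      | p k where "r = Some (Inr p)" "s = Some (Inl k)" | p q where "r = Some (Inr p)" "s = Some (Inr q)"
      by (metis option.exhaust sum.exhaust)
    then show ?thesis
      by cases (simp_all add: star_coeff_nth Ypart lp np lr rl rn levi_civita[OF u])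
  qed
  then show ?thesis using lorentz_orthonormal_expand[of "\<lambda>r. fr r u" "pd i (fr s) u"] fr_orthonormal[OF u] by simp
qed

lemma column_frame_matrix: "column s (frame_matrix \<epsilon> Y b u) = fr s u"
  by (auto simp: column_def frame_matrix_def fr_def vec_eq_iff split: option.split sum.split)

lemma frame_matrix_Lorentz: "u \<in> V \<Longrightarrow> frame_matrix \<epsilon> Y b u \<in> Lorentz_group"
  by (simp add: Lorentz_group_iff column_frame_matrix fr_orthonormal)

lemma smooth_frame_matrix: "smooth_on V (frame_matrix \<epsilon> Y b)"
proof -
  have "frame_matrix \<epsilon> Y b = (\<lambda>u. \<chi> r c. fr c u $ r)"
    by (auto simp: frame_matrix_def fr_def vec_eq_iff fun_eq_iff split: option.split sum.split)
  then show ?thesis by (simp only:) (intro smooth_intros open_domain smooth_fr)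
qed

lemma pd_frame_matrix:
  assumes u: "u \<in> V"
  shows "pd i (frame_matrix \<epsilon> Y b) u = frame_matrix \<epsilon> Y b u ** star_coeff (A u) (F_of b u) (b u) i"
proof -
  have "column s (pd i (frame_matrix \<epsilon> Y b) u) = column s (frame_matrix \<epsilon> Y b u ** star_coeff (A u) (F_of b u) (b u) i)" for s
    using pd_fr[OF u, of i s]
      pd_bounded_linear[OF bounded_linear_column smooth_on_differentiable[OF smooth_frame_matrix u], of i s]
    by (simp add: column_frame_matrix column_matrix_mult)
  then show ?thesis by (simp add: column_def vec_eq_iff)
qed

theorem frame_solves_star: "solves_star V A (F_of b) b (frame_matrix \<epsilon> Y b)"
  unfolding solves_star_def
proof (intro conjI ballI allI smooth_frame_matrix frame_matrix_Lorentz)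
  fix u v assume u: "u \<in> V"
  let ?g = "frame_matrix \<epsilon> Y b u" and ?\<Theta> = "star_coeff (A u) (F_of b u) (b u)"
  note bb = bounded_bilinear_matrix_mul
  have "frechet_derivative (frame_matrix \<epsilon> Y b) (at u) v = ?g ** (\<Sum>i\<in>UNIV. v $ i *\<^sub>R ?\<Theta> i)"
    unfolding frechet_eq_sum_pd[OF smooth_on_differentiable[OF smooth_frame_matrix u]] pd_frame_matrix[OF u]
    by (simp add: bounded_bilinear.sum_right[OF bb] bounded_bilinear.scaleR_right[OF bb])
  then show "matrix_inv ?g ** frechet_derivative (frame_matrix \<epsilon> Y b) (at u) v = (\<Sum>i\<in>UNIV. v $ i *\<^sub>R ?\<Theta> i)"
    using matrix_inv_inverse(2)[OF Lorentz_group_invertible[OF frame_matrix_Lorentz[OF u]]]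
    by (simp add: matrix_mul_assoc)
qed

lemma G1_maps_adapted: "G1_maps V A (F_of b) b"
  unfolding G1_maps_def
proof (intro conjI smooth_A smooth_b ballI allI orthonormal_A)
  show "smooth_on V (F_of b)"
    unfolding F_of_def[abs_def] using b_nonzero by (intro smooth_intros open_domain smooth_b)
qed (auto simp: F_of_def)

text \<open>Flatness is necessary for a frame that already exists: its mixed derivatives commute,
  and the frame matrix can be cancelled because it is invertible.\<close>

theorem adapted_G1_system: "G1_system_I V A (F_of b) b"
  unfolding G1_system_flat_iff[OF open_domain G1_maps_adapted]
proof (intro ballI allI)
  fix u i j assume u: "u \<in> V"
  let ?g = "frame_matrix \<epsilon> Y b" and ?\<Theta> = "\<lambda>i u. star_coeff (A u) (F_of b u) (b u) i"
  have sT: "smooth_on V (?\<Theta> i)" for i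
    using G1_maps_adapted unfolding G1_maps_def by (intro smooth_intros open_domain) auto
  have "pd i (pd j ?g) u = ?g u ** (pd i (?\<Theta> j) u + ?\<Theta> i u ** ?\<Theta> j u)" for i j
  proof -
    have "pd i (pd j ?g) u = pd i (\<lambda>x. ?g x ** ?\<Theta> j x) u"
      by (rule pd_cong[OF open_domain u pd_frame_matrix smooth_on_differentiable[OF smooth_on_pd[OF smooth_frame_matrix] u]])
    also have "\<dots> = ?g u ** pd i (?\<Theta> j) u + pd i ?g u ** ?\<Theta> j u"
      by (rule pd_bilinear[OF bounded_bilinear_matrix_mul smooth_on_differentiable[OF smooth_frame_matrix u] smooth_on_differentiable[OF sT u]])
    finally show ?thesis
      by (simp add: pd_frame_matrix[OF u] matrix_mul_assoc bounded_bilinear.add_right[OF bounded_bilinear_matrix_mul])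
  qed
  then have "?g u ** (pd i (?\<Theta> j) u + ?\<Theta> i u ** ?\<Theta> j u) = ?g u ** (pd j (?\<Theta> i) u + ?\<Theta> j u ** ?\<Theta> i u)"
    using pd_commute[OF open_domain smooth_frame_matrix u, of i j] by simp
  then have "matrix_inv (?g u) ** (?g u ** (pd i (?\<Theta> j) u + ?\<Theta> i u ** ?\<Theta> j u)) =
      matrix_inv (?g u) ** (?g u ** (pd j (?\<Theta> i) u + ?\<Theta> j u ** ?\<Theta> i u))" by simp
  then show "pd i (?\<Theta> j) u + ?\<Theta> i u ** ?\<Theta> j u = pd j (?\<Theta> i) u + ?\<Theta> j u ** ?\<Theta> i u"
    unfolding matrix_mul_assoc[of "matrix_inv (?g u)"]
      matrix_inv_inverse(2)[OF Lorentz_group_invertible[OF frame_matrix_Lorentz[OF u]]] by simp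
qed

end

lemma lax_coeff_one:
  fixes A :: "real ^ 'n::finite ^ 'm::finite"
  shows "cpx_mat (star_coeff A F b i) = lax_coeff A F b 1 i"
proof -
  have "cpx_mat (star_coeff A F b i) $ r $ s = lax_coeff A F b 1 i $ r $ s" for r s
  proof -
    consider "r = None \<and> s = None" | k where "r = None" "s = Some (Inl k)" | q where "r = None" "s = Some (Inr q)"
      | k where "r = Some (Inl k)" "s = None" | k l where "r = Some (Inl k)" "s = Some (Inl l)"
      | k q where "r = Some (Inl k)" "s = Some (Inr q)" | p where "r = Some (Inr p)" "s = None"
      | p k where "r = Some (Inr p)" "s = Some (Inl k)" | p q where "r = Some (Inr p)" "s = Some (Inr q)"
      by (metis option.exhaust sum.exhaust)
    then show ?thesis
      by cases (simp_all add: cpx_mat_def star_coeff_nth lax_coeff_def block3_def Cmat_mult transpose_def cpx_vec_def)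
  qed
  then show ?thesis by (simp add: vec_eq_iff)
qed

subsection \<open>Line of curvature coordinates\<close>

lemma symmetric_eigenvector:
  fixes B :: "'a::euclidean_space \<Rightarrow> 'a \<Rightarrow> real"
  assumes B: "bounded_bilinear B" and Bsym: "\<And>x y. B x y = B y x" and Bpos: "\<And>x. x \<noteq> 0 \<Longrightarrow> B x x > 0"
    and T: "linear T" and adj: "\<And>x y. B (T x) y = B x (T y)"
    and S: "subspace S" "S \<noteq> {0}" "T ` S \<subseteq> S"
  shows "\<exists>x\<in>S. x \<noteq> 0 \<and> (\<exists>l. T x = l *\<^sub>R x)"
proof -
  note Bs = bounded_bilinear.add_left[OF B] bounded_bilinear.add_right[OF B] bounded_bilinear.diff_left[OF B]
    bounded_bilinear.diff_right[OF B] bounded_bilinear.scaleR_left[OF B] bounded_bilinear.scaleR_right[OF B]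
    bounded_bilinear.zero_left[OF B] bounded_bilinear.zero_right[OF B]
  define K where "K = S \<inter> sphere 0 1"
  obtain z where z: "z \<in> S" "z \<noteq> 0" using S subspace_0 by blast
  then have "(1 / norm z) *\<^sub>R z \<in> K" by (auto simp: K_def subspace_scale[OF S(1)])
  then have Kne: "K \<noteq> {}" by blast
  have Kc: "compact K" unfolding K_def using closed_subspace[OF S(1)] by (intro closed_Int_compact compact_sphere)
  have bT: "bounded_linear T" using T by (simp add: linear_conv_bounded_linear)
  have "continuous_on K (\<lambda>x. B x (T x) / B x x)"
  proof (intro continuous_on_divide ballI bounded_bilinear.continuous_on[OF B] continuous_on_id linear_continuous_on bT)
    fix x assume "x \<in> K"
    then have "x \<noteq> 0" by (auto simp: K_def)
    then show "B x x \<noteq> 0" using Bpos[of x] by simp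
  qed
  \<comment> \<open>A maximum point of the Rayleigh quotient. Homogeneity of degree 0 allows the
    compact Euclidean sphere to be used although \<open>B\<close> is another inner product.\<close>
  then obtain x where x: "x \<in> K" and mx: "\<And>y. y \<in> K \<Longrightarrow> B y (T y) / B y y \<le> B x (T x) / B x x"
    using continuous_attains_sup[OF Kc Kne] by blast
  have xS: "x \<in> S" "x \<noteq> 0" using x by (auto simp: K_def)
  define l where "l = B x (T x) / B x x"
  define f where "f y = l * B y y - B y (T y)" for y
  have f0: "f x = 0" using Bpos[OF xS(2)] by (simp add: f_def l_def)
  have fp: "f y \<ge> 0" if "y \<in> S" for y
  proof (cases "y = 0")
    case False
    let ?y = "(1 / norm y) *\<^sub>R y"
    have "?y \<in> K" using that False by (auto simp: K_def subspace_scale[OF S(1)])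
    from mx[OF this] have "B ?y (T ?y) / B ?y ?y \<le> l" by (simp add: l_def)
    moreover have "B ?y (T ?y) / B ?y ?y = B y (T y) / B y y"
      using False by (simp add: linear_cmul[OF T] Bs)
    ultimately show ?thesis using Bpos[OF False] by (simp add: f_def divide_le_eq)
  qed (simp add: f_def Bs)
  \<comment> \<open>Moving the maximum point along the residual \<open>d\<close> changes the
    non-negative function \<open>f\<close> by 2 t B(d, d) to first order, in both directions, so
    \<open>d\<close> must vanish.\<close>
  define d where "d = l *\<^sub>R x - T x"
  have dS: "d \<in> S" unfolding d_def using xS S by (intro subspace_diff subspace_scale) auto
  have "f (x + t *\<^sub>R d) = 2 * t * B d d + t * t * f d" for t
  proof -
    have "f (x + t *\<^sub>R d) = f x + 2 * t * (l * B x d - B (T x) d) + t * t * f d"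
      using Bsym[of d x] adj[of d x] Bsym[of d "T x"]
      by (simp add: f_def Bs linear_add[OF T] linear_cmul[OF T] adj[symmetric] algebra_simps)
    also have "l * B x d - B (T x) d = B d d" by (subst (3) d_def) (simp add: Bs)
    finally show ?thesis by (simp add: f0)
  qed
  then have q: "0 \<le> 2 * t * B d d + t * t * f d" for t
    using fp[of "x + t *\<^sub>R d"] subspace_add[OF S(1) xS(1) subspace_scale[OF S(1) dS]] by simp
  have "d = 0"
  proof (rule ccontr)
    assume "d \<noteq> 0"
    then have p: "B d d > 0" by (rule Bpos)
    have fd: "f d \<ge> 0" by (rule fp[OF dS])
    \<comment> \<open>A negative step, with 1 added to keep the denominator positive, for which t
      f(d) \<ge> - B(d, d); the value of \<open>f\<close> after the step would then be
      negative.\<close>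
    define t where "t = - B d d / (f d + 1)"
    have t: "t < 0" using p fd by (simp add: t_def divide_less_0_iff)
    have "t * (2 * B d d + t * f d) \<ge> 0" using q[of t] by (simp add: algebra_simps)
    then have "2 * B d d + t * f d \<le> 0" using t by (simp add: zero_le_mult_iff)
    moreover have "t * f d \<ge> - B d d"
    proof -
      have "B d d * f d / (f d + 1) \<le> B d d" using fd p by (simp add: field_simps)
      then show ?thesis by (simp add: t_def)
    qed
    ultimately show False using p by linarith
  qed
  then have "T x = l *\<^sub>R x" by (simp add: d_def)
  then show ?thesis using xS by blast
qed

text \<open>In a non-zero common invariant subspace of least dimension, a non-zero eigenspace of any
  \<open>T k\<close> is again invariant because the operators commute. By minimality it is the whole
  subspace, so each \<open>T k\<close> acts there as a scalar.\<close>

lemma common_eigenvector: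
  fixes B :: "'a::euclidean_space \<Rightarrow> 'a \<Rightarrow> real" and T :: "'i \<Rightarrow> 'a \<Rightarrow> 'a"
  assumes B: "bounded_bilinear B" and Bsym: "\<And>x y. B x y = B y x" and Bpos: "\<And>x. x \<noteq> 0 \<Longrightarrow> B x x > 0"
    and T: "\<And>k. linear (T k)" and adj: "\<And>k x y. B (T k x) y = B x (T k y)"
    and comm: "\<And>k l x. T k (T l x) = T l (T k x)"
    and S: "subspace S" "S \<noteq> {0}" "\<And>k. T k ` S \<subseteq> S"
  shows "\<exists>x\<in>S. x \<noteq> 0 \<and> (\<forall>k. \<exists>l. T k x = l *\<^sub>R x)"
proof -
  define P where "P R \<longleftrightarrow> subspace R \<and> R \<noteq> {0} \<and> (\<forall>k. T k ` R \<subseteq> R) \<and> R \<subseteq> S" for R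
  have "P S" using S by (simp add: P_def)
  then obtain R where R: "P R" and min: "\<And>R'. P R' \<Longrightarrow> dim R \<le> dim R'"
    using arg_min_nat_lemma[of P S dim] by (metis)
  have sR: "subspace R" "R \<noteq> {0}" "\<And>k. T k ` R \<subseteq> R" "R \<subseteq> S" using R by (auto simp: P_def)
  have "\<exists>l. \<forall>x\<in>R. T k x = l *\<^sub>R x" for k
  proof -
    obtain z l where z: "z \<in> R" "z \<noteq> 0" "T k z = l *\<^sub>R z"
      using symmetric_eigenvector[OF B Bsym Bpos T adj sR(1,2,3)] by blast
    define R' where "R' = {x \<in> R. T k x = l *\<^sub>R x}"
    have sub: "subspace R'"
      unfolding subspace_def R'_def using sR(1) T[of k]
      by (auto simp: subspace_0 subspace_add subspace_scale linear_0 linear_add linear_cmul scaleR_add_right)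
    have inv: "T j ` R' \<subseteq> R'" for j
    proof clarify
      fix x assume x: "x \<in> R'"
      have "T k (T j x) = T j (T k x)" by (rule comm)
      then show "T j x \<in> R'" using x sR(3)[of j] T[of j] by (auto simp: R'_def linear_cmul)
    qed
    have "P R'" unfolding P_def using sub inv z sR(4) by (auto simp: R'_def)
    then have "dim R \<le> dim R'" by (rule min)
    then have "R' = R" using subspace_dim_equal[OF sub sR(1)] by (auto simp: R'_def)
    then show ?thesis by (auto simp: R'_def)
  qed
  moreover obtain x where "x \<in> R" "x \<noteq> 0" using sR subspace_0 by blast
  ultimately show ?thesis using sR(4) by blast
qed

text \<open>A common eigenvector is split off; self-adjointness makes its
  \<open>B\<close>-orthogonal complement in \<open>S\<close> invariant, and that complement has
  smaller dimension.\<close>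

lemma orthonormal_eigenbasis:
  fixes B :: "'a::euclidean_space \<Rightarrow> 'a \<Rightarrow> real" and T :: "'i \<Rightarrow> 'a \<Rightarrow> 'a"
  assumes B: "bounded_bilinear B" and Bsym: "\<And>x y. B x y = B y x" and Bpos: "\<And>x. x \<noteq> 0 \<Longrightarrow> B x x > 0"
    and T: "\<And>k. linear (T k)" and adj: "\<And>k x y. B (T k x) y = B x (T k y)"
    and comm: "\<And>k l x. T k (T l x) = T l (T k x)"
  shows "subspace S \<Longrightarrow> (\<And>k. T k ` S \<subseteq> S) \<Longrightarrow> \<exists>E. finite E \<and> independent E \<and> span E = S \<and>
    (\<forall>x\<in>E. \<forall>y\<in>E. B x y = (if x = y then 1 else 0)) \<and> (\<forall>x\<in>E. \<forall>k. \<exists>l. T k x = l *\<^sub>R x)"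
proof (induction "dim S" arbitrary: S rule: less_induct)
  case less
  note S = less.prems
  note Bs = bounded_bilinear.add_right[OF B] bounded_bilinear.diff_right[OF B] bounded_bilinear.scaleR_left[OF B]
    bounded_bilinear.scaleR_right[OF B] bounded_bilinear.zero_right[OF B]
  show ?case
  proof (cases "S = {0}")
    case True
    then show ?thesis by (intro exI[of _ "{}"]) (simp add: independent_empty)
  next
    case False
    obtain z where z: "z \<in> S" "z \<noteq> 0" "\<forall>k. \<exists>l. T k z = l *\<^sub>R z"
      using common_eigenvector[where T=T, OF B Bsym Bpos T adj comm S(1) False S(2)] by blast
    define x where "x = (1 / sqrt (B z z)) *\<^sub>R z"
    have p: "B z z > 0" by (rule Bpos[OF z(2)])
    have x: "x \<in> S" "B x x = 1" "\<exists>l. T k x = l *\<^sub>R x" for k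
    proof -
      show "x \<in> S" using z S(1) by (simp add: x_def subspace_scale)
      show "B x x = 1" using p by (simp add: x_def Bs)
      obtain l where "T k z = l *\<^sub>R z" using z(3) by blast
      then have "T k x = l *\<^sub>R x" using T[of k] by (simp add: x_def linear_cmul)
      then show "\<exists>l. T k x = l *\<^sub>R x" by blast
    qed
    define R where "R = {y \<in> S. B x y = 0}"
    have sR: "subspace R"
      unfolding subspace_def R_def using S(1) by (auto simp: subspace_0 subspace_add subspace_scale Bs)
    have iR: "T k ` R \<subseteq> R" for k
    proof clarify
      fix y assume y: "y \<in> R"
      obtain l where "T k x = l *\<^sub>R x" using x(3) by blast
      then have "B x (T k y) = 0" using adj[of k x y, symmetric] y by (simp add: R_def Bs)
      then show "T k y \<in> R" using S(2)[of k] y by (auto simp: R_def)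
    qed
    have xR: "x \<notin> R" using x(2) by (simp add: R_def)
    have "R \<subset> S" using xR x(1) by (auto simp: R_def)
    then have "dim R < dim S" using dim_psubset[of R S] by (simp add: span_eq_iff[THEN iffD2] sR S(1))
    from less.hyps[OF this sR iR] obtain E where E: "finite E" "independent E" "span E = R"
      "\<forall>x\<in>E. \<forall>y\<in>E. B x y = (if x = y then 1 else 0)" "\<forall>x\<in>E. \<forall>k. \<exists>l. T k x = l *\<^sub>R x" by blast
    have ER: "y \<in> R" if "y \<in> E" for y using E(3) span_base that by blast
    have "span (insert x E) = S"
    proof
      show "span (insert x E) \<subseteq> S" using x ER S(1) by (intro span_minimal) (auto simp: R_def)
      show "S \<subseteq> span (insert x E)"
      proof
        fix y assume y: "y \<in> S"
        have "y - B x y *\<^sub>R x \<in> R"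
          unfolding R_def using y x S(1) by (simp add: subspace_diff subspace_scale Bs)
        then show "y \<in> span (insert x E)" unfolding E(3)[symmetric] span_breakdown_eq by blast
      qed
    qed
    moreover have "independent (insert x E)" using E xR by (simp add: independent_insert)
    moreover have "\<forall>u\<in>insert x E. \<forall>y\<in>insert x E. B u y = (if u = y then 1 else 0)"
    proof (intro ballI)
      fix u y assume uy: "u \<in> insert x E" "y \<in> insert x E"
      show "B u y = (if u = y then 1 else 0)"
      proof (cases "u = x")
        case True
        then show ?thesis using uy x ER xR by (auto simp: R_def)
      next
        case False
        then have u: "u \<in> E" using uy by simp
        show ?thesis
        proof (cases "y = x")
          case True
          then show ?thesis using False Bsym[of u x] ER[OF u] by (simp add: R_def)
        next
          case False
          then show ?thesis using u uy E(4) by blast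
        qed
      qed
    qed
    ultimately show ?thesis using E x by (intro exI[of _ "insert x E"]) auto
  qed
qed

lemma bounded_bilinear_matrix_vector: "bounded_bilinear ((*v) :: real ^ 'n::finite ^ 'm::finite \<Rightarrow> _)"
  unfolding bilinear_conv_bounded_bilinear[symmetric] bilinear_def
  by (auto intro!: linearI simp: vec_eq_iff matrix_vector_mult_def sum.distrib sum_distrib_left algebra_simps)

text \<open>The inverse function theorem for pairs (u, x) takes the role of the implicit function
  theorem: an eigenvector near a simple eigenvalue is a zero of one smooth map that depends on
  \<open>u\<close>. The pairs are coded as vectors indexed by \<open>'n + 'n\<close>.\<close>

lemma smooth_eigenvector:
  fixes S :: "real ^ 'n::finite \<Rightarrow> real ^ 'n ^ 'n"
  assumes V: "open V" "smooth_on V S" "u0 \<in> V"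
    and diag: "\<And>r c. S u0 $ r $ c = (if r = c then l r else 0)" and simple: "\<And>j. j \<noteq> i \<Longrightarrow> l j \<noteq> l i"
  shows "\<exists>W x. open W \<and> u0 \<in> W \<and> W \<subseteq> V \<and> smooth_on W x \<and> x u0 = axis i 1 \<and>
    (\<forall>u\<in>W. x u $ i = 1 \<and> S u *v x u = (S u *v x u) $ i *\<^sub>R x u)"
proof -
  define pl where "pl z = (\<chi> a. z $ Inl a)" for z :: "real ^ ('n + 'n)"
  define pr where "pr z = (\<chi> a. z $ Inr a)" for z :: "real ^ ('n + 'n)"
  define pair where "pair u x = (\<chi> s. case s of Inl a \<Rightarrow> u $ a | Inr a \<Rightarrow> x $ a)" for u x :: "real ^ 'n"
  have pp: "pl (pair u x) = u" "pr (pair u x) = x" "pair (pl z) (pr z) = z" for u x z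
    by (simp_all add: pl_def pr_def pair_def vec_eq_iff split: sum.split)
  have bl: "bounded_linear pl" "bounded_linear pr"
    unfolding linear_conv_bounded_linear[symmetric] by (auto intro!: linearI simp: pl_def pr_def vec_eq_iff)
  \<comment> \<open>\<open>\<Phi>\<close> joins the eigenvalue equation, with (S x)_i as the
    eigenvalue, to the normalisation x_i = 1. Its i-th component is (x_i - 1)
    (\<open>\<kappa>\<close> - (S x)_i), so zeros with (S x)_i \<noteq> \<open>\<kappa>\<close> have
    x_i = 1. At the start its derivative in x is diagonal with entries l_a - l_i for a \<noteq> i
    and \<open>\<kappa>\<close> - l_i = 1 for a = i.\<close>
  define \<kappa> where "\<kappa> = l i + 1"
  define m where "m z = S (pl z) *v pr z" for z
  define \<Phi> where "\<Phi> z = m z - (m z $ i) *\<^sub>R pr z + (\<kappa> * (pr z $ i - 1)) *\<^sub>R axis i 1" for z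
  define \<Psi> where "\<Psi> z = pair (pl z) (\<Phi> z)" for z
  define D0 where "D0 = pl -` V"
  have oD: "open D0" unfolding D0_def by (intro open_vimage V linear_continuous_on bl)
  have spl: "smooth_on D0 pl" "smooth_on D0 pr"
    by (intro smooth_on_bounded_linear[OF bl(1) oD smooth_on_ident[OF oD]] smooth_on_bounded_linear[OF bl(2) oD smooth_on_ident[OF oD]])+
  have sS: "smooth_on D0 (\<lambda>z. S (pl z))"
    by (rule smooth_on_compose[OF oD V(1,2) spl(1)]) (auto simp: D0_def)
  have sm: "smooth_on D0 m" unfolding m_def[abs_def] by (intro smooth_intros oD sS spl)
  have s\<Phi>: "smooth_on D0 \<Phi>" unfolding \<Phi>_def[abs_def] by (intro smooth_intros oD sm spl)
  have s\<Psi>: "smooth_on D0 \<Psi>"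
  proof -
    have "smooth_on D0 (\<lambda>z. \<Psi> z $ s)" for s
      by (cases s) (simp_all add: \<Psi>_def pair_def, (intro smooth_intros oD spl s\<Phi>)+)
    then have "smooth_on D0 (\<lambda>z. \<chi> s. \<Psi> z $ s)" by (intro smooth_on_vec_lambda oD)
    then show ?thesis by (rule smooth_on_cong[OF oD]) (simp add: vec_eq_iff)
  qed
  define z0 where "z0 = pair u0 (axis i 1)"
  have z0D: "z0 \<in> D0" by (simp add: z0_def D0_def pp V)
  have Sv: "(S u0 *v d) $ a = l a * d $ a" for d a
    using sum_if_mult(1)[of a "\<lambda>_. l a" "\<lambda>c. d $ c"] by (simp add: matrix_vector_mult_def diag eq_commute[of a])
  have m0: "m z0 = l i *\<^sub>R axis i 1" by (simp add: m_def z0_def pp vec_eq_iff Sv axis_def)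
  have "inj (frechet_derivative \<Psi> (at z0))"
    unfolding linear_injective_0[OF linear_frechet_derivative[OF smooth_on_differentiable[OF s\<Psi> z0D]]]
  proof (intro allI impI)
    fix w assume w: "frechet_derivative \<Psi> (at z0) w = 0"
    have D\<Psi>: "(\<Psi> has_derivative frechet_derivative \<Psi> (at z0)) (at z0)" by (rule smooth_on_has_derivative[OF s\<Psi> z0D])
    have "pl w = 0"
    proof -
      have "((\<lambda>z. pl (\<Psi> z)) has_derivative (\<lambda>w. pl (frechet_derivative \<Psi> (at z0) w))) (at z0)"
        by (rule bounded_linear.has_derivative[OF bl(1) D\<Psi>])
      moreover have "(\<lambda>z. pl (\<Psi> z)) = pl" by (simp add: \<Psi>_def pp fun_eq_iff)
      ultimately have "(pl has_derivative (\<lambda>w. pl (frechet_derivative \<Psi> (at z0) w))) (at z0)" by simp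
      from has_derivative_unique[OF this bounded_linear_imp_has_derivative[OF bl(1)]]
      have "pl (frechet_derivative \<Psi> (at z0) w) = pl w" by metis
      then show ?thesis using w bounded_linear.linear[OF bl(1)] by (simp add: linear_0)
    qed
    have Dpr: "(pr has_derivative pr) (at z0)" by (rule bounded_linear_imp_has_derivative[OF bl(2)])
    have Dm: "(m has_derivative (\<lambda>w. S (pl z0) *v pr w + frechet_derivative (\<lambda>z. S (pl z)) (at z0) w *v pr z0)) (at z0)"
      unfolding m_def by (rule bounded_bilinear.FDERIV[OF bounded_bilinear_matrix_vector smooth_on_has_derivative[OF sS z0D] Dpr])
    define m' where "m' w = S (pl z0) *v pr w + frechet_derivative (\<lambda>z. S (pl z)) (at z0) w *v pr z0" for w
    note Dm = Dm[folded m'_def]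
    have nth: "((\<lambda>z. f z $ a) has_derivative (\<lambda>w. f' w $ a)) (at z0)" if "(f has_derivative f') (at z0)"
      for f f' and a :: 'n by (rule bounded_linear.has_derivative[OF bounded_linear_vec_nth that])
    have D\<Phi>: "(\<Phi> has_derivative (\<lambda>w. m' w - (m z0 $ i *\<^sub>R pr w + m' w $ i *\<^sub>R pr z0) + (\<kappa> * pr w $ i) *\<^sub>R axis i 1)) (at z0)"
      unfolding \<Phi>_def[abs_def]
      by (rule derivative_eq_intros Dm Dpr nth[OF Dm] nth[OF Dpr] refl | simp)+
    have "((\<lambda>z. pr (\<Psi> z)) has_derivative (\<lambda>w. pr (frechet_derivative \<Psi> (at z0) w))) (at z0)"
      by (rule bounded_linear.has_derivative[OF bl(2) D\<Psi>])
    moreover have "(\<lambda>z. pr (\<Psi> z)) = \<Phi>" by (simp add: \<Psi>_def pp fun_eq_iff)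
    ultimately have "(\<Phi> has_derivative (\<lambda>w. pr (frechet_derivative \<Psi> (at z0) w))) (at z0)" by simp
    from has_derivative_unique[OF this D\<Phi>]
    have "pr (frechet_derivative \<Psi> (at z0) w) = m' w - (m z0 $ i *\<^sub>R pr w + m' w $ i *\<^sub>R pr z0) + (\<kappa> * pr w $ i) *\<^sub>R axis i 1"
      by metis
    then have e: "m' w - (m z0 $ i *\<^sub>R pr w + m' w $ i *\<^sub>R pr z0) + (\<kappa> * pr w $ i) *\<^sub>R axis i 1 = 0"
      using w bounded_linear.linear[OF bl(2)] by (simp add: linear_0)
    have "frechet_derivative (\<lambda>z. S (pl z)) (at z0) w = 0"
    proof -
      have "((\<lambda>z. S (pl z)) has_derivative (\<lambda>w. frechet_derivative S (at (pl z0)) (pl w))) (at z0)"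
        by (rule has_derivative_compose[OF bounded_linear_imp_has_derivative[OF bl(1)] smooth_on_has_derivative[OF V(2)]])
          (simp add: z0_def pp V)
      from frechet_derivative_eq[OF this] show ?thesis
        using \<open>pl w = 0\<close> linear_0[OF linear_frechet_derivative[OF smooth_on_differentiable[OF V(2,3)]]] by (simp add: z0_def pp)
    qed
    then have m': "m' w = S u0 *v pr w" by (simp add: m'_def z0_def pp)
    have ea: "l a * pr w $ a - (l i * pr w $ a + l i * pr w $ i * axis i 1 $ a) + \<kappa> * pr w $ i * axis i 1 $ a = 0" for a
      using arg_cong[OF e, of "\<lambda>v. v $ a"] by (simp add: m' m0 Sv) (simp add: Sv z0_def pp)
    have "pr w $ a = 0" for a
    proof (cases "a = i")
      case True
      then show ?thesis using ea[of i] by (simp add: \<kappa>_def algebra_simps)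
    next
      case False
      then show ?thesis using ea[of a] simple[OF False] by (simp add: axis_def algebra_simps)
    qed
    then have "pr w = 0" by (simp add: vec_eq_iff)
    then have "w $ s = 0" for s
      using \<open>pl w = 0\<close> by (cases s) (simp_all add: pl_def pr_def vec_eq_iff)
    then show "w = 0" by (simp add: vec_eq_iff)
  qed
  from smooth_inverse_function[OF oD s\<Psi> z0D this]
  obtain U' V' g where g: "open U'" "U' \<subseteq> D0" "z0 \<in> U'" "open V'" "\<Psi> z0 \<in> V'" "homeomorphism U' V' \<Psi> g" "smooth_on V' g" by metis
  define inc where "inc u = pair u 0" for u
  have blinc: "bounded_linear inc"
    unfolding linear_conv_bounded_linear[symmetric] inc_def pair_def by (auto intro!: linearI simp: vec_eq_iff split: sum.split)
  define x where "x u = pr (g (inc u))" for u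
  define W0 where "W0 = inc -` V'"
  have oW0: "open W0" unfolding W0_def by (intro open_vimage g linear_continuous_on blinc)
  have sx: "smooth_on W0 x"
    unfolding x_def[abs_def]
    by (intro smooth_on_bounded_linear[OF bl(2) oW0] smooth_on_compose[OF oW0 g(4,7)]
        smooth_on_bounded_linear[OF blinc oW0 smooth_on_ident[OF oW0]]) (auto simp: W0_def)
  have W0: "pl (g (inc u)) = u" "\<Phi> (g (inc u)) = 0" "u \<in> V" if "u \<in> W0" for u
  proof -
    have "\<Psi> (g (inc u)) = inc u" "g (inc u) \<in> U'" using g(6) that by (auto simp: W0_def homeomorphism_def)
    then have "pl (\<Psi> (g (inc u))) = pl (inc u)" "pr (\<Psi> (g (inc u))) = pr (inc u)" "g (inc u) \<in> D0" using g(2) by auto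
    then show "pl (g (inc u)) = u" "\<Phi> (g (inc u)) = 0" "u \<in> V" by (auto simp: \<Psi>_def inc_def pp D0_def)
  qed
  have \<Psi>0: "\<Psi> z0 = inc u0" by (simp add: \<Psi>_def \<Phi>_def m0) (simp add: z0_def pp inc_def)
  have u0W: "u0 \<in> W0" using g(5) by (simp add: W0_def \<Psi>0)
  have "g (\<Psi> z0) = z0" using g(3,6) by (simp add: homeomorphism_def)
  then have x0: "x u0 = axis i 1" by (simp add: x_def \<Psi>0) (simp add: z0_def pp)
  define W where "W = {u \<in> W0. (S u *v x u) $ i \<noteq> \<kappa>}"
  have sSx: "smooth_on W0 (\<lambda>u. (S u *v x u) $ i)"
    using W0(3) by (intro smooth_intros oW0 sx smooth_on_subset[OF V(2)]) auto
  have "open W"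
  proof -
    have "open (W0 \<inter> (\<lambda>u. (S u *v x u) $ i) -` (- {\<kappa>}))"
      by (rule continuous_open_preimage[OF smooth_on_continuous[OF sSx] oW0 open_Compl[OF closed_singleton]])
    moreover have "W0 \<inter> (\<lambda>u. (S u *v x u) $ i) -` (- {\<kappa>}) = W" by (auto simp: W_def)
    ultimately show ?thesis by simp
  qed
  moreover have "u0 \<in> W" by (simp add: W_def u0W x0 Sv \<kappa>_def)
  moreover have "W \<subseteq> V" using W0 by (auto simp: W_def)
  moreover have "smooth_on W x" by (rule smooth_on_subset[OF sx]) (auto simp: W_def)
  moreover have "x u $ i = 1 \<and> S u *v x u = (S u *v x u) $ i *\<^sub>R x u" if u: "u \<in> W" for u
  proof -
    have u0: "u \<in> W0" and ne: "(S u *v x u) $ i \<noteq> \<kappa>" using u by (auto simp: W_def)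
    have "S u *v x u - ((S u *v x u) $ i) *\<^sub>R x u + (\<kappa> * (x u $ i - 1)) *\<^sub>R axis i 1 = 0"
      using W0(2)[OF u0] by (simp add: \<Phi>_def m_def W0(1)[OF u0] x_def)
    moreover from arg_cong[OF this, of "\<lambda>v. v $ i"] have "(x u $ i - 1) * (\<kappa> - (S u *v x u) $ i) = 0"
      by (simp add: algebra_simps)
    then have "x u $ i = 1" using ne by simp
    ultimately show ?thesis by simp
  qed
  ultimately show ?thesis using x0 by blast
qed

text \<open>The form is integrated as the matrix connection \<omega> N with N nilpotent: N^2 = 0
  removes the quadratic terms of the flatness condition, which becomes closedness, and the potential
  is the off-diagonal entry of the unipotent solution.\<close>

theorem poincare_lemma:
  fixes \<omega> :: "real ^ 'd::finite \<Rightarrow> real ^ 'd"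
  assumes W: "open W" "convex W" "u0 \<in> W" and s: "smooth_on W \<omega>"
    and closed: "\<And>u i j. u \<in> W \<Longrightarrow> pd i \<omega> u $ j = pd j \<omega> u $ i"
  shows "\<exists>f. smooth_on W f \<and> (\<forall>u\<in>W. (f has_derivative (\<lambda>v. \<omega> u \<bullet> v)) (at u))"
proof -
  define N :: "real ^ bool ^ bool" where "N = (\<chi> r s. if \<not> r \<and> s then 1 else 0)"
  have NN: "N ** N = 0" by (simp add: N_def matrix_matrix_mult_def vec_eq_iff UNIV_bool)
  define \<Theta> where "\<Theta> u = (\<chi> i. \<omega> u $ i *\<^sub>R N)" for u
  have s\<Theta>: "smooth_on W \<Theta>" unfolding \<Theta>_def[abs_def] by (intro smooth_intros W s)
  have pT: "pd i \<Theta> u $ j = pd i \<omega> u $ j *\<^sub>R N" if u: "u \<in> W" for u i j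
  proof -
    have d: "(\<lambda>x. \<omega> x $ j) differentiable (at u)"
      by (rule smooth_on_differentiable[OF smooth_on_vec_nth[OF W(1) s] u])
    have "pd i \<Theta> u $ j = pd i (\<lambda>x. \<omega> x $ j *\<^sub>R N) u"
      using pd_vec_nth[OF smooth_on_differentiable[OF s\<Theta> u], of i j] by (simp add: \<Theta>_def)
    then show ?thesis
      using pd_scaleR[OF d differentiable_const, of i N] pd_vec_nth[OF smooth_on_differentiable[OF s u], of i j] by simp
  qed
  note bb = bounded_bilinear_matrix_mul
  have flat: "pd i \<Theta> u $ j + \<Theta> u $ i ** \<Theta> u $ j = pd j \<Theta> u $ i + \<Theta> u $ j ** \<Theta> u $ i" if u: "u \<in> W" for u i j
    using closed[OF u, of i j]
    by (simp add: pT[OF u]) (simp add: \<Theta>_def bounded_bilinear.scaleR_left[OF bb] bounded_bilinear.scaleR_right[OF bb] NN)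
  obtain g where g: "smooth_on W g" "g u0 = (mat 1 :: real ^ bool ^ bool)"
    and D: "\<And>u. u \<in> W \<Longrightarrow> (g has_derivative (\<lambda>v. g u ** one_form (\<Theta> u) v)) (at u)"
    using linear_total_pde_solvable[OF W s\<Theta> flat] by blast
  have of: "one_form (\<Theta> u) v = (\<omega> u \<bullet> v) *\<^sub>R N" for u v
    by (simp add: one_form_def \<Theta>_def inner_vec_def scaleR_sum_left mult.commute)
  have nth: "((\<lambda>u. g u $ r $ c) has_derivative (\<lambda>v. (g u ** one_form (\<Theta> u) v) $ r $ c)) (at u)" if "u \<in> W" for u r c
    by (intro bounded_linear.has_derivative[OF bounded_linear_vec_nth] D that)
  have "((\<lambda>u. g u $ False $ False) has_derivative (\<lambda>v. 0)) (at u within W)" if "u \<in> W" for u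
    using has_derivative_at_withinI[OF nth[OF that, of False False], of W]
    by (simp add: of matrix_matrix_mult_def N_def UNIV_bool)
  from has_derivative_zero_constant[OF W(2) this] obtain c where c: "\<And>u. u \<in> W \<Longrightarrow> g u $ False $ False = c" by blast
  then have one: "g u $ False $ False = 1" if "u \<in> W" for u using c[OF that] c[OF W(3)] g(2) by (simp add: mat_def)
  have "((\<lambda>u. g u $ False $ True) has_derivative (\<lambda>v. \<omega> u \<bullet> v)) (at u)" if "u \<in> W" for u
    using nth[OF that, of False True] by (simp add: of matrix_matrix_mult_def N_def UNIV_bool one[OF that])
  moreover have "smooth_on W (\<lambda>u. g u $ False $ True)" by (intro smooth_intros W g)
  ultimately show ?thesis by blast
qed

section \<open>The graph chart of hyperbolic space\<close>

definition hyp_graph :: "real ^ 'n::finite \<Rightarrow> real ^ 'n option" where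
  "hyp_graph x = (\<chi> r. case r of None \<Rightarrow> sqrt (1 + x \<bullet> x) | Some i \<Rightarrow> x $ i)"

lemma space_part_hyp_graph [simp]: "space_part (hyp_graph x) = x"
  by (simp add: space_part_def hyp_graph_def)

lemma hyp_graph_in_hyp: "hyp_graph x \<in> hyp"
proof -
  have "0 < 1 + x \<bullet> x" using inner_ge_zero[of x] by linarith
  then show ?thesis by (simp add: hyp_def lorentz_space_part) (simp add: hyp_graph_def)
qed

lemma hyp_graph_space_part:
  assumes "p \<in> hyp"
  shows "hyp_graph (space_part p) = p"
proof -
  have "1 + space_part p \<bullet> space_part p = (p $ None)\<^sup>2" "p $ None > 0"
    using assms by (auto simp: hyp_def lorentz_space_part power2_eq_square)
  then show ?thesis by (simp add: hyp_graph_def vec_eq_iff space_part_def split: option.split)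
qed

lemma smooth_hyp_graph:
  assumes "open V"
  shows "smooth_on V hyp_graph"
proof -
  have "smooth_on V (\<lambda>x. hyp_graph x $ r)" for r
  proof (cases r)
    case None
    have "0 < 1 + x \<bullet> x" for x :: "real ^ 'a" using inner_ge_zero[of x] by linarith
    then show ?thesis by (simp add: hyp_graph_def None) (intro smooth_intros assms, auto)
  qed (simp add: hyp_graph_def, intro smooth_intros assms)
  then have "smooth_on V (\<lambda>x. \<chi> r. hyp_graph x $ r)" by (intro smooth_on_vec_lambda assms)
  then show ?thesis by (rule smooth_on_cong[OF assms]) (simp add: vec_eq_iff)
qed

text \<open>The space components form a global chart of hyperbolic space, so all of \<open>U\<close>
  is covered at once, and the eigenframe can be constructed over a single open subset of R^n before
  adapted coordinates exist.\<close>

lemma local_param_hyp_graph: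
  fixes U :: "(real ^ ('n::finite) option) set"
  assumes U: "openin (top_of_set hyp) U"
  shows "local_param U (space_part ` U) hyp_graph" "hyp_graph ` space_part ` U = U"
proof -
  obtain Q where Q: "open Q" "U = hyp \<inter> Q" using U by (auto simp: openin_open)
  have img: "space_part ` U = hyp_graph -` Q"
    using Q by (force simp: hyp_graph_space_part hyp_graph_in_hyp image_iff intro: bexI[of _ "hyp_graph _"])
  have opn: "open (space_part ` U)"
    unfolding img by (rule open_vimage[OF Q(1) smooth_on_continuous[OF smooth_hyp_graph[OF open_UNIV]]])
  show img_eq: "hyp_graph ` space_part ` U = U"
    using Q by (force simp: hyp_graph_space_part image_iff)
  have lsp: "bounded_linear (space_part :: real ^ 'n option \<Rightarrow> _)"
    unfolding linear_conv_bounded_linear[symmetric] by (auto intro!: linearI simp: space_part_def vec_eq_iff)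
  have "inj (frechet_derivative hyp_graph (at u))" for u :: "real ^ 'n"
  proof (rule inj_on_inverseI)
    fix v
    have "((\<lambda>x. space_part (hyp_graph x)) has_derivative (\<lambda>v. space_part (frechet_derivative hyp_graph (at u) v))) (at u)"
      by (rule bounded_linear.has_derivative[OF lsp smooth_on_has_derivative[OF smooth_hyp_graph[OF open_UNIV] UNIV_I]])
    then have "((\<lambda>x. x) has_derivative (\<lambda>v. space_part (frechet_derivative hyp_graph (at u) v))) (at u)" by simp
    from has_derivative_unique[OF this has_derivative_ident]
    show "space_part (frechet_derivative hyp_graph (at u) v) = v" by metis
  qed
  moreover have "homeomorphism (space_part ` U) (hyp_graph ` space_part ` U) hyp_graph space_part"
    unfolding img_eq
    by (rule homeomorphismI) (use img_eq in \<open>auto intro!: smooth_on_continuous[OF smooth_hyp_graph[OF opn]] linear_continuous_on lsp\<close>,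
        use Q hyp_graph_space_part in blast)
  ultimately show "local_param U (space_part ` U) hyp_graph"
    unfolding local_param_def using opn smooth_hyp_graph[OF opn] by (auto simp: img_eq)
qed

lemma symmetric_form:
  fixes M :: "real ^ 'n::finite ^ 'n"
  assumes "\<And>i j. M $ i $ j = M $ j $ i"
  shows "x \<bullet> (M *v y) = y \<bullet> (M *v x)"
proof -
  have "x \<bullet> (M *v y) = (\<Sum>i\<in>UNIV. \<Sum>j\<in>UNIV. M $ i $ j * (x $ i * y $ j))" for x y
    by (simp add: inner_vec_def matrix_vector_mult_def sum_distrib_left mult_ac)
  then show ?thesis using assms by (subst (2) \<open>\<And>x y. x \<bullet> (M *v y) = _\<close>, subst sum.swap) (simp add: mult.commute)
qed

text \<open>With the \<open>E j\<close> as columns of P, orthonormality says that P^t G is a left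
  inverse of P. For square matrices it is also a right inverse, and that is the expansion.\<close>

lemma form_orthonormal_expand:
  fixes G :: "real ^ 'n::finite ^ 'n" and E :: "'n \<Rightarrow> real ^ 'n"
  assumes "\<And>i j. E i \<bullet> (G *v E j) = (if i = j then 1 else 0)"
  shows "x = (\<Sum>j\<in>UNIV. (E j \<bullet> (G *v x)) *\<^sub>R E j)"
proof -
  define P where "P = (\<chi> r c. E c $ r)"
  have tP: "(y v* P) $ j = E j \<bullet> y" for y j
    by (simp add: P_def vector_matrix_mult_def inner_vec_def mult.commute)
  have Pv: "P *v c = (\<Sum>j\<in>UNIV. c $ j *\<^sub>R E j)" for c
    by (simp add: P_def matrix_vector_mult_def vec_eq_iff mult.commute)
  have "(transpose P ** G) ** P = mat 1"
  proof -
    have "((transpose P ** G) ** P) *v axis j 1 = mat 1 *v axis j 1" for j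
    proof -
      have "P *v axis j 1 = E j" by (simp add: matrix_vector_mult_axis column_def P_def vec_eq_iff)
      then have "((transpose P ** G) ** P) *v axis j 1 = transpose P *v (G *v E j)"
        by (simp add: matrix_vector_mul_assoc[symmetric])
      then show ?thesis by (simp add: vec_eq_iff tP assms axis_def)
    qed
    then show ?thesis unfolding matrix_vector_mult_axis by (simp add: column_def vec_eq_iff)
  qed
  then have "P ** (transpose P ** G) = mat 1" by (simp add: matrix_left_right_inverse)
  then have "P *v ((transpose P ** G) *v x) = x" by (simp add: matrix_vector_mul_assoc)
  then show ?thesis by (simp add: Pv matrix_vector_mul_assoc[symmetric] tP)
qed

lemma local_param_hyp_immersion:
  fixes \<psi> :: "real ^ 'n::finite \<Rightarrow> real ^ ('k::finite) option"
  assumes "U \<subseteq> hyp" "local_param U V \<psi>"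
  shows "hyp_immersion V \<psi>"
proof (rule hyp_immersionI)
  show "\<psi> ` V \<subseteq> hyp" using assms openin_imp_subset unfolding local_param_def by blast
qed (use assms in \<open>auto simp: local_param_def\<close>)

lemma framed_immersion_of_chart:
  fixes U :: "(real ^ ('n::finite) option) set"
    and X :: "real ^ 'n option \<Rightarrow> real ^ (('m::finite) + 'n) option"
  assumes X: "local_isometric_immersion U X" and frame: "parallel_normal_frame U X e"
    and \<psi>: "local_param U V (\<psi> :: real ^ 'n \<Rightarrow> _)"
  shows "framed_immersion V (X \<circ> \<psi>) (\<lambda>a. e a \<circ> \<psi>)"
proof -
  have U: "U \<subseteq> hyp" "smooth_map_on U X" "X ` U \<subseteq> hyp" "\<And>u. u \<in> V \<Longrightarrow> first_ff (X \<circ> \<psi>) u = first_ff \<psi> u"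
    using X \<psi> openin_imp_subset unfolding local_isometric_immersion_def by blast+
  have V: "open V" "smooth_on V \<psi>" "\<psi> ` V \<subseteq> U"
    using \<psi> openin_imp_subset unfolding local_param_def by blast+
  interpret C: hyp_immersion V \<psi> by (rule local_param_hyp_immersion[OF U(1) \<psi>])
  show ?thesis
  proof
    show "open V" by fact
    show "smooth_on V (X \<circ> \<psi>)" by (rule smooth_map_on_compose[OF U(2) V])
    show "(X \<circ> \<psi>) u \<in> hyp" if "u \<in> V" for u using U(3) V(3) that by auto
    show "0 < x \<bullet> (first_ff (X \<circ> \<psi>) u *v x)" if "u \<in> V" "x \<noteq> 0" for u x
      using C.first_ff_pos[OF that] U(4)[OF that(1)] by simp
    show "smooth_on V (e a \<circ> \<psi>)" for a
      using frame V by (intro smooth_map_on_compose[of U]) (auto simp: parallel_normal_frame_def)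
    show "(e a \<circ> \<psi>) u \<bullet>\<^sub>1 (e c \<circ> \<psi>) u = (if a = c then 1 else 0)" if "u \<in> V" for u a c
      using frame V(3) that unfolding parallel_normal_frame_def by auto
    show "(e a \<circ> \<psi>) u \<in> normal_space (X \<circ> \<psi>) u" "normal_deriv (X \<circ> \<psi>) i (e a \<circ> \<psi>) u = 0" if "u \<in> V" for u a i
      using frame \<psi> that unfolding parallel_normal_frame_def by auto
  qed
qed

section \<open>Curvature normals and joint eigenframes\<close>

locale nondegenerate_immersion = framed_immersion V Y \<epsilon>
  for V :: "(real ^ 'n::finite) set" and Y :: "real ^ 'n \<Rightarrow> real ^ ('m::finite + 'n) option" and \<epsilon> +
  fixes \<psi> :: "real ^ 'n \<Rightarrow> real ^ 'n option"
  assumes chart: "hyp_immersion V \<psi>" and isometric: "u \<in> V \<Longrightarrow> first_ff Y u = first_ff \<psi> u"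
    and nondegenerate: "u \<in> V \<Longrightarrow> dim {shape_operator Y \<nu> u | \<nu>. \<nu> \<in> normal_space Y u} = CARD('n)"
begin

abbreviation "G u \<equiv> first_ff Y u"
abbreviation "T k u \<equiv> matrix_inv (first_ff Y u) ** H k u"

lemma G_T: "u \<in> V \<Longrightarrow> G u ** T k u = H k u"
  using matrix_inv_inverse(1)[OF invertible_first_ff] by (simp add: matrix_mul_assoc)

lemma G_T_vec: "u \<in> V \<Longrightarrow> G u *v (T k u *v x) = H k u *v x"
  using G_T[of u k] by (simp add: matrix_vector_mul_assoc)

lemma H_form_sym: "u \<in> V \<Longrightarrow> x \<bullet> (H k u *v y) = y \<bullet> (H k u *v x)"
  by (rule symmetric_form[OF H_sym])

lemma G_form_sym: "x \<bullet> (G u *v y) = y \<bullet> (G u *v x)"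
  by (rule symmetric_form[OF first_ff_sym])

lemma T_adjoint: "u \<in> V \<Longrightarrow> (T k u *v x) \<bullet> (G u *v y) = x \<bullet> (G u *v (T k u *v y))"
  by (subst G_form_sym) (simp add: G_T_vec H_form_sym[of u y])

lemma pd_frame_T: "u \<in> V \<Longrightarrow> pd i (\<epsilon> k) u = (\<Sum>p\<in>UNIV. T k u $ p $ i *\<^sub>R pd p Y u)"
  by (simp add: weingarten matrix_vector_mult_def matrix_matrix_mult_def H_sym[of u k i])

text \<open>The Ricci equation in matrix form: the products of derivatives of the frame are the
  entries of H T, which is G T T, and the invertible G cancels.\<close>

lemma T_commute:
  assumes u: "u \<in> V"
  shows "T k u ** T l u = T l u ** T k u"
proof -
  have c: "pd i (\<epsilon> k) u \<bullet>\<^sub>1 pd j (\<epsilon> l) u = (H l u ** T k u) $ j $ i" for i j k l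
    unfolding pd_frame_T[OF u, of i k]
    by (simp add: lorentz_sum_left lorentz_scaleR_left matrix_matrix_mult_def[of "H l u"] H_nth lorentz_commute[of "pd _ Y u"] mult.commute)
  have "(H l u ** T k u) $ i $ j = (H k u ** T l u) $ i $ j" for i j
    using c[of i k j l] c[of j l i k] ricci_equation[OF u, of i k j l] c[of j k i l] by (simp add: lorentz_commute)
  then have "G u ** (T l u ** T k u) = G u ** (T k u ** T l u)"
    unfolding matrix_mul_assoc[of "G u" "T l u" "T k u"] matrix_mul_assoc[of "G u" "T k u" "T l u"] G_T[OF u]
    by (simp only: vec_eq_iff) simp
  then have "matrix_inv (G u) ** (G u ** (T l u ** T k u)) = matrix_inv (G u) ** (G u ** (T k u ** T l u))" by simp
  then show ?thesis
    unfolding matrix_mul_assoc[of "matrix_inv (G u)" "G u"] matrix_inv_inverse(2)[OF invertible_first_ff[OF u]] by simp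
qed

lemma T_commute_vec: "u \<in> V \<Longrightarrow> T k u *v (T l u *v x) = T l u *v (T k u *v x)"
  using T_commute[of u k l] by (simp add: matrix_vector_mul_assoc)

lemma shape_operator_frame:
  assumes u: "u \<in> V" and \<nu>: "\<nu> \<in> normal_space Y u"
  shows "shape_operator Y \<nu> u = (\<Sum>k\<in>UNIV. (\<nu> \<bullet>\<^sub>1 \<epsilon> k u) *\<^sub>R T k u)"
proof -
  have "\<nu> - (\<Sum>k\<in>UNIV. (\<nu> \<bullet>\<^sub>1 \<epsilon> k u) *\<^sub>R \<epsilon> k u) = 0"
    using \<nu> by (intro frame_complete[OF u])
      (simp_all add: lorentz_simps normal_space_def frame_Y[OF u] frame_tangent[OF u] frame_orthonormal[OF u] if_distrib sum.delta cong: if_cong)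
  then have \<nu>': "\<nu> = (\<Sum>k\<in>UNIV. (\<nu> \<bullet>\<^sub>1 \<epsilon> k u) *\<^sub>R \<epsilon> k u)" by simp
  have "second_ff_vec Y \<nu> u $ i $ j = (\<Sum>k\<in>UNIV. (\<nu> \<bullet>\<^sub>1 \<epsilon> k u) *\<^sub>R H k u) $ i $ j" for i j
  proof -
    have "second_ff_vec Y \<nu> u $ i $ j = - ((\<Sum>k\<in>UNIV. (\<nu> \<bullet>\<^sub>1 \<epsilon> k u) *\<^sub>R \<epsilon> k u) \<bullet>\<^sub>1 pd i (pd j Y) u)"
      using \<nu>' by (simp add: second_ff_vec_def)
    then show ?thesis by (simp add: lorentz_simps H_eq[OF u] sum_negf)
  qed
  then have "second_ff_vec Y \<nu> u = (\<Sum>k\<in>UNIV. (\<nu> \<bullet>\<^sub>1 \<epsilon> k u) *\<^sub>R H k u)" by (simp add: vec_eq_iff)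
  then show ?thesis
    by (simp add: shape_operator_def bounded_bilinear.sum_right[OF bounded_bilinear_matrix_mul]
        bounded_bilinear.scaleR_right[OF bounded_bilinear_matrix_mul])
qed

text \<open>The eigenvalue is spelled as the value of the second fundamental form on
  \<open>E i\<close>; it is then a smooth function as soon as the frame is smooth, without a
  separate choice.\<close>

definition eigenframe :: "real ^ 'n \<Rightarrow> ('n \<Rightarrow> real ^ 'n) \<Rightarrow> bool" where
  "eigenframe u E \<longleftrightarrow> (\<forall>i j. E i \<bullet> (G u *v E j) = (if i = j then 1 else 0)) \<and>
     (\<forall>k i. T k u *v E i = (E i \<bullet> (H k u *v E i)) *\<^sub>R E i)"

lemma eigenframeI:
  assumes u: "u \<in> V" and o: "\<And>i j. E i \<bullet> (G u *v E j) = (if i = j then 1 else 0)"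
    and e: "\<And>k i. \<exists>l. T k u *v E i = l *\<^sub>R E i"
  shows "eigenframe u E"
  unfolding eigenframe_def
proof (intro conjI allI o)
  fix k i
  obtain l where l: "T k u *v E i = l *\<^sub>R E i" using e by blast
  have "E i \<bullet> (H k u *v E i) = l"
    using G_T_vec[OF u, of k "E i"] o[of i i] by (simp add: l matrix_vector_mult_scaleR flip: G_T_vec[OF u])
  then show "T k u *v E i = (E i \<bullet> (H k u *v E i)) *\<^sub>R E i" using l by simp
qed

lemma eigenframe_H:
  assumes u: "u \<in> V" and E: "eigenframe u E"
  shows "E i \<bullet> (H k u *v E j) = (if i = j then E i \<bullet> (H k u *v E i) else 0)"
proof -
  have "E i \<bullet> (H k u *v E j) = (E j \<bullet> (H k u *v E j)) * (E i \<bullet> (G u *v E j))"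
    using E unfolding eigenframe_def by (metis G_T_vec[OF u] inner_scaleR_right matrix_vector_mult_scaleR)
  then show ?thesis using E by (auto simp: eigenframe_def)
qed

text \<open>If all the forms vanished on \<open>E\<^sub>i\<close>, the shape operators would lie in the image of the hyperplane
  \<open>d\<^sub>i = 0\<close> under \<open>d \<mapsto> \<Sum> d\<^sub>j E\<^sub>j \<otimes> G E\<^sub>j\<close>.\<close>

lemma eigenframe_nonzero:
  assumes u: "u \<in> V" and E: "eigenframe u E"
  shows "\<exists>k. E i \<bullet> (H k u *v E i) \<noteq> 0"
proof (rule ccontr)
  assume neg: "\<nexists>k. E i \<bullet> (H k u *v E i) \<noteq> 0"
  define O\<^sub>E where "O\<^sub>E j = (\<chi> r c. E j $ r * (G u *v E j) $ c)" for j
  have Ov: "O\<^sub>E j *v x = (E j \<bullet> (G u *v x)) *\<^sub>R E j" for j x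
  proof -
    have "O\<^sub>E j *v x = ((G u *v E j) \<bullet> x) *\<^sub>R E j"
      by (simp add: O\<^sub>E_def vec_eq_iff matrix_vector_mult_def[of "\<chi> r c. E j $ r * (G u *v E j) $ c"] inner_vec_def sum_distrib_left mult_ac)
    then show ?thesis using G_form_sym[of "E j" u x] by (simp add: inner_commute)
  qed
  define L where "L d = (\<Sum>j\<in>UNIV. d $ j *\<^sub>R O\<^sub>E j)" for d :: "real ^ 'n"
  have lL: "linear L" unfolding L_def by (auto intro!: linearI simp: scaleR_add_left sum.distrib scaleR_sum_right)
  have exp: "x = (\<Sum>j\<in>UNIV. (E j \<bullet> (G u *v x)) *\<^sub>R E j)" for x
    using form_orthonormal_expand[of E "G u" x] E by (simp add: eigenframe_def)
  have TL: "T k u = L (\<chi> j. E j \<bullet> (H k u *v E j))" for k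
  proof -
    have "T k u *v x = L (\<chi> j. E j \<bullet> (H k u *v E j)) *v x" for x
    proof -
      have "T k u *v x = (\<Sum>j\<in>UNIV. (E j \<bullet> (G u *v x)) *\<^sub>R (T k u *v E j))"
        by (subst exp[of x]) (simp only: matrix_vector_mult_scaleR linear_sum[OF matrix_vector_mul_linear])
      also have "\<dots> = L (\<chi> j. E j \<bullet> (H k u *v E j)) *v x"
        using E by (simp add: eigenframe_def L_def bounded_bilinear.sum_left[OF bounded_bilinear_matrix_vector]
            bounded_bilinear.scaleR_left[OF bounded_bilinear_matrix_vector] Ov mult.commute)
      finally show ?thesis .
    qed
    then show ?thesis by (simp add: matrix_eq)
  qed
  have "{shape_operator Y \<nu> u | \<nu>. \<nu> \<in> normal_space Y u} \<subseteq> L ` {d. axis i 1 \<bullet> d = 0}"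
  proof clarify
    fix \<nu> assume \<nu>: "\<nu> \<in> normal_space Y u"
    define d where "d = (\<Sum>k\<in>UNIV. (\<nu> \<bullet>\<^sub>1 \<epsilon> k u) *\<^sub>R (\<chi> j. E j \<bullet> (H k u *v E j)))"
    have "shape_operator Y \<nu> u = L d"
      unfolding shape_operator_frame[OF u \<nu>] TL d_def by (simp add: linear_sum[OF lL] linear_cmul[OF lL])
    moreover have "d $ i = 0" using neg by (simp add: d_def)
    then have "axis i 1 \<bullet> d = 0" by (simp add: inner_axis')
    ultimately show "shape_operator Y \<nu> u \<in> L ` {d. axis i 1 \<bullet> d = 0}" by blast
  qed
  then have "dim {shape_operator Y \<nu> u | \<nu>. \<nu> \<in> normal_space Y u} \<le> dim (L ` {d. axis i 1 \<bullet> d = 0})" by (rule dim_subset)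
  then have "CARD('n) \<le> dim (L ` {d. axis i 1 \<bullet> d = 0})" using nondegenerate[OF u] by simp
  also have "\<dots> \<le> dim {d. axis i (1::real) \<bullet> d = 0}" by (rule dim_image_le[OF lL])
  also have "\<dots> = CARD('n) - 1" using dim_hyperplane[of "axis i (1::real)"] by (simp add: axis_eq_0_iff)
  finally show False using zero_less_card_finite[where 'a='n] by linarith
qed

lemma gauss_form:
  assumes u: "u \<in> V"
  shows "(\<Sum>a\<in>UNIV. (x \<bullet> (H a u *v y)) * (z \<bullet> (H a u *v w))) = (\<Sum>a\<in>UNIV. (z \<bullet> (H a u *v y)) * (x \<bullet> (H a u *v w)))"
proof -
  have form: "x \<bullet> (H a u *v y) = (\<Sum>j\<in>UNIV. \<Sum>k\<in>UNIV. x $ j * y $ k * H a u $ j $ k)" for x y a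
    by (simp add: inner_vec_def matrix_vector_mult_def sum_distrib_left mult_ac)
  have e: "(\<Sum>a\<in>UNIV. (x \<bullet> (H a u *v y)) * (z \<bullet> (H a u *v w))) =
      (\<Sum>j\<in>UNIV. \<Sum>k\<in>UNIV. \<Sum>i\<in>UNIV. \<Sum>q\<in>UNIV. x $ j * y $ k * z $ i * w $ q * (\<Sum>a\<in>UNIV. H a u $ j $ k * H a u $ i $ q))" for x y z w
  proof -
    have "(\<Sum>a\<in>UNIV. (x \<bullet> (H a u *v y)) * (z \<bullet> (H a u *v w))) =
      (\<Sum>a\<in>UNIV. \<Sum>j\<in>UNIV. \<Sum>k\<in>UNIV. \<Sum>i\<in>UNIV. \<Sum>q\<in>UNIV. x $ j * y $ k * z $ i * w $ q * (H a u $ j $ k * H a u $ i $ q))"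
    proof (rule sum.cong[OF refl])
      fix a
      have "(x \<bullet> (H a u *v y)) * (z \<bullet> (H a u *v w)) =
        (\<Sum>j\<in>UNIV. \<Sum>k\<in>UNIV. \<Sum>i\<in>UNIV. \<Sum>q\<in>UNIV. (x $ j * y $ k * H a u $ j $ k) * (z $ i * w $ q * H a u $ i $ q))"
        unfolding form by (simp only: sum_distrib_right) (simp only: sum_distrib_left)
      then show "(x \<bullet> (H a u *v y)) * (z \<bullet> (H a u *v w)) =
        (\<Sum>j\<in>UNIV. \<Sum>k\<in>UNIV. \<Sum>i\<in>UNIV. \<Sum>q\<in>UNIV. x $ j * y $ k * z $ i * w $ q * (H a u $ j $ k * H a u $ i $ q))"
        by (simp add: mult_ac)
    qed
    also have "\<dots> = (\<Sum>j\<in>UNIV. \<Sum>k\<in>UNIV. \<Sum>i\<in>UNIV. \<Sum>q\<in>UNIV. \<Sum>a\<in>UNIV. x $ j * y $ k * z $ i * w $ q * (H a u $ j $ k * H a u $ i $ q))"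
      by (subst sum.swap, rule sum.cong[OF refl], subst sum.swap, rule sum.cong[OF refl],
          subst sum.swap, rule sum.cong[OF refl], rule sum.swap)
    finally show ?thesis by (simp add: sum_distrib_left)
  qed
  have "(\<Sum>a\<in>UNIV. (z \<bullet> (H a u *v y)) * (x \<bullet> (H a u *v w))) =
      (\<Sum>i\<in>UNIV. \<Sum>k\<in>UNIV. \<Sum>j\<in>UNIV. \<Sum>q\<in>UNIV. x $ j * y $ k * z $ i * w $ q * (\<Sum>a\<in>UNIV. H a u $ j $ k * H a u $ i $ q))"
    unfolding e using gauss_isometric[OF chart isometric u] by (simp add: mult_ac)
  also have "\<dots> = (\<Sum>j\<in>UNIV. \<Sum>k\<in>UNIV. \<Sum>i\<in>UNIV. \<Sum>q\<in>UNIV. x $ j * y $ k * z $ i * w $ q * (\<Sum>a\<in>UNIV. H a u $ j $ k * H a u $ i $ q))"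
  proof -
    have "(\<Sum>i\<in>UNIV. \<Sum>k\<in>UNIV. \<Sum>j\<in>UNIV. f i k j) = (\<Sum>j\<in>UNIV. \<Sum>k\<in>UNIV. \<Sum>i\<in>UNIV. f i k j)" for f :: "'n \<Rightarrow> 'n \<Rightarrow> 'n \<Rightarrow> real"
    proof -
      have "(\<Sum>i\<in>UNIV. \<Sum>k\<in>UNIV. \<Sum>j\<in>UNIV. f i k j) = (\<Sum>k\<in>UNIV. \<Sum>i\<in>UNIV. \<Sum>j\<in>UNIV. f i k j)" by (rule sum.swap)
      also have "\<dots> = (\<Sum>k\<in>UNIV. \<Sum>j\<in>UNIV. \<Sum>i\<in>UNIV. f i k j)" by (intro sum.cong refl sum.swap)
      also have "\<dots> = (\<Sum>j\<in>UNIV. \<Sum>k\<in>UNIV. \<Sum>i\<in>UNIV. f i k j)" by (rule sum.swap)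
      finally show ?thesis .
    qed
    then show ?thesis .
  qed
  finally show ?thesis unfolding e by simp
qed

text \<open>The Gauss identity on E_i, E_i, E_j, E_j turns the product of two curvature normals into
  the sum of the squares of H(E_i, E_j), and joint eigenvectors diagonalise every form.\<close>

lemma eigenframe_normals_orthogonal:
  assumes u: "u \<in> V" and E: "eigenframe u E" and ij: "i \<noteq> j"
  shows "(\<Sum>a\<in>UNIV. (E i \<bullet> (H a u *v E i)) * (E j \<bullet> (H a u *v E j))) = 0"
  using gauss_form[OF u, of "E i" "E i" "E j" "E j"] eigenframe_H[OF u E, of i _ j] eigenframe_H[OF u E, of j _ i] ij by simp

lemma eigenframe_exists:
  assumes u: "u \<in> V"
  shows "\<exists>E. eigenframe u E"
proof -
  define B where "B x y = x \<bullet> (G u *v y)" for x y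
  have B: "bounded_bilinear B"
    unfolding bilinear_conv_bounded_bilinear[symmetric] bilinear_def B_def
    by (auto intro!: linearI simp: inner_add_left inner_add_right matrix_vector_right_distrib matrix_vector_mult_scaleR)
  have "\<exists>E. finite E \<and> independent E \<and> span E = (UNIV :: (real ^ 'n) set) \<and>
    (\<forall>x\<in>E. \<forall>y\<in>E. B x y = (if x = y then 1 else 0)) \<and> (\<forall>x\<in>E. \<forall>k. \<exists>l. T k u *v x = l *\<^sub>R x)"
    by (rule orthonormal_eigenbasis[where T="\<lambda>k x. T k u *v x", OF B])
      (auto simp: B_def T_adjoint[OF u] T_commute_vec[OF u] first_ff_pos[OF u] intro: G_form_sym)
  then obtain E where E: "finite E" "independent E" "span E = (UNIV :: (real ^ 'n) set)"
    "\<forall>x\<in>E. \<forall>y\<in>E. B x y = (if x = y then 1 else 0)" "\<forall>x\<in>E. \<forall>k. \<exists>l. T k u *v x = l *\<^sub>R x" by blast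
  have "card E = CARD('n)" using dim_eq_card[OF _ E(2), of UNIV] E(3) by simp
  then obtain p where p: "bij_betw p (UNIV :: 'n set) E" using E(1) finite_same_card_bij[of "UNIV :: 'n set" E] by auto
  then have pE: "p i \<in> E" "(p i = p j) = (i = j)" for i j by (auto simp: bij_betw_def inj_eq)
  have "eigenframe u p" by (rule eigenframeI[OF u]) (use E pE in \<open>auto simp: B_def\<close>)
  then show ?thesis by blast
qed

lemma smooth_T: "smooth_on V (T k)"
  by (intro smooth_intros open_domain smooth_first_ff smooth_H) (rule invertible_first_ff)

text \<open>One operator with simple spectrum represents the commuting family: its eigenvectors
  extend smoothly, and commutation makes them eigenvectors of every shape operator.\<close>

theorem smooth_eigenframe:
  assumes u0: "u0 \<in> V"
  shows "\<exists>W E. open W \<and> u0 \<in> W \<and> W \<subseteq> V \<and> (\<forall>i. smooth_on W (E i)) \<and> (\<forall>u\<in>W. eigenframe u (\<lambda>i. E i u))"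
proof -
  obtain E0 where E0: "eigenframe u0 E0" using eigenframe_exists[OF u0] by blast
  define \<mu> where "\<mu> k i = E0 i \<bullet> (H k u0 *v E0 i)" for k i
  define \<rho> where "\<rho> i = (\<Sum>k\<in>UNIV. \<mu> k i * \<mu> k i)" for i
  have \<rho>: "\<rho> i > 0" for i
  proof -
    obtain k where "\<mu> k i \<noteq> 0" using eigenframe_nonzero[OF u0 E0] by (auto simp: \<mu>_def)
    then show ?thesis unfolding \<rho>_def by (intro sum_pos2[of _ k]) (auto simp: zero_less_mult_iff)
  qed
  obtain f :: "'n \<Rightarrow> nat" where f: "inj f" using finite_imp_inj_to_nat_seg[of "UNIV :: 'n set"] by auto
  \<comment> \<open>The curvature normals at \<open>u0\<close> are orthogonal and non-zero, so the
    combination with these weights has eigenvalue f(j) on \<open>E0 j\<close>; these are distinct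
    because \<open>f\<close> is injective.\<close>
  define c where "c k = (\<Sum>i\<in>UNIV. real (f i) * \<mu> k i / \<rho> i)" for k
  have c: "(\<Sum>k\<in>UNIV. c k * \<mu> k j) = real (f j)" for j
  proof -
    have "(\<Sum>k\<in>UNIV. c k * \<mu> k j) = (\<Sum>i\<in>UNIV. real (f i) / \<rho> i * (\<Sum>k\<in>UNIV. \<mu> k i * \<mu> k j))"
      unfolding c_def sum_distrib_right sum_distrib_left by (subst sum.swap) (simp add: mult_ac)
    also have "\<dots> = (\<Sum>i\<in>UNIV. if i = j then real (f j) else 0)"
    proof (rule sum.cong[OF refl])
      fix i
      show "real (f i) / \<rho> i * (\<Sum>k\<in>UNIV. \<mu> k i * \<mu> k j) = (if i = j then real (f j) else 0)"
        using eigenframe_normals_orthogonal[OF u0 E0, of i j] \<rho>[of j] by (auto simp: \<mu>_def[symmetric] \<rho>_def[symmetric])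
    qed
    finally show ?thesis by simp
  qed
  define Tc where "Tc u = (\<Sum>k\<in>UNIV. c k *\<^sub>R T k u)" for u
  have Tcv: "Tc u *v x = (\<Sum>k\<in>UNIV. c k *\<^sub>R (T k u *v x))" for u x
    by (simp add: Tc_def bounded_bilinear.sum_left[OF bounded_bilinear_matrix_vector]
            bounded_bilinear.scaleR_left[OF bounded_bilinear_matrix_vector])
  have Tc0: "Tc u0 *v E0 j = real (f j) *\<^sub>R E0 j" for j
    using E0 c[of j] unfolding Tcv by (simp add: eigenframe_def \<mu>_def scaleR_sum_left[symmetric])
  have Tc_adj: "(Tc u *v x) \<bullet> (G u *v y) = x \<bullet> (G u *v (Tc u *v y))" if "u \<in> V" for u x y
    unfolding Tcv by (simp add: inner_sum_left inner_sum_right T_adjoint[OF that] linear_sum[OF matrix_vector_mul_linear] matrix_vector_mult_scaleR)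
  have Tc_comm: "Tc u *v (T k u *v x) = T k u *v (Tc u *v x)" if "u \<in> V" for u k x
    unfolding Tcv by (simp add: T_commute_vec[OF that, of _ k] linear_sum[OF matrix_vector_mul_linear] matrix_vector_mult_scaleR)
  define P where "P = (\<chi> r c. E0 c $ r)"
  define Q where "Q = transpose P ** G u0"
  have Pv: "P *v x = (\<Sum>j\<in>UNIV. x $ j *\<^sub>R E0 j)" for x
    by (simp add: P_def matrix_vector_mult_def vec_eq_iff mult.commute)
  have PE: "P *v axis j 1 = E0 j" for j by (simp add: matrix_vector_mult_axis column_def P_def vec_eq_iff)
  have Qv: "(Q *v x) $ j = E0 j \<bullet> (G u0 *v x)" for x j
  proof -
    have "(transpose P *v y) $ j = E0 j \<bullet> y" for y
      by (simp add: transpose_def P_def matrix_vector_mult_def inner_vec_def)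
    then show ?thesis by (simp add: Q_def matrix_vector_mul_assoc[symmetric])
  qed
  have PQ: "P *v (Q *v x) = x" for x
    using form_orthonormal_expand[of E0 "G u0" x] E0 by (simp add: Pv Qv eigenframe_def)
  have QE: "Q *v E0 j = axis j 1" for j using E0 by (simp add: vec_eq_iff Qv eigenframe_def axis_def)
  \<comment> \<open>\<open>Tc\<close> in the basis \<open>E0\<close> of the base point, where its
    matrix is diagonal with distinct entries.\<close>
  define S where "S u = Q ** Tc u ** P" for u
  have sTc: "smooth_on V Tc" unfolding Tc_def[abs_def] by (intro smooth_intros open_domain smooth_T)
  have sS: "smooth_on V S" unfolding S_def[abs_def] by (intro smooth_intros open_domain sTc)
  have Sdiag: "S u0 $ r $ j = (if r = j then real (f r) else 0)" for r j
  proof -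
    have "S u0 *v axis j 1 = Q *v (Tc u0 *v (P *v axis j 1))" by (simp add: S_def matrix_vector_mul_assoc matrix_mul_assoc)
    also have "\<dots> = real (f j) *\<^sub>R axis j 1" by (simp add: PE Tc0 matrix_vector_mult_scaleR QE)
    finally have "column j (S u0) = real (f j) *\<^sub>R axis j 1" by (simp add: matrix_vector_mult_axis)
    from arg_cong[OF this, of "\<lambda>v. v $ r"] show ?thesis by (simp add: column_def axis_def)
  qed
  have "\<exists>W x. open W \<and> u0 \<in> W \<and> W \<subseteq> V \<and> smooth_on W x \<and> x u0 = axis i 1 \<and>
    (\<forall>u\<in>W. x u $ i = 1 \<and> S u *v x u = (S u *v x u) $ i *\<^sub>R x u)" for i
    by (rule smooth_eigenvector[OF open_domain sS u0 Sdiag]) (use f in \<open>auto simp: inj_eq\<close>)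
  then obtain Wi x where Wi: "\<And>i. open (Wi i)" "\<And>i. u0 \<in> Wi i" "\<And>i. Wi i \<subseteq> V" "\<And>i. smooth_on (Wi i) (x i)"
    "\<And>i. x i u0 = axis i 1" "\<And>i u. u \<in> Wi i \<Longrightarrow> x i u $ i = 1"
    "\<And>i u. u \<in> Wi i \<Longrightarrow> S u *v x i u = (S u *v x i u) $ i *\<^sub>R x i u" by metis
  define W0 where "W0 = (\<Inter>i. Wi i)"
  have W0: "open W0" "u0 \<in> W0" "W0 \<subseteq> V"
    using Wi(1,2) Wi(3)[of undefined] unfolding W0_def by auto
  have sx: "smooth_on W0 (x i)" for i using Wi(4)[of i] by (rule smooth_on_subset) (auto simp: W0_def)
  define l where "l i u = (S u *v x i u) $ i" for i u
  have sl: "smooth_on W0 (l i)" for i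
    unfolding l_def[abs_def] by (intro smooth_intros W0 sx smooth_on_subset[OF sS])
  have l0: "l i u0 = real (f i)" for i
    by (simp add: l_def Wi(5) matrix_vector_mult_axis column_def Sdiag)
  \<comment> \<open>Where the eigenvalues stay distinct, the eigenvectors of the self-adjoint
    \<open>Tc\<close> are orthogonal and its eigenspaces are lines.\<close>
  define W where "W = {u \<in> W0. \<forall>i j. i \<noteq> j \<longrightarrow> l i u \<noteq> l j u}"
  have oW: "open W"
  proof -
    have "W = (\<Inter>p\<in>{p. fst p \<noteq> snd p}. W0 \<inter> (\<lambda>u. l (fst p) u - l (snd p) u) -` (- {0})) \<inter> W0"
      by (auto simp: W_def)
    moreover have "open (W0 \<inter> (\<lambda>u. l (fst p) u - l (snd p) u) -` (- {0}))" for p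
      by (rule continuous_open_preimage[OF smooth_on_continuous W0(1) open_Compl[OF closed_singleton]]) (intro smooth_intros W0 sl)
    ultimately show ?thesis using W0(1) by (metis (no_types, lifting) finite open_INT open_Int)
  qed
  have u0W: "u0 \<in> W" using W0 f by (auto simp: W_def l0 inj_eq)
  have WV: "W \<subseteq> V" "W \<subseteq> W0" using W0 by (auto simp: W_def)
  define \<xi> where "\<xi> i u = P *v x i u" for i u
  have s\<xi>: "smooth_on W (\<xi> i)" for i
    unfolding \<xi>_def[abs_def] by (intro smooth_intros oW smooth_on_subset[OF sx WV(2)])
  have \<xi>0: "\<xi> i u \<noteq> 0" if "u \<in> W" for i u
  proof
    assume "\<xi> i u = 0"
    have inj: "inj ((*v) P)"
    proof -
      have "surj ((*v) P)" using PQ by (metis surjI)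
      then show ?thesis using linear_surj_imp_inj[OF matrix_vector_mul_linear, of P] by blast
    qed
    have "x i u = 0" using \<open>\<xi> i u = 0\<close> inj by (simp add: \<xi>_def linear_injective_0[OF matrix_vector_mul_linear])
    then show False using Wi(6)[of u i] that WV by (auto simp: W0_def)
  qed
  have T\<xi>: "Tc u *v \<xi> i u = l i u *\<^sub>R \<xi> i u" if "u \<in> W" for i u
  proof -
    have "Tc u *v \<xi> i u = P *v (Q *v (Tc u *v (P *v x i u)))" by (simp add: PQ \<xi>_def)
    also have "\<dots> = P *v (S u *v x i u)" by (simp add: S_def matrix_vector_mul_assoc matrix_mul_assoc)
    also have "\<dots> = P *v (l i u *\<^sub>R x i u)" using Wi(7)[of u i] that WV by (auto simp: W0_def l_def)
    finally show ?thesis by (simp add: matrix_vector_mult_scaleR \<xi>_def)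
  qed
  define E where "E i u = (1 / sqrt (\<xi> i u \<bullet> (G u *v \<xi> i u))) *\<^sub>R \<xi> i u" for i u
  have pos: "\<xi> i u \<bullet> (G u *v \<xi> i u) > 0" if "u \<in> W" for i u using first_ff_pos \<xi>0[OF that] WV that by blast
  have sE: "smooth_on W (E i)" for i
    unfolding E_def[abs_def] using pos
    by (intro smooth_intros oW s\<xi> smooth_on_subset[OF smooth_first_ff WV(1)]) (auto simp: less_imp_neq[symmetric])
  have TE: "Tc u *v E i u = l i u *\<^sub>R E i u" if "u \<in> W" for i u
    by (simp add: E_def matrix_vector_mult_scaleR T\<xi>[OF that])
  have dl: "l i u \<noteq> l j u" if "u \<in> W" "i \<noteq> j" for i j u using that by (auto simp: W_def)
  have "eigenframe u (\<lambda>i. E i u)" if u: "u \<in> W" for u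
  proof (rule eigenframeI)
    show uV: "u \<in> V" using u WV by blast
    show on: "E i u \<bullet> (G u *v E j u) = (if i = j then 1 else 0)" for i j
    proof (cases "i = j")
      case True
      then show ?thesis using pos[OF u, of j] by (simp add: E_def matrix_vector_mult_scaleR)
    next
      case False
      have "l i u * (E i u \<bullet> (G u *v E j u)) = l j u * (E i u \<bullet> (G u *v E j u))"
        using Tc_adj[OF uV, of "E i u" "E j u"] by (simp add: TE[OF u] matrix_vector_mult_scaleR)
      then show ?thesis using dl[OF u False] False by simp
    qed
    fix k i
    define v where "v = T k u *v E i u"
    \<comment> \<open>\<open>T k\<close> maps E_i into the eigenspace of \<open>Tc\<close> that
      contains E_i, so the components along the other eigenvectors vanish.\<close>
    have "E j u \<bullet> (G u *v v) = 0" if "j \<noteq> i" for j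
    proof -
      have "Tc u *v v = l i u *\<^sub>R v" unfolding v_def by (simp add: Tc_comm[OF uV] TE[OF u] matrix_vector_mult_scaleR)
      then have "l j u * (E j u \<bullet> (G u *v v)) = l i u * (E j u \<bullet> (G u *v v))"
        using Tc_adj[OF uV, of "E j u" v] by (simp add: TE[OF u] matrix_vector_mult_scaleR)
      then show ?thesis using dl[OF u that] by simp
    qed
    then have "(\<Sum>j\<in>UNIV. (E j u \<bullet> (G u *v v)) *\<^sub>R E j u) = (\<Sum>j\<in>UNIV. (if j = i then E i u \<bullet> (G u *v v) else 0) *\<^sub>R E j u)"
      by (intro sum.cong) auto
    then have "v = (E i u \<bullet> (G u *v v)) *\<^sub>R E i u"
      using form_orthonormal_expand[of "\<lambda>j. E j u" "G u" v] on by (simp add: sum_if_scaleR)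
    then show "\<exists>l. T k u *v E i u = l *\<^sub>R E i u" unfolding v_def by blast
  qed
  then show ?thesis using oW u0W WV sE by blast
qed

end

section \<open>Integration of the eigenframe to coordinates\<close>

lemma first_ff_compose:
  assumes "g differentiable (at y)" "Y differentiable (at (g y))"
  shows "first_ff (Y \<circ> g) y $ i $ j = pd i g y \<bullet> (first_ff Y (g y) *v pd j g y)"
  by (simp add: first_ff_nth pd_compose[OF assms] first_ff_form)

lemma second_ff_compose:
  assumes "g differentiable (at y)" "Y differentiable (at (g y))" "\<epsilon> differentiable (at (g y))"
  shows "second_ff (Y \<circ> g) (\<epsilon> \<circ> g) y $ i $ j = pd i g y \<bullet> (second_ff Y \<epsilon> (g y) *v pd j g y)"
  by (simp add: second_ff_def pd_compose[OF assms(1,2)] pd_compose[OF assms(1,3)] inner_vec_def matrix_vector_mult_def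
      lorentz_sum_left lorentz_scaleR_left sum_distrib_left)
    (simp add: lorentz_sum_right lorentz_scaleR_right sum_distrib_left mult_ac)

text \<open>The forms \<open>\<omega>\<^sub>i = \<bar>\<mu>\<^sub>i\<bar> \<langle>\<cdot>, e\<^sub>i\<rangle>\<close>, \<open>\<mu>\<^sub>i\<close> the curvature normals, are closed because
  \<open>d\<epsilon>\<^sub>k = \<Sum>\<^sub>j a\<^bsub>kj\<^esub> \<omega>\<^sub>j e\<^sub>j\<close> and the \<open>a\<^sub>j = \<mu>\<^sub>j / \<bar>\<mu>\<^sub>j\<bar>\<close> are orthonormal by the Gauss equation;
  their primitives are the line of curvature coordinates.\<close>

theorem (in nondegenerate_immersion) curvature_coordinates:
  assumes u0: "u0 \<in> V"
  shows "\<exists>B g O\<^sub>g x A b. open B \<and> connected B \<and> homeomorphism B O\<^sub>g g x \<and> open O\<^sub>g \<and> O\<^sub>g \<subseteq> V \<and> u0 \<in> O\<^sub>g \<and> smooth_on B g \<and>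
    (\<forall>y\<in>B. inj (frechet_derivative g (at y))) \<and> smooth_on B (A :: real ^ 'n \<Rightarrow> real ^ 'n ^ 'm) \<and> smooth_on B b \<and>
    (\<forall>y\<in>B. transpose (A y) ** A y = mat 1) \<and>
    (\<forall>y\<in>B. \<forall>i j. pd i g y \<bullet> (G (g y) *v pd j g y) = (if i = j then (b y $ i)\<^sup>2 else 0)) \<and>
    (\<forall>y\<in>B. \<forall>k i j. pd i g y \<bullet> (H k (g y) *v pd j g y) = (if i = j then A y $ k $ i * b y $ i else 0))"
proof -
  obtain W E where W: "open W" "u0 \<in> W" "W \<subseteq> V" and sE: "\<And>i. smooth_on W (E i)"
    and E: "\<And>u. u \<in> W \<Longrightarrow> eigenframe u (\<lambda>i. E i u)" using smooth_eigenframe[OF u0] by blast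
  have WV: "u \<in> V" if "u \<in> W" for u using that W by blast
  note sub = smooth_on_subset[OF _ W(3)]
  have on: "E i u \<bullet> (G u *v E j u) = (if i = j then 1 else 0)" if "u \<in> W" for i j u
    using E[OF that] by (simp add: eigenframe_def)
  define \<mu> where "\<mu> k i u = E i u \<bullet> (H k u *v E i u)" for k i u
  have TE: "T k u *v E i u = \<mu> k i u *\<^sub>R E i u" if "u \<in> W" for k i u
    using E[OF that] by (simp add: eigenframe_def \<mu>_def)
  have s\<mu>: "smooth_on W (\<mu> k i)" for k i
    unfolding \<mu>_def[abs_def] by (intro smooth_intros W sE sub smooth_H)
  define n2 where "n2 i u = (\<Sum>k\<in>UNIV. \<mu> k i u * \<mu> k i u)" for i u
  have n2: "n2 i u > 0" if u: "u \<in> W" for i u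
  proof -
    obtain k where "\<mu> k i u \<noteq> 0" using eigenframe_nonzero[OF WV[OF u] E[OF u], of i] by (auto simp: \<mu>_def)
    then show ?thesis unfolding n2_def by (intro sum_pos2[of _ k]) (auto simp: zero_less_mult_iff)
  qed
  define \<rho> where "\<rho> i u = sqrt (n2 i u)" for i u
  have \<rho>: "\<rho> i u > 0" "\<rho> i u \<noteq> 0" "\<rho> i u * \<rho> i u = n2 i u" if "u \<in> W" for i u
    using n2[OF that, of i] by (simp_all add: \<rho>_def)
  have s\<rho>: "smooth_on W (\<rho> i)" for i
    unfolding \<rho>_def[abs_def] using n2 unfolding n2_def[abs_def] by (intro smooth_intros W s\<mu>)
  define a where "a k i u = \<mu> k i u / \<rho> i u" for k i u
  have sa: "smooth_on W (a k i)" for k i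
    unfolding a_def[abs_def] using \<rho>(2) by (intro smooth_intros W s\<mu> s\<rho>)
  have aa: "(\<Sum>k\<in>UNIV. a k i u * a k j u) = (if i = j then 1 else 0)" if u: "u \<in> W" for i j u
  proof -
    have "(\<Sum>k\<in>UNIV. a k i u * a k j u) = (\<Sum>k\<in>UNIV. \<mu> k i u * \<mu> k j u) / (\<rho> i u * \<rho> j u)"
      by (simp add: a_def sum_divide_distrib)
    then show ?thesis
      using eigenframe_normals_orthogonal[OF WV[OF u] E[OF u], of i j] \<rho>[OF u, of j] n2[OF u, of j]
      by (auto simp: \<mu>_def[symmetric] n2_def[symmetric])
  qed
  define \<omega> where "\<omega> i u = \<rho> i u *\<^sub>R (G u *v E i u)" for i u
  have s\<omega>: "smooth_on W (\<omega> i)" for i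
    unfolding \<omega>_def[abs_def] by (intro smooth_intros W s\<rho> sE sub smooth_first_ff)
  define e where "e i u = (\<Sum>p\<in>UNIV. E i u $ p *\<^sub>R pd p Y u)" for i u
  have se: "smooth_on W (e i)" for i
    unfolding e_def[abs_def] by (intro smooth_intros W sE sub smooth)
  have ee: "e i u \<bullet>\<^sub>1 e j u = (if i = j then 1 else 0)" if "u \<in> W" for i j u
    using on[OF that, of i j] unfolding first_ff_form e_def .
  have se\<epsilon>: "smooth_on W (\<epsilon> k)" for k by (rule sub[OF smooth_frame])
  have pd\<epsilon>: "pd l (\<epsilon> k) u = (\<Sum>j\<in>UNIV. (a k j u * \<omega> j u $ l) *\<^sub>R e j u)" if u: "u \<in> W" for l k u
  proof -
    have "T k u $ p $ l = (\<Sum>j\<in>UNIV. a k j u * \<omega> j u $ l * E j u $ p)" for p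
    proof -
      have "E j u \<bullet> (G u *v axis l 1) = (G u *v E j u) $ l" for j
        using G_form_sym[of "E j u" u "axis l 1"] by (simp add: inner_axis')
      then have "axis l 1 = (\<Sum>j\<in>UNIV. (G u *v E j u) $ l *\<^sub>R E j u)"
        using form_orthonormal_expand[of "\<lambda>j. E j u" "G u" "axis l 1"] on[OF u] by simp
      then have "T k u *v axis l 1 = T k u *v (\<Sum>j\<in>UNIV. (G u *v E j u) $ l *\<^sub>R E j u)" by simp
      also have "\<dots> = (\<Sum>j\<in>UNIV. (G u *v E j u) $ l *\<^sub>R (T k u *v E j u))"
        by (simp only: linear_sum[OF matrix_vector_mul_linear] matrix_vector_mult_scaleR)
      finally have "column l (T k u) = (\<Sum>j\<in>UNIV. (G u *v E j u) $ l *\<^sub>R (\<mu> k j u *\<^sub>R E j u))"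
        by (simp add: matrix_vector_mult_axis TE[OF u])
      from arg_cong[OF this, of "\<lambda>v. v $ p"]
      have "T k u $ p $ l = (\<Sum>j\<in>UNIV. (G u *v E j u) $ l * (\<mu> k j u * E j u $ p))" by (simp add: column_def mult.assoc)
      moreover have "a k j u * \<omega> j u $ l = (G u *v E j u) $ l * \<mu> k j u" for j
        using \<rho>(2)[OF u] by (simp add: a_def \<omega>_def)
      ultimately show ?thesis by (simp only: mult.assoc)
    qed
    then have "pd l (\<epsilon> k) u = (\<Sum>p\<in>UNIV. \<Sum>j\<in>UNIV. (a k j u * \<omega> j u $ l * E j u $ p) *\<^sub>R pd p Y u)"
      by (simp add: pd_frame_T[OF WV[OF u]] scaleR_sum_left)
    also have "\<dots> = (\<Sum>j\<in>UNIV. (a k j u * \<omega> j u $ l) *\<^sub>R e j u)"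
      unfolding e_def scaleR_sum_right by (subst sum.swap) simp
    finally show ?thesis .
  qed
  have \<epsilon>e: "pd l (\<epsilon> k) u \<bullet>\<^sub>1 e i u = a k i u * \<omega> i u $ l" if u: "u \<in> W" for l k i u
    unfolding pd\<epsilon>[OF u] lorentz_sum_left lorentz_scaleR_left ee[OF u]
    using sum_if_mult(2)[of "\<lambda>j. a k j u * \<omega> j u $ l" i "\<lambda>_. 1"] by simp
  \<comment> \<open>Pairing with the unit vector a_i recovers the form from first derivatives of the
    parallel frame, whose second derivatives are symmetric.\<close>
  have \<omega>_eq: "\<omega> i u $ l = (\<Sum>k\<in>UNIV. a k i u * (pd l (\<epsilon> k) u \<bullet>\<^sub>1 e i u))" if u: "u \<in> W" for l i u
    using aa[OF u, of i i] by (simp add: \<epsilon>e[OF u] mult.assoc[symmetric] sum_distrib_right[symmetric])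
  have ae: "(\<Sum>k\<in>UNIV. a k i u *\<^sub>R pd l (\<epsilon> k) u) = \<omega> i u $ l *\<^sub>R e i u" if u: "u \<in> W" for i l u
  proof -
    have "(\<Sum>k\<in>UNIV. a k i u *\<^sub>R pd l (\<epsilon> k) u) = (\<Sum>k\<in>UNIV. \<Sum>j\<in>UNIV. (a k i u * a k j u * \<omega> j u $ l) *\<^sub>R e j u)"
      unfolding pd\<epsilon>[OF u] scaleR_sum_right by (simp add: mult.assoc)
    also have "\<dots> = (\<Sum>j\<in>UNIV. ((\<Sum>k\<in>UNIV. a k i u * a k j u) * \<omega> j u $ l) *\<^sub>R e j u)"
      by (subst sum.swap) (simp add: scaleR_sum_left sum_distrib_right)
    also have "\<dots> = (\<Sum>j\<in>UNIV. (if j = i then \<omega> i u $ l else 0) *\<^sub>R e j u)"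
      unfolding aa[OF u] by (intro sum.cong) auto
    finally show ?thesis by (simp add: sum_if_scaleR)
  qed
  have closed: "pd p (\<omega> i) u $ l = pd l (\<omega> i) u $ p" if u: "u \<in> W" for p i l u
  proof -
    note du = smooth_on_differentiable[OF _ u]
    \<comment> \<open>Only the term with second derivatives of the frame survives: those in which
      e_i or a_i is differentiated reduce to derivatives of their constant squared lengths.\<close>
    have D: "pd p (\<omega> i) u $ l = (\<Sum>k\<in>UNIV. a k i u * (pd p (pd l (\<epsilon> k)) u \<bullet>\<^sub>1 e i u))" for p l
    proof -
      have d: "(\<lambda>u. pd l (\<epsilon> k) u \<bullet>\<^sub>1 e i u) differentiable (at u)" for k
        by (rule du) (intro smooth_intros W se se\<epsilon>)
      have "pd p (\<omega> i) u $ l = pd p (\<lambda>u. \<omega> i u $ l) u" by (rule pd_vec_nth[OF du[OF s\<omega>], symmetric])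
      also have "\<dots> = pd p (\<lambda>u. \<Sum>k\<in>UNIV. a k i u * (pd l (\<epsilon> k) u \<bullet>\<^sub>1 e i u)) u"
        by (rule pd_cong[OF W(1) u \<omega>_eq du[OF smooth_on_vec_nth[OF W(1) s\<omega>]]])
      also have "\<dots> = (\<Sum>k\<in>UNIV. pd p (\<lambda>u. a k i u * (pd l (\<epsilon> k) u \<bullet>\<^sub>1 e i u)) u)"
        by (rule pd_sum) (rule differentiable_mult[OF du[OF sa] d])
      also have "\<dots> = (\<Sum>k\<in>UNIV. a k i u * (pd l (\<epsilon> k) u \<bullet>\<^sub>1 pd p (e i) u) + a k i u * (pd p (pd l (\<epsilon> k)) u \<bullet>\<^sub>1 e i u)
          + pd p (a k i) u * (pd l (\<epsilon> k) u \<bullet>\<^sub>1 e i u))"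
        by (simp add: pd_mult[OF du[OF sa] d] pd_lorentz[OF du[OF smooth_on_pd[OF se\<epsilon>]] du[OF se]] distrib_left)
      also have "\<dots> = (\<Sum>k\<in>UNIV. a k i u *\<^sub>R pd l (\<epsilon> k) u) \<bullet>\<^sub>1 pd p (e i) u + (\<Sum>k\<in>UNIV. a k i u * (pd p (pd l (\<epsilon> k)) u \<bullet>\<^sub>1 e i u))
          + (\<Sum>k\<in>UNIV. pd p (a k i) u * a k i u) * \<omega> i u $ l"
        by (simp add: sum.distrib \<epsilon>e[OF u] lorentz_sum_left lorentz_scaleR_left sum_distrib_left mult_ac)
      also have "(\<Sum>k\<in>UNIV. a k i u *\<^sub>R pd l (\<epsilon> k) u) \<bullet>\<^sub>1 pd p (e i) u = 0"
      proof -
        have "pd p (\<lambda>u. 1::real) u = pd p (\<lambda>u. e i u \<bullet>\<^sub>1 e i u) u"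
          by (rule pd_cong[OF W(1) u]) (use ee in auto)
        then have "e i u \<bullet>\<^sub>1 pd p (e i) u = 0" by (simp add: pd_lorentz[OF du[OF se] du[OF se]] lorentz_commute)
        then show ?thesis unfolding ae[OF u] by (simp add: lorentz_simps)
      qed
      also have "(\<Sum>k\<in>UNIV. pd p (a k i) u * a k i u) = 0"
      proof -
        have "pd p (\<lambda>u. 1::real) u = pd p (\<lambda>u. \<Sum>k\<in>UNIV. a k i u * a k i u) u"
          by (rule pd_cong[OF W(1) u]) (use aa in auto)
        also have "\<dots> = (\<Sum>k\<in>UNIV. pd p (\<lambda>u. a k i u * a k i u) u)"
          by (rule pd_sum) (rule differentiable_mult[OF du[OF sa] du[OF sa]])
        finally have "(\<Sum>k\<in>UNIV. 2 * (pd p (a k i) u * a k i u)) = 0" by (simp add: pd_mult[OF du[OF sa] du[OF sa]] mult.commute)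
        then show ?thesis by (simp add: sum_distrib_left[symmetric])
      qed
      finally show ?thesis by simp
    qed
    show ?thesis unfolding D using pd_commute[OF W(1) se\<epsilon> u, of p l] by simp
  qed
  \<comment> \<open>A ball, because potentials are constructed on convex sets.\<close>
  obtain r where r: "r > 0" "ball u0 r \<subseteq> W" using W openE by blast
  define B0 where "B0 = ball u0 r"
  have B0: "open B0" "convex B0" "u0 \<in> B0" "B0 \<subseteq> W" using r by (auto simp: B0_def)
  have "\<exists>f. smooth_on B0 f \<and> (\<forall>u\<in>B0. (f has_derivative (\<lambda>v. \<omega> i u \<bullet> v)) (at u))" for i
    by (rule poincare_lemma[OF B0(1-3) smooth_on_subset[OF s\<omega> B0(4)]]) (use closed B0(4) in blast)
  then obtain f where f: "\<And>i. smooth_on B0 (f i)" "\<And>i u. u \<in> B0 \<Longrightarrow> (f i has_derivative (\<lambda>v. \<omega> i u \<bullet> v)) (at u)" by metis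
  define x where "x u = (\<chi> i. f i u)" for u
  have sx: "smooth_on B0 x" unfolding x_def[abs_def] by (intro smooth_intros B0 f)
  have Dx: "frechet_derivative x (at u) v $ i = \<omega> i u \<bullet> v" if u: "u \<in> B0" for u v i
  proof -
    have "((\<lambda>u. x u $ i) has_derivative (\<lambda>v. frechet_derivative x (at u) v $ i)) (at u)"
      by (rule bounded_linear.has_derivative[OF bounded_linear_vec_nth smooth_on_has_derivative[OF sx u]])
    then have "(f i has_derivative (\<lambda>v. frechet_derivative x (at u) v $ i)) (at u)" by (simp add: x_def)
    from has_derivative_unique[OF this f(2)[OF u]] show ?thesis by metis
  qed
  have \<omega>v: "\<omega> i u \<bullet> v = \<rho> i u * (E i u \<bullet> (G u *v v))" for i u v
    using G_form_sym[of v u "E i u"] by (simp add: \<omega>_def inner_commute)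
  have expand: "v = (\<Sum>j\<in>UNIV. (\<omega> j u \<bullet> v / \<rho> j u) *\<^sub>R E j u)" if u: "u \<in> W" for u v
    using form_orthonormal_expand[of "\<lambda>j. E j u" "G u" v] on[OF u] \<rho>(2)[OF u] by (simp add: \<omega>v)
  have "inj (frechet_derivative x (at u0))"
    unfolding linear_injective_0[OF linear_frechet_derivative[OF smooth_on_differentiable[OF sx B0(3)]]]
  proof (intro allI impI)
    fix v assume "frechet_derivative x (at u0) v = 0"
    then have "\<omega> i u0 \<bullet> v = 0" for i using Dx[OF B0(3), of v i] by simp
    then show "v = 0" using expand[of u0 v] W by simp
  qed
  from smooth_inverse_function[OF B0(1) sx B0(3) this]
  obtain U' V' g where g: "open U'" "U' \<subseteq> B0" "u0 \<in> U'" "open V'" "x u0 \<in> V'" "homeomorphism U' V' x g" "smooth_on V' g"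
    "\<And>y v. y \<in> V' \<Longrightarrow> frechet_derivative x (at (g y)) (frechet_derivative g (at y) v) = v" by metis
  \<comment> \<open>Shrinking to a ball in the coordinate space makes the domain of the new chart
    connected.\<close>
  obtain s where s: "s > 0" "ball (x u0) s \<subseteq> V'" using g openE by blast
  define B where "B = ball (x u0) s"
  have B: "open B" "connected B" "x u0 \<in> B" "B \<subseteq> V'" using s by (auto simp: B_def)
  have gB: "g y \<in> U'" "g y \<in> B0" "g y \<in> W" "x (g y) = y" if "y \<in> B" for y
  proof -
    have yV: "y \<in> V'" using B(4) that by blast
    have "g y \<in> g ` V'" "g ` V' = U'" using yV g(6) by (auto simp: homeomorphism_def)
    then show 1: "g y \<in> U'" by simp
    then show "g y \<in> B0" "g y \<in> W" using g(2) B0(4) by blast+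
    show "x (g y) = y" using g(6) yV by (simp add: homeomorphism_def)
  qed
  have sg: "smooth_on B g" by (rule smooth_on_subset[OF g(7) B(4)])
  have hom: "homeomorphism B (g ` B) g x"
    using homeomorphism_of_subsets[OF homeomorphism_symD[OF g(6)] B(4)] g(6) B(4) by (auto simp: homeomorphism_def)
  have img: "g ` B = U' \<inter> x -` B"
  proof
    show "g ` B \<subseteq> U' \<inter> x -` B" using gB by auto
    show "U' \<inter> x -` B \<subseteq> g ` B" using g(6) by (force simp: homeomorphism_def image_iff)
  qed
  have q1: "open (g ` B)" unfolding img
    by (rule continuous_open_preimage[OF smooth_on_continuous[OF smooth_on_subset[OF sx g(2)]] g(1) B(1)])
  have q2: "g ` B \<subseteq> V" using gB WV by blast
  have q3: "u0 \<in> g ` B" unfolding img using g(3) B(3) by simp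
  have q4: "inj (frechet_derivative g (at y))" if "y \<in> B" for y
    using g(8)[of y] that B(4) by (intro inj_on_inverseI[where g="frechet_derivative x (at (g y))"]) auto
  \<comment> \<open>The coordinate fields are dual to the forms \<omega>_i, hence E_j / \<rho>_j; so
    b_j is the reciprocal length of the j-th curvature normal.\<close>
  have pdg: "pd j g y = (1 / \<rho> j (g y)) *\<^sub>R E j (g y)" if y: "y \<in> B" for y j
  proof -
    have "\<omega> i (g y) \<bullet> pd j g y = (if i = j then 1 else 0)" for i
      using Dx[OF gB(2)[OF y], of "pd j g y" i] g(8)[of y "axis j 1"] B(4) y by (auto simp: pd_def axis_def)
    then have "pd j g y = (\<Sum>i\<in>UNIV. (if i = j then 1 / \<rho> j (g y) else 0) *\<^sub>R E i (g y))"
      by (subst expand[OF gB(3)[OF y]]) (intro sum.cong, auto)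
    then show ?thesis by (simp add: sum_if_scaleR)
  qed
  define A where "A y = (\<chi> k i. a k i (g y))" for y
  define b where "b y = (\<chi> i. 1 / \<rho> i (g y))" for y
  have comp: "smooth_on B (\<lambda>y. h (g y))" if "smooth_on W h" for h :: "real ^ 'n \<Rightarrow> real"
    by (rule smooth_on_compose[OF B(1) W(1) that sg]) (use gB in blast)
  have q5: "smooth_on B A" unfolding A_def[abs_def] by (intro smooth_on_vec_lambda B comp sa)
  have q6: "smooth_on B b" unfolding b_def[abs_def]
    using \<rho>(2)[OF gB(3)] by (intro smooth_on_vec_lambda smooth_on_divide smooth_on_const B comp s\<rho>)
  have q7: "transpose (A y) ** A y = mat 1" if "y \<in> B" for y
    using aa[OF gB(3)[OF that]] by (simp add: vec_eq_iff matrix_matrix_mult_def transpose_def A_def mat_def)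
  have q8: "pd i g y \<bullet> (G (g y) *v pd j g y) = (if i = j then (b y $ i)\<^sup>2 else 0)" if "y \<in> B" for y i j
    by (simp add: pdg[OF that] matrix_vector_mult_scaleR on[OF gB(3)[OF that]] b_def power2_eq_square)
  have q9: "pd i g y \<bullet> (H k (g y) *v pd j g y) = (if i = j then A y $ k $ i * b y $ i else 0)" if y: "y \<in> B" for y i j k
    using eigenframe_H[OF WV[OF gB(3)[OF y]] E[OF gB(3)[OF y]], of i k j]
    by (simp add: pdg[OF y] matrix_vector_mult_scaleR A_def b_def a_def \<mu>_def)
  show ?thesis
    by (rule exI[of _ B], rule exI[of _ g], rule exI[of _ "g ` B"], rule exI[of _ x], rule exI[of _ A], rule exI[of _ b],
        intro conjI ballI allI)
      (fact B hom sg q1 q2 q3 | rule q4 q5 q6 q7 q8 q9, assumption?)+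
qed

theorem exists_adapted_coords:
  fixes U :: "(real ^ ('n::finite) option) set"
    and X :: "real ^ 'n option \<Rightarrow> real ^ (('m::finite) + 'n) option"
  assumes X: "local_isometric_immersion U X" and nondeg: "nondegenerate_normal_bundle U X"
    and frame: "parallel_normal_frame U X e" and p: "p \<in> U"
  shows "\<exists>V \<psi> A b. connected V \<and> p \<in> \<psi> ` V \<and> adapted_coords U X e V \<psi> A b"
proof -
  have U: "openin (top_of_set hyp) U" "U \<subseteq> hyp"
    using X openin_imp_subset unfolding local_isometric_immersion_def by blast+
  define V where "V = space_part ` U"
  have lp: "local_param U V hyp_graph" and img: "hyp_graph ` V = U"
    unfolding V_def by (rule local_param_hyp_graph[OF U(1)])+
  define Y where "Y = X \<circ> hyp_graph"
  define \<epsilon> where "\<epsilon> a = e a \<circ> hyp_graph" for a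
  interpret framed_immersion V Y \<epsilon>
    unfolding Y_def \<epsilon>_def[abs_def] by (rule framed_immersion_of_chart[OF X frame lp])
  interpret nondegenerate_immersion V Y \<epsilon> hyp_graph
  proof
    show "open V" by (rule open_domain)
    have "hyp_immersion V hyp_graph" by (rule local_param_hyp_immersion[OF U(2) lp])
    then show "smooth_on V hyp_graph" "\<And>u. u \<in> V \<Longrightarrow> hyp_graph u \<in> hyp"
      "\<And>u x. u \<in> V \<Longrightarrow> x \<noteq> 0 \<Longrightarrow> 0 < x \<bullet> (first_ff hyp_graph u *v x)" by (simp_all add: hyp_immersion_def)
    show "first_ff Y u = first_ff hyp_graph u" if "u \<in> V" for u
      using X lp that unfolding local_isometric_immersion_def Y_def by blast
    show "dim {shape_operator Y \<nu> u | \<nu>. \<nu> \<in> normal_space Y u} = CARD('n)" if "u \<in> V" for u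
      using nondeg lp that unfolding nondegenerate_normal_bundle_def Y_def by blast
  qed
  have u0: "space_part p \<in> V" using p by (simp add: V_def)
  from curvature_coordinates[OF u0] obtain B g O\<^sub>g x A b where B: "open B" "connected B" "homeomorphism B O\<^sub>g g x"
    "open O\<^sub>g" "O\<^sub>g \<subseteq> V" "space_part p \<in> O\<^sub>g" "smooth_on B g" "\<forall>y\<in>B. inj (frechet_derivative g (at y))"
    and A: "smooth_on B (A :: real ^ 'n \<Rightarrow> real ^ 'n ^ 'm)" "smooth_on B b" "\<forall>y\<in>B. transpose (A y) ** A y = mat 1"
    and ff: "\<forall>y\<in>B. \<forall>i j. pd i g y \<bullet> (G (g y) *v pd j g y) = (if i = j then (b y $ i)\<^sup>2 else 0)"
      "\<forall>y\<in>B. \<forall>k i j. pd i g y \<bullet> (H k (g y) *v pd j g y) = (if i = j then A y $ k $ i * b y $ i else 0)"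
    by blast
  define \<psi> where "\<psi> = hyp_graph \<circ> g"
  have gB: "g ` B = O\<^sub>g" using B(3) by (simp add: homeomorphism_def)
  have gV: "g y \<in> V" if "y \<in> B" for y using gB B(5) that by blast
  have dg: "g differentiable (at y)" if "y \<in> B" for y by (rule smooth_on_differentiable[OF B(7) that])
  have hg: "hyp_graph differentiable (at u)" for u :: "real ^ 'n"
    by (rule smooth_on_differentiable[OF smooth_hyp_graph[OF open_UNIV] UNIV_I])
  have lp\<psi>: "local_param U B \<psi>"
    unfolding local_param_def
  proof (intro conjI ballI B)
    have "smooth_on B (\<lambda>y. hyp_graph (g y))"
      by (rule smooth_on_compose[OF B(1) open_UNIV smooth_hyp_graph[OF open_UNIV] B(7)]) simp
    then show "smooth_on B \<psi>" by (simp add: \<psi>_def o_def)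
    show "inj (frechet_derivative \<psi> (at y))" if y: "y \<in> B" for y
      unfolding \<psi>_def frechet_derivative_compose[OF dg[OF y] hg]
      using B(8) y lp gV[OF y] by (intro inj_compose) (auto simp: local_param_def)
    obtain \<phi> where \<phi>: "homeomorphism V U hyp_graph \<phi>" using lp img unfolding local_param_def by auto
    have im: "\<psi> ` B = hyp_graph ` O\<^sub>g" by (simp only: \<psi>_def image_comp[symmetric] gB)
    show "openin (top_of_set U) (\<psi> ` B)"
      unfolding im by (rule homeomorphism_imp_open_map[OF \<phi>]) (use B open_domain in \<open>simp add: openin_open_eq\<close>)
    have "homeomorphism O\<^sub>g (hyp_graph ` O\<^sub>g) hyp_graph \<phi>"
      using homeomorphism_of_subsets[OF \<phi> B(5)] \<phi> B(5) by (auto simp: homeomorphism_def)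
    from homeomorphism_compose[OF B(3) this]
    show "\<exists>\<phi>. homeomorphism B (\<psi> ` B) \<psi> \<phi>" unfolding im unfolding \<psi>_def by blast
  qed
  have X\<psi>: "X \<circ> \<psi> = Y \<circ> g" "e k \<circ> \<psi> = \<epsilon> k \<circ> g" for k by (simp_all add: \<psi>_def Y_def \<epsilon>_def o_assoc)
  have f1: "first_ff (X \<circ> \<psi>) y $ i $ j = (if i = j then (b y $ i)\<^sup>2 else 0)" if y: "y \<in> B" for y i j
    unfolding X\<psi> first_ff_compose[OF dg[OF y] diff_Y[OF gV[OF y]]] using ff(1) y by blast
  have f2: "second_ff (X \<circ> \<psi>) (e k \<circ> \<psi>) y $ i $ j = (if i = j then A y $ k $ i * b y $ i else 0)" if y: "y \<in> B" for y i j k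
    unfolding X\<psi> second_ff_compose[OF dg[OF y] diff_Y[OF gV[OF y]] diff_frame[OF gV[OF y]]] using ff(2) y by blast
  have "line_of_curvature_coords X e B \<psi>"
    unfolding line_of_curvature_coords_def
    by (rule exI[of _ b], rule exI[of _ "\<lambda>y. \<chi> k i. A y $ k $ i * b y $ i"]) (simp add: f1 f2)
  then have "adapted_coords U X e B \<psi> A b"
    unfolding adapted_coords_def using lp\<psi> A f1 f2 by blast
  moreover have "p \<in> \<psi> ` B"
  proof -
    have "hyp_graph (space_part p) = p" using hyp_graph_space_part U(2) p by blast
    then show ?thesis using B(6) unfolding gB[symmetric] \<psi>_def by force
  qed
  ultimately show ?thesis using B(2) by blast
qed

subsection \<open>Umbilic hypersurfaces\<close>

text \<open>The vectors \<open>a\<close>, \<open>\<nu>\<close> and \<open>t i\<close> are k + 1 in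
  number with a block diagonal Gram matrix of trivial kernel, hence a basis. The bijection
  \<open>\<sigma>\<close> only relabels \<open>'k\<close> as \<open>'q option\<close>.\<close>

lemma codim_one_complete:
  fixes t :: "'q::finite \<Rightarrow> real ^ ('k::finite) option"
  assumes card: "CARD('q) + 1 = CARD('k)"
    and a: "a \<bullet>\<^sub>1 a = -1" "\<And>i. t i \<bullet>\<^sub>1 a = 0" and \<nu>: "\<nu> \<bullet>\<^sub>1 a = 0" "\<And>i. t i \<bullet>\<^sub>1 \<nu> = 0" "\<nu> \<bullet>\<^sub>1 \<nu> > 0"
    and gram: "\<And>c. (\<And>j. (\<Sum>i\<in>UNIV. c i * (t i \<bullet>\<^sub>1 t j)) = 0) \<Longrightarrow> (\<And>i. c i = 0)"
    and x: "x \<bullet>\<^sub>1 a = 0" "x \<bullet>\<^sub>1 \<nu> = 0" "\<And>i. x \<bullet>\<^sub>1 t i = 0"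
  shows "x = 0"
proof -
  have "card (UNIV :: 'k set) = card (UNIV :: 'q option set)" using card by simp
  then obtain \<sigma> :: "'k \<Rightarrow> 'q option" where "bij_betw \<sigma> UNIV UNIV"
    using finite_same_card_bij[of "UNIV :: 'k set" "UNIV :: 'q option set"] by auto
  then have \<sigma>: "bij \<sigma>" .
  define f where "f r = (case r of None \<Rightarrow> a | Some j \<Rightarrow> (case \<sigma> j of None \<Rightarrow> \<nu> | Some i \<Rightarrow> t i))" for r
  define j where "j i = inv \<sigma> i" for i
  have \<sigma>j: "\<sigma> (j i) = i" for i unfolding j_def using \<sigma> by (simp add: bij_is_surj surj_f_inv_f)
  have j\<sigma>: "j (\<sigma> i) = i" for i unfolding j_def using \<sigma> by (simp add: bij_is_inj)
  have fs: "f None = a" "f (Some (j None)) = \<nu>" "f (Some (j (Some i))) = t i" for i by (simp_all add: f_def \<sigma>j)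
  have sumf: "(\<Sum>r\<in>UNIV. h r) = h None + h (Some (j None)) + (\<Sum>i\<in>UNIV. h (Some (j (Some i))))"
    for h :: "'k option \<Rightarrow> 'c::comm_monoid_add"
  proof -
    have "(\<Sum>l\<in>UNIV. h (Some l)) = (\<Sum>i\<in>UNIV. h (Some (j i)))"
      by (rule sum.reindex_bij_witness[of _ j \<sigma>]) (simp_all add: \<sigma>j j\<sigma>)
    then show ?thesis by (simp add: sum_UNIV_option add.assoc)
  qed
  have sym: "a \<bullet>\<^sub>1 t i = 0" "\<nu> \<bullet>\<^sub>1 t i = 0" "a \<bullet>\<^sub>1 \<nu> = 0" for i using a \<nu> by (simp_all add: lorentz_commute)
  have cases: "P r" if "P None" "P (Some (j None))" "\<And>i. P (Some (j (Some i)))" for P r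
    using that j\<sigma> by (metis option.exhaust)
  have gr: "c r = 0" if c: "\<And>s. (\<Sum>r\<in>UNIV. c r * (f r \<bullet>\<^sub>1 f s)) = 0" for c r
  proof -
    have "c None = 0" using c[of None] a \<nu> by (simp add: sumf fs)
    moreover have "c (Some (j None)) = 0" using c[of "Some (j None)"] a \<nu> sym by (simp add: sumf fs)
    moreover have "c (Some (j (Some i))) = 0" for i
      by (rule gram[of "\<lambda>i. c (Some (j (Some i)))"]) (use c[of "Some (j (Some l))" for l] a \<nu> sym in \<open>simp add: sumf fs\<close>)
    ultimately show "c r = 0" by (rule cases)
  qed
  show "x = 0"
  proof (rule lorentz_frame_complete[of f])
    show "c r = 0" if "\<And>s. (\<Sum>r\<in>UNIV. c r * (f r \<bullet>\<^sub>1 f s)) = 0" for c r using gr that by blast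
    fix s show "x \<bullet>\<^sub>1 f s = 0" by (rule cases) (simp_all add: fs x)
  qed
qed

lemma exists_ne_of_card:
  assumes "2 \<le> CARD('q::finite)"
  shows "\<exists>i. i \<noteq> (j :: 'q)"
proof (rule ccontr)
  assume "\<not> ?thesis"
  then have "UNIV = {j}" by auto
  then have "CARD('q) = card {j}" by simp
  then show False using assms by simp
qed

section \<open>Local geometry of hypersurfaces\<close>

locale hypersurface_immersion = hyp_immersion V Y
  for V :: "(real ^ 'q::finite) set" and Y :: "real ^ 'q \<Rightarrow> real ^ ('k::finite) option" +
  assumes codim: "CARD('q) + 1 = CARD('k)"
begin

lemma tangent_gram:
  assumes u: "u \<in> V" and c: "\<And>j. (\<Sum>i\<in>UNIV. c i * (pd i Y u \<bullet>\<^sub>1 pd j Y u)) = 0"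
  shows "c i = 0"
proof -
  have "first_ff Y u *v (\<chi> i. c i) = 0"
    using c by (simp add: vec_eq_iff matrix_vector_mult_def first_ff_nth mult.commute lorentz_commute)
  then have "(\<chi> i. c i) = 0" using first_ff_pos[OF u, of "\<chi> i. c i"] by force
  then show ?thesis by (simp add: vec_eq_iff)
qed

lemma complete:
  assumes u: "u \<in> V" and \<nu>: "\<nu> \<in> normal_space Y u" "\<nu> \<noteq> 0"
    and x: "x \<bullet>\<^sub>1 Y u = 0" "x \<bullet>\<^sub>1 \<nu> = 0" "\<And>i. x \<bullet>\<^sub>1 pd i Y u = 0"
  shows "x = 0"
proof (rule codim_one_complete[OF codim norm_Y[OF u]])
  show "pd i Y u \<bullet>\<^sub>1 Y u = 0" for i by (rule tangent_orthogonal[OF u])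
  show "\<nu> \<bullet>\<^sub>1 Y u = 0" "pd i Y u \<bullet>\<^sub>1 \<nu> = 0" for i using \<nu> by (simp_all add: normal_space_def lorentz_commute)
  then show "\<nu> \<bullet>\<^sub>1 \<nu> > 0" using spacelike_of_orthogonal[OF u] \<nu> by blast
  show "c i = 0" if "\<And>j. (\<Sum>i\<in>UNIV. c i * (pd i Y u \<bullet>\<^sub>1 pd j Y u)) = 0" for c i using tangent_gram[OF u that] .
qed (use x in auto)

lemma normal_spacelike: "u \<in> V \<Longrightarrow> \<nu> \<in> normal_space Y u \<Longrightarrow> \<nu> \<noteq> 0 \<Longrightarrow> \<nu> \<bullet>\<^sub>1 \<nu> > 0"
  using spacelike_of_orthogonal by (simp add: normal_space_def)

lemma normal_line:
  assumes u: "u \<in> V" and \<nu>: "\<nu> \<in> normal_space Y u" "\<nu> \<noteq> 0" and \<nu>': "\<nu>' \<in> normal_space Y u"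
  shows "\<nu>' = ((\<nu>' \<bullet>\<^sub>1 \<nu>) / (\<nu> \<bullet>\<^sub>1 \<nu>)) *\<^sub>R \<nu>"
proof -
  have "\<nu>' - ((\<nu>' \<bullet>\<^sub>1 \<nu>) / (\<nu> \<bullet>\<^sub>1 \<nu>)) *\<^sub>R \<nu> = 0"
    by (rule complete[OF u \<nu>]) (use \<nu> \<nu>' normal_spacelike[OF u \<nu>] in \<open>simp_all add: lorentz_simps normal_space_def\<close>)
  then show ?thesis by simp
qed

text \<open>The q + 1 vectors \<open>Y u\<close> and \<open>pd i Y u\<close> cannot span a space of
  dimension q + 2, and a Euclidean normal to their time-flipped copies is a Lorentz normal to the
  vectors themselves.\<close>

lemma normal_exists:
  assumes u: "u \<in> V"
  shows "\<exists>\<nu>\<in>normal_space Y u. \<nu> \<noteq> 0"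
proof -
  let ?S = "insert (time_flip (Y u)) (range (\<lambda>i. time_flip (pd i Y u)))"
  have "dim ?S \<le> card ?S" by (rule dim_le_card') simp
  also have "\<dots> \<le> Suc (card (range (\<lambda>i. time_flip (pd i Y u))))" by (rule card_insert_le_m1) auto
  also have "\<dots> \<le> Suc CARD('q)" using card_image_le[of "UNIV :: 'q set" "\<lambda>i. time_flip (pd i Y u)"] by simp
  also have "\<dots> < DIM(real ^ 'k option)" using codim by simp
  finally obtain \<nu> where \<nu>: "\<nu> \<noteq> 0" "\<And>y. y \<in> span ?S \<Longrightarrow> orthogonal \<nu> y"
    using orthogonal_to_subspace_exists by blast
  have "\<nu> \<bullet>\<^sub>1 y = 0" if "time_flip y \<in> ?S" for y
    using \<nu>(2)[OF span_base[OF that]] by (simp add: lorentz_eq_inner orthogonal_def)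
  then have "\<nu> \<in> normal_space Y u" by (simp add: normal_space_def)
  then show ?thesis using \<nu>(1) by blast
qed

text \<open>Differentiating the equation of the hyperplane makes p orthogonal to the tangent
  vectors, and adding l Y removes its component along \<open>Y\<close>: p + l Y is the normal of the
  section inside \<open>hyp\<close>.\<close>

lemma hyperplane_normal:
  assumes pl: "\<And>x. x \<in> V \<Longrightarrow> p \<bullet>\<^sub>1 Y x = l" and u: "u \<in> V"
  shows "p \<bullet>\<^sub>1 pd i Y u = 0" "p \<bullet>\<^sub>1 pd i (pd j Y) u = 0" "p + l *\<^sub>R Y u \<in> normal_space Y u"
    "(p + l *\<^sub>R Y u) \<bullet>\<^sub>1 (p + l *\<^sub>R Y u) = p \<bullet>\<^sub>1 p + l * l"
    "(p + l *\<^sub>R Y u) \<bullet>\<^sub>1 pd i (pd j Y) u = - (l * first_ff Y u $ i $ j)"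
proof -
  have 1: "p \<bullet>\<^sub>1 pd i Y u = 0" if u: "u \<in> V" for i u
    using orthogonal_derivative[OF u differentiable_const diff_Y[OF u], of p l i] pl by (simp add: lorentz_simps)
  then show "p \<bullet>\<^sub>1 pd i Y u = 0" using u by blast
  show 2: "p \<bullet>\<^sub>1 pd i (pd j Y) u = 0" for j
    using orthogonal_derivative[OF u differentiable_const diff_pd[OF u], of p j 0 i] 1 by (simp add: lorentz_simps)
  show "p + l *\<^sub>R Y u \<in> normal_space Y u"
    using 1[OF u] by (simp add: normal_space_def lorentz_simps norm_Y[OF u] pl[OF u] tangent_orthogonal'[OF u])
  show "(p + l *\<^sub>R Y u) \<bullet>\<^sub>1 (p + l *\<^sub>R Y u) = p \<bullet>\<^sub>1 p + l * l"
    by (simp add: lorentz_simps norm_Y[OF u] pl[OF u] lorentz_commute[of "Y u" p])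
  show "(p + l *\<^sub>R Y u) \<bullet>\<^sub>1 pd i (pd j Y) u = - (l * first_ff Y u $ i $ j)"
    using pd_pd_orthogonal[OF u, of i j] by (simp add: lorentz_simps 2 lorentz_commute)
qed

lemma hyperplane_shape_operator:
  assumes pl: "\<And>x. x \<in> V \<Longrightarrow> p \<bullet>\<^sub>1 Y x = l" and u: "u \<in> V"
  shows "shape_operator Y (c *\<^sub>R (p + l *\<^sub>R Y u)) u = mat (c * l)"
proof -
  have "second_ff_vec Y (c *\<^sub>R (p + l *\<^sub>R Y u)) u = (c * l) *\<^sub>R first_ff Y u"
    by (simp add: second_ff_vec_def vec_eq_iff lorentz_scaleR_left hyperplane_normal(5)[OF pl u])
  moreover have "(c * l) *\<^sub>R (mat 1 :: real ^ 'q ^ 'q) = mat (c * l)" by (simp add: mat_def vec_eq_iff)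
  ultimately show ?thesis
    by (simp add: shape_operator_def bounded_bilinear.scaleR_right[OF bounded_bilinear_matrix_mul]
        matrix_inv_inverse(2)[OF invertible_first_ff[OF u]])
qed

text \<open>All second normals are metric coefficients times one vector Y - (l / \<rho>) \<nu>, with
  \<nu> = p + l Y. By the Gauss equation its square l^2 / \<rho> - 1 is the curvature.\<close>

lemma hyperplane_curvature:
  assumes pl: "\<And>x. x \<in> V \<Longrightarrow> p \<bullet>\<^sub>1 Y x = l" and \<rho>: "p \<bullet>\<^sub>1 p + l * l > 0" and u: "u \<in> V"
    and ind: "x \<noteq> y" "independent {x, y}"
  shows "sectional_curvature (first_ff Y) u x y = l * l / (p \<bullet>\<^sub>1 p + l * l) - 1"
proof (rule sectional_curvature_eq[OF u _ ind])
  define \<nu> where "\<nu> = p + l *\<^sub>R Y u"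
  define \<rho> where "\<rho> = p \<bullet>\<^sub>1 p + l * l"
  note hn = hyperplane_normal[OF pl u, folded \<nu>_def \<rho>_def]
  have \<nu>0: "\<nu> \<noteq> 0" using hn(4) \<rho> unfolding \<rho>_def[symmetric] by (auto simp: lorentz_simps)
  have \<rho>0: "\<rho> \<noteq> 0" using \<rho> by (simp add: \<rho>_def)
  have YN: "\<nu> \<bullet>\<^sub>1 Y u = 0" "Y u \<bullet>\<^sub>1 \<nu> = 0" "\<nu> \<bullet>\<^sub>1 pd i Y u = 0" for i
    using hn(3) by (simp_all add: normal_space_def lorentz_commute)
  have N: "second_normal i j u = first_ff Y u $ i $ j *\<^sub>R (Y u - (l / \<rho>) *\<^sub>R \<nu>)" for i j
  proof -
    have "second_normal i j u \<bullet>\<^sub>1 \<nu> = - (l * first_ff Y u $ i $ j)"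
      using hn(5)[of i j] YN by (simp add: second_normal_def lorentz_simps lorentz_commute[of _ \<nu>])
    then have "second_normal i j u - first_ff Y u $ i $ j *\<^sub>R (Y u - (l / \<rho>) *\<^sub>R \<nu>) = 0"
      by (intro complete[OF u hn(3) \<nu>0])
        (simp_all add: lorentz_simps second_normal_Y[OF u] second_normal_orthogonal[OF u] norm_Y[OF u] YN hn(4) \<rho>0
          tangent_orthogonal'[OF u])
    then show ?thesis by simp
  qed
  have NN: "(Y u - (l / \<rho>) *\<^sub>R \<nu>) \<bullet>\<^sub>1 (Y u - (l / \<rho>) *\<^sub>R \<nu>) = l * l / \<rho> - 1"
    using \<rho>0 by (simp add: lorentz_simps norm_Y[OF u] YN hn(4))
  fix i j k q
  show "second_normal j k u \<bullet>\<^sub>1 second_normal i q u - second_normal i k u \<bullet>\<^sub>1 second_normal j q u =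
     (l * l / (p \<bullet>\<^sub>1 p + l * l) - 1) * (first_ff Y u $ j $ k * first_ff Y u $ i $ q - first_ff Y u $ i $ k * first_ff Y u $ j $ q)"
    unfolding N lorentz_scaleR_left lorentz_scaleR_right NN \<rho>_def[symmetric] by (simp add: algebra_simps)
qed

text \<open>Normal spaces are lines, so the unit normals p + l Y and p' + l' Y agree up to a sign.
  Comparing their products with a second derivative of \<open>Y\<close> passes the sign on to l, and
  hence to p.\<close>

lemma hyperplane_unique:
  assumes pl: "\<And>x. x \<in> V \<Longrightarrow> p \<bullet>\<^sub>1 Y x = l" "p \<bullet>\<^sub>1 p + l * l = 1"
    and pl': "\<And>x. x \<in> V \<Longrightarrow> p' \<bullet>\<^sub>1 Y x = l'" "p' \<bullet>\<^sub>1 p' + l' * l' = 1" and u: "u \<in> V"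
  shows "p' = p \<and> l' = l \<or> p' = - p \<and> l' = - l"
proof -
  define \<nu> where "\<nu> = p + l *\<^sub>R Y u"
  define \<nu>' where "\<nu>' = p' + l' *\<^sub>R Y u"
  note n = hyperplane_normal[OF pl(1) u, folded \<nu>_def] and n' = hyperplane_normal[OF pl'(1) u, folded \<nu>'_def]
  have "\<nu> \<noteq> 0" using n(4) pl(2) by (auto simp: lorentz_simps)
  define c where "c = (\<nu>' \<bullet>\<^sub>1 \<nu>) / (\<nu> \<bullet>\<^sub>1 \<nu>)"
  have \<nu>': "\<nu>' = c *\<^sub>R \<nu>" unfolding c_def by (rule normal_line[OF u n(3) \<open>\<nu> \<noteq> 0\<close> n'(3)])
  have "c * c = 1" using n(4) n'(4) pl(2) pl'(2) by (simp add: \<nu>' lorentz_simps)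
  then have c: "c = 1 \<or> c = -1" by (simp add: square_eq_1_iff)
  obtain i :: 'q where True by simp
  have G: "first_ff Y u $ i $ i \<noteq> 0"
  proof -
    have "axis i 1 \<bullet> (first_ff Y u *v axis i 1) = first_ff Y u $ i $ i"
      by (simp add: matrix_vector_mult_axis inner_axis' column_def)
    then show ?thesis using first_ff_pos[OF u, of "axis i 1"] by (auto simp: axis_eq_0_iff)
  qed
  have "l' * first_ff Y u $ i $ i = c * l * first_ff Y u $ i $ i"
    using n(5)[of i i] n'(5)[of i i] by (auto simp: \<nu>' lorentz_simps)
  then have l': "l' = c * l" using G by auto
  then have "p' = c *\<^sub>R p" using \<nu>' by (simp add: \<nu>_def \<nu>'_def scaleR_add_right)
  then show ?thesis using l' c by auto
qed

text \<open>Umbilicity gives d\<nu> = l dY. Equality of the mixed derivatives of \<nu> leaves l_i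
  Y_j = l_j Y_i, so with at least two independent directions l is constant on a ball.\<close>

lemma umbilic_in_hyperplane:
  assumes umb: "\<And>u \<nu>. u \<in> V \<Longrightarrow> \<nu> \<in> normal_space Y u \<Longrightarrow> \<exists>c. shape_operator Y \<nu> u = mat c"
    and q: "2 \<le> CARD('q)" and u0: "u0 \<in> V"
  shows "\<exists>p l r. r > 0 \<and> ball u0 r \<subseteq> V \<and> (\<forall>u\<in>ball u0 r. p \<bullet>\<^sub>1 Y u = l) \<and> p \<bullet>\<^sub>1 p + l * l = 1"
proof -
  obtain \<nu>0 where \<nu>0: "\<nu>0 \<in> normal_space Y u0" "\<nu>0 \<noteq> 0" using normal_exists[OF u0] by blast
  \<comment> \<open>The normal component of the fixed vector \<open>\<nu>0\<close> at each point: a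
    smooth normal field that equals \<open>\<nu>0\<close> at \<open>u0\<close> and is therefore
    spacelike nearby.\<close>
  define n where "n u = \<nu>0 + (\<nu>0 \<bullet>\<^sub>1 Y u) *\<^sub>R Y u
    - (\<Sum>p\<in>UNIV. (matrix_inv (first_ff Y u) *v (\<chi> q. \<nu>0 \<bullet>\<^sub>1 pd q Y u)) $ p *\<^sub>R pd p Y u)" for u
  have sn: "smooth_on V n"
    unfolding n_def[abs_def] by (intro smooth_intros open_domain smooth smooth_first_ff) (rule invertible_first_ff)
  have n_normal: "n u \<bullet>\<^sub>1 Y u = 0" "n u \<bullet>\<^sub>1 pd q Y u = 0" if u: "u \<in> V" for u q
    using tangent_coefficients[OF u, of "\<chi> q. \<nu>0 \<bullet>\<^sub>1 pd q Y u" q] tangent_orthogonal[OF u]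
    by (simp_all add: n_def lorentz_simps norm_Y[OF u] first_ff_nth tangent_orthogonal'[OF u])
  have "n u0 = \<nu>0"
  proof -
    have "(\<chi> q. \<nu>0 \<bullet>\<^sub>1 pd q Y u0) = 0" using \<nu>0 by (simp add: normal_space_def vec_eq_iff)
    then show ?thesis using \<nu>0 by (simp add: n_def normal_space_def)
  qed
  then have n0: "n u0 \<bullet>\<^sub>1 n u0 > 0" using normal_spacelike[OF u0 \<nu>0] by simp
  define O\<^sub>n where "O\<^sub>n = V \<inter> (\<lambda>u. n u \<bullet>\<^sub>1 n u) -` {0<..}"
  have "open O\<^sub>n" unfolding O\<^sub>n_def
    by (rule continuous_open_preimage[OF smooth_on_continuous open_domain]) (intro smooth_intros open_domain sn, simp)
  moreover have "u0 \<in> O\<^sub>n" using n0 u0 by (simp add: O\<^sub>n_def)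
  ultimately obtain r where r: "r > 0" "ball u0 r \<subseteq> O\<^sub>n" using openE by blast
  define B where "B = ball u0 r"
  have B: "open B" "B \<subseteq> V" "u0 \<in> B" "\<And>u. u \<in> B \<Longrightarrow> n u \<bullet>\<^sub>1 n u > 0" using r by (auto simp: B_def O\<^sub>n_def)
  have BV: "u \<in> V" if "u \<in> B" for u using that B(2) by blast
  define \<nu> where "\<nu> u = (1 / sqrt (n u \<bullet>\<^sub>1 n u)) *\<^sub>R n u" for u
  have s\<nu>: "smooth_on B \<nu>"
    unfolding \<nu>_def[abs_def]
    by (intro smooth_intros B smooth_on_subset[OF sn B(2)]) (use B(4) in \<open>auto simp: less_imp_neq[symmetric]\<close>)
  have \<nu>: "\<nu> u \<in> normal_space Y u" "\<nu> u \<bullet>\<^sub>1 \<nu> u = 1" "\<nu> u \<noteq> 0" if u: "u \<in> B" for u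
  proof -
    show "\<nu> u \<in> normal_space Y u" using n_normal[OF BV[OF u]] by (simp add: normal_space_def \<nu>_def lorentz_simps)
    show 1: "\<nu> u \<bullet>\<^sub>1 \<nu> u = 1" using B(4)[OF u] by (simp add: \<nu>_def lorentz_simps)
    then show "\<nu> u \<noteq> 0" by (auto simp: lorentz_simps)
  qed
  have \<nu>o: "\<nu> u \<bullet>\<^sub>1 Y u = 0" "\<nu> u \<bullet>\<^sub>1 pd i Y u = 0" if "u \<in> B" for u i
    using \<nu>(1)[OF that] by (simp_all add: normal_space_def)
  obtain i0 :: 'q where True by simp
  have G: "first_ff Y u $ i0 $ i0 \<noteq> 0" if u: "u \<in> V" for u
  proof -
    have "axis i0 1 \<bullet> (first_ff Y u *v axis i0 1) = first_ff Y u $ i0 $ i0"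
      by (simp add: matrix_vector_mult_axis inner_axis' column_def)
    then show ?thesis using first_ff_pos[OF u, of "axis i0 1"] by (auto simp: axis_eq_0_iff)
  qed
  \<comment> \<open>Read off from one diagonal entry, which shows smoothness; umbilicity makes it
    the factor in all entries.\<close>
  define l where "l u = - (\<nu> u \<bullet>\<^sub>1 pd i0 (pd i0 Y) u) / first_ff Y u $ i0 $ i0" for u
  have sl: "smooth_on B l"
    unfolding l_def[abs_def]
    by (intro smooth_intros B s\<nu> smooth_on_subset[OF smooth B(2)] smooth_on_subset[OF smooth_first_ff B(2)]) (use G BV in auto)
  have lG: "\<nu> u \<bullet>\<^sub>1 pd i (pd j Y) u = - (l u * first_ff Y u $ i $ j)" if u: "u \<in> B" for u i j
  proof -
    obtain c where c: "shape_operator Y (\<nu> u) u = mat c" using umb[OF BV[OF u] \<nu>(1)[OF u]] by blast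
    have "first_ff Y u ** shape_operator Y (\<nu> u) u = second_ff_vec Y (\<nu> u) u"
      by (simp add: shape_operator_def matrix_mul_assoc matrix_inv_inverse(1)[OF invertible_first_ff[OF BV[OF u]]])
    moreover have "first_ff Y u ** mat c = c *\<^sub>R first_ff Y u"
      using sum_if_mult(2)[of "\<lambda>k. first_ff Y u $ i $ k" _ "\<lambda>_. c" for i]
      by (simp add: vec_eq_iff matrix_matrix_mult_def mat_def mult.commute)
    ultimately have s: "second_ff_vec Y (\<nu> u) u = c *\<^sub>R first_ff Y u" using c by simp
    have e: "\<nu> u \<bullet>\<^sub>1 pd i (pd j Y) u = - (c * first_ff Y u $ i $ j)" for i j
      using arg_cong[OF s, of "\<lambda>M. M $ i $ j"] by (simp add: second_ff_vec_def)
    then have "l u = c" using G[OF BV[OF u]] by (simp add: l_def)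
    then show ?thesis using e by simp
  qed
  note d\<nu> = smooth_on_differentiable[OF s\<nu>] and dl = smooth_on_differentiable[OF sl]
  have od: "pd i f u \<bullet>\<^sub>1 g u = - (f u \<bullet>\<^sub>1 pd i g u)"
    if "u \<in> B" "f differentiable (at u)" "g differentiable (at u)" "\<And>x. x \<in> B \<Longrightarrow> f x \<bullet>\<^sub>1 g x = c" for f g u i c
  proof -
    have "pd i (\<lambda>x. c) u = pd i (\<lambda>x. f x \<bullet>\<^sub>1 g x) u" by (rule pd_cong[OF B(1) that(1)]) (use that in auto)
    then show ?thesis using pd_lorentz[OF that(2,3), of i] by simp
  qed
  have pd\<nu>: "pd i \<nu> u = l u *\<^sub>R pd i Y u" if u: "u \<in> B" for u i
  proof -
    have "pd i \<nu> u - l u *\<^sub>R pd i Y u = 0"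
    proof (rule complete[OF BV[OF u] \<nu>(1,3)[OF u]])
      have "pd i \<nu> u \<bullet>\<^sub>1 Y u = 0" using od[OF u d\<nu>[OF u] diff_Y[OF BV[OF u]], of 0 i] \<nu>o u by simp
      then show "(pd i \<nu> u - l u *\<^sub>R pd i Y u) \<bullet>\<^sub>1 Y u = 0" by (simp add: lorentz_simps tangent_orthogonal[OF BV[OF u]])
      have "pd i \<nu> u \<bullet>\<^sub>1 \<nu> u = 0" using od[OF u d\<nu>[OF u] d\<nu>[OF u], of 1 i] \<nu>(2) by (simp add: lorentz_commute)
      then show "(pd i \<nu> u - l u *\<^sub>R pd i Y u) \<bullet>\<^sub>1 \<nu> u = 0"
        using \<nu>o(2)[OF u] by (simp add: lorentz_simps lorentz_commute[of "pd i Y u"])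
      show "(pd i \<nu> u - l u *\<^sub>R pd i Y u) \<bullet>\<^sub>1 pd j Y u = 0" for j
        using od[OF u d\<nu>[OF u] diff_pd[OF BV[OF u]], of j 0 i] \<nu>o lG[OF u, of i j]
        by (simp add: lorentz_simps first_ff_nth)
    qed
    then show ?thesis by simp
  qed
  have pdl: "pd j l u = 0" if u: "u \<in> B" for u j
  proof -
    obtain i :: 'q where ij: "i \<noteq> j"
      using exists_ne_of_card[OF q] by blast
    have pp: "pd i (pd j \<nu>) u = l u *\<^sub>R pd i (pd j Y) u + pd i l u *\<^sub>R pd j Y u" for i j
    proof -
      have "pd i (pd j \<nu>) u = pd i (\<lambda>x. l x *\<^sub>R pd j Y x) u"
        by (rule pd_cong[OF B(1) u pd\<nu> smooth_on_differentiable[OF smooth_on_pd[OF s\<nu>] u]])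
      then show ?thesis by (simp add: pd_scaleR[OF dl[OF u] diff_pd[OF BV[OF u]]])
    qed
    have "pd i l u *\<^sub>R pd j Y u = pd j l u *\<^sub>R pd i Y u"
      using pp[of i j] pp[of j i] pd_commute[OF B(1) s\<nu> u, of i j] pd_pd_sym[OF BV[OF u], of i j] by simp
    then have s0: "pd j l u *\<^sub>R pd i Y u - pd i l u *\<^sub>R pd j Y u = 0" by simp
    define c where "c k = (if k = i then pd j l u else 0) - (if k = j then pd i l u else 0)" for k
    have "(\<Sum>k\<in>UNIV. c k *\<^sub>R pd k Y u) = 0"
      using s0 by (simp add: c_def scaleR_diff_left sum_subtractf sum_if_scaleR)
    then have "(\<Sum>k\<in>UNIV. c k * (pd k Y u \<bullet>\<^sub>1 pd m Y u)) = 0" for m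
      using lorentz_sum_left[of "\<lambda>k. c k *\<^sub>R pd k Y u" UNIV "pd m Y u"] by (simp add: lorentz_scaleR_left lorentz_zero_left)
    then have "c i = 0" by (rule tangent_gram[OF BV[OF u]])
    then show ?thesis using ij by (simp add: c_def)
  qed
  have zero: "\<exists>c. \<forall>u\<in>B. h u = c" if "smooth_on B h" "\<And>u i. u \<in> B \<Longrightarrow> pd i h u = 0" for h :: "real ^ 'q \<Rightarrow> 'b::real_normed_vector"
  proof (rule has_derivative_zero_constant)
    show "convex B" by (simp add: B_def)
    show "(h has_derivative (\<lambda>v. 0)) (at u within B)" if u: "u \<in> B" for u
    proof -
      have "frechet_derivative h (at u) = (\<lambda>v. 0)"
        using frechet_eq_sum_pd[OF smooth_on_differentiable[OF \<open>smooth_on B h\<close> u]] \<open>\<And>u i. u \<in> B \<Longrightarrow> pd i h u = 0\<close>[OF u]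
        by (simp add: fun_eq_iff)
      then show ?thesis using has_derivative_at_withinI[OF smooth_on_has_derivative[OF \<open>smooth_on B h\<close> u]] by simp
    qed
  qed
  obtain l0 where l0: "\<And>u. u \<in> B \<Longrightarrow> l u = l0" using zero[OF sl pdl] by blast
  have sp: "smooth_on B (\<lambda>u. \<nu> u - l0 *\<^sub>R Y u)"
    by (intro smooth_intros B s\<nu> smooth_on_subset[OF smooth B(2)])
  have "pd i (\<lambda>u. \<nu> u - l0 *\<^sub>R Y u) u = 0" if u: "u \<in> B" for u i
  proof -
    have "pd i (\<lambda>u. l0 *\<^sub>R Y u) u = l0 *\<^sub>R pd i Y u"
      by (rule pd_bounded_linear[OF bounded_linear_scaleR_right diff_Y[OF BV[OF u]]])
    moreover have "(\<lambda>u. l0 *\<^sub>R Y u) differentiable (at u)"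
      by (rule smooth_on_differentiable[OF _ u]) (intro smooth_intros B smooth_on_subset[OF smooth B(2)])
    ultimately show ?thesis using pd_diff[OF d\<nu>[OF u], of "\<lambda>u. l0 *\<^sub>R Y u" i] pd\<nu>[OF u, of i] l0[OF u] by simp
  qed
  from zero[OF sp this] obtain p where p: "\<And>u. u \<in> B \<Longrightarrow> \<nu> u - l0 *\<^sub>R Y u = p" by blast
  have "p \<bullet>\<^sub>1 Y u = l0" if u: "u \<in> B" for u
  proof -
    have "(\<nu> u - l0 *\<^sub>R Y u) \<bullet>\<^sub>1 Y u = l0" by (simp add: lorentz_diff_left lorentz_scaleR_left \<nu>o[OF u] norm_Y[OF BV[OF u]])
    then show ?thesis by (simp only: p[OF u])
  qed
  moreover have "p \<bullet>\<^sub>1 p + l0 * l0 = 1"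
  proof -
    have "Y u0 \<bullet>\<^sub>1 \<nu> u0 = 0" using \<nu>o(1)[OF B(3)] by (simp add: lorentz_commute)
    then have "(\<nu> u0 - l0 *\<^sub>R Y u0) \<bullet>\<^sub>1 (\<nu> u0 - l0 *\<^sub>R Y u0) + l0 * l0 = 1"
      by (simp add: lorentz_diff_left lorentz_diff_right lorentz_scaleR_left lorentz_scaleR_right norm_Y[OF u0]
          \<nu>(2)[OF B(3)] \<nu>o(1)[OF B(3)])
    then show ?thesis by (simp only: p[OF B(3)])
  qed
  ultimately show ?thesis using r(1) B(2) unfolding B_def
    by (intro exI[of _ p] exI[of _ l0] exI[of _ r]) auto
qed

end

lemma hypersurface_chart:
  assumes "hypersurface TYPE('q::finite) (Q :: (real ^ ('k::finite) option) set)" "local_param Q V (y :: real ^ 'q \<Rightarrow> _)"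
  shows "hypersurface_immersion V y" "y ` V \<subseteq> Q"
proof -
  have Q: "Q \<subseteq> hyp" "CARD('q) + 1 = CARD('k)" using assms(1) by (simp_all add: hypersurface_def)
  show "hypersurface_immersion V y"
    using local_param_hyp_immersion[OF Q(1) assms(2)] Q(2)
    by (simp add: hypersurface_immersion_def hypersurface_immersion_axioms_def)
  show "y ` V \<subseteq> Q" using assms(2) openin_imp_subset unfolding local_param_def by blast
qed

text \<open>Normal vectors are multiples of p + l Y, whose shape operator is l; so l decides on
  total geodesy. The curvature l^2 / (p.p + l^2) - 1 vanishes exactly when p is null, and two
  dimensions are what it takes to have a plane on which to measure it.\<close>

lemma hyperplane_section_umbilic:
  assumes Q: "hypersurface TYPE('q::finite) (Q :: (real ^ ('k::finite) option) set)"
    and pl: "\<And>x. x \<in> Q \<Longrightarrow> p \<bullet>\<^sub>1 x = l" and \<rho>: "p \<bullet>\<^sub>1 p + l * l > 0"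
  shows "totally_umbilic TYPE('q) Q" "l = 0 \<Longrightarrow> totally_geodesic TYPE('q) Q" "l \<noteq> 0 \<Longrightarrow> \<not> totally_geodesic TYPE('q) Q"
    "2 \<le> CARD('q) \<Longrightarrow> flat_hypersurface TYPE('q) Q \<longleftrightarrow> p \<bullet>\<^sub>1 p = 0"
proof -
  have so: "\<exists>c. shape_operator y \<nu> u = mat (c * l)"
    if lp: "local_param Q V (y :: real ^ 'q \<Rightarrow> _)" and u: "u \<in> V" and \<nu>: "\<nu> \<in> normal_space y u" for V y u \<nu>
  proof -
    interpret hypersurface_immersion V y by (rule hypersurface_chart(1)[OF Q lp])
    have ply: "p \<bullet>\<^sub>1 y x = l" if "x \<in> V" for x using pl hypersurface_chart(2)[OF Q lp] that by blast
    have "p + l *\<^sub>R y u \<noteq> 0" 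
    proof
      assume "p + l *\<^sub>R y u = 0"
      then have "0 = p \<bullet>\<^sub>1 p + l * l" using hyperplane_normal(4)[OF ply u] by (simp only: lorentz_zero_left)
      then show False using \<rho> by simp
    qed
    from normal_line[OF u hyperplane_normal(3)[OF ply u] this \<nu>] obtain c where "\<nu> = c *\<^sub>R (p + l *\<^sub>R y u)" by blast
    then show ?thesis using hyperplane_shape_operator[OF ply u] by blast
  qed
  show "totally_umbilic TYPE('q) Q" unfolding totally_umbilic_def using Q so by blast
  show "totally_geodesic TYPE('q) Q" if "l = 0"
    unfolding totally_geodesic_def
  proof (intro conjI allI impI ballI Q)
    fix V and y :: "real ^ 'q \<Rightarrow> real ^ 'k option" and u \<nu> assume "local_param Q V y" "u \<in> V" "\<nu> \<in> normal_space y u"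
    from so[OF this] show "shape_operator y \<nu> u = 0" using that by (auto simp: mat_0)
  qed
  obtain x0 where x0: "x0 \<in> Q" using Q by (auto simp: hypersurface_def)
  obtain V and y :: "real ^ 'q \<Rightarrow> _" where lp: "local_param Q V y" "x0 \<in> y ` V"
    using Q x0 unfolding hypersurface_def by blast
  obtain u where u: "u \<in> V" using lp by blast
  interpret I: hypersurface_immersion V y by (rule hypersurface_chart(1)[OF Q lp(1)])
  have ply: "p \<bullet>\<^sub>1 y x = l" if "x \<in> V" for x using pl hypersurface_chart(2)[OF Q lp(1)] that by blast
  show "\<not> totally_geodesic TYPE('q) Q" if "l \<noteq> 0"
  proof
    assume "totally_geodesic TYPE('q) Q"
    then have "shape_operator y (p + l *\<^sub>R y u) u = 0"
      using lp(1) u I.hyperplane_normal(3)[OF ply u] unfolding totally_geodesic_def by blast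
    then have m: "(mat l :: real ^ 'q ^ 'q) = 0" using I.hyperplane_shape_operator[OF ply u, of 1] by simp
    obtain i :: 'q where True by simp
    have "(mat l :: real ^ 'q ^ 'q) $ i $ i = 0" unfolding m by simp
    then show False using that by (simp add: mat_def)
  qed
  have curv: "sectional_curvature (first_ff y) u a b = l * l / (p \<bullet>\<^sub>1 p + l * l) - 1"
    if "local_param Q V (y :: real ^ 'q \<Rightarrow> _)" "u \<in> V" "a \<noteq> b" "independent {a, b}" for V y u a b
  proof -
    interpret J: hypersurface_immersion V y by (rule hypersurface_chart(1)[OF Q that(1)])
    show ?thesis
      by (rule J.hyperplane_curvature[OF _ \<rho> that(2-4)]) (use pl hypersurface_chart(2)[OF Q that(1)] in blast)
  qed
  have c0: "l * l / (p \<bullet>\<^sub>1 p + l * l) - 1 = 0 \<longleftrightarrow> p \<bullet>\<^sub>1 p = 0" using \<rho> by (auto simp: field_simps)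
  show "flat_hypersurface TYPE('q) Q \<longleftrightarrow> p \<bullet>\<^sub>1 p = 0" if q: "2 \<le> CARD('q)"
  proof
    assume "p \<bullet>\<^sub>1 p = 0"
    then show "flat_hypersurface TYPE('q) Q"
      using Q c0 by (simp add: flat_hypersurface_def const_curvature_def curv)
  next
    assume fl: "flat_hypersurface TYPE('q) Q"
    obtain i j :: 'q where ij: "i \<noteq> j"
      using exists_ne_of_card[OF q] by blast
    have ax: "axis i (1::real) \<noteq> axis j 1" using ij by (simp add: axis_eq_axis)
    have "independent {axis i (1::real), axis j 1}"
      by (rule independent_mono[OF independent_Basis]) auto
    then have "sectional_curvature (first_ff y) u (axis i 1) (axis j 1) = 0"
      using fl lp(1) u ax unfolding flat_hypersurface_def const_curvature_def by blast
    then show "p \<bullet>\<^sub>1 p = 0" using curv[OF lp(1) u ax \<open>independent _\<close>] c0 by simp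
  qed
qed

text \<open>Near each point the hypersurface lies in a hyperplane with normalised data (p, l),
  unique up to a common sign. As \<open>good\<close> is invariant under that sign, the points
  sharing the data of \<open>x0\<close> form an open and closed subset of the connected
  hypersurface.\<close>

theorem umbilic_hypersurface_in_hyperplane:
  assumes umb: "totally_umbilic TYPE('q::finite) (Q :: (real ^ ('k::finite) option) set)" and q: "2 \<le> CARD('q)"
  shows "\<exists>p l. (\<forall>x\<in>Q. p \<bullet>\<^sub>1 x = l) \<and> p \<bullet>\<^sub>1 p + l * l = 1"
proof -
  have Q: "hypersurface TYPE('q) Q" using umb by (simp add: totally_umbilic_def)
  define good where "good p l x \<longleftrightarrow> (\<exists>D. open D \<and> x \<in> D \<and> (\<forall>z\<in>Q \<inter> D. p \<bullet>\<^sub>1 z = l)) \<and> p \<bullet>\<^sub>1 p + l * l = 1" for p l x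
  have good_neg: "good (- p) (- l) x \<longleftrightarrow> good p l x" for p l x by (simp add: good_def lorentz_simps)
  have ex: "\<exists>p l. good p l x" if x: "x \<in> Q" for x
  proof -
    obtain V and y :: "real ^ 'q \<Rightarrow> _" where lp: "local_param Q V y" "x \<in> y ` V"
      using Q x unfolding hypersurface_def by blast
    obtain u where u: "u \<in> V" "y u = x" using lp(2) by blast
    interpret I: hypersurface_immersion V y by (rule hypersurface_chart(1)[OF Q lp(1)])
    have "\<exists>c. shape_operator y \<nu> v = mat c" if "v \<in> V" "\<nu> \<in> normal_space y v" for v \<nu>
      using umb lp(1) that unfolding totally_umbilic_def by blast
    from I.umbilic_in_hyperplane[OF this q u(1)] obtain p l r where
      p: "r > 0" "ball u r \<subseteq> V" "\<forall>v\<in>ball u r. p \<bullet>\<^sub>1 y v = l" "p \<bullet>\<^sub>1 p + l * l = 1" by blast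
    obtain \<phi> where \<phi>: "homeomorphism V (y ` V) y \<phi>" "openin (top_of_set Q) (y ` V)" using lp(1) unfolding local_param_def by blast
    have "openin (top_of_set (y ` V)) (y ` ball u r)"
      by (rule homeomorphism_imp_open_map[OF \<phi>(1)]) (use p(2) I.open_domain in \<open>simp add: openin_open_eq\<close>)
    then have "openin (top_of_set Q) (y ` ball u r)" using \<phi>(2) openin_trans by blast
    then obtain D where D: "open D" "y ` ball u r = Q \<inter> D" by (auto simp: openin_open)
    moreover have "x \<in> y ` ball u r" using p(1) u by auto
    ultimately have "good p l x" unfolding good_def using p(3,4) by (metis D(2) IntD2 imageE)
    then show ?thesis by blast
  qed
  have un: "p' = p \<and> l' = l \<or> p' = - p \<and> l' = - l" if x: "x \<in> Q" and g: "good p l x" "good p' l' x" for x p l p' l'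
  proof -
    obtain D D' where D: "open D" "x \<in> D" "\<forall>z\<in>Q \<inter> D. p \<bullet>\<^sub>1 z = l" "p \<bullet>\<^sub>1 p + l * l = 1"
      "open D'" "x \<in> D'" "\<forall>z\<in>Q \<inter> D'. p' \<bullet>\<^sub>1 z = l'" "p' \<bullet>\<^sub>1 p' + l' * l' = 1" using g unfolding good_def by blast
    obtain V and y :: "real ^ 'q \<Rightarrow> _" where lp: "local_param Q V y" "x \<in> y ` V"
      using Q x unfolding hypersurface_def by blast
    obtain u where u: "u \<in> V" "y u = x" using lp(2) by blast
    interpret I: hypersurface_immersion V y by (rule hypersurface_chart(1)[OF Q lp(1)])
    define V' where "V' = V \<inter> y -` (D \<inter> D')"
    have oV': "open V'" unfolding V'_def
      by (rule continuous_open_preimage[OF smooth_on_continuous[OF I.smooth] I.open_domain]) (use D in auto)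
    interpret J: hypersurface_immersion V' y
      by unfold_locales (use oV' I.in_hyp I.first_ff_pos I.codim smooth_on_subset[OF I.smooth] in \<open>auto simp: V'_def\<close>)
    show ?thesis
      by (rule J.hyperplane_unique[OF _ D(4) _ D(8), of u])
        (use D u hypersurface_chart(2)[OF Q lp(1)] in \<open>auto simp: V'_def\<close>)
  qed
  obtain x0 where x0: "x0 \<in> Q" using Q by (auto simp: hypersurface_def)
  obtain p l where pl: "good p l x0" using ex[OF x0] by blast
  define S where "S = {x \<in> Q. good p l x}"
  have loc: "\<exists>D. open D \<and> x \<in> D \<and> (\<forall>z\<in>Q \<inter> D. good p' l' z)" if "good p' l' x" for x p' l'
    using that unfolding good_def by blast
  have "openin (top_of_set Q) S"
    unfolding openin_subopen[of _ S]
  proof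
    fix x assume x: "x \<in> S"
    then obtain D where "open D" "x \<in> D" "\<forall>z\<in>Q \<inter> D. good p l z" using loc[of p l x] by (auto simp: S_def)
    then show "\<exists>T. openin (top_of_set Q) T \<and> x \<in> T \<and> T \<subseteq> S"
      using x by (intro exI[of _ "Q \<inter> D"]) (auto simp: S_def openin_open)
  qed
  moreover have "openin (top_of_set Q) (Q - S)"
    unfolding openin_subopen[of _ "Q - S"]
  proof
    fix x assume x: "x \<in> Q - S"
    then obtain p' l' where g: "good p' l' x" using ex by blast
    then obtain D where D: "open D" "x \<in> D" "\<forall>z\<in>Q \<inter> D. good p' l' z" using loc by blast
    have "z \<notin> S" if z: "z \<in> Q \<inter> D" for z
    proof
      assume "z \<in> S"
      then have "p' = p \<and> l' = l \<or> p' = - p \<and> l' = - l" using un[of z p l p' l'] z D(3) by (auto simp: S_def)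
      then have "good p l x" using g good_neg[of p l x] by auto
      then show False using x by (simp add: S_def)
    qed
    then show "\<exists>T. openin (top_of_set Q) T \<and> x \<in> T \<and> T \<subseteq> Q - S"
      using x D by (intro exI[of _ "Q \<inter> D"]) (auto simp: openin_open)
  qed
  then have "closedin (top_of_set Q) S" by (simp add: closedin_def S_def)
  ultimately have "S = Q"
    using Q x0 pl unfolding hypersurface_def connected_clopen S_def by blast
  then have "\<forall>x\<in>Q. p \<bullet>\<^sub>1 x = l" unfolding S_def good_def by blast
  then show ?thesis using pl unfolding good_def by blast
qed

section \<open>Hyperplane sections as hypersurfaces\<close>

lemma lorentz_complement_parametrization:
  fixes B :: "(real ^ ('k::finite) option) set"
  assumes B: "independent B" and card: "card B + CARD('d::finite) = CARD('k) + 1"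
  shows "\<exists>(E :: real ^ 'd \<Rightarrow> real ^ 'k option) L. linear E \<and> linear L \<and> (\<forall>s. \<forall>b\<in>B. E s \<bullet>\<^sub>1 b = 0) \<and> (\<forall>s. L (E s) = s) \<and>
    (\<forall>x. (\<forall>b\<in>B. x \<bullet>\<^sub>1 b = 0) \<longrightarrow> E (L x) = x)"
proof -
  \<comment> \<open>As the Euclidean orthogonal complement of the time-flipped vectors,
    \<open>S\<close> has a known dimension.\<close>
  define S where "S = {x. \<forall>b\<in>B. x \<bullet>\<^sub>1 b = 0}"
  have inj: "inj time_flip" by (metis injI time_flip_time_flip)
  have "independent (time_flip ` B)"
    by (rule linear_independent_injective_image[OF linear_time_flip B inj_on_subset[OF inj subset_UNIV]])
  then have "dim (span (time_flip ` B)) = card B"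
    by (simp add: dim_eq_card_independent card_image[OF inj_on_subset[OF inj]])
  moreover have "S = {y \<in> UNIV. \<forall>x\<in>span (time_flip ` B). orthogonal x y}"
  proof -
    have "(\<forall>x\<in>span (time_flip ` B). orthogonal x y) \<longleftrightarrow> (\<forall>b\<in>B. y \<bullet>\<^sub>1 b = 0)" for y
    proof
      assume "\<forall>b\<in>B. y \<bullet>\<^sub>1 b = 0"
      then have "orthogonal y x" if "x \<in> time_flip ` B" for x using that by (auto simp: orthogonal_def lorentz_eq_inner)
      then show "\<forall>x\<in>span (time_flip ` B). orthogonal x y"
        using orthogonal_to_span[of _ "time_flip ` B" y] by (metis orthogonal_commute)
    next
      assume "\<forall>x\<in>span (time_flip ` B). orthogonal x y"
      then show "\<forall>b\<in>B. y \<bullet>\<^sub>1 b = 0" by (simp add: lorentz_eq_inner orthogonal_def span_base inner_commute[of y])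
    qed
    then show ?thesis by (simp add: S_def)
  qed
  ultimately have "dim S + card B = CARD('k) + 1"
    using dim_subspace_orthogonal_to_vectors[of "span (time_flip ` B)" "UNIV :: (real ^ 'k option) set"] by simp
  then have "dim S = dim (UNIV :: (real ^ 'd) set)" using card by simp
  moreover have "subspace S" by (simp add: S_def subspace_def lorentz_simps)
  ultimately obtain E L where EL: "linear E" "linear L" "E ` (UNIV :: (real ^ 'd) set) = S" "\<And>s. L (E s) = s" "\<And>x. x \<in> S \<Longrightarrow> E (L x) = x"
    using isometries_subspaces[of "UNIV :: (real ^ 'd) set" S] by (metis UNIV_I subspace_UNIV)
  have "E s \<in> S" for s using EL(3) by blast
  then show ?thesis using EL by (intro exI[of _ E] exI[of _ L]) (simp add: S_def)
qed

text \<open>Write \<open>x = (1 - \<rho>\<beta>) x\<^sub>0 + \<beta> \<nu> + E s\<close> with \<open>\<nu> = p + x\<^sub>0\<close>. Then \<open>\<langle>x, x\<rangle>\<^sub>1 = -1\<close> is the quadratic equation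
  \<open>\<rho>(1 - \<rho>)\<beta>\<^sup>2 + 2\<rho>\<beta> + \<langle>E s, E s\<rangle>\<^sub>1 = 0\<close>, and \<open>\<beta> s\<close> below is its root vanishing at \<open>s = 0\<close>, rationalised so that the
  formula also covers \<open>\<rho> = 1\<close>.\<close>

lemma hyperplane_section_chart:
  fixes p x0 :: "real ^ ('k::finite) option"
  assumes card: "CARD('q::finite) + 1 = CARD('k)" and \<rho>: "p \<bullet>\<^sub>1 p > -1" and x0: "x0 \<in> hyp" "p \<bullet>\<^sub>1 x0 = 1"
  defines "Q \<equiv> {x \<in> hyp. p \<bullet>\<^sub>1 x = 1}"
  shows "\<exists>V (y :: real ^ 'q \<Rightarrow> _). local_param Q V y \<and> x0 \<in> y ` V \<and> (p \<bullet>\<^sub>1 p \<ge> 0 \<longrightarrow> V = UNIV \<and> y ` V = Q)"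
proof -
  define \<rho> where "\<rho> = p \<bullet>\<^sub>1 p + 1"
  define \<nu> where "\<nu> = p + x0"
  have \<rho>0: "\<rho> > 0" using \<rho> by (simp add: \<rho>_def)
  have xx: "x0 \<bullet>\<^sub>1 x0 = -1" using x0 by (simp add: hyp_def)
  have xp: "x0 \<bullet>\<^sub>1 p = 1" using x0(2) by (simp add: lorentz_commute)
  have \<nu>: "x0 \<bullet>\<^sub>1 \<nu> = 0" "\<nu> \<bullet>\<^sub>1 x0 = 0" "\<nu> \<bullet>\<^sub>1 \<nu> = \<rho>"
    using xx xp x0(2) by (simp_all add: \<nu>_def \<rho>_def lorentz_add_left lorentz_add_right)
  have \<nu>0: "\<nu> \<noteq> 0" using \<nu>(3) \<rho>0 by (metis lorentz_zero_left less_irrefl)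
  have x00: "x0 \<noteq> 0" using xx by (metis lorentz_zero_left neg_equal_0_iff_equal zero_neq_one)
  have ne: "x0 \<noteq> \<nu>" using \<nu>(1) xx by auto
  have "\<nu> \<notin> span {x0}"
  proof
    assume "\<nu> \<in> span {x0}"
    then obtain c where "\<nu> = c *\<^sub>R x0" by (auto simp: span_singleton)
    then show False using \<nu>(2) \<nu>0 xx by (simp add: lorentz_scaleR_left)
  qed
  then have "independent {\<nu>, x0}" using x00 ne by (simp add: independent_insert)
  moreover have "card {\<nu>, x0} + CARD('q) = CARD('k) + 1" using card ne by (auto simp: card_insert_if)
  ultimately obtain E :: "real ^ 'q \<Rightarrow> real ^ 'k option" and L where E: "linear E" "linear L"
    "\<forall>s. \<forall>b\<in>{\<nu>, x0}. E s \<bullet>\<^sub>1 b = 0" "\<forall>s. L (E s) = s"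
    "\<forall>x. (\<forall>b\<in>{\<nu>, x0}. x \<bullet>\<^sub>1 b = 0) \<longrightarrow> E (L x) = x"
    using lorentz_complement_parametrization[of "{\<nu>, x0}", where ?'d = 'q] by blast
  have Eo: "E s \<bullet>\<^sub>1 \<nu> = 0" "E s \<bullet>\<^sub>1 x0 = 0" "\<nu> \<bullet>\<^sub>1 E s = 0" "x0 \<bullet>\<^sub>1 E s = 0" for s
    using E(3) by (simp_all add: lorentz_commute)
  have bl: "bounded_linear E" "bounded_linear L" using E by (simp_all add: linear_conv_bounded_linear)
  define h where "h s = E s \<bullet>\<^sub>1 E s" for s
  have h0: "h s \<ge> 0" for s
  proof (cases "E s = 0")
    case False
    then show ?thesis using lorentz_orthogonal_to_timelike[of x0 "E s"] xx Eo unfolding h_def by simp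
  qed (simp add: h_def lorentz_zero_left)
  \<comment> \<open>Exactly the set where the radicand in \<open>w\<close> is positive.\<close>
  define V where "V = {s. (1 - \<rho>) * h s < \<rho>}"
  have sh: "smooth_on T h" if "open T" for T
    unfolding h_def[abs_def] by (intro smooth_intros that smooth_on_bounded_linear[OF bl(1) that])
  have oV: "open V" unfolding V_def
    by (rule open_Collect_less) (intro continuous_intros smooth_on_continuous[OF sh] open_UNIV)+
  define w where "w s = sqrt (1 - (1 - \<rho>) * h s / \<rho>)" for s
  define \<beta> where "\<beta> s = - h s / (\<rho> * (1 + w s))" for s
  define y where "y s = (1 - \<rho> * \<beta> s) *\<^sub>R x0 + \<beta> s *\<^sub>R \<nu> + E s" for s
  have pos: "1 - (1 - \<rho>) * h s / \<rho> > 0" if "s \<in> V" for s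
    using that \<rho>0 by (simp add: V_def field_simps)
  have w: "w s > 0" "w s * w s = 1 - (1 - \<rho>) * h s / \<rho>" if "s \<in> V" for s
    using pos[OF that] by (simp_all add: w_def)
  have \<beta>h: "\<beta> s * (\<rho> * (1 + w s)) = - h s" if "s \<in> V" for s
    using w(1)[OF that] \<rho>0 by (simp add: \<beta>_def add_nonneg_eq_0_iff)
  have \<beta>w: "1 + (1 - \<rho>) * \<beta> s = w s" if "s \<in> V" for s
  proof -
    have "\<rho> * (1 + w s) * (1 + (1 - \<rho>) * \<beta> s) = \<rho> * (1 + w s) + (1 - \<rho>) * (\<beta> s * (\<rho> * (1 + w s)))"
      by (simp add: algebra_simps)
    also have "\<dots> = \<rho> * (1 + w s) - (1 - \<rho>) * h s" unfolding \<beta>h[OF that] by simp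
    also have "\<dots> = \<rho> * (1 + w s) * w s"
    proof -
      have "\<rho> * (w s * w s) = \<rho> - (1 - \<rho>) * h s" using w(2)[OF that] \<rho>0 by (simp add: field_simps)
      then show ?thesis by (simp add: algebra_simps)
    qed
    finally show ?thesis using w(1)[OF that] \<rho>0 by simp
  qed
  have quad: "\<rho> * (1 - \<rho>) * \<beta> s * \<beta> s + 2 * \<rho> * \<beta> s + h s = 0" if "s \<in> V" for s
    using \<beta>h[OF that] unfolding \<beta>w[OF that, symmetric] by (simp add: algebra_simps)
  have px: "p = \<nu> - x0" by (simp add: \<nu>_def)
  have yx: "y s \<bullet>\<^sub>1 x0 = - (1 - \<rho> * \<beta> s)" and y\<nu>: "y s \<bullet>\<^sub>1 \<nu> = \<rho> * \<beta> s" for s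
    by (simp_all add: y_def lorentz_simps xx \<nu> Eo)
  have yy: "y s \<bullet>\<^sub>1 y s = -1" if "s \<in> V" for s
    using quad[OF that] by (simp add: y_def lorentz_simps xx \<nu> Eo h_def[symmetric] algebra_simps)
  have yQ: "y s \<in> Q" if "s \<in> V" for s
  proof -
    have "\<beta> s \<le> 0" using h0[of s] w(1)[OF that] \<rho>0 by (simp add: \<beta>_def divide_nonneg_pos)
    then have "\<rho> * \<beta> s \<le> 0" using \<rho>0 by (simp add: mult_nonneg_nonpos)
    then have "x0 \<bullet>\<^sub>1 y s < 0" using yx[of s] by (simp add: lorentz_commute)
    then have "y s \<in> hyp" using hyp_memI x0(1) yy[OF that] by blast
    moreover have "p \<bullet>\<^sub>1 y s = 1" using yx[of s] y\<nu>[of s] by (simp add: px lorentz_diff_left lorentz_diff_right lorentz_commute)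
    ultimately show ?thesis by (simp add: Q_def)
  qed
  \<comment> \<open>The inverse of the chart is the restriction of a linear map: the components
    along x0 and \<nu> are projected away, and \<open>L\<close> recovers s from E s.\<close>
  define \<phi> where "\<phi> x = L (x + (x \<bullet>\<^sub>1 x0) *\<^sub>R x0 - (x \<bullet>\<^sub>1 \<nu> / \<rho>) *\<^sub>R \<nu>)" for x
  have l\<phi>: "linear \<phi>" unfolding \<phi>_def using E(2)
    by (auto intro!: linearI simp: lorentz_simps linear_add linear_diff linear_scale add_divide_distrib algebra_simps)
  have \<phi>y: "\<phi> (y s) = s" for s
  proof -
    have "y s + (y s \<bullet>\<^sub>1 x0) *\<^sub>R x0 - (y s \<bullet>\<^sub>1 \<nu> / \<rho>) *\<^sub>R \<nu> = E s"
      unfolding yx y\<nu> using \<rho>0 by (simp add: y_def algebra_simps)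
    then show ?thesis using E(4) by (simp add: \<phi>_def)
  qed
  have sy: "smooth_on V y"
    unfolding y_def[abs_def] \<beta>_def[abs_def] w_def[abs_def]
    by (intro smooth_intros oV sh smooth_on_bounded_linear[OF bl(1) oV])
      (use pos w(1) \<rho>0 in \<open>auto simp: w_def add_nonneg_eq_0_iff less_imp_le order.strict_implies_not_eq\<close>)
  \<comment> \<open>Of the two roots of the quadratic equation the chart takes the one for which 1 +
    (1 - \<rho>) \<beta> is the positive root w, so its image is the part of \<open>Q\<close> where
    that expression is positive.\<close>
  have img: "y ` V = {x \<in> Q. 1 + (1 - \<rho>) * (x \<bullet>\<^sub>1 \<nu> / \<rho>) > 0}"
  proof (rule equalityI; rule subsetI)
    fix x assume "x \<in> y ` V"
    then obtain s where s: "s \<in> V" "x = y s" by blast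
    then show "x \<in> {x \<in> Q. 1 + (1 - \<rho>) * (x \<bullet>\<^sub>1 \<nu> / \<rho>) > 0}"
      using yQ[OF s(1)] \<beta>w[OF s(1)] w(1)[OF s(1)] \<rho>0 by (simp add: y\<nu>)
  next
    fix x assume x: "x \<in> {x \<in> Q. 1 + (1 - \<rho>) * (x \<bullet>\<^sub>1 \<nu> / \<rho>) > 0}"
    define b where "b = x \<bullet>\<^sub>1 \<nu> / \<rho>"
    have xQ: "x \<bullet>\<^sub>1 x = -1" "p \<bullet>\<^sub>1 x = 1" and bp: "1 + (1 - \<rho>) * b > 0" using x by (auto simp: Q_def hyp_def b_def)
    have xb: "x \<bullet>\<^sub>1 \<nu> = \<rho> * b" using \<rho>0 by (simp add: b_def)
    have xa: "x \<bullet>\<^sub>1 x0 = - (1 - \<rho> * b)" using xQ(2) xb by (simp add: px lorentz_diff_left lorentz_diff_right lorentz_commute)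
    define s where "s = \<phi> x"
    have "E s = x + (x \<bullet>\<^sub>1 x0) *\<^sub>R x0 - (x \<bullet>\<^sub>1 \<nu> / \<rho>) *\<^sub>R \<nu>"
      unfolding s_def \<phi>_def
      by (rule E(5)[rule_format]) (use \<rho>0 in \<open>auto simp: lorentz_simps xx \<nu>\<close>)
    then have xe: "x = (1 - \<rho> * b) *\<^sub>R x0 + b *\<^sub>R \<nu> + E s" unfolding xa b_def[symmetric] by (simp add: algebra_simps)
    have "x \<bullet>\<^sub>1 x = - (1 - \<rho> * b) * (1 - \<rho> * b) + b * b * \<rho> + h s"
      by (subst xe, subst xe) (simp add: lorentz_simps xx \<nu> Eo h_def[symmetric] algebra_simps)
    then have q: "\<rho> * (1 - \<rho>) * b * b + 2 * \<rho> * b + h s = 0" using xQ(1) by (simp add: algebra_simps)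
    have sq: "(1 + (1 - \<rho>) * b) * (1 + (1 - \<rho>) * b) = 1 - (1 - \<rho>) * h s / \<rho>"
    proof -
      have "h s / \<rho> = - ((1 - \<rho>) * b * b + 2 * b)" using q \<rho>0 by (simp add: field_simps)
      then have "(1 - \<rho>) * h s / \<rho> = (1 - \<rho>) * - ((1 - \<rho>) * b * b + 2 * b)" by (metis times_divide_eq_right)
      then show ?thesis by (simp add: algebra_simps)
    qed
    have "1 - (1 - \<rho>) * h s / \<rho> > 0" unfolding sq[symmetric] using bp by simp
    then have sV: "s \<in> V" using \<rho>0 by (simp add: V_def field_simps)
    have ws: "w s = 1 + (1 - \<rho>) * b" unfolding w_def sq[symmetric] using bp by simp
    have "b * (\<rho> * (1 + w s)) = - h s" unfolding ws using q by (simp add: algebra_simps)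
    then have "b * (\<rho> * (1 + w s)) = \<beta> s * (\<rho> * (1 + w s))" using \<beta>h[OF sV] by simp
    then have "b = \<beta> s" using w(1)[OF sV] \<rho>0 by simp
    then have "x = y s" using xe by (simp add: y_def)
    then show "x \<in> y ` V" using sV by blast
  qed
  have "local_param Q V y"
    unfolding local_param_def
  proof (intro conjI ballI exI[of _ \<phi>] oV sy)
    fix u assume u: "u \<in> V"
    have "((\<lambda>s. \<phi> (y s)) has_derivative (\<lambda>v. \<phi> (frechet_derivative y (at u) v))) (at u)"
      by (rule bounded_linear.has_derivative[OF _ smooth_on_has_derivative[OF sy u]])
        (use l\<phi> in \<open>simp add: linear_conv_bounded_linear\<close>)
    then have "((\<lambda>s. s) has_derivative (\<lambda>v. \<phi> (frechet_derivative y (at u) v))) (at u)" by (simp add: \<phi>y)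
    then have "(\<lambda>v. \<phi> (frechet_derivative y (at u) v)) = (\<lambda>v. v)"
      using has_derivative_unique[OF _ has_derivative_ident] by blast
    then have "\<phi> (frechet_derivative y (at u) v) = v" for v by (rule fun_cong)
    then show "inj (frechet_derivative y (at u))" by (rule inj_on_inverseI)
  next
    have "open {x. 0 < 1 + (1 - \<rho>) * (x \<bullet>\<^sub>1 \<nu> / \<rho>)}"
      by (rule open_Collect_less)
        (intro continuous_intros linear_continuous_on bounded_bilinear.bounded_linear_left[OF bounded_bilinear_lorentz] | use \<rho>0 in simp)+
    moreover have "y ` V = Q \<inter> {x. 0 < 1 + (1 - \<rho>) * (x \<bullet>\<^sub>1 \<nu> / \<rho>)}" unfolding img by blast
    ultimately show "openin (top_of_set Q) (y ` V)" by (auto simp: openin_open)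
    show "homeomorphism V (y ` V) y \<phi>"
      unfolding homeomorphism_def using \<phi>y smooth_on_continuous[OF sy] linear_continuous_on[of \<phi>] l\<phi>
      by (auto simp: linear_conv_bounded_linear image_iff)
  qed
  moreover have "x0 \<in> y ` V" unfolding img using x0 by (simp add: Q_def \<nu>)
  \<comment> \<open>Here \<rho> \<ge> 1, so the radicand is positive everywhere. For x in
    \<open>Q\<close> the product with \<nu> is the product with x0 plus 1, hence \<le> 0, and the
    positivity condition on the image holds on all of \<open>Q\<close>.\<close>
  moreover have "V = UNIV \<and> y ` V = Q" if "p \<bullet>\<^sub>1 p \<ge> 0"
  proof
    have \<rho>1: "1 - \<rho> \<le> 0" using that by (simp add: \<rho>_def)
    have "(1 - \<rho>) * h s < \<rho>" for s using mult_nonpos_nonneg[OF \<rho>1 h0, of s] \<rho>0 by linarith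
    then show "V = UNIV" by (simp add: V_def)
    have "1 + (1 - \<rho>) * (x \<bullet>\<^sub>1 \<nu> / \<rho>) > 0" if x: "x \<in> Q" for x
    proof -
      have "x \<bullet>\<^sub>1 \<nu> = x \<bullet>\<^sub>1 x0 + 1" using x by (simp add: Q_def \<nu>_def lorentz_add_right lorentz_commute)
      then have "x \<bullet>\<^sub>1 \<nu> / \<rho> \<le> 0" using hyp_lorentz_le[of x x0] x x0 \<rho>0 by (simp add: Q_def divide_nonpos_pos)
      then show ?thesis using mult_nonpos_nonpos[OF \<rho>1] by fastforce
    qed
    then show "y ` V = Q" unfolding img by blast
  qed
  ultimately show ?thesis by blast
qed

text \<open>For timelike p the section is a round sphere with centre c = p / (p.p) and squared
  radius R2 in the spacelike complement of p. It is the radial image of R^k without the origin,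
  which is connected for k \<ge> 2.\<close>

lemma connected_timelike_hyperplane_section:
  fixes p :: "real ^ ('k::finite) option"
  assumes k: "2 \<le> CARD('k)" and p: "-1 < p \<bullet>\<^sub>1 p" "p \<bullet>\<^sub>1 p < 0" and x0: "x0 \<in> hyp" "p \<bullet>\<^sub>1 x0 = 1"
  shows "connected {x \<in> hyp. p \<bullet>\<^sub>1 x = 1}"
proof -
  define c where "c = (1 / (p \<bullet>\<^sub>1 p)) *\<^sub>R p"
  define R2 where "R2 = - 1 - 1 / (p \<bullet>\<^sub>1 p)"
  have R2: "R2 > 0" using p by (simp add: R2_def field_simps)
  have pc: "p \<bullet>\<^sub>1 c = 1" "c \<bullet>\<^sub>1 c = 1 / (p \<bullet>\<^sub>1 p)"
    using p by (simp_all add: c_def lorentz_scaleR_left lorentz_scaleR_right)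
  have "p \<noteq> 0" using p by (metis lorentz_zero_left less_irrefl)
  then have "independent {p}" by simp
  then obtain E :: "real ^ 'k \<Rightarrow> real ^ 'k option" and L where E: "linear E" "linear L"
    "\<forall>s. \<forall>b\<in>{p}. E s \<bullet>\<^sub>1 b = 0" "\<forall>s. L (E s) = s" "\<forall>x. (\<forall>b\<in>{p}. x \<bullet>\<^sub>1 b = 0) \<longrightarrow> E (L x) = x"
    using lorentz_complement_parametrization[of "{p}", where ?'d = 'k] by auto
  have Ep: "E s \<bullet>\<^sub>1 p = 0" "p \<bullet>\<^sub>1 E s = 0" "E s \<bullet>\<^sub>1 c = 0" "c \<bullet>\<^sub>1 E s = 0" for s
    using E(3) by (simp_all add: c_def lorentz_scaleR_left lorentz_scaleR_right lorentz_commute)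
  have h: "E s \<bullet>\<^sub>1 E s > 0" if "s \<noteq> 0" for s
  proof (rule lorentz_orthogonal_to_timelike[OF p(2) Ep(1)])
    show "E s \<noteq> 0" using E(4) that linear_0[OF E(2)] by metis
  qed
  define f where "f s = c + sqrt (R2 / (E s \<bullet>\<^sub>1 E s)) *\<^sub>R E s" for s
  have "continuous_on (- {0}) f"
  proof -
    have cE: "continuous_on T E" for T using E(1) linear_continuous_on by (simp add: linear_conv_bounded_linear)
    show ?thesis unfolding f_def[abs_def]
      by (intro continuous_intros cE bounded_bilinear.continuous_on[OF bounded_bilinear_lorentz]) (use h in force)
  qed
  moreover have "connected (- {0 :: real ^ 'k})" using k by (intro connected_punctured_universe) simp
  ultimately have "connected (f ` (- {0}))" by (rule connected_continuous_image)
  moreover have "f ` (- {0}) = {x \<in> hyp. p \<bullet>\<^sub>1 x = 1}"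
  proof (rule equalityI; rule subsetI)
    fix x assume "x \<in> f ` (- {0})"
    then obtain s where s: "s \<noteq> 0" "x = f s" by blast
    define t where "t = sqrt (R2 / (E s \<bullet>\<^sub>1 E s))"
    have "t * t = R2 / (E s \<bullet>\<^sub>1 E s)" using R2 h[OF s(1)] by (simp add: t_def)
    then have tt: "t * (t * (E s \<bullet>\<^sub>1 E s)) = R2" using h[OF s(1)] by (simp add: field_simps)
    have xt: "x = c + t *\<^sub>R E s" using s by (simp add: f_def t_def)
    have "x \<bullet>\<^sub>1 x = -1" unfolding xt by (simp add: lorentz_simps pc Ep tt) (simp add: R2_def)
    moreover have px: "p \<bullet>\<^sub>1 x = 1" unfolding xt by (simp add: lorentz_simps pc Ep)
    moreover have "x \<in> hyp"
    proof (rule hyp_memI)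
      \<comment> \<open>Minus p, normalised: the given point \<open>x0\<close> places it on the
        upper sheet, and its product with x shows that x lies on the same sheet.\<close>
      define q where "q = (- 1 / sqrt (- (p \<bullet>\<^sub>1 p))) *\<^sub>R p"
      have sp: "sqrt (- (p \<bullet>\<^sub>1 p)) > 0" using p by simp
      have "sqrt (- (p \<bullet>\<^sub>1 p)) * sqrt (- (p \<bullet>\<^sub>1 p)) = - (p \<bullet>\<^sub>1 p)" using p by simp
      then have "q \<bullet>\<^sub>1 q = -1" using p sp by (simp add: q_def lorentz_minus_left lorentz_minus_right lorentz_scaleR_left lorentz_scaleR_right field_simps)
      moreover have "x0 \<bullet>\<^sub>1 q < 0" using x0 sp by (simp add: q_def lorentz_minus_right lorentz_scaleR_right lorentz_commute[of x0 p])
      ultimately show "q \<in> hyp" using hyp_memI x0(1) by blast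
      show "q \<bullet>\<^sub>1 x < 0" using px sp by (simp add: q_def lorentz_minus_left lorentz_scaleR_left)
    qed fact
    ultimately show "x \<in> {x \<in> hyp. p \<bullet>\<^sub>1 x = 1}" by simp
  next
    fix x assume x: "x \<in> {x \<in> hyp. p \<bullet>\<^sub>1 x = 1}"
    define s where "s = L (x - c)"
    have xp: "x \<bullet>\<^sub>1 p = 1" "x \<bullet>\<^sub>1 x = -1" using x by (simp_all add: lorentz_commute hyp_def)
    have Es: "E s = x - c" unfolding s_def
      by (rule E(5)[rule_format]) (use xp(1) pc(1) in \<open>simp add: lorentz_diff_left lorentz_commute[of c p]\<close>)
    have "(c + E s) \<bullet>\<^sub>1 (c + E s) = 1 / (p \<bullet>\<^sub>1 p) + E s \<bullet>\<^sub>1 E s" by (simp add: lorentz_add_left lorentz_add_right pc Ep)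
    then have "x \<bullet>\<^sub>1 x = 1 / (p \<bullet>\<^sub>1 p) + E s \<bullet>\<^sub>1 E s" by (simp add: Es)
    then have EE: "E s \<bullet>\<^sub>1 E s = R2" using xp(2) by (simp add: R2_def)
    then have "s \<noteq> 0" using R2 linear_0[OF E(1)] by (auto simp: lorentz_zero_left)
    moreover have "f s = x" unfolding f_def EE using R2 by (simp add: Es)
    ultimately show "x \<in> f ` (- {0})" by blast
  qed
  ultimately show ?thesis by simp
qed

text \<open>Connectedness comes from a single global chart when p is null or spacelike, and from the
  sphere when p is timelike.\<close>

theorem hyperplane_section_hypersurface:
  fixes p x0 :: "real ^ ('k::finite) option"
  assumes card: "CARD('q::finite) + 1 = CARD('k)" and \<rho>: "p \<bullet>\<^sub>1 p > -1" and x0: "x0 \<in> hyp" "p \<bullet>\<^sub>1 x0 = 1"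
  shows "hypersurface TYPE('q) {x \<in> hyp. p \<bullet>\<^sub>1 x = 1}"
proof -
  have "connected {x \<in> hyp. p \<bullet>\<^sub>1 x = 1}"
  proof (cases "p \<bullet>\<^sub>1 p \<ge> 0")
    case True
    obtain V and y :: "real ^ 'q \<Rightarrow> _" where "local_param {x \<in> hyp. p \<bullet>\<^sub>1 x = 1} V y" "V = UNIV" "y ` V = {x \<in> hyp. p \<bullet>\<^sub>1 x = 1}"
      using hyperplane_section_chart[OF card \<rho> x0] True by blast
    then show ?thesis
      using connected_continuous_image[OF smooth_on_continuous[of UNIV y] connected_UNIV] by (simp add: local_param_def)
  next
    case False
    have "2 \<le> CARD('k)" using card zero_less_card_finite[where 'a = 'q] by linarith
    then show ?thesis using connected_timelike_hyperplane_section[OF _ \<rho> _ x0] False by simp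
  qed
  moreover have "\<exists>V (y :: real ^ 'q \<Rightarrow> _). local_param {x \<in> hyp. p \<bullet>\<^sub>1 x = 1} V y \<and> x \<in> y ` V" if "x \<in> {x \<in> hyp. p \<bullet>\<^sub>1 x = 1}" for x
    using hyperplane_section_chart[OF card \<rho>, of x] that by blast
  ultimately show ?thesis using card x0 unfolding hypersurface_def by blast
qed

subsection \<open>Submanifolds of umbilic hypersurfaces\<close>

lemma constant_of_pd_zero:
  fixes f :: "real ^ 'n::finite \<Rightarrow> 'b::real_normed_vector"
  assumes V: "open V" "connected V" and f: "\<And>u. u \<in> V \<Longrightarrow> f differentiable (at u)" "\<And>u i. u \<in> V \<Longrightarrow> pd i f u = 0"
    and uv: "u \<in> V" "v \<in> V"
  shows "f u = f v"
proof (rule has_derivative_zero_unique_connected[OF V _ uv])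
  fix x assume x: "x \<in> V"
  have "frechet_derivative f (at x) = (\<lambda>v. 0)"
    using frechet_eq_sum_pd[OF f(1)[OF x]] f(2)[OF x] by (simp add: fun_eq_iff)
  then show "(f has_derivative (\<lambda>v. 0)) (at x)" using f(1)[OF x] by (simp add: frechet_derivative_works)
qed

context adapted_immersion
begin

lemma pd_frame_eq: "u \<in> V \<Longrightarrow> pd i (\<epsilon> k) u = A u $ k $ i *\<^sub>R fr (Some (Inr i)) u"
  using pd_fr[of u i "Some (Inl k)"]
  by (simp add: sum_UNIV_option sum_UNIV_sum star_coeff_nth fr_simps(2)[abs_def] sum_if_scaleR)

lemma pd_tangent_self:
  "u \<in> V \<Longrightarrow> pd i (fr (Some (Inr i))) u = b u $ i *\<^sub>R Y u - (\<Sum>k\<in>UNIV. A u $ k $ i *\<^sub>R \<epsilon> k u) - (\<Sum>j\<in>UNIV. F_of b u $ i $ j *\<^sub>R fr (Some (Inr j)) u)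
    + F_of b u $ i $ i *\<^sub>R fr (Some (Inr i)) u"
  using pd_fr[of u i "Some (Inr i)"]
  by (simp add: sum_UNIV_option sum_UNIV_sum star_coeff_nth fr_simps(1,2) sum_if_scaleR scaleR_diff_left sum_subtractf
      sum_negf algebra_simps)

lemma in_hyperplane_of_weights:
  assumes conn: "connected V" and w: "\<And>u. u \<in> V \<Longrightarrow> b u = transpose (A u) *v w"
  shows "\<exists>p. p \<bullet>\<^sub>1 p = w \<bullet> w - 1 \<and> (\<forall>u\<in>V. p \<bullet>\<^sub>1 Y u = 1)"
proof (cases "V = {}")
  case False
  then obtain u0 where u0: "u0 \<in> V" by blast
  define P where "P u = (\<Sum>k\<in>UNIV. w $ k *\<^sub>R \<epsilon> k u) - Y u" for u
  have b: "b u $ i = (\<Sum>k\<in>UNIV. w $ k * A u $ k $ i)" if "u \<in> V" for u i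
    by (subst w[OF that]) (simp add: matrix_vector_mult_def transpose_def mult.commute)
  have d: "(\<lambda>x. \<Sum>k\<in>UNIV. w $ k *\<^sub>R \<epsilon> k x) differentiable (at u)" "(\<lambda>x. w $ k *\<^sub>R \<epsilon> k x) differentiable (at u)" if "u \<in> V" for u k
    using diff_frame[OF that] by (auto intro!: derivative_intros)
  have "pd i P u = 0" if u: "u \<in> V" for u i
  proof -
    have "pd i P u = (\<Sum>k\<in>UNIV. w $ k *\<^sub>R pd i (\<epsilon> k) u) - pd i Y u"
      unfolding P_def[abs_def]
      by (simp add: pd_diff[OF d(1)[OF u] diff_Y[OF u]] pd_sum[OF d(2)[OF u]]
          pd_bounded_linear[OF bounded_linear_scaleR_right diff_frame[OF u]])
    also have "\<dots> = (\<Sum>k\<in>UNIV. w $ k * A u $ k $ i) *\<^sub>R fr (Some (Inr i)) u - b u $ i *\<^sub>R fr (Some (Inr i)) u"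
      by (simp add: pd_frame_eq[OF u] pd_Y_eq[OF u] scaleR_sum_left)
    finally show ?thesis using b[OF u] by simp
  qed
  moreover have "P differentiable (at u)" if "u \<in> V" for u
    unfolding P_def[abs_def] by (intro derivative_intros d(1) diff_Y that)
  ultimately have P: "P u = P u0" if "u \<in> V" for u
    using constant_of_pd_zero[OF open_domain conn] that u0 by blast
  have "P u \<bullet>\<^sub>1 Y u = 1" if "u \<in> V" for u
    by (simp add: P_def lorentz_simps norm_Y[OF that] frame_Y[OF that])
  moreover have "P u0 \<bullet>\<^sub>1 P u0 = w \<bullet> w - 1"
  proof -
    have "P u0 \<bullet>\<^sub>1 \<epsilon> k u0 = w $ k" for k
      using sum_if_mult(2)[of "\<lambda>k. w $ k" k "\<lambda>_. 1"]
      by (simp add: P_def lorentz_simps frame_orthonormal[OF u0] frame_Y'[OF u0])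
    moreover have "P u0 \<bullet>\<^sub>1 P u0 = (\<Sum>k\<in>UNIV. w $ k * (P u0 \<bullet>\<^sub>1 \<epsilon> k u0)) - P u0 \<bullet>\<^sub>1 Y u0"
      by (subst (2) P_def) (simp add: lorentz_diff_right lorentz_sum_right lorentz_scaleR_right)
    ultimately show ?thesis using \<open>\<And>u. u \<in> V \<Longrightarrow> P u \<bullet>\<^sub>1 Y u = 1\<close>[OF u0] by (simp add: inner_vec_def)
  qed
  ultimately show ?thesis using P by (intro exI[of _ "P u0"]) auto
next
  case True
  obtain k :: 'm where True by simp
  \<comment> \<open>On an empty domain only the square of p is at stake; a spacelike or timelike
    multiple of a basis vector attains the value.\<close>
  define p :: "real ^ ('m + 'n) option" where
    "p = (if w \<bullet> w \<ge> 1 then sqrt (w \<bullet> w - 1) *\<^sub>R axis (Some (Inl k)) 1 else sqrt (1 - w \<bullet> w) *\<^sub>R axis None 1)"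
  have "p \<bullet>\<^sub>1 p = w \<bullet> w - 1" by (simp add: p_def lorentz_scaleR_left lorentz_scaleR_right lorentz_axis)
  then show ?thesis using True by blast
qed

lemma weights_of_hyperplane:
  assumes conn: "connected V" "u0 \<in> V" and p: "\<And>u. u \<in> V \<Longrightarrow> p \<bullet>\<^sub>1 Y u = l"
  shows "\<exists>w. w \<bullet> w = p \<bullet>\<^sub>1 p + l * l \<and> (\<forall>u\<in>V. transpose (A u) *v w = l *\<^sub>R b u)"
proof -
  have pt: "p \<bullet>\<^sub>1 fr (Some (Inr i)) u = 0" if u: "u \<in> V" for u i
    using orthogonal_derivative[OF u differentiable_const diff_Y[OF u], of p l i] p
    by (simp add: lorentz_zero_left fr_simps lorentz_scaleR_right)
  have "pd i (\<lambda>u. p \<bullet>\<^sub>1 \<epsilon> k u) u = 0" if u: "u \<in> V" for u i k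
    using pd_lorentz[OF differentiable_const diff_frame[OF u], of i p k]
    by (simp add: lorentz_zero_left pd_frame_eq[OF u] lorentz_scaleR_right pt[OF u])
  moreover have "(\<lambda>u. p \<bullet>\<^sub>1 \<epsilon> k u) differentiable (at u)" if "u \<in> V" for u k
    by (rule smooth_on_differentiable[OF _ that]) (intro smooth_intros open_domain smooth_frame)
  ultimately have c: "p \<bullet>\<^sub>1 \<epsilon> k u = p \<bullet>\<^sub>1 \<epsilon> k u0" if "u \<in> V" for u k
    using constant_of_pd_zero[OF open_domain conn(1) _ _ that conn(2), of "\<lambda>u. p \<bullet>\<^sub>1 \<epsilon> k u"] by blast
  define w :: "real ^ 'm" where "w = (\<chi> k. p \<bullet>\<^sub>1 \<epsilon> k u0)"
  have "(transpose (A u) *v w) $ i = (l *\<^sub>R b u) $ i" if u: "u \<in> V" for u i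
  proof -
    have "p \<bullet>\<^sub>1 pd i (fr (Some (Inr i))) u = 0"
      using orthogonal_derivative[OF u differentiable_const diff_fr[OF u, of "Some (Inr i)"], of p 0 i] pt
      by (simp add: lorentz_zero_left)
    then have "l * b u $ i = (\<Sum>k\<in>UNIV. A u $ k $ i * (p \<bullet>\<^sub>1 \<epsilon> k u))"
      by (simp add: pd_tangent_self[OF u] lorentz_add_right lorentz_diff_right lorentz_sum_right lorentz_scaleR_right p[OF u] pt[OF u] mult.commute[of l])
    then show ?thesis by (simp add: matrix_vector_mult_def transpose_def w_def c[OF u])
  qed
  then have "\<forall>u\<in>V. transpose (A u) *v w = l *\<^sub>R b u" by (simp add: vec_eq_iff)
  moreover have "w \<bullet> w = p \<bullet>\<^sub>1 p + l * l"
  proof -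
    \<comment> \<open>In the adapted frame p has the components w along the normal frame, none along
      the tangent vectors, and -l along the timelike \<open>Y\<close>.\<close>
    let ?e = "\<Sum>r\<in>UNIV. (lsign r * (p \<bullet>\<^sub>1 fr r u0)) *\<^sub>R fr r u0"
    have "p = ?e" using lorentz_orthonormal_expand[of "\<lambda>r. fr r u0" p] fr_orthonormal[OF conn(2)] by simp
    then have "p \<bullet>\<^sub>1 p = p \<bullet>\<^sub>1 ?e" by simp
    also have "\<dots> = (\<Sum>r\<in>UNIV. lsign r * (p \<bullet>\<^sub>1 fr r u0) * (p \<bullet>\<^sub>1 fr r u0))"
      by (simp only: lorentz_sum_right lorentz_scaleR_right)
    also have "\<dots> = w \<bullet> w - l * l"
      by (simp add: sum_UNIV_option sum_UNIV_sum pt[OF conn(2)]) (simp add: fr_simps p[OF conn(2)] inner_vec_def w_def)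
    finally show ?thesis by simp
  qed
  ultimately show ?thesis by blast
qed

text \<open>For m = n the matrix \<open>A u\<close> is orthogonal, so its transpose is injective.
  This excludes l = 0 in the relation A^t w = l b with |w| = 1.\<close>

lemma weights_zero:
  assumes "CARD('m) = CARD('n)" "u \<in> V" "transpose (A u) *v w = 0"
  shows "w = 0"
proof -
  have l: "linear ((*v) (A u))" by simp
  have AA: "transpose (A u) *v (A u *v x) = x" for x
    by (simp add: matrix_vector_mul_assoc orthonormal_A[OF assms(2)] del: transpose_matrix_vector)
  have "inj ((*v) (A u))" by (rule inj_on_inverseI[of _ "\<lambda>x. transpose (A u) *v x"]) (rule AA)
  then have "surj ((*v) (A u))" using linear_injective_imp_surjective[OF l] assms(1) by simp
  then obtain x where "w = A u *v x" by blast
  then show ?thesis using assms(3) AA[of x] by (metis matrix_vector_mult_0_right)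
qed

text \<open>\<open>w\<close> cannot vanish because \<open>b\<close> does not, so p.p = |w|^2 - 1 >
  -1, which makes the section at l = 1 a hypersurface. As l is non-zero it is not totally geodesic,
  and it is flat iff p is null.\<close>

lemma umbilic_of_weights:
  assumes conn: "connected V" "u0 \<in> V" and w: "\<And>u. u \<in> V \<Longrightarrow> b u = transpose (A u) *v w"
    and q: "CARD('q::finite) + 1 = CARD('m) + CARD('n)" "2 \<le> CARD('q)"
  shows "\<exists>Q. totally_umbilic TYPE('q) Q \<and> \<not> totally_geodesic TYPE('q) Q \<and> Y ` V \<subseteq> Q \<and>
    (flat_hypersurface TYPE('q) Q \<longleftrightarrow> norm w = 1)"
proof -
  obtain p where p: "p \<bullet>\<^sub>1 p = w \<bullet> w - 1" "\<And>u. u \<in> V \<Longrightarrow> p \<bullet>\<^sub>1 Y u = 1"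
    using in_hyperplane_of_weights[OF conn(1) w] by blast
  define Q where "Q = {x \<in> hyp. p \<bullet>\<^sub>1 x = 1}"
  have "w \<noteq> 0"
  proof
    assume "w = 0"
    then have "b u0 = 0" using w[OF conn(2)] by simp
    then show False using b_nonzero[OF conn(2)] by simp
  qed
  then have \<rho>: "w \<bullet> w > 0" by simp
  have Q: "hypersurface TYPE('q) Q" unfolding Q_def
    by (rule hyperplane_section_hypersurface[of p "Y u0"]) (use q p \<rho> in_hyp[OF conn(2)] conn(2) in auto)
  have \<rho>': "p \<bullet>\<^sub>1 p + 1 * 1 > 0" using \<rho> p(1) by simp
  have pl: "p \<bullet>\<^sub>1 x = 1" if "x \<in> Q" for x using that by (simp add: Q_def)
  have "Y ` V \<subseteq> Q" using p(2) in_hyp by (auto simp: Q_def)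
  moreover have "norm w = 1 \<longleftrightarrow> p \<bullet>\<^sub>1 p = 0" by (simp add: p(1) norm_eq_1)
  ultimately show ?thesis
    using hyperplane_section_umbilic(1)[OF Q pl \<rho>'] hyperplane_section_umbilic(3)[OF Q pl \<rho>'] hyperplane_section_umbilic(4)[OF Q pl \<rho>' q(2)]
    by (intro exI[of _ Q]) simp
qed

lemma weights_of_umbilic:
  assumes conn: "connected V" "u0 \<in> V" and q: "2 \<le> CARD('q::finite)"
    and Q: "totally_umbilic TYPE('q) Q" "Y ` V \<subseteq> Q"
  shows "\<exists>l w. norm w = 1 \<and> (\<forall>u\<in>V. transpose (A u) *v w = l *\<^sub>R b u) \<and>
    (l = 0 \<longrightarrow> totally_geodesic TYPE('q) Q) \<and> (flat_hypersurface TYPE('q) Q \<longrightarrow> \<bar>l\<bar> = 1)"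
proof -
  obtain p l where pl: "\<forall>x\<in>Q. p \<bullet>\<^sub>1 x = l" "p \<bullet>\<^sub>1 p + l * l = 1"
    using umbilic_hypersurface_in_hyperplane[OF Q(1) q] by blast
  have "p \<bullet>\<^sub>1 Y u = l" if "u \<in> V" for u using pl(1) Q(2) that by blast
  from weights_of_hyperplane[OF conn this] obtain w where
    w: "w \<bullet> w = p \<bullet>\<^sub>1 p + l * l" "\<forall>u\<in>V. transpose (A u) *v w = l *\<^sub>R b u" by blast
  have H: "hypersurface TYPE('q) Q" using Q(1) by (simp add: totally_umbilic_def)
  have pos: "p \<bullet>\<^sub>1 p + l * l > 0" using pl(2) by simp
  have "norm w = 1" using w(1) pl(2) by (simp add: norm_eq_1)
  moreover have "totally_geodesic TYPE('q) Q" if "l = 0"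
    by (rule hyperplane_section_umbilic(2)[OF H _ pos that]) (use pl(1) in blast)
  moreover have "\<bar>l\<bar> = 1" if "flat_hypersurface TYPE('q) Q"
  proof -
    have "p \<bullet>\<^sub>1 p = 0" using hyperplane_section_umbilic(4)[OF H _ pos q] pl(1) that by blast
    then have "l\<^sup>2 = 1" using pl(2) by (simp add: power2_eq_square)
    then show ?thesis by (auto simp: power2_eq_1_iff)
  qed
  ultimately show ?thesis using w(2) by (intro exI[of _ l] exI[of _ w]) simp
qed

text \<open>An umbilic hypersurface gives A^t w = l b with |w| = 1, and dividing by l gives the
  weights. The case l = 0 makes the hypersurface totally geodesic and has to be excluded: because it
  is assumed not to be so, or because m = n. For flat ones |l| = 1, so the division keeps the norm
  of w.\<close>

lemma umbilic_iff:
  assumes conn: "connected V" "V \<noteq> {}" and M: "M = Y ` V"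
    and q: "CARD('q::finite) + 1 = CARD('m) + CARD('n)" "2 \<le> CARD('q)"
  shows "(\<exists>Q. totally_umbilic TYPE('q) Q \<and> \<not> totally_geodesic TYPE('q) Q \<and> M \<subseteq> Q) \<longleftrightarrow>
      (\<exists>w. \<forall>u\<in>V. b u = transpose (A u) *v w)" (is "?a \<longleftrightarrow> ?W")
    and "CARD('m) = CARD('n) \<or> \<not> (\<exists>Q. totally_geodesic TYPE('q) Q \<and> M \<subseteq> Q) \<Longrightarrow>
      (\<exists>Q. totally_umbilic TYPE('q) Q \<and> M \<subseteq> Q) \<longleftrightarrow> (\<exists>w. \<forall>u\<in>V. b u = transpose (A u) *v w)" (is "_ \<Longrightarrow> ?b \<longleftrightarrow> ?W")
    and "(\<exists>Q. totally_umbilic TYPE('q) Q \<and> flat_hypersurface TYPE('q) Q \<and> M \<subseteq> Q) \<longleftrightarrow>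
      (\<exists>w. norm w = 1 \<and> (\<forall>u\<in>V. b u = transpose (A u) *v w))" (is "?c \<longleftrightarrow> ?W1")
proof -
  obtain u0 where u0: "u0 \<in> V" using conn(2) by blast
  have up: "\<exists>Q. totally_umbilic TYPE('q) Q \<and> \<not> totally_geodesic TYPE('q) Q \<and> M \<subseteq> Q \<and>
      (flat_hypersurface TYPE('q) Q \<longleftrightarrow> norm w = 1)" if "\<forall>u\<in>V. b u = transpose (A u) *v w" for w
    unfolding M by (rule umbilic_of_weights[OF conn(1) u0 _ q]) (use that in blast)
  have down: "\<exists>l w. norm w = 1 \<and> (\<forall>u\<in>V. transpose (A u) *v w = l *\<^sub>R b u) \<and>
      (l = 0 \<longrightarrow> totally_geodesic TYPE('q) Q) \<and> (flat_hypersurface TYPE('q) Q \<longrightarrow> \<bar>l\<bar> = 1)"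
    if "totally_umbilic TYPE('q) Q" "M \<subseteq> Q" for Q
    by (rule weights_of_umbilic[OF conn(1) u0 q(2) that(1)]) (use that(2) M in simp)
  have scale: "b u = transpose (A u) *v ((1 / l) *\<^sub>R w)" if "transpose (A u) *v w = l *\<^sub>R b u" "l \<noteq> 0" for u l w
    using that by (simp add: matrix_vector_mult_scaleR del: transpose_matrix_vector)
  show "?a \<longleftrightarrow> ?W"
  proof
    assume ?a
    then obtain Q where Q: "totally_umbilic TYPE('q) Q" "\<not> totally_geodesic TYPE('q) Q" "M \<subseteq> Q" by blast
    from down[OF Q(1,3)] obtain l w where lw: "\<forall>u\<in>V. transpose (A u) *v w = l *\<^sub>R b u" "l = 0 \<longrightarrow> totally_geodesic TYPE('q) Q" by blast
    then have "l \<noteq> 0" using Q(2) by blast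
    then show ?W using scale lw(1) by blast
  qed (use up in blast)
  show "?b \<longleftrightarrow> ?W" if hyp: "CARD('m) = CARD('n) \<or> \<not> (\<exists>Q. totally_geodesic TYPE('q) Q \<and> M \<subseteq> Q)"
  proof
    assume ?b
    then obtain Q where Q: "totally_umbilic TYPE('q) Q" "M \<subseteq> Q" by blast
    from down[OF Q] obtain l w where lw: "norm w = 1" "\<forall>u\<in>V. transpose (A u) *v w = l *\<^sub>R b u"
      "l = 0 \<longrightarrow> totally_geodesic TYPE('q) Q" by blast
    have "l \<noteq> 0"
    proof
      assume l: "l = 0"
      then have "CARD('m) = CARD('n)" using lw(3) Q(2) hyp by blast
      from weights_zero[OF this u0] lw(2) l u0 have "w = 0" by simp
      then show False using lw(1) by simp
    qed
    then show ?W using scale lw(2) by blast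
  qed (use up in blast)
  show "?c \<longleftrightarrow> ?W1"
  proof
    assume ?c
    then obtain Q where Q: "totally_umbilic TYPE('q) Q" "M \<subseteq> Q" "flat_hypersurface TYPE('q) Q" by blast
    from down[OF Q(1,2)] Q(3) obtain l w where lw: "norm w = 1" "\<forall>u\<in>V. transpose (A u) *v w = l *\<^sub>R b u" "\<bar>l\<bar> = 1" by blast
    then have "norm ((1 / l) *\<^sub>R w) = 1" "l \<noteq> 0" by auto
    then show ?W1 using scale lw(2) by blast
  qed (use up in blast)
qed

end

text \<open>The type \<open>'q\<close> supplies the dimension n + m - 1 of hypersurfaces. The sign
  in (v) fixes the time orientation of a solution in the full group. The first equivalence of (vi)
  comes in two versions because a totally geodesic hypersurface only yields A^t w = 0, which is no
  condition on \<open>b\<close>.\<close>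

theorem theorem7p3:
  fixes U :: "(real ^ ('n::finite) option) set"
    and X :: "real ^ 'n option \<Rightarrow> real ^ (('m::finite) + 'n) option"
    and e :: "'m \<Rightarrow> real ^ 'n option \<Rightarrow> real ^ ('m + 'n) option"
  assumes X: "local_isometric_immersion U X"
    and flat: "flat_normal_bundle U X"
    and nondeg: "nondegenerate_normal_bundle U X"
    and frame: "parallel_normal_frame U X e"
    and dim_q: "CARD('q::finite) + 1 = CARD('m) + CARD('n)"
  shows
    \<comment> \<open>(i)\<close>
    "(\<forall>p\<in>U. \<exists>V \<psi> A b. connected V \<and> p \<in> \<psi> ` V \<and> adapted_coords U X e V \<psi> A b)
     \<and>
     \<comment> \<open>(ii), (iii)\<close>
     (\<forall>V \<psi> A b. adapted_coords U X e V \<psi> A b \<longrightarrow>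
        (\<forall>u\<in>V. \<forall>i. b u $ i \<noteq> 0) \<and>
        G1_system_I V A (F_of b) b \<and>
        solves_star V A (F_of b) b (frame_matrix (\<lambda>k. e k \<circ> \<psi>) (X \<circ> \<psi>) b) \<and>
        (\<forall>u\<in>V. \<forall>i. cpx_mat (star_coeff (A u) (F_of b u) (b u) i) = lax_coeff (A u) (F_of b u) (b u) 1 i))
     \<and>
     \<comment> \<open>(iv)\<close>
     (\<forall>(V :: (real ^ 'n) set) (A :: real ^ 'n \<Rightarrow> real ^ 'n ^ 'm) F b W u0 g0.
        open V \<and> G1_system_I V A F b \<and> W \<subseteq> V \<and> open W \<and> convex W \<and> u0 \<in> W \<and> g0 \<in> Lorentz_group \<longrightarrow>
        (\<exists>g. solves_star W A F b g \<and> g u0 = g0))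
     \<and>
     \<comment> \<open>(v)\<close>
     (\<forall>(V :: (real ^ 'n) set) (A :: real ^ 'n \<Rightarrow> real ^ 'n ^ 'm) F b g u0.
        open V \<and> connected V \<and> G1_maps V A F b \<and> (\<forall>u\<in>V. \<forall>i. b u $ i \<noteq> 0) \<and>
        solves_star V A F b g \<and> u0 \<in> V \<longrightarrow>
        (let Y = (\<lambda>u. sgn (g u0 $ None $ None) *\<^sub>R column None (g u)) in
           immersion_into_hyp V Y \<and>
           (\<forall>u\<in>V. \<forall>i j. first_ff Y u $ i $ j = (if i = j then (b u $ i)\<^sup>2 else 0)) \<and>
           const_curvature V (first_ff Y) (-1)))
     \<and>
     \<comment> \<open>(vi)\<close>
     (\<forall>V \<psi> A b M. adapted_coords U X e V \<psi> A b \<and> connected V \<and> V \<noteq> {} \<and> M = X ` \<psi> ` V \<and>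
        2 \<le> CARD('q) \<longrightarrow>
        ((\<exists>Q. totally_umbilic TYPE('q) Q \<and> \<not> totally_geodesic TYPE('q) Q \<and> M \<subseteq> Q) \<longleftrightarrow>
           (\<exists>w. \<forall>u\<in>V. b u = transpose (A u) *v w)) \<and>
        (CARD('m) = CARD('n) \<or> \<not> (\<exists>Q. totally_geodesic TYPE('q) Q \<and> M \<subseteq> Q) \<longrightarrow>
           (\<exists>Q. totally_umbilic TYPE('q) Q \<and> M \<subseteq> Q) \<longleftrightarrow>
           (\<exists>w. \<forall>u\<in>V. b u = transpose (A u) *v w)) \<and>
        ((\<exists>Q. totally_umbilic TYPE('q) Q \<and> flat_hypersurface TYPE('q) Q \<and> M \<subseteq> Q) \<longleftrightarrow>
           (\<exists>w. norm w = 1 \<and> (\<forall>u\<in>V. b u = transpose (A u) *v w))))"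
proof -
  have adapted: "adapted_immersion V (X \<circ> \<psi>) (\<lambda>k. e k \<circ> \<psi>) A b" if "adapted_coords U X e V \<psi> A b" for V \<psi> A b
    using that framed_immersion_of_chart[OF X frame, of V \<psi>]
    unfolding adapted_coords_def adapted_immersion_def adapted_immersion_axioms_def by blast
  show ?thesis
  proof (intro conjI ballI allI impI; (elim conjE)?)
    show "\<exists>V \<psi> A b. connected V \<and> p \<in> \<psi> ` V \<and> adapted_coords U X e V \<psi> A b" if "p \<in> U" for p
      by (rule exists_adapted_coords[OF X nondeg frame that])
  next
    fix V \<psi> A b assume ac: "adapted_coords U X e V \<psi> A b"
    interpret adapted_immersion V "X \<circ> \<psi>" "\<lambda>k. e k \<circ> \<psi>" A b by (rule adapted[OF ac])
    show "b u $ i \<noteq> 0" if "u \<in> V" for u i by (rule b_nonzero[OF that])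
    show "G1_system_I V A (F_of b) b" by (rule adapted_G1_system)
    show "solves_star V A (F_of b) b (frame_matrix (\<lambda>k. e k \<circ> \<psi>) (X \<circ> \<psi>) b)" by (rule frame_solves_star)
    show "cpx_mat (star_coeff (A u) (F_of b u) (b u) i) = lax_coeff (A u) (F_of b u) (b u) 1 i" for u i
      by (rule lax_coeff_one)
  next
    fix V W :: "(real ^ 'n) set" and A :: "real ^ 'n \<Rightarrow> real ^ 'n ^ 'm" and F b u0
      and g0 :: "real ^ ('m + 'n) option ^ ('m + 'n) option"
    assume "open V" "G1_system_I V A F b" "W \<subseteq> V" "open W" "convex W" "u0 \<in> W" "g0 \<in> Lorentz_group"
    then show "\<exists>g. solves_star W A F b g \<and> g u0 = g0" by (rule star_solvable)
  next
    fix V :: "(real ^ 'n) set" and A :: "real ^ 'n \<Rightarrow> real ^ 'n ^ 'm" and F b g u0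
    assume "open V" "connected V" "G1_maps V A F b" "\<forall>u\<in>V. \<forall>i. b u $ i \<noteq> 0" "solves_star V A F b g" "u0 \<in> V"
    then show "let Y = (\<lambda>u. sgn (g u0 $ None $ None) *\<^sub>R column None (g u)) in
           immersion_into_hyp V Y \<and>
           (\<forall>u\<in>V. \<forall>i j. first_ff Y u $ i $ j = (if i = j then (b u $ i)\<^sup>2 else 0)) \<and>
           const_curvature V (first_ff Y) (-1)"
      unfolding Let_def by (intro star_solution_immersion) auto
  next
    fix V \<psi> A b M
    assume ac: "adapted_coords U X e V \<psi> A b" and V: "connected V" "V \<noteq> {}" and M: "M = X ` \<psi> ` V" and q: "2 \<le> CARD('q)"
    have M': "M = (X \<circ> \<psi>) ` V" using M by (simp add: image_comp)
    note iff = adapted_immersion.umbilic_iff[OF adapted[OF ac] V M' dim_q q]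
    show "(\<exists>Q. totally_umbilic TYPE('q) Q \<and> \<not> totally_geodesic TYPE('q) Q \<and> M \<subseteq> Q) \<longleftrightarrow>
        (\<exists>w. \<forall>u\<in>V. b u = transpose (A u) *v w)" by (rule iff(1))
    show "(\<exists>Q. totally_umbilic TYPE('q) Q \<and> M \<subseteq> Q) \<longleftrightarrow> (\<exists>w. \<forall>u\<in>V. b u = transpose (A u) *v w)"
      if "CARD('m) = CARD('n) \<or> \<not> (\<exists>Q. totally_geodesic TYPE('q) Q \<and> M \<subseteq> Q)" by (rule iff(2)[OF that])
    show "(\<exists>Q. totally_umbilic TYPE('q) Q \<and> flat_hypersurface TYPE('q) Q \<and> M \<subseteq> Q) \<longleftrightarrow>
        (\<exists>w. norm w = 1 \<and> (\<forall>u\<in>V. b u = transpose (A u) *v w))" by (rule iff(3))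
  qed
qed

end
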